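(* Let $G$ be a finite group. The free $G$-Tambara functor $\mathcal{A}[x_G]$ on a generator at level $G/G$ is levelwise finitely generated as a commutative ring: for every subgroup $H\le G$, the commutative ring $\mathcal{A}[x_G](G/H)$ is finitely generated.
   Context: **Tambara functors.** $\mathcal{P}_G$ is the category whose objects are finite $G$-sets and whose morphisms $X \to Y$ are isomorphism classes of bispans $X \leftarrow A \to B \to Y$ of finite $G$-sets. For $f:X\to Y$ put $T_f=[X = X = X \xrightarrow{f} Y]$, $N_f=[X = X \xrightarrow{f} Y = Y]$, $R_f=[Y \xleftarrow{f} X = X = X]$; then $[X\xleftarrow{h}A\xrightarrow{g}B\xrightarrow{f}Y]=T_fN_gR_h$. Composition is determined by $T_gT_f=T_{gf}$, $N_gN_f=N_{gf}$, $R_fR_g=R_{gf}$; $R_gT_f=T_{f'}R_{g'}$ and $R_gN_f=N_{f'}R_{g'}$ for every pullback square $f g'=g f'$; and $N_gT_f=T_{\Pi_g f}N_{g'}R_{\varepsilon}$ for $X\xrightarrow{f}Y\xrightarrow{g}Z$, where $\Pi_g$ is the right adjoint of pullback $g^*$ on slice categories, $g'$ is the projection from the pullback of $\Pi_g f$ along $g$ to the domain of $\Pi_g f$, and $\varepsilon$ is the counit $g^*\Pi_g f\to f$. Disjoint union gives finite products in $\mathcal{P}_G$. A $G$-Tambara functor is a product-preserving functor $F:\mathcal{P}_G\to\mathsf{Set}$ such that each commutative semiring $F(X)$ (addition induced by $T_\nabla$, multiplication by $N_\nabla$, $\nabla$ the fold map) is a ring; morphisms are natural transformations. **Free Tambara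 functor.** $\mathcal{A}[x_G]$ is the $G$-Tambara functor representing the functor $T\mapsto T(G/G)$ (as a set) on the category of $G$-Tambara functors. Finitely generated means finitely generated as a commutative ring, i.e. as a $\mathbb{Z}$-algebra. *)

theory Defs
  imports "HOL-Algebra.Group_Action" "HOL-Algebra.Left_Coset" "HOL-Algebra.Generated_Rings"
begin

section \<open>Finite G-sets\<close>

text \<open>
  All G-sets live in one infinite type of points, so that they form a single small category. The
  type contains the cosets of every subgroup, and every finite G-set is isomorphic to one with
  points in it. The natural number serves as a tag for disjoint unions.
\<close>

type_synonym 'g point = "'g set \<times> nat"

record 'g gset =
  points :: "'g point set"
  act :: "'g \<Rightarrow> 'g point \<Rightarrow> 'g point"

definition finite_gset :: "('g, 'm) monoid_scheme \<Rightarrow> 'g gset \<Rightarrow> bool" where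
  "finite_gset G X \<longleftrightarrow> finite (points X) \<and> group_action G (points X) (act X)"

text \<open>
  Equivariant maps are taken extensional (as in \<^term>\<open>PiE\<close>), so that equality of maps is HOL
  equality. Accordingly they are composed with \<^const>\<open>compose\<close>.
\<close>

definition gset_hom ::
    "('g, 'm) monoid_scheme \<Rightarrow> 'g gset \<Rightarrow> 'g gset \<Rightarrow> ('g point \<Rightarrow> 'g point) set" where
  "gset_hom G X Y =
     {f \<in> points X \<rightarrow>\<^sub>E points Y.
        \<forall>g\<in>carrier G. \<forall>x\<in>points X. f (act X g x) = act Y g (f x)}"

definition gset_id :: "'g gset \<Rightarrow> 'g point \<Rightarrow> 'g point" where
  "gset_id X = (\<lambda>x\<in>points X. x)"

definition gset_comp ::
    "'g gset \<Rightarrow> ('g point \<Rightarrow> 'g point) \<Rightarrow> ('g point \<Rightarrow> 'g point) \<Rightarrow> 'g point \<Rightarrow> 'g point" where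
  "gset_comp X g f = compose (points X) g f"

definition coset_gset :: "('g, 'm) monoid_scheme \<Rightarrow> 'g set \<Rightarrow> 'g gset" where
  "coset_gset G H =
     \<lparr>points = (lcosets\<^bsub>G\<^esub> H) \<times> {0},
      act = (\<lambda>g. \<lambda>p\<in>(lcosets\<^bsub>G\<^esub> H) \<times> {0}. (g <#\<^bsub>G\<^esub> fst p, 0))\<rparr>"

definition empty_gset :: "'g gset" where
  "empty_gset = \<lparr>points = {}, act = (\<lambda>g. \<lambda>p\<in>{}. p)\<rparr>"

definition inl_point :: "'g point \<Rightarrow> 'g point" where
  "inl_point p = (fst p, 2 * snd p)"

definition inr_point :: "'g point \<Rightarrow> 'g point" where
  "inr_point p = (fst p, 2 * snd p + 1)"

definition untag_point :: "'g point \<Rightarrow> 'g point" where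
  "untag_point p = (fst p, snd p div 2)"

definition disjoint_union :: "'g gset \<Rightarrow> 'g gset \<Rightarrow> 'g gset" where
  "disjoint_union X Y =
     (let U = inl_point ` points X \<union> inr_point ` points Y in
      \<lparr>points = U,
       act = (\<lambda>g. \<lambda>p\<in>U. if even (snd p) then inl_point (act X g (untag_point p))
                         else inr_point (act Y g (untag_point p)))\<rparr>)"

definition incl_left :: "'g gset \<Rightarrow> 'g point \<Rightarrow> 'g point" where
  "incl_left X = (\<lambda>x\<in>points X. inl_point x)"

definition incl_right :: "'g gset \<Rightarrow> 'g point \<Rightarrow> 'g point" where
  "incl_right Y = (\<lambda>y\<in>points Y. inr_point y)"

definition fold_map :: "'g gset \<Rightarrow> 'g point \<Rightarrow> 'g point" where
  "fold_map X = (\<lambda>p\<in>points (disjoint_union X X). untag_point p)"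

definition from_empty :: "'g point \<Rightarrow> 'g point" where
  "from_empty = (\<lambda>p\<in>{}. p)"

text \<open>
  In the following square \<open>P\<close> is a pullback of \<open>f\<close> along \<open>g\<close>: the comparison map to the fibre
  product is bijective.
  \<^verbatim>\<open>
      P --q--> Y
      |p       |g
      v        v
      X --f--> Z
  \<close>
\<close>

definition is_pullback ::
    "('g, 'm) monoid_scheme \<Rightarrow> 'g gset \<Rightarrow> ('g point \<Rightarrow> 'g point) \<Rightarrow> ('g point \<Rightarrow> 'g point) \<Rightarrow>
     'g gset \<Rightarrow> ('g point \<Rightarrow> 'g point) \<Rightarrow> 'g gset \<Rightarrow> ('g point \<Rightarrow> 'g point) \<Rightarrow> 'g gset \<Rightarrow> bool" where
  "is_pullback G P p q X f Y g Z \<longleftrightarrow>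
     finite_gset G P \<and> finite_gset G X \<and> finite_gset G Y \<and> finite_gset G Z \<and>
     p \<in> gset_hom G P X \<and> q \<in> gset_hom G P Y \<and> f \<in> gset_hom G X Z \<and> g \<in> gset_hom G Y Z \<and>
     bij_betw (\<lambda>w. (p w, q w)) (points P) {(x, y). x \<in> points X \<and> y \<in> points Y \<and> f x = g y}"

text \<open>
  For \<open>f : X \<rightarrow> Y\<close> and \<open>g : Y \<rightarrow> Z\<close>, the map \<open>p : E \<rightarrow> Z\<close> is the value at \<open>f\<close> of the right adjoint
  of the pullback functor along \<open>g\<close> on slice categories, with counit \<open>e\<close>. Here \<open>P\<close> is a pullback
  of \<open>p\<close> along \<open>g\<close> with projections \<open>q : P \<rightarrow> Y\<close> and \<open>g' : P \<rightarrow> E\<close>, and \<open>e : P \<rightarrow> X\<close> is the universal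
  arrow: for every \<open>w : W \<rightarrow> Z\<close> with pullback \<open>V\<close> along \<open>g\<close>, each map \<open>u : V \<rightarrow> X\<close> over \<open>Y\<close> factors
  as \<open>e \<circ> t\<close> where \<open>t : V \<rightarrow> P\<close> is the pullback of a unique map \<open>s : W \<rightarrow> E\<close> over \<open>Z\<close>.
\<close>

definition is_dependent_product ::
    "('g, 'm) monoid_scheme \<Rightarrow> 'g gset \<Rightarrow> ('g point \<Rightarrow> 'g point) \<Rightarrow> 'g gset \<Rightarrow>
     ('g point \<Rightarrow> 'g point) \<Rightarrow> 'g gset \<Rightarrow>
     'g gset \<Rightarrow> ('g point \<Rightarrow> 'g point) \<Rightarrow>
     'g gset \<Rightarrow> ('g point \<Rightarrow> 'g point) \<Rightarrow> ('g point \<Rightarrow> 'g point) \<Rightarrow> ('g point \<Rightarrow> 'g point) \<Rightarrow> bool" where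
  "is_dependent_product G X f Y g Z E p P q g' e \<longleftrightarrow>
     finite_gset G X \<and> f \<in> gset_hom G X Y \<and>
     is_pullback G P q g' Y g E p Z \<and>
     e \<in> gset_hom G P X \<and> gset_comp P f e = q \<and>
     (\<forall>W w V v g\<^sub>W u.
        is_pullback G V v g\<^sub>W Y g W w Z \<and> u \<in> gset_hom G V X \<and> gset_comp V f u = v \<longrightarrow>
        (\<exists>!s. s \<in> gset_hom G W E \<and> gset_comp W p s = w \<and>
              (\<exists>t\<in>gset_hom G V P. gset_comp V q t = v \<and> gset_comp V g' t = gset_comp V s g\<^sub>W \<and>
                                  gset_comp V e t = u)))"


section \<open>The category of bispans\<close>

text \<open>A bispan \<open>src \<leftarrow> top1 \<rightarrow> top2 \<rightarrow> tgt\<close>.\<close>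

record 'g bispan =
  src :: "'g gset"
  top1 :: "'g gset"
  top2 :: "'g gset"
  tgt :: "'g gset"
  res_leg :: "'g point \<Rightarrow> 'g point"
  nm_leg :: "'g point \<Rightarrow> 'g point"
  tr_leg :: "'g point \<Rightarrow> 'g point"

definition bispans :: "('g, 'm) monoid_scheme \<Rightarrow> 'g gset \<Rightarrow> 'g gset \<Rightarrow> 'g bispan set" where
  "bispans G X Y =
     {S. src S = X \<and> tgt S = Y \<and>
         finite_gset G X \<and> finite_gset G (top1 S) \<and> finite_gset G (top2 S) \<and> finite_gset G Y \<and>
         res_leg S \<in> gset_hom G (top1 S) X \<and>
         nm_leg S \<in> gset_hom G (top1 S) (top2 S) \<and>
         tr_leg S \<in> gset_hom G (top2 S) Y}"

definition bispan_iso ::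
    "('g, 'm) monoid_scheme \<Rightarrow> 'g gset \<Rightarrow> 'g gset \<Rightarrow> ('g bispan \<times> 'g bispan) set" where
  "bispan_iso G X Y =
     {(S, S'). S \<in> bispans G X Y \<and> S' \<in> bispans G X Y \<and>
        (\<exists>a\<in>gset_hom G (top1 S) (top1 S'). \<exists>b\<in>gset_hom G (top2 S) (top2 S').
           bij_betw a (points (top1 S)) (points (top1 S')) \<and>
           bij_betw b (points (top2 S)) (points (top2 S')) \<and>
           gset_comp (top1 S) (res_leg S') a = res_leg S \<and>
           gset_comp (top1 S) (nm_leg S') a = gset_comp (top1 S) b (nm_leg S) \<and>
           gset_comp (top2 S) (tr_leg S') b = tr_leg S)}"

definition pg_hom :: "('g, 'm) monoid_scheme \<Rightarrow> 'g gset \<Rightarrow> 'g gset \<Rightarrow> 'g bispan set set" where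
  "pg_hom G X Y = bispans G X Y // bispan_iso G X Y"

definition bispan_class :: "('g, 'm) monoid_scheme \<Rightarrow> 'g bispan \<Rightarrow> 'g bispan set" where
  "bispan_class G S = bispan_iso G (src S) (tgt S) `` {S}"

definition pg_T ::
    "('g, 'm) monoid_scheme \<Rightarrow> 'g gset \<Rightarrow> 'g gset \<Rightarrow> ('g point \<Rightarrow> 'g point) \<Rightarrow> 'g bispan set" where
  "pg_T G X Y f = bispan_class G
     \<lparr>src = X, top1 = X, top2 = X, tgt = Y,
      res_leg = gset_id X, nm_leg = gset_id X, tr_leg = f\<rparr>"

definition pg_N ::
    "('g, 'm) monoid_scheme \<Rightarrow> 'g gset \<Rightarrow> 'g gset \<Rightarrow> ('g point \<Rightarrow> 'g point) \<Rightarrow> 'g bispan set" where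
  "pg_N G X Y f = bispan_class G
     \<lparr>src = X, top1 = X, top2 = Y, tgt = Y,
      res_leg = gset_id X, nm_leg = f, tr_leg = gset_id Y\<rparr>"

definition pg_R ::
    "('g, 'm) monoid_scheme \<Rightarrow> 'g gset \<Rightarrow> 'g gset \<Rightarrow> ('g point \<Rightarrow> 'g point) \<Rightarrow> 'g bispan set" where
  "pg_R G X Y f = bispan_class G
     \<lparr>src = Y, top1 = X, top2 = X, tgt = X,
      res_leg = f, nm_leg = gset_id X, tr_leg = gset_id X\<rparr>"

definition pg_id :: "('g, 'm) monoid_scheme \<Rightarrow> 'g gset \<Rightarrow> 'g bispan set" where
  "pg_id G X = bispan_class G
     \<lparr>src = X, top1 = X, top2 = X, tgt = X,
      res_leg = gset_id X, nm_leg = gset_id X, tr_leg = gset_id X\<rparr>"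

text \<open>
  \<open>Q\<close> is a composite of \<open>S = [X \<leftarrow>h\<midarrow> A \<midarrow>g\<rightarrow> B \<midarrow>f\<rightarrow> Y]\<close> followed by
  \<open>S' = [Y \<leftarrow>k\<midarrow> C \<midarrow>l\<rightarrow> D \<midarrow>m\<rightarrow> Z]\<close>. The commutation rules for \<open>T\<close>, \<open>N\<close> and \<open>R\<close> give
  \<^item> \<open>R k T f = T f1 R k1\<close>, with \<open>B1\<close> the pullback of \<open>f\<close> and \<open>k\<close>;
  \<^item> \<open>R k1 N g = N g1 R k2\<close>, with \<open>A1\<close> the pullback of \<open>g\<close> and \<open>k1\<close>;
  \<^item> \<open>N l T f1 = T p N l1 R e\<close>, with \<open>p : E \<rightarrow> D\<close> the dependent product of \<open>f1\<close> along \<open>l\<close>;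
  \<^item> \<open>R e N g1 = N g2 R e1\<close>, with \<open>A2\<close> the pullback of \<open>g1\<close> and \<open>e\<close>;

  and hence \<open>(T m N l R k) (T f N g R h) = T (m p) N (l1 g2) R (h k2 e1)\<close>.
\<close>

definition is_composite ::
    "('g, 'm) monoid_scheme \<Rightarrow> 'g bispan \<Rightarrow> 'g bispan \<Rightarrow> 'g bispan \<Rightarrow> bool" where
  "is_composite G S' S Q \<longleftrightarrow>
     (\<exists>B1 k1 f1 A1 k2 g1 E p P q l1 e A2 e1 g2.
        is_pullback G B1 k1 f1 (top2 S) (tr_leg S) (top1 S') (res_leg S') (tgt S) \<and>
        is_pullback G A1 k2 g1 (top1 S) (nm_leg S) B1 k1 (top2 S) \<and>
        is_dependent_product G B1 f1 (top1 S') (nm_leg S') (top2 S') E p P q l1 e \<and>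
        is_pullback G A2 e1 g2 A1 g1 P e B1 \<and>
        Q = \<lparr>src = src S, top1 = A2, top2 = E, tgt = tgt S',
             res_leg = gset_comp A2 (res_leg S) (gset_comp A2 k2 e1),
             nm_leg = gset_comp A2 l1 g2,
             tr_leg = gset_comp E (tr_leg S') p\<rparr>)"

text \<open>
  The composite of two isomorphism classes. Pullbacks and dependent products being determined up
  to isomorphism only, the possible \<open>Q\<close> below form exactly one isomorphism class.
\<close>

definition pg_comp ::
    "('g, 'm) monoid_scheme \<Rightarrow> 'g bispan set \<Rightarrow> 'g bispan set \<Rightarrow> 'g bispan set" where
  "pg_comp G \<beta> \<alpha> = {Q. \<exists>S\<in>\<alpha>. \<exists>S'\<in>\<beta>. is_composite G S' S Q}"


section \<open>Tambara functors\<close>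

text \<open>
  Set-valued functors on the category of bispans; the values are subsets of the type \<open>'a\<close>.
\<close>

record ('g, 'a) pg_functor =
  fobj :: "'g gset \<Rightarrow> 'a set"
  farr :: "'g bispan set \<Rightarrow> 'a \<Rightarrow> 'a"

definition is_functor :: "('g, 'm) monoid_scheme \<Rightarrow> ('g, 'a) pg_functor \<Rightarrow> bool" where
  "is_functor G F \<longleftrightarrow>
     (\<forall>X Y. finite_gset G X \<longrightarrow> finite_gset G Y \<longrightarrow>
        (\<forall>\<alpha>\<in>pg_hom G X Y. farr F \<alpha> \<in> fobj F X \<rightarrow> fobj F Y)) \<and>
     (\<forall>X. finite_gset G X \<longrightarrow> (\<forall>a\<in>fobj F X. farr F (pg_id G X) a = a)) \<and>
     (\<forall>X Y Z. finite_gset G X \<longrightarrow> finite_gset G Y \<longrightarrow> finite_gset G Z \<longrightarrow>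
        (\<forall>\<alpha>\<in>pg_hom G X Y. \<forall>\<beta>\<in>pg_hom G Y Z. \<forall>a\<in>fobj F X.
           farr F (pg_comp G \<beta> \<alpha>) a = farr F \<beta> (farr F \<alpha> a)))"

text \<open>
  The product of \<open>X\<close> and \<open>Y\<close> in the category of bispans is their disjoint union; the projections
  are the restrictions along the two inclusions.
\<close>

definition proj_pair ::
    "('g, 'm) monoid_scheme \<Rightarrow> ('g, 'a) pg_functor \<Rightarrow> 'g gset \<Rightarrow> 'g gset \<Rightarrow> 'a \<Rightarrow> 'a \<times> 'a" where
  "proj_pair G F X Y c =
     (farr F (pg_R G X (disjoint_union X Y) (incl_left X)) c,
      farr F (pg_R G Y (disjoint_union X Y) (incl_right Y)) c)"

definition product_preserving :: "('g, 'm) monoid_scheme \<Rightarrow> ('g, 'a) pg_functor \<Rightarrow> bool" where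
  "product_preserving G F \<longleftrightarrow>
     (\<exists>a. fobj F empty_gset = {a}) \<and>
     (\<forall>X Y. finite_gset G X \<longrightarrow> finite_gset G Y \<longrightarrow>
        bij_betw (proj_pair G F X Y) (fobj F (disjoint_union X Y)) (fobj F X \<times> fobj F Y))"

definition pairing ::
    "('g, 'm) monoid_scheme \<Rightarrow> ('g, 'a) pg_functor \<Rightarrow> 'g gset \<Rightarrow> 'g gset \<Rightarrow> 'a \<Rightarrow> 'a \<Rightarrow> 'a" where
  "pairing G F X Y a b =
     the_inv_into (fobj F (disjoint_union X Y)) (proj_pair G F X Y) (a, b)"

text \<open>
  Addition and multiplication on \<open>F X\<close> come from the transfer and the norm along the fold map, the
  neutral elements from the transfer and the norm along \<open>\<emptyset> \<rightarrow> X\<close>.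
\<close>

definition level_ring ::
    "('g, 'm) monoid_scheme \<Rightarrow> ('g, 'a) pg_functor \<Rightarrow> 'g gset \<Rightarrow> 'a ring" where
  "level_ring G F X =
     \<lparr>carrier = fobj F X,
      mult = (\<lambda>a b. farr F (pg_N G (disjoint_union X X) X (fold_map X)) (pairing G F X X a b)),
      one = farr F (pg_N G empty_gset X from_empty) (the_elem (fobj F empty_gset)),
      zero = farr F (pg_T G empty_gset X from_empty) (the_elem (fobj F empty_gset)),
      add = (\<lambda>a b. farr F (pg_T G (disjoint_union X X) X (fold_map X)) (pairing G F X X a b))\<rparr>"

definition tambara_functor :: "('g, 'm) monoid_scheme \<Rightarrow> ('g, 'a) pg_functor \<Rightarrow> bool" where
  "tambara_functor G F \<longleftrightarrow>
     is_functor G F \<and> product_preserving G F \<and>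
     (\<forall>X. finite_gset G X \<longrightarrow> cring (level_ring G F X))"

text \<open>Natural transformations, extensional both in the object and in the element.\<close>

definition tambara_hom ::
    "('g, 'm) monoid_scheme \<Rightarrow> ('g, 'a) pg_functor \<Rightarrow> ('g, 'b) pg_functor \<Rightarrow>
     ('g gset \<Rightarrow> 'a \<Rightarrow> 'b) set" where
  "tambara_hom G F F' =
     {\<eta> \<in> (\<Pi>\<^sub>E X\<in>{X. finite_gset G X}. fobj F X \<rightarrow>\<^sub>E fobj F' X).
        \<forall>X Y. finite_gset G X \<longrightarrow> finite_gset G Y \<longrightarrow>
          (\<forall>\<alpha>\<in>pg_hom G X Y. \<forall>a\<in>fobj F X. \<eta> Y (farr F \<alpha> a) = farr F' \<alpha> (\<eta> X a))}"

definition tambara_comp ::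
    "('g, 'm) monoid_scheme \<Rightarrow> ('g, 'a) pg_functor \<Rightarrow> ('g gset \<Rightarrow> 'b \<Rightarrow> 'c) \<Rightarrow>
     ('g gset \<Rightarrow> 'a \<Rightarrow> 'b) \<Rightarrow> 'g gset \<Rightarrow> 'a \<Rightarrow> 'c" where
  "tambara_comp G F \<theta> \<eta> = (\<lambda>X\<in>{X. finite_gset G X}. compose (fobj F X) (\<theta> X) (\<eta> X))"


section \<open>The free Tambara functor on a generator at level G/G\<close>

text \<open>
  \<open>A\<close> represents \<open>T \<mapsto> T(G/G)\<close>: there are bijections \<open>\<Phi> T\<close> from morphisms \<open>A \<rightarrow> T\<close> to \<open>T(G/G)\<close>,
  natural in \<open>T\<close>. HOL cannot quantify over the type of values of \<open>T\<close>, so \<open>T\<close> ranges over the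
  Tambara functors with values in the type \<open>'a\<close> in which \<open>A\<close> itself takes its values. This loses
  nothing: the free Tambara functor has countable levels, so as soon as \<open>'a\<close> is infinite it has
  an isomorphic copy among these \<open>T\<close>, and \<open>A\<close> is isomorphic to it by uniqueness of
  representing objects. A finite \<open>'a\<close> is too small for the free Tambara functor itself.
\<close>

definition free_tambara_functor ::
    "('g, 'm) monoid_scheme \<Rightarrow> ('g, 'a) pg_functor \<Rightarrow> bool" where
  "free_tambara_functor G A \<longleftrightarrow>
     tambara_functor G A \<and>
     (\<exists>\<Phi> :: ('g, 'a) pg_functor \<Rightarrow> ('g gset \<Rightarrow> 'a \<Rightarrow> 'a) \<Rightarrow> 'a.
        (\<forall>T. tambara_functor G T \<longrightarrow>
           bij_betw (\<Phi> T) (tambara_hom G A T) (fobj T (coset_gset G (carrier G)))) \<and>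
        (\<forall>T T'. tambara_functor G T \<longrightarrow> tambara_functor G T' \<longrightarrow>
           (\<forall>\<theta>\<in>tambara_hom G T T'. \<forall>\<eta>\<in>tambara_hom G A T.
              \<Phi> T' (tambara_comp G A \<theta> \<eta>) = \<theta> (coset_gset G (carrier G)) (\<Phi> T \<eta>))))"

definition finitely_generated_ring :: "('a, 'n) ring_scheme \<Rightarrow> bool" where
  "finitely_generated_ring R \<longleftrightarrow>
     (\<exists>S. finite S \<and> S \<subseteq> carrier R \<and> generate_ring R S = carrier R)"

end

theory Submission
  imports Defs
begin

text \<open>
  Let \<open>x\<close> be the universal element of \<open>A(G/G)\<close>. Evaluating the bispans \<open>G/G \<leftarrow> E \<rightarrow> B \<rightarrow> X\<close> at \<open>x\<close>
  gives elements \<open>[E \<rightarrow> B \<rightarrow> X]\<close> of \<open>A(X)\<close>, and their differences form a sub-Tambara functor: closure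
  under norms follows by induction on the size of the fibres. By the universal property this
  subfunctor is all of \<open>A\<close>, so \<open>A(X)\<close> is additively generated by the elements with \<open>B\<close> an orbit.

  Let \<open>d\<close> be the order of \<open>G\<close>. If \<open>E\<close> is large, then \<open>E = C + d D\<close> over \<open>B\<close> for some orbit \<open>D\<close>. Let \<open>P\<^sub>i\<close>
  be the set of \<open>i\<close>-element subsets \<open>S\<close> of the fibres of \<open>B \<rightarrow> X\<close>, and \<open>D\<^sub>i \<rightarrow> P\<^sub>i\<close> the map whose fibre
  over \<open>S\<close> is the part of \<open>D\<close> over \<open>S\<close>. The product of \<open>[C + (d - i) D \<rightarrow> B \<rightarrow> X]\<close> and
  \<open>[D\<^sub>i \<rightarrow> P\<^sub>i \<rightarrow> X]\<close> lives over the pairs \<open>(b, S)\<close>. The pairs for which the stabilizer of \<open>b\<close> moves \<open>S\<close>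
  have smaller stabilizers than \<open>b\<close>. Among the other pairs, \<open>S \<mapsto> S \<union> {b}\<close> matches those with \<open>b \<notin> S\<close>
  and \<open>|S| = i\<close> with those with \<open>b \<in> S\<close> and \<open>|S| = i + 1\<close>, so in the alternating sum over \<open>i\<close> they
  cancel. This expresses \<open>[E \<rightarrow> B \<rightarrow> X]\<close> by elements with smaller stabilizers or smaller \<open>E\<close>, and the
  finitely many elements with \<open>E\<close> and \<open>B\<close> of bounded size generate the ring.
\<close>

section \<open>Actions and equivariant maps\<close>

text \<open>Points are pairs, and splitting the quantifiers over them only obscures the goals.\<close>

declare split_paired_All [simp del] split_paired_Ex [simp del]

text \<open>The alternating sum goes back to the identity \<Sum> (-1)^i e_i t_b^(n-i) = 0, obtained
  by expanding the product of the differences t_b - t_b' over all n elements b' of the fibre that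
  contains b. Let the orbit \<open>D'\<close> attach the monomial t_b to the point b. Then
  \<open>\<Psi> i\<close> is the elementary symmetric polynomial e_i of the fibre, and
  \<open>\<Gamma> (d - i)\<close> is the transfer of c_b t_b^(d-i), where c_b comes from
  \<open>C\<close>. Multiplying by further powers of t_b allows every d that is at least the size of
  the fibre; an orbit has at most |G| points, whence the choice of d. Bispans have no signs, so the
  cancellation has to be exhibited by isomorphisms of bispans, and the subtraction happens in the
  ring afterwards. The obstacle is that composition of bispans is specified by a universal property,
  whereas all arguments of this kind manipulate individual terms and factors. Dependent products are
  therefore identified with explicit sets of sections; after that, sums, products and norms are
  concrete sets, and each ring identity is a bijection compatible with the actions.\<close>

definition gact :: "('g, 'm) monoid_scheme \<Rightarrow> 'b set \<Rightarrow> ('g \<Rightarrow> 'b \<Rightarrow> 'b) \<Rightarrow> bool" where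
  "gact G B \<phi> \<longleftrightarrow>
     (\<forall>g\<in>carrier G. \<forall>b\<in>B. \<phi> g b \<in> B) \<and> (\<forall>b\<in>B. \<phi> \<one>\<^bsub>G\<^esub> b = b) \<and>
     (\<forall>g\<in>carrier G. \<forall>h\<in>carrier G. \<forall>b\<in>B. \<phi> (g \<otimes>\<^bsub>G\<^esub> h) b = \<phi> g (\<phi> h b))"

text \<open>Neither \<open>gact\<close> nor \<open>gmap\<close> asks for extensionality, and the
  carriers may have any type. Actions on sections, subsets and tagged sums can thus be given by
  plain functions.\<close>

definition gmap :: "('g, 'm) monoid_scheme \<Rightarrow> 'b set \<Rightarrow> ('g \<Rightarrow> 'b \<Rightarrow> 'b) \<Rightarrow>
    'c set \<Rightarrow> ('g \<Rightarrow> 'c \<Rightarrow> 'c) \<Rightarrow> ('b \<Rightarrow> 'c) \<Rightarrow> bool" where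
  "gmap G B \<phi> C \<psi> f \<longleftrightarrow>
     (\<forall>b\<in>B. f b \<in> C) \<and> (\<forall>g\<in>carrier G. \<forall>b\<in>B. f (\<phi> g b) = \<psi> g (f b))"

lemma gactI:
  assumes "\<And>g b. \<lbrakk>g \<in> carrier G; b \<in> B\<rbrakk> \<Longrightarrow> \<phi> g b \<in> B"
    and "\<And>b. b \<in> B \<Longrightarrow> \<phi> \<one>\<^bsub>G\<^esub> b = b"
    and "\<And>g h b. \<lbrakk>g \<in> carrier G; h \<in> carrier G; b \<in> B\<rbrakk> \<Longrightarrow> \<phi> (g \<otimes>\<^bsub>G\<^esub> h) b = \<phi> g (\<phi> h b)"
  shows "gact G B \<phi>"
  using assms by (auto simp: gact_def)

lemma gact_closed: "\<lbrakk>gact G B \<phi>; g \<in> carrier G; b \<in> B\<rbrakk> \<Longrightarrow> \<phi> g b \<in> B"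
  and gact_one: "\<lbrakk>gact G B \<phi>; b \<in> B\<rbrakk> \<Longrightarrow> \<phi> \<one>\<^bsub>G\<^esub> b = b"
  and gact_mult: "\<lbrakk>gact G B \<phi>; g \<in> carrier G; h \<in> carrier G; b \<in> B\<rbrakk> \<Longrightarrow>
    \<phi> (g \<otimes>\<^bsub>G\<^esub> h) b = \<phi> g (\<phi> h b)"
  by (auto simp: gact_def)

lemma (in group) gact_inv:
  assumes "gact G B \<phi>" "g \<in> carrier G" "b \<in> B"
  shows "\<phi> (inv g) (\<phi> g b) = b" "\<phi> g (\<phi> (inv g) b) = b"
  using gact_mult[OF assms(1), of "inv g" g b] gact_mult[OF assms(1), of g "inv g" b]
    gact_one[OF assms(1,3)] assms by auto

lemma (in group) gact_inj:
  assumes "gact G B \<phi>" "g \<in> carrier G" "b \<in> B" "b' \<in> B" "\<phi> g b = \<phi> g b'"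
  shows "b = b'"
  using gact_inv[OF assms(1,2)] assms(3-5) by metis

text \<open>A \<open>group_action\<close> maps into \<open>BijGroup\<close>, whose elements are
  extensional bijections. Bijectivity follows from the action of inverses; extensionality does not,
  and remains as the third conjunct.\<close>

lemma (in group) finite_gset_iff:
  "finite_gset G X \<longleftrightarrow>
     finite (points X) \<and> gact G (points X) (act X) \<and>
     (\<forall>g\<in>carrier G. act X g \<in> extensional (points X))"
proof
  assume X: "finite_gset G X"
  then interpret group_action G "points X" "act X" by (simp add: finite_gset_def)
  have "gact G (points X) (act X)"
  proof (rule gactI)
    fix b assume "b \<in> points X"
    then show "act X \<one> b = b" by (metis id_eq_one restrict_apply')
  qed (simp_all add: element_image[OF _ _ refl] composition_rule)
  moreover have "\<forall>g\<in>carrier G. act X g \<in> extensional (points X)"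
    using bij_prop0 by (auto simp: Bij_def)
  ultimately show "finite (points X) \<and> gact G (points X) (act X) \<and>
     (\<forall>g\<in>carrier G. act X g \<in> extensional (points X))"
    using X by (simp add: finite_gset_def)
next
  assume *: "finite (points X) \<and> gact G (points X) (act X) \<and>
     (\<forall>g\<in>carrier G. act X g \<in> extensional (points X))"
  then have X: "gact G (points X) (act X)" by simp
  have bij: "act X g \<in> Bij (points X)" if g: "g \<in> carrier G" for g
  proof -
    have "bij_betw (act X g) (points X) (points X)"
      by (rule bij_betw_byWitness[where f' = "act X (inv g)"])
        (use X g gact_inv gact_closed in \<open>auto simp: gact_closed\<close>)
    then show ?thesis using * g by (auto simp: Bij_def)
  qed
  have "group_hom G (BijGroup (points X)) (act X)"
  proof (intro group_hom.intro group_hom_axioms.intro homI)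
    fix g h assume gh: "g \<in> carrier G" "h \<in> carrier G"
    show "act X (g \<otimes> h) = act X g \<otimes>\<^bsub>BijGroup (points X)\<^esub> act X h"
    proof (rule extensionalityI[where A = "points X"])
      show "act X (g \<otimes> h) \<in> extensional (points X)" using * gh by auto
      show "act X g \<otimes>\<^bsub>BijGroup (points X)\<^esub> act X h \<in> extensional (points X)"
        using bij gh by (auto simp: BijGroup_def)
    qed (use X gh bij in \<open>auto simp: BijGroup_def compose_eq gact_mult\<close>)
  qed (use bij group_BijGroup is_group in \<open>auto simp: BijGroup_def\<close>)
  then show "finite_gset G X" using * by (simp add: finite_gset_def group_action_def)
qed

lemma gset_hom_iff:
  "f \<in> gset_hom G X Y \<longleftrightarrow>
     f \<in> extensional (points X) \<and> gmap G (points X) (act X) (points Y) (act Y) f"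
  by (auto simp: gset_hom_def gmap_def PiE_iff)

lemma gset_id_apply [simp]: "x \<in> points X \<Longrightarrow> gset_id X x = x"
  by (simp add: gset_id_def)

lemma gset_comp_apply [simp]: "x \<in> points X \<Longrightarrow> gset_comp X g f x = g (f x)"
  by (simp add: gset_comp_def compose_eq)

lemma gset_comp_extensional [simp]: "gset_comp X g f \<in> extensional (points X)"
  by (simp add: gset_comp_def)

lemma (in group) gset_id_hom: "finite_gset G X \<Longrightarrow> gset_id X \<in> gset_hom G X X"
  unfolding gset_hom_iff finite_gset_iff gset_id_def by (auto simp: gmap_def gact_closed)

lemma (in group) gset_comp_hom:
  assumes "finite_gset G X" "f \<in> gset_hom G X Y" "g \<in> gset_hom G Y Z"
  shows "gset_comp X g f \<in> gset_hom G X Z"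
  using assms unfolding gset_hom_iff finite_gset_iff
  by (auto simp: gmap_def gact_closed)


section \<open>Bispans with tops of arbitrary type\<close>

text \<open>
  The sets of sections and of subsets that occur below are not sets of points. Bispans whose two
  middle sets have arbitrary types avoid coding them as such; \<open>xclass\<close> is the isomorphism class
  of the genuine bispans isomorphic to one of these.
\<close>

record ('g, 'c, 'b) xbispan =
  up :: "'c set"
  up_act :: "'g \<Rightarrow> 'c \<Rightarrow> 'c"
  lo :: "'b set"
  lo_act :: "'g \<Rightarrow> 'b \<Rightarrow> 'b"
  rleg :: "'c \<Rightarrow> 'g point"
  nleg :: "'c \<Rightarrow> 'b"
  tleg :: "'b \<Rightarrow> 'g point"

definition xbispans ::
    "('g, 'm) monoid_scheme \<Rightarrow> 'g gset \<Rightarrow> 'g gset \<Rightarrow> ('g, 'c, 'b) xbispan set" where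
  "xbispans G X Y =
     {\<beta>. finite_gset G X \<and> finite_gset G Y \<and> finite (up \<beta>) \<and> finite (lo \<beta>) \<and>
         gact G (up \<beta>) (up_act \<beta>) \<and> gact G (lo \<beta>) (lo_act \<beta>) \<and>
         gmap G (up \<beta>) (up_act \<beta>) (points X) (act X) (rleg \<beta>) \<and>
         gmap G (up \<beta>) (up_act \<beta>) (lo \<beta>) (lo_act \<beta>) (nleg \<beta>) \<and>
         gmap G (lo \<beta>) (lo_act \<beta>) (points Y) (act Y) (tleg \<beta>)}"

text \<open>The two bispans may have middle sets of different types. This is needed to compare
  constructions on sections or subsets with bispans whose middle sets consist of points.\<close>

definition xiso :: "('g, 'm) monoid_scheme \<Rightarrow> ('g, 'c, 'b) xbispan \<Rightarrow> ('g, 'd, 'e) xbispan \<Rightarrow> bool" where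
  "xiso G \<beta> \<beta>' \<longleftrightarrow>
     (\<exists>a b. bij_betw a (up \<beta>) (up \<beta>') \<and> bij_betw b (lo \<beta>) (lo \<beta>') \<and>
        (\<forall>g\<in>carrier G. \<forall>c\<in>up \<beta>. a (up_act \<beta> g c) = up_act \<beta>' g (a c)) \<and>
        (\<forall>g\<in>carrier G. \<forall>c\<in>lo \<beta>. b (lo_act \<beta> g c) = lo_act \<beta>' g (b c)) \<and>
        (\<forall>c\<in>up \<beta>. rleg \<beta>' (a c) = rleg \<beta> c \<and> nleg \<beta>' (a c) = b (nleg \<beta> c)) \<and>
        (\<forall>c\<in>lo \<beta>. tleg \<beta>' (b c) = tleg \<beta> c))"

definition of_bispan :: "'g bispan \<Rightarrow> ('g, 'g point, 'g point) xbispan" where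
  "of_bispan S = \<lparr>up = points (top1 S), up_act = act (top1 S), lo = points (top2 S),
     lo_act = act (top2 S), rleg = res_leg S, nleg = nm_leg S, tleg = tr_leg S\<rparr>"

lemma of_bispan_simps [simp]:
  "up (of_bispan S) = points (top1 S)" "up_act (of_bispan S) = act (top1 S)"
  "lo (of_bispan S) = points (top2 S)" "lo_act (of_bispan S) = act (top2 S)"
  "rleg (of_bispan S) = res_leg S" "nleg (of_bispan S) = nm_leg S" "tleg (of_bispan S) = tr_leg S"
  by (simp_all add: of_bispan_def)

lemma xisoI:
  assumes "\<And>c. c \<in> up \<beta> \<Longrightarrow> a c \<in> up \<beta>' \<and> a' (a c) = c"
    and "\<And>c. c \<in> up \<beta>' \<Longrightarrow> a' c \<in> up \<beta> \<and> a (a' c) = c"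
    and "\<And>c. c \<in> lo \<beta> \<Longrightarrow> b c \<in> lo \<beta>' \<and> b' (b c) = c"
    and "\<And>c. c \<in> lo \<beta>' \<Longrightarrow> b' c \<in> lo \<beta> \<and> b (b' c) = c"
    and "\<And>g c. \<lbrakk>g \<in> carrier G; c \<in> up \<beta>\<rbrakk> \<Longrightarrow> a (up_act \<beta> g c) = up_act \<beta>' g (a c)"
    and "\<And>g c. \<lbrakk>g \<in> carrier G; c \<in> lo \<beta>\<rbrakk> \<Longrightarrow> b (lo_act \<beta> g c) = lo_act \<beta>' g (b c)"
    and "\<And>c. c \<in> up \<beta> \<Longrightarrow> rleg \<beta>' (a c) = rleg \<beta> c"
    and "\<And>c. c \<in> up \<beta> \<Longrightarrow> nleg \<beta>' (a c) = b (nleg \<beta> c)"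
    and "\<And>c. c \<in> lo \<beta> \<Longrightarrow> tleg \<beta>' (b c) = tleg \<beta> c"
  shows "xiso G \<beta> \<beta>'"
  unfolding xiso_def
proof (intro exI conjI)
  show "bij_betw a (up \<beta>) (up \<beta>')"
    by (rule bij_betw_byWitness[where f' = a']) (use assms(1,2) in auto)
  show "bij_betw b (lo \<beta>) (lo \<beta>')"
    by (rule bij_betw_byWitness[where f' = b']) (use assms(3,4) in auto)
qed (use assms in auto)

lemma xisoI':
  assumes "bij_betw a (up \<beta>) (up \<beta>')" and "bij_betw b (lo \<beta>) (lo \<beta>')"
    and "\<And>g c. \<lbrakk>g \<in> carrier G; c \<in> up \<beta>\<rbrakk> \<Longrightarrow> a (up_act \<beta> g c) = up_act \<beta>' g (a c)"
    and "\<And>g c. \<lbrakk>g \<in> carrier G; c \<in> lo \<beta>\<rbrakk> \<Longrightarrow> b (lo_act \<beta> g c) = lo_act \<beta>' g (b c)"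
    and "\<And>c. c \<in> up \<beta> \<Longrightarrow> rleg \<beta>' (a c) = rleg \<beta> c"
    and "\<And>c. c \<in> up \<beta> \<Longrightarrow> nleg \<beta>' (a c) = b (nleg \<beta> c)"
    and "\<And>c. c \<in> lo \<beta> \<Longrightarrow> tleg \<beta>' (b c) = tleg \<beta> c"
  shows "xiso G \<beta> \<beta>'"
  unfolding xiso_def using assms by blast

lemma xiso_trans:
  assumes "xiso G \<beta> \<beta>'" "xiso G \<beta>' \<beta>''"
  shows "xiso G \<beta> \<beta>''"
proof -
  obtain a b where ab: "bij_betw a (up \<beta>) (up \<beta>')" "bij_betw b (lo \<beta>) (lo \<beta>')"
     "\<forall>g\<in>carrier G. \<forall>c\<in>up \<beta>. a (up_act \<beta> g c) = up_act \<beta>' g (a c)"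
     "\<forall>g\<in>carrier G. \<forall>c\<in>lo \<beta>. b (lo_act \<beta> g c) = lo_act \<beta>' g (b c)"
     "\<forall>c\<in>up \<beta>. rleg \<beta>' (a c) = rleg \<beta> c \<and> nleg \<beta>' (a c) = b (nleg \<beta> c)"
     "\<forall>c\<in>lo \<beta>. tleg \<beta>' (b c) = tleg \<beta> c"
    using assms(1) unfolding xiso_def by blast
  obtain a' b' where ab': "bij_betw a' (up \<beta>') (up \<beta>'')" "bij_betw b' (lo \<beta>') (lo \<beta>'')"
     "\<forall>g\<in>carrier G. \<forall>c\<in>up \<beta>'. a' (up_act \<beta>' g c) = up_act \<beta>'' g (a' c)"
     "\<forall>g\<in>carrier G. \<forall>c\<in>lo \<beta>'. b' (lo_act \<beta>' g c) = lo_act \<beta>'' g (b' c)"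
     "\<forall>c\<in>up \<beta>'. rleg \<beta>'' (a' c) = rleg \<beta>' c \<and> nleg \<beta>'' (a' c) = b' (nleg \<beta>' c)"
     "\<forall>c\<in>lo \<beta>'. tleg \<beta>'' (b' c) = tleg \<beta>' c"
    using assms(2) unfolding xiso_def by blast
  have in': "\<And>c. c \<in> up \<beta> \<Longrightarrow> a c \<in> up \<beta>'" "\<And>c. c \<in> lo \<beta> \<Longrightarrow> b c \<in> lo \<beta>'"
    using ab(1,2) by (auto simp: bij_betw_def)
  show ?thesis
    by (rule xisoI'[OF bij_betw_trans[OF ab(1) ab'(1)] bij_betw_trans[OF ab(2) ab'(2)]])
      (use ab ab' in' in auto)
qed

text \<open>The inverse maps are equivariant because they undo a and b on translates as well, which
  requires the translates to stay inside \<open>up \<beta>\<close> and \<open>lo \<beta>\<close>.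
  Such closure is not part of \<open>xiso\<close>, so it is assumed.\<close>

lemma xiso_sym:
  assumes "xiso G \<beta> \<beta>'" "gact G (up \<beta>) (up_act \<beta>)" "gact G (lo \<beta>) (lo_act \<beta>)"
    "\<And>c. c \<in> up \<beta> \<Longrightarrow> nleg \<beta> c \<in> lo \<beta>"
  shows "xiso G \<beta>' \<beta>"
proof -
  obtain a b where ab: "bij_betw a (up \<beta>) (up \<beta>')" "bij_betw b (lo \<beta>) (lo \<beta>')"
     "\<forall>g\<in>carrier G. \<forall>c\<in>up \<beta>. a (up_act \<beta> g c) = up_act \<beta>' g (a c)"
     "\<forall>g\<in>carrier G. \<forall>c\<in>lo \<beta>. b (lo_act \<beta> g c) = lo_act \<beta>' g (b c)"
     "\<forall>c\<in>up \<beta>. rleg \<beta>' (a c) = rleg \<beta> c \<and> nleg \<beta>' (a c) = b (nleg \<beta> c)"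
     "\<forall>c\<in>lo \<beta>. tleg \<beta>' (b c) = tleg \<beta> c"
    using assms(1) unfolding xiso_def by blast
  define a' b' where "a' = inv_into (up \<beta>) a" and "b' = inv_into (lo \<beta>) b"
  have inv: "\<And>c. c \<in> up \<beta> \<Longrightarrow> a' (a c) = c" "\<And>c. c \<in> lo \<beta> \<Longrightarrow> b' (b c) = c"
     "\<And>c. c \<in> up \<beta>' \<Longrightarrow> a (a' c) = c \<and> a' c \<in> up \<beta>" "\<And>c. c \<in> lo \<beta>' \<Longrightarrow> b (b' c) = c \<and> b' c \<in> lo \<beta>"
    using ab(1,2) unfolding a'_def b'_def
    by (auto simp: bij_betw_def inv_into_f_f f_inv_into_f inv_into_into)
  show ?thesis
  proof (rule xisoI'[of a' _ _ b'])
    show "bij_betw a' (up \<beta>') (up \<beta>)" "bij_betw b' (lo \<beta>') (lo \<beta>)"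
      using ab(1,2) by (auto simp: a'_def b'_def bij_betw_inv_into)
    show "a' (up_act \<beta>' g c) = up_act \<beta> g (a' c)" if "g \<in> carrier G" "c \<in> up \<beta>'" for g c
      using ab(3) inv that gact_closed[OF assms(2)] by metis
    show "b' (lo_act \<beta>' g c) = lo_act \<beta> g (b' c)" if "g \<in> carrier G" "c \<in> lo \<beta>'" for g c
      using ab(4) inv that gact_closed[OF assms(3)] by metis
    show "nleg \<beta> (a' c) = b' (nleg \<beta>' c)" if "c \<in> up \<beta>'" for c
      using ab(5) inv that assms(4) by metis
  qed (use ab inv in \<open>metis\<close>)+
qed

lemma xbispansD:
  assumes "\<beta> \<in> xbispans G X Y"
  shows "finite_gset G X" "finite_gset G Y" "finite (up \<beta>)" "finite (lo \<beta>)"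
    "gact G (up \<beta>) (up_act \<beta>)" "gact G (lo \<beta>) (lo_act \<beta>)"
    "gmap G (up \<beta>) (up_act \<beta>) (points X) (act X) (rleg \<beta>)"
    "gmap G (up \<beta>) (up_act \<beta>) (lo \<beta>) (lo_act \<beta>) (nleg \<beta>)"
    "gmap G (lo \<beta>) (lo_act \<beta>) (points Y) (act Y) (tleg \<beta>)"
  using assms by (auto simp: xbispans_def)

lemma xbispansI:
  assumes "finite_gset G X" "finite_gset G Y" "finite (up \<beta>)" "finite (lo \<beta>)"
    "gact G (up \<beta>) (up_act \<beta>)" "gact G (lo \<beta>) (lo_act \<beta>)"
    "gmap G (up \<beta>) (up_act \<beta>) (points X) (act X) (rleg \<beta>)"
    "gmap G (up \<beta>) (up_act \<beta>) (lo \<beta>) (lo_act \<beta>) (nleg \<beta>)"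
    "gmap G (lo \<beta>) (lo_act \<beta>) (points Y) (act Y) (tleg \<beta>)"
  shows "\<beta> \<in> xbispans G X Y"
  using assms by (auto simp: xbispans_def)

lemma xbispan_facts:
  assumes "\<beta> \<in> xbispans G X Y"
  shows "\<And>c. c \<in> up \<beta> \<Longrightarrow> rleg \<beta> c \<in> points X" "\<And>c. c \<in> up \<beta> \<Longrightarrow> nleg \<beta> c \<in> lo \<beta>"
    "\<And>c. c \<in> lo \<beta> \<Longrightarrow> tleg \<beta> c \<in> points Y"
    "\<And>g c. \<lbrakk>g \<in> carrier G; c \<in> up \<beta>\<rbrakk> \<Longrightarrow> up_act \<beta> g c \<in> up \<beta>"
    "\<And>g c. \<lbrakk>g \<in> carrier G; c \<in> lo \<beta>\<rbrakk> \<Longrightarrow> lo_act \<beta> g c \<in> lo \<beta>"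
    "\<And>c. c \<in> up \<beta> \<Longrightarrow> up_act \<beta> \<one>\<^bsub>G\<^esub> c = c"
    "\<And>c. c \<in> lo \<beta> \<Longrightarrow> lo_act \<beta> \<one>\<^bsub>G\<^esub> c = c"
    "\<And>g c. \<lbrakk>g \<in> carrier G; c \<in> up \<beta>\<rbrakk> \<Longrightarrow> rleg \<beta> (up_act \<beta> g c) = act X g (rleg \<beta> c)"
    "\<And>g c. \<lbrakk>g \<in> carrier G; c \<in> up \<beta>\<rbrakk> \<Longrightarrow> nleg \<beta> (up_act \<beta> g c) = lo_act \<beta> g (nleg \<beta> c)"
    "\<And>g c. \<lbrakk>g \<in> carrier G; c \<in> lo \<beta>\<rbrakk> \<Longrightarrow> tleg \<beta> (lo_act \<beta> g c) = act Y g (tleg \<beta> c)"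
    "\<And>g h c. \<lbrakk>g \<in> carrier G; h \<in> carrier G; c \<in> up \<beta>\<rbrakk> \<Longrightarrow>
       up_act \<beta> (g \<otimes>\<^bsub>G\<^esub> h) c = up_act \<beta> g (up_act \<beta> h c)"
    "\<And>g h c. \<lbrakk>g \<in> carrier G; h \<in> carrier G; c \<in> lo \<beta>\<rbrakk> \<Longrightarrow>
       lo_act \<beta> (g \<otimes>\<^bsub>G\<^esub> h) c = lo_act \<beta> g (lo_act \<beta> h c)"
  using xbispansD(5-)[OF assms]
  by (simp_all add: gmap_def gact_closed gact_one gact_mult)

lemma xiso_sym': "\<lbrakk>xiso G \<beta> \<beta>'; \<beta> \<in> xbispans G X Y\<rbrakk> \<Longrightarrow> xiso G \<beta>' \<beta>"
  by (rule xiso_sym) (auto dest: xbispansD simp: xbispan_facts)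

lemma bispansD:
  assumes "S \<in> bispans G X Y"
  shows "src S = X" "tgt S = Y" "finite_gset G X" "finite_gset G (top1 S)"
    "finite_gset G (top2 S)" "finite_gset G Y" "res_leg S \<in> gset_hom G (top1 S) X"
    "nm_leg S \<in> gset_hom G (top1 S) (top2 S)" "tr_leg S \<in> gset_hom G (top2 S) Y"
  using assms by (auto simp: bispans_def)

lemma (in group) of_bispan_xbispans:
  "S \<in> bispans G X Y \<Longrightarrow> of_bispan S \<in> xbispans G X Y"
  by (auto simp: bispans_def xbispans_def gset_hom_iff finite_gset_iff)

text \<open>The gap between the two notions is that the maps in \<open>bispan_iso\<close> are
  extensional; restricting the bijections of \<open>xiso\<close> to the middle sets closes
  it.\<close>

lemma (in group) bispan_iso_iff:
  "(S, S') \<in> bispan_iso G X Y \<longleftrightarrow>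
     S \<in> bispans G X Y \<and> S' \<in> bispans G X Y \<and> xiso G (of_bispan S) (of_bispan S')"
proof (intro iffI; (elim conjE)?)
  assume "(S, S') \<in> bispan_iso G X Y"
  then obtain a b where S: "S \<in> bispans G X Y" "S' \<in> bispans G X Y"
    and a: "a \<in> gset_hom G (top1 S) (top1 S')" and b: "b \<in> gset_hom G (top2 S) (top2 S')"
    and bij: "bij_betw a (points (top1 S)) (points (top1 S'))"
           "bij_betw b (points (top2 S)) (points (top2 S'))"
    and eq: "gset_comp (top1 S) (res_leg S') a = res_leg S"
           "gset_comp (top1 S) (nm_leg S') a = gset_comp (top1 S) b (nm_leg S)"
           "gset_comp (top2 S) (tr_leg S') b = tr_leg S"
    by (auto simp: bispan_iso_def)
  have "xiso G (of_bispan S) (of_bispan S')"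
    by (rule xisoI'[where a = a and b = b])
      (use a b bij eq in \<open>auto simp: gset_hom_iff gmap_def dest: fun_cong\<close>,
        (metis gset_comp_apply)+)
  then show "S \<in> bispans G X Y \<and> S' \<in> bispans G X Y \<and> xiso G (of_bispan S) (of_bispan S')"
    using S by simp
next
  assume S: "S \<in> bispans G X Y" "S' \<in> bispans G X Y"
    and iso: "xiso G (of_bispan S) (of_bispan S')"
  then obtain a b where ab: "bij_betw a (points (top1 S)) (points (top1 S'))"
      "bij_betw b (points (top2 S)) (points (top2 S'))"
     "\<forall>g\<in>carrier G. \<forall>c\<in>points (top1 S). a (act (top1 S) g c) = act (top1 S') g (a c)"
     "\<forall>g\<in>carrier G. \<forall>c\<in>points (top2 S). b (act (top2 S) g c) = act (top2 S') g (b c)"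
     "\<forall>c\<in>points (top1 S). res_leg S' (a c) = res_leg S c \<and> nm_leg S' (a c) = b (nm_leg S c)"
     "\<forall>c\<in>points (top2 S). tr_leg S' (b c) = tr_leg S c"
    unfolding xiso_def by auto
  define a' b' where "a' = restrict a (points (top1 S))" and "b' = restrict b (points (top2 S))"
  note B = bispansD[OF S(1)] bispansD[OF S(2)]
  have in': "\<And>c. c \<in> points (top1 S) \<Longrightarrow> a c \<in> points (top1 S')"
    "\<And>c. c \<in> points (top2 S) \<Longrightarrow> b c \<in> points (top2 S')"
    using ab(1,2) by (auto simp: bij_betw_def)
  have cl: "\<And>g c. \<lbrakk>g \<in> carrier G; c \<in> points (top1 S)\<rbrakk> \<Longrightarrow> act (top1 S) g c \<in> points (top1 S)"
    "\<And>g c. \<lbrakk>g \<in> carrier G; c \<in> points (top2 S)\<rbrakk> \<Longrightarrow> act (top2 S) g c \<in> points (top2 S)"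
    "\<And>c. c \<in> points (top1 S) \<Longrightarrow> nm_leg S c \<in> points (top2 S)"
    using B by (auto simp: finite_gset_iff gact_closed gset_hom_iff gmap_def)
  have "bij_betw a' (points (top1 S)) (points (top1 S'))"
       "bij_betw b' (points (top2 S)) (points (top2 S'))"
    using ab(1,2) by (auto simp: a'_def b'_def cong: bij_betw_cong)
  moreover have "a' \<in> gset_hom G (top1 S) (top1 S')" "b' \<in> gset_hom G (top2 S) (top2 S')"
    using ab in' cl by (auto simp: a'_def b'_def gset_hom_iff gmap_def)
  moreover have "gset_comp (top1 S) (res_leg S') a' = res_leg S"
    by (rule extensionalityI[where A = "points (top1 S)"])
      (use ab B in \<open>auto simp: a'_def gset_hom_iff\<close>)
  moreover have "gset_comp (top2 S) (tr_leg S') b' = tr_leg S"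
    by (rule extensionalityI[where A = "points (top2 S)"])
      (use ab B in \<open>auto simp: b'_def gset_hom_iff\<close>)
  moreover have "gset_comp (top1 S) (nm_leg S') a' = gset_comp (top1 S) b' (nm_leg S)"
    by (rule extensionalityI[where A = "points (top1 S)"])
      (use ab B cl in \<open>auto simp: a'_def b'_def gset_hom_iff\<close>)
  ultimately show "(S, S') \<in> bispan_iso G X Y"
    using S unfolding bispan_iso_def by blast
qed

definition xclass :: "('g, 'm) monoid_scheme \<Rightarrow> 'g gset \<Rightarrow> 'g gset \<Rightarrow>
    ('g, 'c, 'b) xbispan \<Rightarrow> 'g bispan set" where
  "xclass G X Y \<beta> = {S \<in> bispans G X Y. xiso G \<beta> (of_bispan S)}"

lemma (in group) bispan_class_eq:
  assumes "S \<in> bispans G X Y"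
  shows "bispan_class G S = xclass G X Y (of_bispan S)"
  using assms bispansD(1,2)[OF assms]
  by (auto simp: bispan_class_def xclass_def bispan_iso_iff)

lemma xclass_cong:
  assumes "xiso G \<beta> \<beta>'" "\<beta> \<in> xbispans G X Y"
  shows "xclass G X Y \<beta> = xclass G X Y \<beta>'"
  unfolding xclass_def using xiso_trans[OF assms(1)] xiso_trans[OF xiso_sym'[OF assms]] by blast

lemma (in group) transport_gact:
  assumes "gact G B \<phi>" "bij_betw e B B'"
  defines "\<psi> \<equiv> \<lambda>g\<in>carrier G. \<lambda>y\<in>B'. e (\<phi> g (inv_into B e y))"
  shows "gact G B' \<psi>" and "\<And>g b. \<lbrakk>g \<in> carrier G; b \<in> B\<rbrakk> \<Longrightarrow> e (\<phi> g b) = \<psi> g (e b)"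
proof -
  have i: "\<And>b. b \<in> B \<Longrightarrow> inv_into B e (e b) = b" "\<And>b. b \<in> B \<Longrightarrow> e b \<in> B'"
    "\<And>y. y \<in> B' \<Longrightarrow> inv_into B e y \<in> B \<and> e (inv_into B e y) = y"
    using assms(2) by (auto simp: bij_betw_def inv_into_f_f f_inv_into_f inv_into_into)
  show *: "e (\<phi> g b) = \<psi> g (e b)" if "g \<in> carrier G" "b \<in> B" for g b
    using that i by (simp add: \<psi>_def)
  show "gact G B' \<psi>"
    by (rule gactI) (use i assms(1) in \<open>auto simp: \<psi>_def gact_closed gact_one gact_mult\<close>)
qed

text \<open>All data of the copy are extensional. Hence it can be packaged as a genuine bispan
  (\<open>realization\<close>), and for fixed finite \<open>A'\<close> and \<open>B'\<close> only
  finitely many copies exist (\<open>finite_gens\<close>).\<close>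

lemma (in group) xbispan_transport:
  fixes \<beta> :: "('a, 'p, 'q) xbispan"
  assumes "\<beta> \<in> xbispans G X Y" "bij_betw e (up \<beta>) (A' :: 'd set)" "bij_betw d (lo \<beta>) (B' :: 'e set)"
  obtains \<gamma> :: "('a, 'd, 'e) xbispan" where "\<gamma> \<in> xbispans G X Y" "xiso G \<beta> \<gamma>"
    "up \<gamma> = A'" "lo \<gamma> = B'"
    "up_act \<gamma> \<in> carrier G \<rightarrow>\<^sub>E (A' \<rightarrow>\<^sub>E A')" "lo_act \<gamma> \<in> carrier G \<rightarrow>\<^sub>E (B' \<rightarrow>\<^sub>E B')"
    "rleg \<gamma> \<in> A' \<rightarrow>\<^sub>E points X" "nleg \<gamma> \<in> A' \<rightarrow>\<^sub>E B'" "tleg \<gamma> \<in> B' \<rightarrow>\<^sub>E points Y"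
proof -
  note V = xbispansD[OF assms(1)]
  note F = xbispan_facts[OF assms(1)]
  define \<gamma> :: "('a, 'd, 'e) xbispan" where
    "\<gamma> = \<lparr>up = A', up_act = \<lambda>g\<in>carrier G. \<lambda>y\<in>A'. e (up_act \<beta> g (inv_into (up \<beta>) e y)),
          lo = B', lo_act = \<lambda>g\<in>carrier G. \<lambda>y\<in>B'. d (lo_act \<beta> g (inv_into (lo \<beta>) d y)),
          rleg = \<lambda>y\<in>A'. rleg \<beta> (inv_into (up \<beta>) e y),
          nleg = \<lambda>y\<in>A'. d (nleg \<beta> (inv_into (up \<beta>) e y)),
          tleg = \<lambda>y\<in>B'. tleg \<beta> (inv_into (lo \<beta>) d y)\<rparr>"
  have i: "\<And>b. b \<in> up \<beta> \<Longrightarrow> inv_into (up \<beta>) e (e b) = b" "\<And>b. b \<in> up \<beta> \<Longrightarrow> e b \<in> A'"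
    "\<And>y. y \<in> A' \<Longrightarrow> inv_into (up \<beta>) e y \<in> up \<beta>" "\<And>y. y \<in> A' \<Longrightarrow> e (inv_into (up \<beta>) e y) = y"
    "\<And>b. b \<in> lo \<beta> \<Longrightarrow> inv_into (lo \<beta>) d (d b) = b" "\<And>b. b \<in> lo \<beta> \<Longrightarrow> d b \<in> B'"
    "\<And>y. y \<in> B' \<Longrightarrow> inv_into (lo \<beta>) d y \<in> lo \<beta>" "\<And>y. y \<in> B' \<Longrightarrow> d (inv_into (lo \<beta>) d y) = y"
    using assms(2,3) by (auto simp: bij_betw_def inv_into_f_f f_inv_into_f inv_into_into)
  have "\<gamma> \<in> xbispans G X Y"
  proof (rule xbispansI)
    show "gact G (up \<gamma>) (up_act \<gamma>)" "gact G (lo \<gamma>) (lo_act \<gamma>)"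
      using transport_gact(1)[OF V(5) assms(2)] transport_gact(1)[OF V(6) assms(3)]
      by (simp_all add: \<gamma>_def)
    show "finite (up \<gamma>)" "finite (lo \<gamma>)"
      using V(3,4) assms(2,3) by (auto simp: \<gamma>_def dest: bij_betw_finite)
  qed (use V(1,2) i F in \<open>auto simp: \<gamma>_def gmap_def\<close>)
  moreover have "xiso G \<beta> \<gamma>"
    by (rule xisoI'[where a = e and b = d]) (use assms(2,3) i F in \<open>auto simp: \<gamma>_def\<close>)
  ultimately show thesis
    by (rule that) (auto simp: \<gamma>_def i F)
qed

text \<open>The tags alone provide infinitely many points, whatever the group, so a finite set
  embeds by numbering its elements.\<close>

lemma ex_point_copy:
  assumes "finite B"
  obtains e :: "'b \<Rightarrow> 'g point" and C where "bij_betw e B C"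
proof -
  obtain h :: "'b \<Rightarrow> nat" where "bij_betw h B {0..<card B}"
    using assms ex_bij_betw_finite_nat by blast
  then have "inj_on h B" by (simp add: bij_betw_def)
  then have "inj_on (\<lambda>b. ({}, h b) :: 'g point) B" by (auto simp: inj_on_def)
  then show thesis using that by (meson bij_betw_imageI)
qed

text \<open>This keeps \<open>xclass\<close> from being empty, so that a bispan built on other types
  still defines a morphism of the category.\<close>

lemma (in group) realization:
  assumes "\<beta> \<in> xbispans G X Y"
  obtains S where "S \<in> bispans G X Y" "xiso G \<beta> (of_bispan S)"
proof -
  obtain e :: "_ \<Rightarrow> 'a point" and A' where e: "bij_betw e (up \<beta>) A'"
    using ex_point_copy xbispansD(3)[OF assms] by blast
  obtain d :: "_ \<Rightarrow> 'a point" and B' where d: "bij_betw d (lo \<beta>) B'"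
    using ex_point_copy xbispansD(4)[OF assms] by blast
  obtain \<gamma> where \<gamma>: "\<gamma> \<in> xbispans G X Y" "xiso G \<beta> \<gamma>" "up \<gamma> = A'" "lo \<gamma> = B'"
    "up_act \<gamma> \<in> carrier G \<rightarrow>\<^sub>E (A' \<rightarrow>\<^sub>E A')" "lo_act \<gamma> \<in> carrier G \<rightarrow>\<^sub>E (B' \<rightarrow>\<^sub>E B')"
    "rleg \<gamma> \<in> A' \<rightarrow>\<^sub>E points X" "nleg \<gamma> \<in> A' \<rightarrow>\<^sub>E B'" "tleg \<gamma> \<in> B' \<rightarrow>\<^sub>E points Y"
    by (rule xbispan_transport[OF assms e d])
  define S where "S = \<lparr>src = X, top1 = \<lparr>points = A', act = up_act \<gamma>\<rparr>,
    top2 = \<lparr>points = B', act = lo_act \<gamma>\<rparr>, tgt = Y, res_leg = rleg \<gamma>, nm_leg = nleg \<gamma>, tr_leg = tleg \<gamma>\<rparr>"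
  have "of_bispan S = \<gamma>" using \<gamma>(3,4) by (simp add: of_bispan_def S_def)
  moreover have "S \<in> bispans G X Y"
    using xbispansD[OF \<gamma>(1)] \<gamma>(3-)
    by (auto simp: S_def bispans_def finite_gset_iff gset_hom_iff PiE_iff)
  ultimately show thesis using that \<gamma>(2) by metis
qed

lemma (in group) xclass_pg_hom:
  assumes "\<beta> \<in> xbispans G X Y"
  shows "xclass G X Y \<beta> \<in> pg_hom G X Y"
proof -
  obtain S where S: "S \<in> bispans G X Y" "xiso G \<beta> (of_bispan S)"
    by (rule realization[OF assms])
  have "xclass G X Y \<beta> = bispan_class G S"
    using xclass_cong[OF S(2) assms] bispan_class_eq[OF S(1)] by simp
  then show ?thesis
    using S(1) bispansD(1,2)[OF S(1)] by (auto simp: pg_hom_def bispan_class_def intro: quotientI)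
qed

lemma (in group) pg_hom_E:
  assumes "\<alpha> \<in> pg_hom G X Y"
  obtains S where "S \<in> bispans G X Y" "\<alpha> = xclass G X Y (of_bispan S)"
proof -
  from assms obtain S where "S \<in> bispans G X Y" "\<alpha> = bispan_iso G X Y `` {S}"
    by (auto simp: pg_hom_def quotient_def)
  then show thesis
    using that bispan_class_eq[of S X Y] bispansD(1,2)[of S G X Y] by (auto simp: bispan_class_def)
qed

section \<open>Pullbacks and dependent products\<close>

lemma (in group) gset_copy:
  assumes "gact G B \<phi>" "finite B"
  obtains X :: "'a gset" and e where "finite_gset G X" "bij_betw e B (points X)"
    "\<And>g b. \<lbrakk>g \<in> carrier G; b \<in> B\<rbrakk> \<Longrightarrow> e (\<phi> g b) = act X g (e b)"
proof -
  obtain e :: "_ \<Rightarrow> 'a point" and B' where e: "bij_betw e B B'"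
    using ex_point_copy assms(2) by blast
  define X where "X = \<lparr>points = B', act = \<lambda>g\<in>carrier G. \<lambda>y\<in>B'. e (\<phi> g (inv_into B e y))\<rparr>"
  have "finite_gset G X"
    using transport_gact(1)[OF assms(1) e] assms(2) e
    by (auto simp: X_def finite_gset_iff dest: bij_betw_finite)
  then show thesis
    using that[of X e] transport_gact(2)[OF assms(1) e] e by (simp add: X_def)
qed

lemma (in group) gset_facts:
  assumes "finite_gset G X"
  shows "finite (points X)" "gact G (points X) (act X)"
    "\<And>g x. \<lbrakk>g \<in> carrier G; x \<in> points X\<rbrakk> \<Longrightarrow> act X g x \<in> points X"
    "\<And>x. x \<in> points X \<Longrightarrow> act X \<one> x = x"
    "\<And>g h x. \<lbrakk>g \<in> carrier G; h \<in> carrier G; x \<in> points X\<rbrakk> \<Longrightarrow> act X (g \<otimes> h) x = act X g (act X h x)"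
    "\<And>g x. \<lbrakk>g \<in> carrier G; x \<in> points X\<rbrakk> \<Longrightarrow> act X g (act X (inv g) x) = x"
    "\<And>g x. \<lbrakk>g \<in> carrier G; x \<in> points X\<rbrakk> \<Longrightarrow> act X (inv g) (act X g x) = x"
  using assms by (auto simp: finite_gset_iff gact_closed gact_one gact_mult gact_inv)

lemma hom_facts:
  assumes "f \<in> gset_hom G X Y"
  shows "\<And>x. x \<in> points X \<Longrightarrow> f x \<in> points Y"
    "\<And>g x. \<lbrakk>g \<in> carrier G; x \<in> points X\<rbrakk> \<Longrightarrow> f (act X g x) = act Y g (f x)"
    "f \<in> extensional (points X)"
  using assms by (auto simp: gset_hom_iff gmap_def)

lemma gset_homI:
  assumes "\<And>x. x \<in> points X \<Longrightarrow> f x \<in> points Y"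
    "\<And>g x. \<lbrakk>g \<in> carrier G; x \<in> points X\<rbrakk> \<Longrightarrow> f (act X g x) = act Y g (f x)"
    "f \<in> extensional (points X)"
  shows "f \<in> gset_hom G X Y"
  using assms by (auto simp: gset_hom_iff gmap_def)

lemma hom_eqI:
  assumes "f \<in> extensional (points X)" "f' \<in> extensional (points X)"
    "\<And>x. x \<in> points X \<Longrightarrow> f x = f' x"
  shows "f = f'"
  using assms by (rule extensionalityI)

section \<open>Points of pullbacks and of dependent products\<close>

text \<open>The inverse of the comparison map to the fibre product, meaningful only for x and y with
  the same image.\<close>

definition pb_pt ::
    "'g gset \<Rightarrow> ('g point \<Rightarrow> 'g point) \<Rightarrow> ('g point \<Rightarrow> 'g point) \<Rightarrow> 'g point \<Rightarrow> 'g point \<Rightarrow> 'g point" where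
  "pb_pt P p q x y = (THE w. w \<in> points P \<and> p w = x \<and> q w = y)"

locale pullback_square = group G for G (structure) +
  fixes P p q X f Y g Z
  assumes pb: "is_pullback G P p q X f Y g Z"
begin

lemma pb_gsets: "finite_gset G P" "finite_gset G X" "finite_gset G Y" "finite_gset G Z"
    "p \<in> gset_hom G P X" "q \<in> gset_hom G P Y" "f \<in> gset_hom G X Z" "g \<in> gset_hom G Y Z"
  using pb by (simp_all add: is_pullback_def)

lemma pb_bij: "bij_betw (\<lambda>w. (p w, q w)) (points P) {(x, y). x \<in> points X \<and> y \<in> points Y \<and> f x = g y}"
  using pb by (simp add: is_pullback_def)

lemma pb_inj: "\<lbrakk>w \<in> points P; w' \<in> points P; p w = p w'; q w = q w'\<rbrakk> \<Longrightarrow> w = w'"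
  using pb_bij by (auto simp: bij_betw_def inj_on_def)

lemma pb_comm: "w \<in> points P \<Longrightarrow> f (p w) = g (q w)"
  using bij_betw_imp_funcset[OF pb_bij] by auto

lemma pb_pt:
  assumes "x \<in> points X" "y \<in> points Y" "f x = g y"
  shows "pb_pt P p q x y \<in> points P" "p (pb_pt P p q x y) = x" "q (pb_pt P p q x y) = y"
proof -
  have "(x, y) \<in> (\<lambda>w. (p w, q w)) ` points P"
    using pb_bij assms by (auto simp: bij_betw_def)
  then obtain w where w: "w \<in> points P" "p w = x" "q w = y" by auto
  have "pb_pt P p q x y = w"
    unfolding pb_pt_def by (rule the_equality) (use w pb_inj in auto)
  then show "pb_pt P p q x y \<in> points P" "p (pb_pt P p q x y) = x" "q (pb_pt P p q x y) = y"
    using w by auto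
qed

lemma pb_pt_eq: "w \<in> points P \<Longrightarrow> pb_pt P p q (p w) (q w) = w"
  using pb_pt[OF hom_facts(1)[OF pb_gsets(5)] hom_facts(1)[OF pb_gsets(6)]] pb_comm pb_inj by metis

lemma pb_pt_eqI: "\<lbrakk>w \<in> points P; p w = x; q w = y\<rbrakk> \<Longrightarrow> w = pb_pt P p q x y"
  using pb_pt_eq[of w] by simp

lemma pb_pt_act:
  assumes "x \<in> points X" "y \<in> points Y" "f x = g y" "h \<in> carrier G"
  shows "act P h (pb_pt P p q x y) = pb_pt P p q (act X h x) (act Y h y)"
  using assms pb_pt[OF assms(1-3)] pb_gsets
  by (intro pb_pt_eqI) (simp_all add: gset_facts hom_facts(2))

end

lemma (in group) pullback_ex:
  assumes X: "finite_gset G X" and Y: "finite_gset G Y" and Z: "finite_gset G Z"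
    and f: "f \<in> gset_hom G X Z" and g: "g \<in> gset_hom G Y Z"
  obtains P p q where "is_pullback G P p q X f Y g Z"
proof -
  define B where "B = {(x, y). x \<in> points X \<and> y \<in> points Y \<and> f x = g y}"
  define \<phi> where "\<phi> = (\<lambda>h (x, y). (act X h x, act Y h y))"
  have gB: "gact G B \<phi>"
    by (rule gactI) (auto simp: B_def \<phi>_def gset_facts[OF X] gset_facts[OF Y] hom_facts[OF f] hom_facts[OF g])
  have "B \<subseteq> points X \<times> points Y" by (auto simp: B_def)
  then have "finite B" using gset_facts(1)[OF X] gset_facts(1)[OF Y] finite_subset by blast
  then obtain P e where P: "finite_gset G P" and e: "bij_betw e B (points P)"
    and eq: "\<And>h b. \<lbrakk>h \<in> carrier G; b \<in> B\<rbrakk> \<Longrightarrow> e (\<phi> h b) = act P h (e b)"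
    using gset_copy[OF gB] by metis
  define i where "i = inv_into B e"
  have i: "\<And>w. w \<in> points P \<Longrightarrow> i w \<in> B" "\<And>w. w \<in> points P \<Longrightarrow> e (i w) = w" "\<And>b. b \<in> B \<Longrightarrow> i (e b) = b"
    using e unfolding i_def by (auto simp: bij_betw_def inv_into_f_f f_inv_into_f inv_into_into)
  have iact: "i (act P h w) = \<phi> h (i w)" if "h \<in> carrier G" "w \<in> points P" for h w
    using eq[OF that(1) i(1)[OF that(2)]] i that gact_closed[OF gB] by metis
  define p q where "p = (\<lambda>w\<in>points P. fst (i w))" and "q = (\<lambda>w\<in>points P. snd (i w))"
  have iB: "fst (i w) \<in> points X" "snd (i w) \<in> points Y" "f (fst (i w)) = g (snd (i w))"
    if "w \<in> points P" for w
    using i(1)[OF that] by (auto simp: B_def)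
  have "p \<in> gset_hom G P X" "q \<in> gset_hom G P Y"
    by (rule gset_homI; simp add: p_def q_def iB iact gset_facts[OF P] \<phi>_def split_beta)+
  moreover have "bij_betw (\<lambda>w. (p w, q w)) (points P) B"
    by (rule bij_betw_byWitness[where f' = e])
      (use i e in \<open>auto simp: p_def q_def bij_betw_def\<close>)
  ultimately have "is_pullback G P p q X f Y g Z"
    using P X Y Z f g by (simp add: is_pullback_def B_def)
  then show thesis by (rule that)
qed

text \<open>
  A point \<open>\<epsilon>\<close> of the dependent product \<open>p : E \<rightarrow> Z\<close> of \<open>f : X \<rightarrow> Y\<close> along \<open>g : Y \<rightarrow> Z\<close> amounts to the point
  \<open>p \<epsilon>\<close> and the section of \<open>f\<close> over the fibre of \<open>g\<close> at \<open>p \<epsilon>\<close> that is read off from the counit.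
\<close>

definition dp_sec ::
    "'g gset \<Rightarrow> ('g point \<Rightarrow> 'g point) \<Rightarrow> ('g point \<Rightarrow> 'g point) \<Rightarrow> 'g gset \<Rightarrow>
     ('g point \<Rightarrow> 'g point) \<Rightarrow> ('g point \<Rightarrow> 'g point) \<Rightarrow> ('g point \<Rightarrow> 'g point) \<Rightarrow>
     'g point \<Rightarrow> 'g point \<Rightarrow> 'g point" where
  "dp_sec Y g p P q g' e \<epsilon> = (\<lambda>y\<in>{y\<in>points Y. g y = p \<epsilon>}. e (pb_pt P q g' y \<epsilon>))"

definition dp_sections ::
    "'g gset \<Rightarrow> ('g point \<Rightarrow> 'g point) \<Rightarrow> 'g gset \<Rightarrow> ('g point \<Rightarrow> 'g point) \<Rightarrow> 'g gset \<Rightarrow>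
     ('g point \<times> ('g point \<Rightarrow> 'g point)) set" where
  "dp_sections X f Y g Z =
     {(z, s). z \<in> points Z \<and> s \<in> (\<Pi>\<^sub>E y\<in>{y\<in>points Y. g y = z}. {x\<in>points X. f x = y})}"

text \<open>Everything in \<open>is_dependent_product\<close> except the universal property. The
  lemmas \<open>dp_conv\<close> and \<open>dp_imp\<close> show that the latter means exactly that
  the points of E are the sections.\<close>

locale dependent_square = pullback_square G P q g' Y g E p Z
  for G (structure) and P q g' Y g E p Z +
  fixes X f e
  assumes X: "finite_gset G X" and f: "f \<in> gset_hom G X Y" and e: "e \<in> gset_hom G P X"
    and fe: "gset_comp P f e = q"
begin

abbreviation "sec \<equiv> dp_sec Y g p P q g' e"

lemma sec_app: "\<lbrakk>y \<in> points Y; g y = p \<epsilon>\<rbrakk> \<Longrightarrow> sec \<epsilon> y = e (pb_pt P q g' y \<epsilon>)"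
  by (simp add: dp_sec_def)

lemma fe_app: "w \<in> points P \<Longrightarrow> f (e w) = q w"
  using fe by (metis gset_comp_apply)

lemma sec_in:
  assumes "\<epsilon> \<in> points E"
  shows "(p \<epsilon>, sec \<epsilon>) \<in> dp_sections X f Y g Z"
  using assms pb_gsets by (auto simp: dp_sections_def dp_sec_def hom_facts(1)[OF e] fe_app pb_pt
    hom_facts(1)[OF pb_gsets(8)])

lemma sec_act:
  assumes "\<epsilon> \<in> points E" "h \<in> carrier G" "y \<in> points Y" "g y = p \<epsilon>"
  shows "sec (act E h \<epsilon>) (act Y h y) = act X h (sec \<epsilon> y)"
  using assms pb_gsets
  by (simp add: sec_app gset_facts hom_facts(2) pb_pt_act[symmetric] hom_facts(2)[OF e] pb_pt)

text \<open>Reading off sections turns the action on E into conjugation of sections; the fibre on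
  which the section lives moves along.\<close>

lemma sec_eq_act:
  assumes "\<epsilon> \<in> points E" "h \<in> carrier G"
  shows "sec (act E h \<epsilon>) = (\<lambda>y\<in>{y\<in>points Y. g y = act Z h (p \<epsilon>)}. act X h (sec \<epsilon> (act Y (inv h) y)))"
proof (rule extensionalityI[where A = "{y\<in>points Y. g y = act Z h (p \<epsilon>)}"])
  show "sec (act E h \<epsilon>) \<in> extensional {y \<in> points Y. g y = act Z h (p \<epsilon>)}"
    using assms pb_gsets by (simp add: dp_sec_def hom_facts(2)[OF pb_gsets(8)])
  fix y assume y: "y \<in> {y \<in> points Y. g y = act Z h (p \<epsilon>)}"
  note F = gset_facts[OF pb_gsets(2)] gset_facts[OF pb_gsets(3)] gset_facts[OF pb_gsets(4)]
    hom_facts[OF pb_gsets(7)] hom_facts[OF pb_gsets(8)]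
  have "sec (act E h \<epsilon>) (act Y h (act Y (inv h) y)) = act X h (sec \<epsilon> (act Y (inv h) y))"
    by (rule sec_act) (use y assms F in auto)
  then show "sec (act E h \<epsilon>) y =
      (\<lambda>y\<in>{y\<in>points Y. g y = act Z h (p \<epsilon>)}. act X h (sec \<epsilon> (act Y (inv h) y))) y"
    using y assms F by simp
qed auto

text \<open>A map u out of the pullback V transposes to a family of sections indexed by W, and the
  bijection turns the family into a map to E. Injectivity yields both its equivariance and its
  uniqueness.\<close>

lemma dp_conv:
  assumes bij: "bij_betw (\<lambda>\<epsilon>. (p \<epsilon>, sec \<epsilon>)) (points E) (dp_sections X f Y g Z)"
  shows "is_dependent_product G X f Y g Z E p P q g' e"
  unfolding is_dependent_product_def
proof (intro conjI allI impI X f pb e fe; elim conjE)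
  fix W w V v gW u
  assume V: "is_pullback G V v gW Y g W w Z" and u: "u \<in> gset_hom G V X" and fu: "gset_comp V f u = v"
  interpret V: pullback_square G V v gW Y g W w Z by unfold_locales (rule V)
  note F = gset_facts[OF pb_gsets(1)] gset_facts[OF pb_gsets(2)] gset_facts[OF pb_gsets(3)]
    gset_facts[OF pb_gsets(4)] gset_facts[OF X] gset_facts[OF V.pb_gsets(1)] gset_facts[OF V.pb_gsets(3)]
    hom_facts[OF pb_gsets(7)] hom_facts[OF pb_gsets(8)] hom_facts[OF pb_gsets(5)] hom_facts[OF pb_gsets(6)]
    hom_facts[OF V.pb_gsets(5)] hom_facts[OF V.pb_gsets(6)] hom_facts[OF V.pb_gsets(8)]
    hom_facts[OF f] hom_facts[OF e] hom_facts[OF u]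
  have fu': "f (u \<nu>) = v \<nu>" if "\<nu> \<in> points V" for \<nu> using fu that by (metis gset_comp_apply)
  \<comment> \<open>The transpose of u: the fibre of V over \<omega> is a copy of the fibre of g at
    \<open>w \<omega>\<close>, so u restricts to a section over it.\<close>
  define \<sigma> where "\<sigma> = (\<lambda>\<omega>. \<lambda>y\<in>{y\<in>points Y. g y = w \<omega>}. u (pb_pt V v gW y \<omega>))"
  have \<sigma>: "(w \<omega>, \<sigma> \<omega>) \<in> dp_sections X f Y g Z" if "\<omega> \<in> points W" for \<omega>
    using that by (simp add: dp_sections_def \<sigma>_def F V.pb_pt fu' PiE_iff)
  have ex: "\<exists>\<epsilon>\<in>points E. p \<epsilon> = w \<omega> \<and> sec \<epsilon> = \<sigma> \<omega>" if "\<omega> \<in> points W" for \<omega>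
  proof -
    have "(w \<omega>, \<sigma> \<omega>) \<in> (\<lambda>\<epsilon>. (p \<epsilon>, sec \<epsilon>)) ` points E"
      using \<sigma>[OF that] bij by (simp add: bij_betw_def)
    then show ?thesis by (elim imageE) (simp, blast)
  qed
  have inj: "\<epsilon> = \<epsilon>'" if "\<epsilon> \<in> points E" "\<epsilon>' \<in> points E" "p \<epsilon> = p \<epsilon>'" "sec \<epsilon> = sec \<epsilon>'" for \<epsilon> \<epsilon>'
    using bij that by (auto simp: bij_betw_def inj_on_def)
  define s where "s = (\<lambda>\<omega>\<in>points W. SOME \<epsilon>. \<epsilon> \<in> points E \<and> p \<epsilon> = w \<omega> \<and> sec \<epsilon> = \<sigma> \<omega>)"
  have s: "s \<omega> \<in> points E" "p (s \<omega>) = w \<omega>" "sec (s \<omega>) = \<sigma> \<omega>" if "\<omega> \<in> points W" for \<omega>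
    using someI_ex[of "\<lambda>\<epsilon>. \<epsilon> \<in> points E \<and> p \<epsilon> = w \<omega> \<and> sec \<epsilon> = \<sigma> \<omega>"] ex[OF that] that
    unfolding s_def by auto
  have sact: "s (act W h \<omega>) = act E h (s \<omega>)" if "h \<in> carrier G" "\<omega> \<in> points W" for h \<omega>
  proof (rule inj)
    have "sec (act E h (s \<omega>)) = (\<lambda>y\<in>{y\<in>points Y. g y = act Z h (w \<omega>)}. act X h (\<sigma> \<omega> (act Y (inv h) y)))"
      using sec_eq_act[OF s(1)[OF that(2)] that(1)] s that by simp
    also have "\<dots> = \<sigma> (act W h \<omega>)"
    proof (rule extensionalityI[where A = "{y\<in>points Y. g y = act Z h (w \<omega>)}"])
      fix y assume y: "y \<in> {y\<in>points Y. g y = act Z h (w \<omega>)}"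
      then have y': "act Y (inv h) y \<in> points Y" "g (act Y (inv h) y) = w \<omega>"
        using that F by auto
      have "act X h (\<sigma> \<omega> (act Y (inv h) y)) = u (act V h (pb_pt V v gW (act Y (inv h) y) \<omega>))"
        using y' that F V.pb_pt by (simp add: \<sigma>_def)
      also have "\<dots> = \<sigma> (act W h \<omega>) y"
        using y' y that F V.pb_pt_act by (simp add: \<sigma>_def)
      finally show "(\<lambda>y\<in>{y\<in>points Y. g y = act Z h (w \<omega>)}. act X h (\<sigma> \<omega> (act Y (inv h) y))) y
          = \<sigma> (act W h \<omega>) y" using y by simp
    qed (use that F in \<open>auto simp: \<sigma>_def\<close>)
    finally show "sec (s (act W h \<omega>)) = sec (act E h (s \<omega>))" using s that F by simp
  qed (use that s F in auto)
  have shom: "s \<in> gset_hom G W E"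
    by (rule gset_homI) (use s sact in \<open>auto simp: s_def\<close>)
  have ps: "gset_comp W p s = w"
    by (rule hom_eqI[where X = W]) (use s F in auto)
  \<comment> \<open>This t is forced, since it has to lie over v and over s after gW.\<close>
  define t where "t = (\<lambda>\<nu>\<in>points V. pb_pt P q g' (v \<nu>) (s (gW \<nu>)))"
  have t: "t \<nu> \<in> points P" "q (t \<nu>) = v \<nu>" "g' (t \<nu>) = s (gW \<nu>)" if "\<nu> \<in> points V" for \<nu>
    using that s F V.pb_comm[OF that] pb_pt by (auto simp: t_def)
  have thom: "t \<in> gset_hom G V P"
    by (rule gset_homI) (use t s sact F V.pb_comm pb_pt_act in \<open>auto simp: t_def\<close>)
  have et: "e (t \<nu>) = u \<nu>" if "\<nu> \<in> points V" for \<nu>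
  proof -
    have "sec (s (gW \<nu>)) (v \<nu>) = e (pb_pt P q g' (v \<nu>) (s (gW \<nu>)))"
      by (rule sec_app) (use that V.pb_comm[OF that] s(2) in \<open>simp_all add: F\<close>)
    then have "e (t \<nu>) = sec (s (gW \<nu>)) (v \<nu>)" using that by (simp add: t_def)
    also have "\<dots> = u \<nu>"
      using that s(3)[of "gW \<nu>"] V.pb_comm[OF that] V.pb_pt_eq[OF that] by (simp add: F \<sigma>_def)
    finally show ?thesis .
  qed
  have uniq: "s' = s" if s': "s' \<in> gset_hom G W E" "gset_comp W p s' = w"
      and t': "t' \<in> gset_hom G V P" "gset_comp V q t' = v" "gset_comp V g' t' = gset_comp V s' gW"
        "gset_comp V e t' = u" for s' t'
  proof (rule hom_eqI[where X = W])
    fix \<omega> assume \<omega>: "\<omega> \<in> points W"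
    have p': "p (s' \<omega>) = w \<omega>" using s'(2) \<omega> by (metis gset_comp_apply)
    show "s' \<omega> = s \<omega>"
    proof (rule inj)
      show "sec (s' \<omega>) = sec (s \<omega>)"
      proof (rule extensionalityI[where A = "{y\<in>points Y. g y = w \<omega>}"])
        fix y assume y: "y \<in> {y\<in>points Y. g y = w \<omega>}"
        define \<nu> where "\<nu> = pb_pt V v gW y \<omega>"
        have \<nu>: "\<nu> \<in> points V" "v \<nu> = y" "gW \<nu> = \<omega>" using y \<omega> V.pb_pt by (auto simp: \<nu>_def)
        have "t' \<nu> = pb_pt P q g' y (s' \<omega>)"
          by (rule pb_pt_eqI) (use \<nu> t' hom_facts[OF t'(1)] in \<open>auto dest: fun_cong[of _ _ \<nu>]\<close>)
        then have "sec (s' \<omega>) y = e (t' \<nu>)" using y p' by (simp add: sec_app)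
        also have "\<dots> = u \<nu>" using t'(4) \<nu> by (metis gset_comp_apply)
        also have "\<dots> = sec (s \<omega>) y" using y \<omega> s by (simp add: \<sigma>_def \<nu>_def)
        finally show "sec (s' \<omega>) y = sec (s \<omega>) y" .
      qed (use p' s(2)[OF \<omega>] in \<open>simp_all add: dp_sec_def\<close>)
    qed (use \<omega> s p' hom_facts[OF s'(1)] in auto)
  qed (use hom_facts(3)[OF s'(1)] in \<open>auto simp: s_def\<close>)
  show "\<exists>!s. s \<in> gset_hom G W E \<and> gset_comp W p s = w \<and>
     (\<exists>t\<in>gset_hom G V P. gset_comp V q t = v \<and> gset_comp V g' t = gset_comp V s gW \<and> gset_comp V e t = u)"
  proof (rule ex1I[of _ s], intro conjI shom ps bexI[of _ t] thom)
    show "gset_comp V q t = v" by (rule hom_eqI[where X = V]) (use t F in auto)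
    show "gset_comp V g' t = gset_comp V s gW" by (rule hom_eqI[where X = V]) (use t F in auto)
    show "gset_comp V e t = u" by (rule hom_eqI[where X = V]) (use et F in auto)
  qed (use uniq in blast)
qed

text \<open>The set of all sections is itself a finite G-set and can serve as test object W. The
  universal property then gives s from W to E, and the section of \<open>s (i (z, \<sigma>))\<close>
  is \<sigma>, so every section occurs. Injectivity follows from the uniqueness part, applied to E
  itself.\<close>

lemma dp_imp:
  assumes DP: "is_dependent_product G X f Y g Z E p P q g' e"
  shows "bij_betw (\<lambda>\<epsilon>. (p \<epsilon>, sec \<epsilon>)) (points E) (dp_sections X f Y g Z)"
proof -
  note UP = DP[unfolded is_dependent_product_def, THEN conjunct2, THEN conjunct2, THEN conjunct2,
      THEN conjunct2, THEN conjunct2, rule_format]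
  define \<Gamma> where "\<Gamma> = dp_sections X f Y g Z"
  define \<phi> where "\<phi> = (\<lambda>h (z, s). (act Z h z, \<lambda>y\<in>{y\<in>points Y. g y = act Z h z}. act X h (s (act Y (inv h) y))))"
  note F = gset_facts[OF pb_gsets(1)] gset_facts[OF pb_gsets(2)] gset_facts[OF pb_gsets(3)]
    gset_facts[OF pb_gsets(4)] gset_facts[OF X]
    hom_facts[OF pb_gsets(7)] hom_facts[OF pb_gsets(8)] hom_facts[OF pb_gsets(5)] hom_facts[OF pb_gsets(6)]
    hom_facts[OF f] hom_facts[OF e]
  have g\<Gamma>: "gact G \<Gamma> \<phi>"
  proof (rule gactI)
    fix b assume "b \<in> \<Gamma>"
    then obtain z s where b: "b = (z, s)" "z \<in> points Z"
      and s: "s \<in> (\<Pi>\<^sub>E y\<in>{y\<in>points Y. g y = z}. {x\<in>points X. f x = y})"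
      by (auto simp: \<Gamma>_def dp_sections_def)
    have s': "s y \<in> points X" "f (s y) = y" if "y \<in> points Y" "g y = z" for y
      using PiE_mem[OF s, of y] that by auto
    show "\<phi> \<one> b = b"
    proof -
      have "(\<lambda>y\<in>{y\<in>points Y. g y = z}. act X \<one> (s (act Y (inv \<one>) y))) = s"
        by (rule extensionalityI[where A = "{y\<in>points Y. g y = z}"])
         (use s s' F in \<open>auto simp: PiE_def\<close>)
      then show ?thesis using b F by (simp add: \<phi>_def)
    qed
    show "\<phi> h b \<in> \<Gamma>" if "h \<in> carrier G" for h
      using that b s' F by (auto simp: \<Gamma>_def \<phi>_def dp_sections_def)
    show "\<phi> (h \<otimes> k) b = \<phi> h (\<phi> k b)" if hk: "h \<in> carrier G" "k \<in> carrier G" for h k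
    proof -
      have "(\<lambda>y\<in>{y\<in>points Y. g y = act Z (h \<otimes> k) z}. act X (h \<otimes> k) (s (act Y (inv (h \<otimes> k)) y))) =
        (\<lambda>y\<in>{y\<in>points Y. g y = act Z h (act Z k z)}.
           act X h ((\<lambda>y\<in>{y\<in>points Y. g y = act Z k z}. act X k (s (act Y (inv k) y))) (act Y (inv h) y)))"
        by (rule extensionalityI[where A = "{y\<in>points Y. g y = act Z (h \<otimes> k) z}"])
         (use hk b s' F in \<open>auto simp: inv_mult_group\<close>)
      then show ?thesis using b hk F by (simp add: \<phi>_def)
    qed
  qed
  have "(\<Pi>\<^sub>E y\<in>{y\<in>points Y. g y = z}. {x\<in>points X. f x = y}) \<subseteq>
      (\<Pi>\<^sub>E y\<in>{y\<in>points Y. g y = z}. points X)" for z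
    by (rule PiE_mono) blast
  then have "\<Gamma> \<subseteq> Sigma (points Z) (\<lambda>z. \<Pi>\<^sub>E y\<in>{y\<in>points Y. g y = z}. points X)"
    unfolding \<Gamma>_def dp_sections_def by blast
  then have fin\<Gamma>: "finite \<Gamma>"
    by (rule finite_subset) (use F in \<open>auto intro!: finite_SigmaI finite_PiE\<close>)
  obtain W i where W: "finite_gset G W" and i: "bij_betw i \<Gamma> (points W)"
    and iact: "\<And>h b. \<lbrakk>h \<in> carrier G; b \<in> \<Gamma>\<rbrakk> \<Longrightarrow> i (\<phi> h b) = act W h (i b)"
    using gset_copy[OF g\<Gamma> fin\<Gamma>] by metis
  define j where "j = inv_into \<Gamma> i"
  have j: "\<And>w. w \<in> points W \<Longrightarrow> j w \<in> \<Gamma>" "\<And>w. w \<in> points W \<Longrightarrow> i (j w) = w" "\<And>b. b \<in> \<Gamma> \<Longrightarrow> j (i b) = b"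
     "\<And>b. b \<in> \<Gamma> \<Longrightarrow> i b \<in> points W"
    using i unfolding j_def by (auto simp: bij_betw_def inv_into_f_f f_inv_into_f inv_into_into)
  have jact: "j (act W h w) = \<phi> h (j w)" if "h \<in> carrier G" "w \<in> points W" for h w
    using iact[OF that(1) j(1)[OF that(2)]] j that gact_closed[OF g\<Gamma>] by metis
  define w where "w = (\<lambda>\<omega>\<in>points W. fst (j \<omega>))"
  have jin: "fst (j \<omega>) \<in> points Z" "\<And>y. \<lbrakk>y \<in> points Y; g y = fst (j \<omega>)\<rbrakk> \<Longrightarrow>
      snd (j \<omega>) y \<in> points X \<and> f (snd (j \<omega>) y) = y" if "\<omega> \<in> points W" for \<omega>
    using j(1)[OF that] by (auto simp: \<Gamma>_def dp_sections_def)
  have whom: "w \<in> gset_hom G W Z"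
    by (rule gset_homI) (auto simp: w_def jin jact \<phi>_def split_beta gset_facts[OF W])
  obtain V v gW where V: "is_pullback G V v gW Y g W w Z"
    using pullback_ex[OF pb_gsets(2) W pb_gsets(4) pb_gsets(7) whom] by metis
  interpret V: pullback_square G V v gW Y g W w Z by unfold_locales (rule V)
  note FV = gset_facts[OF V.pb_gsets(1)] gset_facts[OF W] hom_facts[OF V.pb_gsets(5)]
    hom_facts[OF V.pb_gsets(6)] hom_facts[OF whom]
  \<comment> \<open>The tautological map: evaluate the section at the point of the fibre.\<close>
  define u where "u = (\<lambda>\<nu>\<in>points V. snd (j (gW \<nu>)) (v \<nu>))"
  have gv: "g (v \<nu>) = fst (j (gW \<nu>))" if "\<nu> \<in> points V" for \<nu>
    using V.pb_comm[OF that] FV that by (simp add: w_def)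
  have uin: "u \<nu> \<in> points X" "f (u \<nu>) = v \<nu>" if "\<nu> \<in> points V" for \<nu>
    using jin[of "gW \<nu>"] FV that gv by (auto simp: u_def)
  have uhom: "u \<in> gset_hom G V X"
  proof (rule gset_homI)
    fix h \<nu> assume h: "h \<in> carrier G" "\<nu> \<in> points V"
    then show "u (act V h \<nu>) = act X h (u \<nu>)"
      using FV F gv by (simp add: u_def jact \<phi>_def split_beta)
  qed (use uin in \<open>auto simp: u_def\<close>)
  have "gset_comp V f u = v" by (rule hom_eqI[where X = V]) (use uin FV in auto)
  then obtain s t where s: "s \<in> gset_hom G W E" "gset_comp W p s = w"
    and t: "t \<in> gset_hom G V P" "gset_comp V q t = v" "gset_comp V g' t = gset_comp V s gW"
        "gset_comp V e t = u"
    using UP[OF conjI[OF V conjI[OF uhom]]] by blast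
  have ps: "p (s \<omega>) = w \<omega>" if "\<omega> \<in> points W" for \<omega> using s(2) that by (metis gset_comp_apply)
  have sec_s: "sec (s (i (z, \<sigma>))) = \<sigma>" "p (s (i (z, \<sigma>))) = z" if z\<sigma>: "(z, \<sigma>) \<in> \<Gamma>" for z \<sigma>
  proof -
    define \<omega> where "\<omega> = i (z, \<sigma>)"
    have \<omega>: "\<omega> \<in> points W" "j \<omega> = (z, \<sigma>)" using j z\<sigma> by (auto simp: \<omega>_def)
    then have pz: "p (s \<omega>) = z" using ps by (simp add: w_def)
    have "sec (s \<omega>) = \<sigma>"
    proof (rule extensionalityI[where A = "{y\<in>points Y. g y = z}"])
      show "\<sigma> \<in> extensional {y\<in>points Y. g y = z}"
        using z\<sigma> by (auto simp: \<Gamma>_def dp_sections_def PiE_def)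
      fix y assume y: "y \<in> {y\<in>points Y. g y = z}"
      define \<nu> where "\<nu> = pb_pt V v gW y \<omega>"
      have \<nu>: "\<nu> \<in> points V" "v \<nu> = y" "gW \<nu> = \<omega>" using y \<omega> V.pb_pt by (auto simp: \<nu>_def w_def)
      have "t \<nu> = pb_pt P q g' y (s \<omega>)"
        by (rule pb_pt_eqI) (use \<nu> t hom_facts[OF t(1)] in \<open>auto dest: fun_cong[of _ _ \<nu>]\<close>)
      then have "sec (s \<omega>) y = e (t \<nu>)" using y pz by (simp add: sec_app)
      also have "\<dots> = u \<nu>" using t(4) \<nu> by (metis gset_comp_apply)
      also have "\<dots> = \<sigma> y" using \<nu> \<omega> by (simp add: u_def)
      finally show "sec (s \<omega>) y = \<sigma> y" .
    qed (simp add: dp_sec_def pz)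
    then show "sec (s (i (z, \<sigma>))) = \<sigma>" "p (s (i (z, \<sigma>))) = z" using pz by (auto simp: \<omega>_def)
  qed
  have sin: "s \<omega> \<in> points E" if "\<omega> \<in> points W" for \<omega> using that hom_facts(1)[OF s(1)] by simp
  \<comment> \<open>Replaces a point by the one that s assigns to its section. Both r and the
    identity solve the universal problem for W = E and u = e, so they coincide and s inverts the
    passage to sections.\<close>
  define r where "r = (\<lambda>\<epsilon>\<in>points E. s (i (p \<epsilon>, sec \<epsilon>)))"
  have r: "r \<epsilon> \<in> points E" "p (r \<epsilon>) = p \<epsilon>" "sec (r \<epsilon>) = sec \<epsilon>" if "\<epsilon> \<in> points E" for \<epsilon>
    using sec_in[OF that] sec_s j(4) sin that by (auto simp: r_def \<Gamma>_def)
  have ract: "r (act E h \<epsilon>) = act E h (r \<epsilon>)" if "h \<in> carrier G" "\<epsilon> \<in> points E" for h \<epsilon>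
  proof -
    have "(p (act E h \<epsilon>), sec (act E h \<epsilon>)) = \<phi> h (p \<epsilon>, sec \<epsilon>)"
      using that F by (simp add: sec_eq_act \<phi>_def)
    then have "r (act E h \<epsilon>) = s (i (\<phi> h (p \<epsilon>, sec \<epsilon>)))" using that F by (simp add: r_def)
    also have "\<dots> = act E h (r \<epsilon>)"
      using that sec_in[OF that(2)] iact j(4) hom_facts(2)[OF s(1)] by (simp add: r_def \<Gamma>_def)
    finally show ?thesis .
  qed
  have rhom: "r \<in> gset_hom G E E" by (rule gset_homI) (use r ract in \<open>auto simp: r_def\<close>)
  define \<tau> where "\<tau> = (\<lambda>\<pi>\<in>points P. pb_pt P q g' (q \<pi>) (r (g' \<pi>)))"
  have cm: "g (q \<pi>) = p (r (g' \<pi>))" if "\<pi> \<in> points P" for \<pi>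
    using pb_comm[OF that] r that F by simp
  have \<tau>: "\<tau> \<pi> \<in> points P" "q (\<tau> \<pi>) = q \<pi>" "g' (\<tau> \<pi>) = r (g' \<pi>)" if "\<pi> \<in> points P" for \<pi>
    using that r F cm pb_pt by (auto simp: \<tau>_def)
  have \<tau>hom: "\<tau> \<in> gset_hom G P P"
    by (rule gset_homI) (use \<tau> r ract F cm pb_pt_act in \<open>auto simp: \<tau>_def\<close>)
  have e\<tau>: "e (\<tau> \<pi>) = e \<pi>" if "\<pi> \<in> points P" for \<pi>
  proof -
    have "sec (r (g' \<pi>)) (q \<pi>) = e (pb_pt P q g' (q \<pi>) (r (g' \<pi>)))"
      by (rule sec_app) (use that cm[OF that] in \<open>simp_all add: F\<close>)
    then have "e (\<tau> \<pi>) = sec (r (g' \<pi>)) (q \<pi>)" using that by (simp add: \<tau>_def)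
    also have "\<dots> = sec (g' \<pi>) (q \<pi>)" using that r(3) by (simp add: F)
    also have "\<dots> = e (pb_pt P q g' (q \<pi>) (g' \<pi>))"
      by (rule sec_app) (use that pb_comm[OF that] in \<open>simp_all add: F\<close>)
    also have "\<dots> = e \<pi>" using that by (simp add: pb_pt_eq)
    finally show ?thesis .
  qed
  have "\<exists>!s. s \<in> gset_hom G E E \<and> gset_comp E p s = p \<and>
     (\<exists>t\<in>gset_hom G P P. gset_comp P q t = q \<and> gset_comp P g' t = gset_comp P s g' \<and> gset_comp P e t = e)"
    by (rule UP) (use pb e fe in simp)
  moreover have "r \<in> gset_hom G E E \<and> gset_comp E p r = p \<and>
     (\<exists>t\<in>gset_hom G P P. gset_comp P q t = q \<and> gset_comp P g' t = gset_comp P r g' \<and> gset_comp P e t = e)"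
  proof (intro conjI rhom bexI[of _ \<tau>] \<tau>hom)
    show "gset_comp E p r = p" by (rule hom_eqI[where X = E]) (use r F in auto)
    show "gset_comp P q \<tau> = q" "gset_comp P e \<tau> = e" by (rule hom_eqI[where X = P]; use \<tau> e\<tau> F in auto)+
    show "gset_comp P g' \<tau> = gset_comp P r g'" by (rule hom_eqI[where X = P]) (use \<tau> in auto)
  qed
  moreover have "gset_id E \<in> gset_hom G E E \<and> gset_comp E p (gset_id E) = p \<and>
     (\<exists>t\<in>gset_hom G P P. gset_comp P q t = q \<and> gset_comp P g' t = gset_comp P (gset_id E) g' \<and> gset_comp P e t = e)"
  proof (intro conjI gset_id_hom pb_gsets bexI[of _ "gset_id P"])
    show "gset_comp E p (gset_id E) = p" by (rule hom_eqI[where X = E]) (use F in auto)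
    show "gset_comp P q (gset_id P) = q" "gset_comp P e (gset_id P) = e"
      by (rule hom_eqI[where X = P]; use F in auto)+
    show "gset_comp P g' (gset_id P) = gset_comp P (gset_id E) g'"
      by (rule hom_eqI[where X = P]) (use F in auto)
  qed
  ultimately have rid: "r = gset_id E" by blast
  show ?thesis
  proof (rule bij_betwI')
    show "((p \<epsilon>, sec \<epsilon>) = (p \<epsilon>', sec \<epsilon>')) = (\<epsilon> = \<epsilon>')" if "\<epsilon> \<in> points E" "\<epsilon>' \<in> points E" for \<epsilon> \<epsilon>'
    proof -
      have *: "s (i (p \<epsilon>, sec \<epsilon>)) = \<epsilon>" "s (i (p \<epsilon>', sec \<epsilon>')) = \<epsilon>'"
        using rid that by (simp_all add: r_def fun_eq_iff) (metis gset_id_apply)+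
      show ?thesis
      proof
        assume "(p \<epsilon>, sec \<epsilon>) = (p \<epsilon>', sec \<epsilon>')"
        then have "s (i (p \<epsilon>, sec \<epsilon>)) = s (i (p \<epsilon>', sec \<epsilon>'))" by (rule arg_cong)
        then show "\<epsilon> = \<epsilon>'" by (simp only: *)
      qed simp
    qed
    show "(p \<epsilon>, sec \<epsilon>) \<in> dp_sections X f Y g Z" if "\<epsilon> \<in> points E" for \<epsilon> by (rule sec_in[OF that])
    show "\<exists>\<epsilon>\<in>points E. b = (p \<epsilon>, sec \<epsilon>)" if "b \<in> dp_sections X f Y g Z" for b
    proof -
      obtain z \<sigma> where b: "b = (z, \<sigma>)" by (cases b)
      then have "(z, \<sigma>) \<in> \<Gamma>" using that by (simp add: \<Gamma>_def)
      then show ?thesis using sec_s[of z \<sigma>] j(4)[of "(z, \<sigma>)"] sin b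
        by (intro bexI[of _ "s (i (z, \<sigma>))"]) simp_all
    qed
  qed
qed

end

section \<open>Composition of bispans\<close>

text \<open>
  The composite of \<open>X \<leftarrow> A \<rightarrow> B \<rightarrow> Y\<close> and \<open>Y \<leftarrow> C \<rightarrow> E \<rightarrow> Z\<close> is \<open>X \<leftarrow> A' \<rightarrow> E' \<rightarrow> Z\<close>, where \<open>E'\<close> (\<open>xlo\<close>) consists of
  the points \<open>e\<close> of \<open>E\<close> with a lift \<open>s\<close> of the fibre \<open>C\<^sub>e \<rightarrow> Y\<close> to \<open>B\<close>, and the fibre of \<open>A'\<close> (\<open>xup\<close>) over
  \<open>(e, s)\<close> is the union of the fibres of \<open>A\<close> over the values of \<open>s\<close>.
\<close>

definition xfib :: "('g, 'c, 'b) xbispan \<Rightarrow> 'b \<Rightarrow> 'c set" where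
  "xfib \<beta> d = {c \<in> up \<beta>. nleg \<beta> c = d}"

definition xlo :: "('g, 'e, 'd) xbispan \<Rightarrow> ('g, 'c, 'b) xbispan \<Rightarrow> ('d \<times> ('e \<Rightarrow> 'b)) set" where
  "xlo \<beta>' \<beta> = {(d, s). d \<in> lo \<beta>' \<and> s \<in> (\<Pi>\<^sub>E c\<in>xfib \<beta>' d. {b \<in> lo \<beta>. tleg \<beta> b = rleg \<beta>' c})}"

definition xup :: "('g, 'e, 'd) xbispan \<Rightarrow> ('g, 'c, 'b) xbispan \<Rightarrow> (('d \<times> ('e \<Rightarrow> 'b)) \<times> 'e \<times> 'c) set" where
  "xup \<beta>' \<beta> = {(y, c, a). y \<in> xlo \<beta>' \<beta> \<and> c \<in> xfib \<beta>' (fst y) \<and> a \<in> up \<beta> \<and> nleg \<beta> a = snd y c}"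

text \<open>The conjugation action on lifts, cut down to the translated fibre so that the result is
  again extensional.\<close>

definition xlo_act :: "('g, 'm) monoid_scheme \<Rightarrow> ('g, 'e, 'd) xbispan \<Rightarrow> ('g, 'c, 'b) xbispan \<Rightarrow>
    'g \<Rightarrow> 'd \<times> ('e \<Rightarrow> 'b) \<Rightarrow> 'd \<times> ('e \<Rightarrow> 'b)" where
  "xlo_act G \<beta>' \<beta> g y = (lo_act \<beta>' g (fst y),
     \<lambda>c\<in>xfib \<beta>' (lo_act \<beta>' g (fst y)). lo_act \<beta> g (snd y (up_act \<beta>' (inv\<^bsub>G\<^esub> g) c)))"

definition xcomp :: "('g, 'm) monoid_scheme \<Rightarrow> ('g, 'e, 'd) xbispan \<Rightarrow> ('g, 'c, 'b) xbispan \<Rightarrow>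
    ('g, ('d \<times> ('e \<Rightarrow> 'b)) \<times> 'e \<times> 'c, 'd \<times> ('e \<Rightarrow> 'b)) xbispan" where
  "xcomp G \<beta>' \<beta> = \<lparr>up = xup \<beta>' \<beta>,
     up_act = \<lambda>g w. (xlo_act G \<beta>' \<beta> g (fst w), up_act \<beta>' g (fst (snd w)), up_act \<beta> g (snd (snd w))),
     lo = xlo \<beta>' \<beta>, lo_act = xlo_act G \<beta>' \<beta>,
     rleg = \<lambda>w. rleg \<beta> (snd (snd w)), nleg = fst, tleg = \<lambda>y. tleg \<beta>' (fst y)\<rparr>"

lemma xcomp_simps [simp]:
  "up (xcomp G \<beta>' \<beta>) = xup \<beta>' \<beta>" "lo (xcomp G \<beta>' \<beta>) = xlo \<beta>' \<beta>"
  "up_act (xcomp G \<beta>' \<beta>) g w =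
     (xlo_act G \<beta>' \<beta> g (fst w), up_act \<beta>' g (fst (snd w)), up_act \<beta> g (snd (snd w)))"
  "lo_act (xcomp G \<beta>' \<beta>) = xlo_act G \<beta>' \<beta>"
  "rleg (xcomp G \<beta>' \<beta>) w = rleg \<beta> (snd (snd w))" "nleg (xcomp G \<beta>' \<beta>) = fst"
  "tleg (xcomp G \<beta>' \<beta>) y = tleg \<beta>' (fst y)"
  by (simp_all add: xcomp_def)

lemma xloD:
  assumes "y \<in> xlo \<beta>' \<beta>"
  shows "fst y \<in> lo \<beta>'" "snd y \<in> extensional (xfib \<beta>' (fst y))"
    "\<And>c. c \<in> xfib \<beta>' (fst y) \<Longrightarrow> snd y c \<in> lo \<beta> \<and> tleg \<beta> (snd y c) = rleg \<beta>' c"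
  using assms by (auto simp: xlo_def PiE_iff)

lemma xloI:
  assumes "d \<in> lo \<beta>'" "s \<in> extensional (xfib \<beta>' d)"
    "\<And>c. c \<in> xfib \<beta>' d \<Longrightarrow> s c \<in> lo \<beta> \<and> tleg \<beta> (s c) = rleg \<beta>' c"
  shows "(d, s) \<in> xlo \<beta>' \<beta>"
  using assms by (auto simp: xlo_def PiE_iff)

lemma xlo_eqI:
  assumes "y \<in> xlo \<beta>' \<beta>" "y' \<in> xlo \<beta>' \<beta>" "fst y = fst y'"
    "\<And>c. c \<in> xfib \<beta>' (fst y) \<Longrightarrow> snd y c = snd y' c"
  shows "y = y'"
proof (rule prod_eqI[OF assms(3)])
  show "snd y = snd y'"
    using xloD(2)[OF assms(1)] xloD(2)[OF assms(2)] assms(3,4) by (auto intro: extensionalityI)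
qed

lemma xupI:
  assumes "y \<in> xlo \<beta>' \<beta>" "c \<in> xfib \<beta>' (fst y)" "a \<in> up \<beta>" "nleg \<beta> a = snd y c"
  shows "(y, c, a) \<in> xup \<beta>' \<beta>"
  using assms by (simp add: xup_def)

lemma xupD:
  assumes "w \<in> xup \<beta>' \<beta>"
  shows "fst w \<in> xlo \<beta>' \<beta>" "fst (snd w) \<in> xfib \<beta>' (fst (fst w))" "snd (snd w) \<in> up \<beta>"
    "nleg \<beta> (snd (snd w)) = snd (fst w) (fst (snd w))"
  using assms by (auto simp: xup_def)

lemma xfibD: "c \<in> xfib \<beta> d \<Longrightarrow> c \<in> up \<beta>" "c \<in> xfib \<beta> d \<Longrightarrow> nleg \<beta> c = d"
  by (simp_all add: xfib_def)

lemma (in group) xbispan_inv: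
  assumes "\<beta> \<in> xbispans G X Y" "g \<in> carrier G"
  shows "c \<in> up \<beta> \<Longrightarrow> up_act \<beta> g (up_act \<beta> (inv g) c) = c"
    "c \<in> up \<beta> \<Longrightarrow> up_act \<beta> (inv g) (up_act \<beta> g c) = c"
    "d \<in> lo \<beta> \<Longrightarrow> lo_act \<beta> g (lo_act \<beta> (inv g) d) = d"
    "d \<in> lo \<beta> \<Longrightarrow> lo_act \<beta> (inv g) (lo_act \<beta> g d) = d"
  using gact_inv[OF xbispansD(5)[OF assms(1)] assms(2)]
    gact_inv[OF xbispansD(6)[OF assms(1)] assms(2)] by auto

lemma (in group) xfib_act:
  assumes "\<beta> \<in> xbispans G X Y" "g \<in> carrier G" "c \<in> xfib \<beta> d"
  shows "up_act \<beta> g c \<in> xfib \<beta> (lo_act \<beta> g d)"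
  using assms xbispan_facts[OF assms(1)] by (auto simp: xfib_def)

lemma (in group) xfib_act_inv:
  assumes "\<beta> \<in> xbispans G X Y" "g \<in> carrier G" "d \<in> lo \<beta>" "c \<in> xfib \<beta> (lo_act \<beta> g d)"
  shows "up_act \<beta> (inv g) c \<in> xfib \<beta> d"
  using xfib_act[OF assms(1) inv_closed[OF assms(2)] assms(4)] xbispan_inv(4)[OF assms(1-3)] by simp

lemma (in group) xlo_act_in:
  assumes \<beta>: "\<beta> \<in> xbispans G X Y" and \<beta>': "\<beta>' \<in> xbispans G Y Z" and g: "g \<in> carrier G"
    and y: "y \<in> xlo \<beta>' \<beta>"
  shows "xlo_act G \<beta>' \<beta> g y \<in> xlo \<beta>' \<beta>"
  unfolding xlo_act_def
proof (rule xloI)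
  note F = xbispan_facts[OF \<beta>] and F' = xbispan_facts[OF \<beta>']
  show "lo_act \<beta>' g (fst y) \<in> lo \<beta>'" using g xloD(1)[OF y] F'(5) by simp
  fix c assume c: "c \<in> xfib \<beta>' (lo_act \<beta>' g (fst y))"
  have c': "up_act \<beta>' (inv g) c \<in> xfib \<beta>' (fst y)" by (rule xfib_act_inv[OF \<beta>' g xloD(1)[OF y] c])
  have "act Y g (rleg \<beta>' (up_act \<beta>' (inv g) c)) = rleg \<beta>' c"
    using F'(8)[OF g xfibD(1)[OF c']] xbispan_inv(1)[OF \<beta>' g xfibD(1)[OF c]] by simp
  then show "(\<lambda>c\<in>xfib \<beta>' (lo_act \<beta>' g (fst y)). lo_act \<beta> g (snd y (up_act \<beta>' (inv g) c))) c \<in> lo \<beta> \<and>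
      tleg \<beta> ((\<lambda>c\<in>xfib \<beta>' (lo_act \<beta>' g (fst y)). lo_act \<beta> g (snd y (up_act \<beta>' (inv g) c))) c) = rleg \<beta>' c"
    using c c' g xloD(3)[OF y c'] F(5,10) by simp
qed simp

lemma (in group) xlo_act_app:
  assumes \<beta>': "\<beta>' \<in> xbispans G Y Z" and g: "g \<in> carrier G" and y: "y \<in> xlo \<beta>' \<beta>"
    and c: "c \<in> xfib \<beta>' (fst y)"
  shows "snd (xlo_act G \<beta>' \<beta> g y) (up_act \<beta>' g c) = lo_act \<beta> g (snd y c)"
  using xfib_act[OF \<beta>' g c] xbispan_inv(2)[OF \<beta>' g xfibD(1)[OF c]] by (simp add: xlo_act_def)

lemma (in group) xcomp_xbispans:
  assumes \<beta>: "\<beta> \<in> xbispans G X Y" and \<beta>': "\<beta>' \<in> xbispans G Y Z"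
  shows "xcomp G \<beta>' \<beta> \<in> xbispans G X Z"
proof -
  note D = xbispansD[OF \<beta>] and D' = xbispansD[OF \<beta>']
  note F = xbispan_facts[OF \<beta>] and F' = xbispan_facts[OF \<beta>']
  have fx: "fst (xlo_act G \<beta>' \<beta> g y) = lo_act \<beta>' g (fst y)" for g y by (simp add: xlo_act_def)
  have "(\<Pi>\<^sub>E c\<in>xfib \<beta>' d. {b \<in> lo \<beta>. tleg \<beta> b = rleg \<beta>' c}) \<subseteq> (\<Pi>\<^sub>E c\<in>xfib \<beta>' d. lo \<beta>)" for d
    by (rule PiE_mono) blast
  then have "xlo \<beta>' \<beta> \<subseteq> Sigma (lo \<beta>') (\<lambda>d. \<Pi>\<^sub>E c\<in>xfib \<beta>' d. lo \<beta>)"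
    unfolding xlo_def by blast
  moreover have "finite (xfib \<beta>' d)" for d
    using D'(3) by (auto simp: xfib_def)
  ultimately have flo: "finite (xlo \<beta>' \<beta>)"
    by (elim finite_subset) (use D(4) D'(4) in \<open>auto intro!: finite_SigmaI finite_PiE\<close>)
  have "xup \<beta>' \<beta> \<subseteq> xlo \<beta>' \<beta> \<times> up \<beta>' \<times> up \<beta>"
    by (auto simp: xup_def xfib_def)
  then have fup: "finite (xup \<beta>' \<beta>)"
    by (rule finite_subset) (use flo D(3) D'(3) in auto)
  have glo: "gact G (xlo \<beta>' \<beta>) (xlo_act G \<beta>' \<beta>)"
  proof (rule gactI)
    fix y assume y: "y \<in> xlo \<beta>' \<beta>"
    show "xlo_act G \<beta>' \<beta> \<one> y = y"
    proof (rule xlo_eqI[OF xlo_act_in[OF \<beta> \<beta>' one_closed y] y])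
      fix c assume "c \<in> xfib \<beta>' (fst (xlo_act G \<beta>' \<beta> \<one> y))"
      then show "snd (xlo_act G \<beta>' \<beta> \<one> y) c = snd y c"
        using xloD(1)[OF y] xloD(3)[OF y] F(7) F'(6,7) by (auto simp: xlo_act_def xfibD)
    qed (use xloD(1)[OF y] F'(7) in \<open>simp add: fx\<close>)
    show "xlo_act G \<beta>' \<beta> (g \<otimes> h) y = xlo_act G \<beta>' \<beta> g (xlo_act G \<beta>' \<beta> h y)"
      if g: "g \<in> carrier G" and h: "h \<in> carrier G" for g h
    proof (rule xlo_eqI[OF xlo_act_in[OF \<beta> \<beta>' _ y] xlo_act_in[OF \<beta> \<beta>' g xlo_act_in[OF \<beta> \<beta>' h y]]])
      show "g \<otimes> h \<in> carrier G" using g h by simp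
      show "fst (xlo_act G \<beta>' \<beta> (g \<otimes> h) y) = fst (xlo_act G \<beta>' \<beta> g (xlo_act G \<beta>' \<beta> h y))"
        using g h F'(12) xloD(1)[OF y] by (simp add: fx)
      fix c assume "c \<in> xfib \<beta>' (fst (xlo_act G \<beta>' \<beta> (g \<otimes> h) y))"
      then have c: "c \<in> xfib \<beta>' (lo_act \<beta>' g (lo_act \<beta>' h (fst y)))"
        using g h F'(12) xloD(1)[OF y] by (simp add: fx)
      have c1: "up_act \<beta>' (inv g) c \<in> xfib \<beta>' (lo_act \<beta>' h (fst y))"
        by (rule xfib_act_inv[OF \<beta>' g _ c]) (use F'(5) h xloD(1)[OF y] in simp)
      have c2: "up_act \<beta>' (inv h) (up_act \<beta>' (inv g) c) \<in> xfib \<beta>' (fst y)"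
        by (rule xfib_act_inv[OF \<beta>' h xloD(1)[OF y] c1])
      show "snd (xlo_act G \<beta>' \<beta> (g \<otimes> h) y) c = snd (xlo_act G \<beta>' \<beta> g (xlo_act G \<beta>' \<beta> h y)) c"
        using g h c c1 xloD(1)[OF y] xloD(3)[OF y c2] F(12) F'(11,12)
        by (simp add: xlo_act_def inv_mult_group xfibD(1)[OF c])
    qed
  qed (rule xlo_act_in[OF \<beta> \<beta>'])
  have gup_in: "(xlo_act G \<beta>' \<beta> g (fst w), up_act \<beta>' g (fst (snd w)), up_act \<beta> g (snd (snd w))) \<in> xup \<beta>' \<beta>"
    if g: "g \<in> carrier G" and w: "w \<in> xup \<beta>' \<beta>" for g w
  proof (rule xupI)
    show "xlo_act G \<beta>' \<beta> g (fst w) \<in> xlo \<beta>' \<beta>" by (rule xlo_act_in[OF \<beta> \<beta>' g xupD(1)[OF w]])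
    show "up_act \<beta>' g (fst (snd w)) \<in> xfib \<beta>' (fst (xlo_act G \<beta>' \<beta> g (fst w)))"
      using xfib_act[OF \<beta>' g xupD(2)[OF w]] by (simp add: fx)
    show "up_act \<beta> g (snd (snd w)) \<in> up \<beta>" using F(4) g xupD(3)[OF w] by simp
    show "nleg \<beta> (up_act \<beta> g (snd (snd w))) = snd (xlo_act G \<beta>' \<beta> g (fst w)) (up_act \<beta>' g (fst (snd w)))"
      using xlo_act_app[OF \<beta>' g xupD(1)[OF w] xupD(2)[OF w]] F(9)[OF g xupD(3)[OF w]] xupD(4)[OF w] by simp
  qed
  have gup: "gact G (xup \<beta>' \<beta>) (up_act (xcomp G \<beta>' \<beta>))"
    by (rule gactI)
      (simp_all add: gup_in gact_one[OF glo] gact_mult[OF glo] xupD(1) xupD(3) F(6,11)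
        F'(6)[OF xfibD(1)[OF xupD(2)]] F'(11)[OF _ _ xfibD(1)[OF xupD(2)]])
  show ?thesis
    by (rule xbispansI)
      (simp_all add: D(1) D'(2) fup flo glo gup gmap_def xupD(1,3) xloD(1) F(1,8) F'(3,10) fx)
qed

text \<open>One half of an isomorphism with named inverses; the other half is the same statement
  with the roles exchanged. A construction on isomorphisms such as \<open>xcomp_via\<close> is thus
  proved in one direction and used twice.\<close>

definition xiso_via :: "('g, 'm) monoid_scheme \<Rightarrow> ('g, 'c, 'b) xbispan \<Rightarrow> ('g, 'd, 'e) xbispan \<Rightarrow>
    ('c \<Rightarrow> 'd) \<Rightarrow> ('d \<Rightarrow> 'c) \<Rightarrow> ('b \<Rightarrow> 'e) \<Rightarrow> ('e \<Rightarrow> 'b) \<Rightarrow> bool" where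
  "xiso_via G \<beta> \<gamma> a a' b b' \<longleftrightarrow>
     (\<forall>c\<in>up \<beta>. a c \<in> up \<gamma> \<and> a' (a c) = c \<and> rleg \<gamma> (a c) = rleg \<beta> c \<and> nleg \<gamma> (a c) = b (nleg \<beta> c)) \<and>
     (\<forall>c\<in>lo \<beta>. b c \<in> lo \<gamma> \<and> b' (b c) = c \<and> tleg \<gamma> (b c) = tleg \<beta> c) \<and>
     (\<forall>g\<in>carrier G. \<forall>c\<in>up \<beta>. a (up_act \<beta> g c) = up_act \<gamma> g (a c)) \<and>
     (\<forall>g\<in>carrier G. \<forall>c\<in>lo \<beta>. b (lo_act \<beta> g c) = lo_act \<gamma> g (b c))"

lemma xiso_viaD:
  assumes "xiso_via G \<beta> \<gamma> a a' b b'"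
  shows "\<And>c. c \<in> up \<beta> \<Longrightarrow> a c \<in> up \<gamma>" "\<And>c. c \<in> up \<beta> \<Longrightarrow> a' (a c) = c"
    "\<And>c. c \<in> up \<beta> \<Longrightarrow> rleg \<gamma> (a c) = rleg \<beta> c" "\<And>c. c \<in> up \<beta> \<Longrightarrow> nleg \<gamma> (a c) = b (nleg \<beta> c)"
    "\<And>c. c \<in> lo \<beta> \<Longrightarrow> b c \<in> lo \<gamma>" "\<And>c. c \<in> lo \<beta> \<Longrightarrow> b' (b c) = c"
    "\<And>c. c \<in> lo \<beta> \<Longrightarrow> tleg \<gamma> (b c) = tleg \<beta> c"
    "\<And>g c. \<lbrakk>g \<in> carrier G; c \<in> up \<beta>\<rbrakk> \<Longrightarrow> a (up_act \<beta> g c) = up_act \<gamma> g (a c)"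
    "\<And>g c. \<lbrakk>g \<in> carrier G; c \<in> lo \<beta>\<rbrakk> \<Longrightarrow> b (lo_act \<beta> g c) = lo_act \<gamma> g (b c)"
  using assms by (simp_all add: xiso_via_def)

lemma xiso_via_xiso:
  assumes "xiso_via G \<beta> \<gamma> a a' b b'" "xiso_via G \<gamma> \<beta> a' a b' b"
  shows "xiso G \<beta> \<gamma>"
  by (rule xisoI[where a = a and a' = a' and b = b and b' = b'])
    (simp_all add: xiso_viaD[OF assms(1)] xiso_viaD[OF assms(2)])

lemma xiso_obtain_via:
  assumes "xiso G \<beta> \<gamma>" "\<beta> \<in> xbispans G X Y"
  obtains a a' b b' where "xiso_via G \<beta> \<gamma> a a' b b'" "xiso_via G \<gamma> \<beta> a' a b' b"
proof -
  obtain a b where ab: "bij_betw a (up \<beta>) (up \<gamma>)" "bij_betw b (lo \<beta>) (lo \<gamma>)"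
     "\<forall>g\<in>carrier G. \<forall>c\<in>up \<beta>. a (up_act \<beta> g c) = up_act \<gamma> g (a c)"
     "\<forall>g\<in>carrier G. \<forall>c\<in>lo \<beta>. b (lo_act \<beta> g c) = lo_act \<gamma> g (b c)"
     "\<forall>c\<in>up \<beta>. rleg \<gamma> (a c) = rleg \<beta> c \<and> nleg \<gamma> (a c) = b (nleg \<beta> c)"
     "\<forall>c\<in>lo \<beta>. tleg \<gamma> (b c) = tleg \<beta> c"
    using assms(1) unfolding xiso_def by blast
  define a' b' where "a' = inv_into (up \<beta>) a" and "b' = inv_into (lo \<beta>) b"
  have inv: "\<And>c. c \<in> up \<beta> \<Longrightarrow> a' (a c) = c" "\<And>c. c \<in> lo \<beta> \<Longrightarrow> b' (b c) = c"
     "\<And>c. c \<in> up \<gamma> \<Longrightarrow> a (a' c) = c" "\<And>c. c \<in> up \<gamma> \<Longrightarrow> a' c \<in> up \<beta>"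
     "\<And>c. c \<in> lo \<gamma> \<Longrightarrow> b (b' c) = c" "\<And>c. c \<in> lo \<gamma> \<Longrightarrow> b' c \<in> lo \<beta>"
     "\<And>c. c \<in> up \<beta> \<Longrightarrow> a c \<in> up \<gamma>" "\<And>c. c \<in> lo \<beta> \<Longrightarrow> b c \<in> lo \<gamma>"
    using ab(1,2) unfolding a'_def b'_def
    by (auto simp: bij_betw_def inv_into_f_f f_inv_into_f inv_into_into)
  note F = xbispan_facts[OF assms(2)]
  have 1: "xiso_via G \<beta> \<gamma> a a' b b'"
    using ab inv by (simp add: xiso_via_def)
  have "rleg \<beta> (a' c) = rleg \<gamma> c" "nleg \<beta> (a' c) = b' (nleg \<gamma> c)" if "c \<in> up \<gamma>" for c
    using ab(5)[rule_format, OF inv(4)[OF that]] inv(3)[OF that] inv(2)[OF F(2)[OF inv(4)[OF that]]] by auto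
  moreover have "tleg \<beta> (b' c) = tleg \<gamma> c" if "c \<in> lo \<gamma>" for c
    using ab(6)[rule_format, OF inv(6)[OF that]] inv(5)[OF that] by auto
  moreover have "a' (up_act \<gamma> g c) = up_act \<beta> g (a' c)" if "g \<in> carrier G" "c \<in> up \<gamma>" for g c
    using ab(3)[rule_format, OF that(1) inv(4)[OF that(2)]] inv(3)[OF that(2)]
      inv(1)[OF F(4)[OF that(1) inv(4)[OF that(2)]]] by simp
  moreover have "b' (lo_act \<gamma> g c) = lo_act \<beta> g (b' c)" if "g \<in> carrier G" "c \<in> lo \<gamma>" for g c
    using ab(4)[rule_format, OF that(1) inv(6)[OF that(2)]] inv(5)[OF that(2)]
      inv(2)[OF F(5)[OF that(1) inv(6)[OF that(2)]]] by simp
  ultimately have 2: "xiso_via G \<gamma> \<beta> a' a b' b"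
    using inv by (simp add: xiso_via_def)
  show thesis by (rule that[OF 1 2])
qed

definition xlo_map where
  "xlo_map b c' d \<gamma>' y = (d (fst y), \<lambda>k\<in>xfib \<gamma>' (d (fst y)). b (snd y (c' k)))"

lemma (in group) xcomp_via:
  assumes \<beta>: "\<beta> \<in> xbispans G X Y" and \<beta>': "\<beta>' \<in> xbispans G Y Z"
    and \<gamma>: "\<gamma> \<in> xbispans G X Y" and \<gamma>': "\<gamma>' \<in> xbispans G Y Z"
    and v: "xiso_via G \<beta> \<gamma> a a' b b'" "xiso_via G \<gamma> \<beta> a' a b' b"
    and v': "xiso_via G \<beta>' \<gamma>' c c' d d'" "xiso_via G \<gamma>' \<beta>' c' c d' d"
  shows "xiso_via G (xcomp G \<beta>' \<beta>) (xcomp G \<gamma>' \<gamma>)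
     (\<lambda>w. (xlo_map b c' d \<gamma>' (fst w), c (fst (snd w)), a (snd (snd w))))
     (\<lambda>w. (xlo_map b' c d' \<beta>' (fst w), c' (fst (snd w)), a' (snd (snd w))))
     (xlo_map b c' d \<gamma>') (xlo_map b' c d' \<beta>')"
proof -
  note V = xiso_viaD[OF v(1)] and V' = xiso_viaD[OF v'(1)]
  note U = xiso_viaD[OF v(2)] and U' = xiso_viaD[OF v'(2)]
  have cf: "c k \<in> xfib \<gamma>' (d z)" if "k \<in> xfib \<beta>' z" for k z
    using that by (simp add: xfib_def V')
  have cf': "c' k \<in> xfib \<beta>' z" if "k \<in> xfib \<gamma>' (d z)" "z \<in> lo \<beta>'" for k z
    using that by (simp add: xfib_def U' V')
  have inl: "xlo_map b c' d \<gamma>' y \<in> xlo \<gamma>' \<gamma>" if y: "y \<in> xlo \<beta>' \<beta>" for y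
    unfolding xlo_map_def
  proof (rule xloI)
    show "d (fst y) \<in> lo \<gamma>'" by (rule V'(5)[OF xloD(1)[OF y]])
    fix k assume k: "k \<in> xfib \<gamma>' (d (fst y))"
    have k': "c' k \<in> xfib \<beta>' (fst y)" by (rule cf'[OF k xloD(1)[OF y]])
    show "(\<lambda>k\<in>xfib \<gamma>' (d (fst y)). b (snd y (c' k))) k \<in> lo \<gamma> \<and>
       tleg \<gamma> ((\<lambda>k\<in>xfib \<gamma>' (d (fst y)). b (snd y (c' k))) k) = rleg \<gamma>' k"
      using k xloD(3)[OF y k'] V(5,7) U'(3)[OF xfibD(1)[OF k]] by simp
  qed simp
  have app: "snd (xlo_map b c' d \<gamma>' y) (c k) = b (snd y k)" if "k \<in> xfib \<beta>' (fst y)" for y k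
    using cf[OF that] V'(2)[OF xfibD(1)[OF that]] by (simp add: xlo_map_def)
  have fst_map [simp]: "fst (xlo_map b c' d \<gamma>' y) = d (fst y)" for y by (simp add: xlo_map_def)
  have bk: "xlo_map b' c d' \<beta>' (xlo_map b c' d \<gamma>' y) = y" if y: "y \<in> xlo \<beta>' \<beta>" for y
  proof (rule prod_eqI)
    show "fst (xlo_map b' c d' \<beta>' (xlo_map b c' d \<gamma>' y)) = fst y"
      using V'(6)[OF xloD(1)[OF y]] by (simp add: xlo_map_def)
    show "snd (xlo_map b' c d' \<beta>' (xlo_map b c' d \<gamma>' y)) = snd y"
    proof (rule extensionalityI[where A = "xfib \<beta>' (fst y)"])
      show "snd (xlo_map b' c d' \<beta>' (xlo_map b c' d \<gamma>' y)) \<in> extensional (xfib \<beta>' (fst y))"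
        using V'(6)[OF xloD(1)[OF y]] by (simp add: xlo_map_def)
      fix k assume k: "k \<in> xfib \<beta>' (fst y)"
      show "snd (xlo_map b' c d' \<beta>' (xlo_map b c' d \<gamma>' y)) k = snd y k"
        using V'(6)[OF xloD(1)[OF y]] app[OF k] k xloD(3)[OF y k] V(6)
        unfolding xlo_map_def[of b' c d' \<beta>'] by simp
    qed (rule xloD(2)[OF y])
  qed
  have eqv: "xlo_map b c' d \<gamma>' (xlo_act G \<beta>' \<beta> g y) = xlo_act G \<gamma>' \<gamma> g (xlo_map b c' d \<gamma>' y)"
    if g: "g \<in> carrier G" and y: "y \<in> xlo \<beta>' \<beta>" for g y
  proof (rule xlo_eqI[OF inl[OF xlo_act_in[OF \<beta> \<beta>' g y]] xlo_act_in[OF \<gamma> \<gamma>' g inl[OF y]]])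
    show e: "fst (xlo_map b c' d \<gamma>' (xlo_act G \<beta>' \<beta> g y)) = fst (xlo_act G \<gamma>' \<gamma> g (xlo_map b c' d \<gamma>' y))"
      using V'(9)[OF g xloD(1)[OF y]] by (simp add: xlo_act_def)
    fix k assume "k \<in> xfib \<gamma>' (fst (xlo_map b c' d \<gamma>' (xlo_act G \<beta>' \<beta> g y)))"
    then have k: "k \<in> xfib \<gamma>' (lo_act \<gamma>' g (d (fst y)))"
      using e by (simp add: xlo_act_def)
    define j where "j = up_act \<gamma>' (inv g) k"
    have j: "j \<in> xfib \<gamma>' (d (fst y))"
      unfolding j_def by (rule xfib_act_inv[OF \<gamma>' g V'(5)[OF xloD(1)[OF y]] k])
    have kj: "k = up_act \<gamma>' g j"
      using xbispan_inv(1)[OF \<gamma>' g xfibD(1)[OF k]] by (simp add: j_def)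
    define i where "i = c' j"
    have i: "i \<in> xfib \<beta>' (fst y)" unfolding i_def by (rule cf'[OF j xloD(1)[OF y]])
    have ji: "j = c i" using U'(2)[OF xfibD(1)[OF j]] by (simp add: i_def)
    have ki: "k = c (up_act \<beta>' g i)" using V'(8)[OF g xfibD(1)[OF i]] kj ji by simp
    have gi: "up_act \<beta>' g i \<in> xfib \<beta>' (fst (xlo_act G \<beta>' \<beta> g y))"
      using xfib_act[OF \<beta>' g i] by (simp add: xlo_act_def)
    have "snd (xlo_map b c' d \<gamma>' (xlo_act G \<beta>' \<beta> g y)) k = b (lo_act \<beta> g (snd y i))"
      unfolding ki app[OF gi] xlo_act_app[OF \<beta>' g y i] ..
    also have "\<dots> = lo_act \<gamma> g (b (snd y i))" using V(9)[OF g] xloD(3)[OF y i] by simp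
    also have "\<dots> = lo_act \<gamma> g (snd (xlo_map b c' d \<gamma>' y) j)" using app[OF i] ji by simp
    also have "\<dots> = snd (xlo_act G \<gamma>' \<gamma> g (xlo_map b c' d \<gamma>' y)) k"
      unfolding kj by (rule xlo_act_app[OF \<gamma>' g inl[OF y], symmetric]) (simp add: j)
    finally show "snd (xlo_map b c' d \<gamma>' (xlo_act G \<beta>' \<beta> g y)) k =
      snd (xlo_act G \<gamma>' \<gamma> g (xlo_map b c' d \<gamma>' y)) k" .
  qed
  have upin: "(xlo_map b c' d \<gamma>' (fst w), c (fst (snd w)), a (snd (snd w))) \<in> xup \<gamma>' \<gamma>"
    if w: "w \<in> xup \<beta>' \<beta>" for w
  proof (rule xupI)
    show "nleg \<gamma> (a (snd (snd w))) = snd (xlo_map b c' d \<gamma>' (fst w)) (c (fst (snd w)))"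
      unfolding app[OF xupD(2)[OF w]] V(4)[OF xupD(3)[OF w]] xupD(4)[OF w] ..
  qed (use inl[OF xupD(1)[OF w]] cf[OF xupD(2)[OF w]] V(1)[OF xupD(3)[OF w]] in simp_all)
  show ?thesis
    unfolding xiso_via_def
    by (simp add: upin inl bk eqv xupD(1) xupD(3) V(2,3,8) V'(7) xloD(1)
        V'(2)[OF xfibD(1)[OF xupD(2)]] V'(8)[OF _ xfibD(1)[OF xupD(2)]])
qed

lemma (in group) xcomp_cong:
  assumes "\<beta> \<in> xbispans G X Y" "\<beta>' \<in> xbispans G Y Z" "\<gamma> \<in> xbispans G X Y" "\<gamma>' \<in> xbispans G Y Z"
    and "xiso G \<beta> \<gamma>" "xiso G \<beta>' \<gamma>'"
  shows "xiso G (xcomp G \<beta>' \<beta>) (xcomp G \<gamma>' \<gamma>)"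
proof -
  obtain a a' b b' where v: "xiso_via G \<beta> \<gamma> a a' b b'" "xiso_via G \<gamma> \<beta> a' a b' b"
    by (rule xiso_obtain_via[OF assms(5,1)])
  obtain c c' d d' where v': "xiso_via G \<beta>' \<gamma>' c c' d d'" "xiso_via G \<gamma>' \<beta>' c' c d' d"
    by (rule xiso_obtain_via[OF assms(6,2)])
  show ?thesis
    by (rule xiso_via_xiso[OF xcomp_via[OF assms(1-4) v v'] xcomp_via[OF assms(3,4,1,2) v(2,1) v'(2,1)]])
qed

locale composable = group G for G (structure) +
  fixes S S' X Y Z
  assumes S: "S \<in> bispans G X Y" and S': "S' \<in> bispans G Y Z"
begin

abbreviation "\<beta> \<equiv> of_bispan S"
abbreviation "\<beta>' \<equiv> of_bispan S'"

lemmas gs = bispansD(3-6)[OF S] bispansD(4-6)[OF S']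
lemmas hs = bispansD(7-9)[OF S] bispansD(7-9)[OF S']

lemma xb: "\<beta> \<in> xbispans G X Y" "\<beta>' \<in> xbispans G Y Z"
  using of_bispan_xbispans S S' by auto

lemma xfib_of: "xfib \<beta>' d = {c \<in> points (top1 S'). nm_leg S' c = d}"
  by (simp add: xfib_def)

text \<open>A section with values in the pullback \<open>B1\<close> has its second component
  prescribed. It is determined by the first component, which is a lift of the fibre to
  \<open>top2 S\<close>.\<close>

lemma dp_sections_bij:
  assumes "is_pullback G B1 k1 f1 (top2 S) (tr_leg S) (top1 S') (res_leg S') Y"
  defines "\<D> \<equiv> dp_sections B1 f1 (top1 S') (nm_leg S') (top2 S')"
  shows "bij_betw (\<lambda>y. (fst y, \<lambda>c\<in>xfib \<beta>' (fst y). k1 (snd y c))) \<D> (xlo \<beta>' \<beta>)"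
    and "bij_betw (\<lambda>y. (fst y, \<lambda>c\<in>xfib \<beta>' (fst y). pb_pt B1 k1 f1 (snd y c) c)) (xlo \<beta>' \<beta>) \<D>"
proof -
  interpret B: pullback_square G B1 k1 f1 "top2 S" "tr_leg S" "top1 S'" "res_leg S'" Y
    by unfold_locales (rule assms)
  define \<kappa> \<kappa>' where "\<kappa> = (\<lambda>y. (fst y, \<lambda>c\<in>xfib \<beta>' (fst y). k1 (snd y c)))"
    and "\<kappa>' = (\<lambda>y. (fst y, \<lambda>c\<in>xfib \<beta>' (fst y). pb_pt B1 k1 f1 (snd y c) c))"
  have D: "y \<in> \<D> \<longleftrightarrow> fst y \<in> points (top2 S') \<and> snd y \<in> extensional (xfib \<beta>' (fst y)) \<and>
      (\<forall>c\<in>xfib \<beta>' (fst y). snd y c \<in> points B1 \<and> f1 (snd y c) = c)" for y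
    by (cases y) (auto simp: \<D>_def dp_sections_def xfib_of PiE_iff)
  have 1: "\<kappa> y \<in> xlo \<beta>' \<beta>" if "y \<in> \<D>" for y
    unfolding \<kappa>_def by (rule xloI)
      (use that B.pb_comm in \<open>simp_all add: D hom_facts(1)[OF B.pb_gsets(5)]\<close>)
  have L: "snd y c \<in> points (top2 S)" "tr_leg S (snd y c) = res_leg S' c" "c \<in> points (top1 S')"
    if "y \<in> xlo \<beta>' \<beta>" "c \<in> xfib \<beta>' (fst y)" for y c
    using xloD(3)[OF that] xfibD(1)[OF that(2)] by simp_all
  have 2: "\<kappa>' y \<in> \<D>" if y: "y \<in> xlo \<beta>' \<beta>" for y
    using xloD(1)[OF y] by (simp add: D \<kappa>'_def B.pb_pt L[OF y])
  have 3: "\<kappa>' (\<kappa> y) = y" if y: "y \<in> \<D>" for y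
  proof (rule prod_eqI)
    show "snd (\<kappa>' (\<kappa> y)) = snd y"
    proof (rule extensionalityI[where A = "xfib \<beta>' (fst y)"])
      fix c assume c: "c \<in> xfib \<beta>' (fst y)"
      show "snd (\<kappa>' (\<kappa> y)) c = snd y c"
        using y c B.pb_pt_eq[of "snd y c"] by (simp add: D \<kappa>_def \<kappa>'_def)
    qed (use y in \<open>simp_all add: D \<kappa>_def \<kappa>'_def\<close>)
  qed (simp add: \<kappa>_def \<kappa>'_def)
  have 4: "\<kappa> (\<kappa>' y) = y" if y: "y \<in> xlo \<beta>' \<beta>" for y
  proof (rule prod_eqI)
    show "snd (\<kappa> (\<kappa>' y)) = snd y"
      by (rule extensionalityI[where A = "xfib \<beta>' (fst y)"])
       (use xloD(2)[OF y] in \<open>simp_all add: \<kappa>_def \<kappa>'_def B.pb_pt L[OF y]\<close>)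
  qed (simp add: \<kappa>_def \<kappa>'_def)
  show "bij_betw (\<lambda>y. (fst y, \<lambda>c\<in>xfib \<beta>' (fst y). k1 (snd y c))) \<D> (xlo \<beta>' \<beta>)"
    unfolding \<kappa>_def[symmetric] by (rule bij_betw_byWitness[where f' = \<kappa>']) (use 1 2 3 4 in blast)+
  show "bij_betw (\<lambda>y. (fst y, \<lambda>c\<in>xfib \<beta>' (fst y). pb_pt B1 k1 f1 (snd y c) c)) (xlo \<beta>' \<beta>) \<D>"
    unfolding \<kappa>'_def[symmetric] by (rule bij_betw_byWitness[where f' = \<kappa>]) (use 1 2 3 4 in blast)+
qed

text \<open>Whatever pullbacks and dependent product are chosen, E becomes \<open>xlo\<close> by
  \<open>dp_imp\<close> and \<open>dp_sections_bij\<close>. A point of \<open>A2\<close> amounts to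
  such a lift, a point c of the fibre, and a point of \<open>top1 S\<close> over the value of the
  lift at c, that is, to a point of \<open>xup\<close>.\<close>

lemma is_composite_imp:
  assumes "is_composite G S' S Q"
  shows "Q \<in> bispans G X Z" "xiso G (xcomp G \<beta>' \<beta>) (of_bispan Q)"
proof -
  from assms obtain B1 k1 f1 A1 k2 g1 E p P q l1 e A2 e1 g2 where
    B1: "is_pullback G B1 k1 f1 (top2 S) (tr_leg S) (top1 S') (res_leg S') (tgt S)" and
    A1: "is_pullback G A1 k2 g1 (top1 S) (nm_leg S) B1 k1 (top2 S)" and
    DP: "is_dependent_product G B1 f1 (top1 S') (nm_leg S') (top2 S') E p P q l1 e" and
    A2: "is_pullback G A2 e1 g2 A1 g1 P e B1" and
    Q: "Q = \<lparr>src = src S, top1 = A2, top2 = E, tgt = tgt S',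
             res_leg = gset_comp A2 (res_leg S) (gset_comp A2 k2 e1),
             nm_leg = gset_comp A2 l1 g2,
             tr_leg = gset_comp E (tr_leg S') p\<rparr>"
    unfolding is_composite_def by metis
  have ends: "src S = X" "tgt S = Y" "src S' = Y" "tgt S' = Z" using bispansD(1,2)[OF S] bispansD(1,2)[OF S'] by auto
  interpret B: pullback_square G B1 k1 f1 "top2 S" "tr_leg S" "top1 S'" "res_leg S'" Y
    by unfold_locales (use B1 ends in simp)
  interpret A: pullback_square G A1 k2 g1 "top1 S" "nm_leg S" B1 k1 "top2 S"
    by unfold_locales (rule A1)
  interpret D: dependent_square G P q l1 "top1 S'" "nm_leg S'" E p "top2 S'" B1 f1 e
    by unfold_locales (use DP in \<open>auto simp: is_dependent_product_def\<close>)
  interpret W: pullback_square G A2 e1 g2 A1 g1 P e B1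
    by unfold_locales (rule A2)
  note H = hom_facts(1)[OF B.pb_gsets(5)] hom_facts(1)[OF B.pb_gsets(6)]
    hom_facts(1)[OF A.pb_gsets(5)] hom_facts(1)[OF A.pb_gsets(6)]
    hom_facts(1)[OF D.pb_gsets(5)] hom_facts(1)[OF D.pb_gsets(6)] hom_facts(1)[OF D.pb_gsets(8)]
    hom_facts(1)[OF D.e] hom_facts(1)[OF W.pb_gsets(5)] hom_facts(1)[OF W.pb_gsets(6)]
  note E = hom_facts(2)[OF B.pb_gsets(5)] hom_facts(2)[OF B.pb_gsets(6)]
    hom_facts(2)[OF A.pb_gsets(5)] hom_facts(2)[OF A.pb_gsets(6)]
    hom_facts(2)[OF D.pb_gsets(5)] hom_facts(2)[OF D.pb_gsets(6)] hom_facts(2)[OF D.pb_gsets(8)]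
    hom_facts(2)[OF D.e] hom_facts(2)[OF W.pb_gsets(5)] hom_facts(2)[OF W.pb_gsets(6)]
  show QB: "Q \<in> bispans G X Z"
    unfolding Q bispans_def using ends gs D.pb_gsets W.pb_gsets A.pb_gsets B.pb_gsets hs
    by (simp add: gset_comp_hom[OF W.pb_gsets(1) gset_comp_hom[OF W.pb_gsets(1) W.pb_gsets(5) A.pb_gsets(5)] hs(1)]
        gset_comp_hom[OF W.pb_gsets(1) W.pb_gsets(6) D.pb_gsets(6)]
        gset_comp_hom[OF D.pb_gsets(3) D.pb_gsets(8) hs(6)])
  have bij\<kappa>: "bij_betw ((\<lambda>y. (fst y, \<lambda>c\<in>xfib \<beta>' (fst y). k1 (snd y c))) \<circ> (\<lambda>\<epsilon>. (p \<epsilon>, D.sec \<epsilon>)))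
      (points E) (xlo \<beta>' \<beta>)"
    by (rule bij_betw_trans[OF D.dp_imp[OF DP] dp_sections_bij(1)]) (use B1 ends in simp)
  define b where "b = (\<lambda>\<epsilon>. (p \<epsilon>, \<lambda>c\<in>xfib \<beta>' (p \<epsilon>). k1 (D.sec \<epsilon> c)))"
  have bij_b: "bij_betw b (points E) (xlo \<beta>' \<beta>)"
    using bij\<kappa> by (simp add: b_def comp_def)
  have b_in: "b \<epsilon> \<in> xlo \<beta>' \<beta>" if "\<epsilon> \<in> points E" for \<epsilon> using bij_b that by (auto simp: bij_betw_def)
  have sec_q: "D.sec (l1 \<pi>) (q \<pi>) = e \<pi>" if "\<pi> \<in> points P" for \<pi>
    using D.sec_app[of "q \<pi>" "l1 \<pi>"] D.pb_comm[OF that] D.pb_pt_eq[OF that] that H by simp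
  have qfib: "q \<pi> \<in> xfib \<beta>' (p (l1 \<pi>))" if "\<pi> \<in> points P" for \<pi>
    using D.pb_comm[OF that] that H by (simp add: xfib_of)
  define a where "a = (\<lambda>w. (b (l1 (g2 w)), q (g2 w), k2 (e1 w)))"
  have a_in: "a w \<in> xup \<beta>' \<beta>" if w: "w \<in> points A2" for w
    unfolding a_def
  proof (rule xupI)
    show "b (l1 (g2 w)) \<in> xlo \<beta>' \<beta>" using b_in w H by simp
    show "q (g2 w) \<in> xfib \<beta>' (fst (b (l1 (g2 w))))" using qfib w H by (simp add: b_def)
    show "k2 (e1 w) \<in> up \<beta>" using w H by simp
    show "nleg \<beta> (k2 (e1 w)) = snd (b (l1 (g2 w))) (q (g2 w))"
      using w H A.pb_comm[of "e1 w"] W.pb_comm[OF w] qfib sec_q by (simp add: b_def)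
  qed
  have bij_a: "bij_betw a (points A2) (xup \<beta>' \<beta>)"
  proof (rule bij_betwI')
    fix w w' assume w: "w \<in> points A2" "w' \<in> points A2"
    show "(a w = a w') = (w = w')"
    proof
      \<comment> \<open>The pullbacks are peeled off one by one: l1 and q determine the point of P,
        then k2 and g1 the point of \<open>A1\<close>, and both together the point of
        \<open>A2\<close>.\<close>
      assume eq: "a w = a w'"
      have "b (l1 (g2 w)) = b (l1 (g2 w'))" using eq by (simp add: a_def)
      then have "l1 (g2 w) = l1 (g2 w')"
        using inj_onD[OF bij_betw_imp_inj_on[OF bij_b]] w H by simp
      then have g: "g2 w = g2 w'"
        by (intro D.pb_inj[of "g2 w" "g2 w'", rotated 2]) (use eq w H in \<open>simp_all add: a_def\<close>)
      have "g1 (e1 w) = g1 (e1 w')" using W.pb_comm[OF w(1)] W.pb_comm[OF w(2)] g by simp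
      then have "e1 w = e1 w'"
        by (intro A.pb_inj[of "e1 w" "e1 w'", rotated 2]) (use eq w H in \<open>simp_all add: a_def\<close>)
      then show "w = w'" using W.pb_inj[OF w _ g] by simp
    qed simp
  next
    fix w assume "w \<in> points A2" then show "a w \<in> xup \<beta>' \<beta>" by (rule a_in)
  next
    fix x assume x: "x \<in> xup \<beta>' \<beta>"
    obtain y c \<alpha> where xe: "x = (y, c, \<alpha>)" by (cases x)
    have y: "y \<in> xlo \<beta>' \<beta>" "c \<in> xfib \<beta>' (fst y)" "\<alpha> \<in> points (top1 S)" "nm_leg S \<alpha> = snd y c"
      using xupD[OF x] xe by simp_all
    obtain \<epsilon> where \<epsilon>: "\<epsilon> \<in> points E" "y = b \<epsilon>"
      using y(1) unfolding bij_betw_imp_surj_on[OF bij_b, symmetric] by blast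
    have c: "c \<in> points (top1 S')" "nm_leg S' c = p \<epsilon>"
      using y(2) \<epsilon> by (simp_all add: xfib_of b_def)
    define \<pi> where "\<pi> = pb_pt P q l1 c \<epsilon>"
    have \<pi>: "\<pi> \<in> points P" "q \<pi> = c" "l1 \<pi> = \<epsilon>"
      unfolding \<pi>_def using D.pb_pt[OF c(1) \<epsilon>(1) c(2)] by auto
    have "k1 (e \<pi>) = nm_leg S \<alpha>"
      using y(2,4) \<epsilon>(2) sec_q[OF \<pi>(1)] \<pi>(2,3) by (simp add: b_def)
    then have \<alpha>: "pb_pt A1 k2 g1 \<alpha> (e \<pi>) \<in> points A1" "k2 (pb_pt A1 k2 g1 \<alpha> (e \<pi>)) = \<alpha>"
      "g1 (pb_pt A1 k2 g1 \<alpha> (e \<pi>)) = e \<pi>"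
      using A.pb_pt[OF y(3) H(8)[OF \<pi>(1)]] by simp_all
    show "\<exists>w\<in>points A2. x = a w"
      using W.pb_pt[OF \<alpha>(1) \<pi>(1) \<alpha>(3)] \<pi> \<alpha> \<epsilon> xe
      by (intro bexI[of _ "pb_pt A2 e1 g2 (pb_pt A1 k2 g1 \<alpha> (e \<pi>)) \<pi>"]) (simp_all add: a_def)
  qed
  have b_act: "b (act E g \<epsilon>) = xlo_act G \<beta>' \<beta> g (b \<epsilon>)" if g: "g \<in> carrier G" and \<epsilon>: "\<epsilon> \<in> points E" for g \<epsilon>
  proof (rule xlo_eqI[OF b_in xlo_act_in[OF xb g b_in[OF \<epsilon>]]])
    show gE: "act E g \<epsilon> \<in> points E" using gset_facts(3)[OF D.pb_gsets(3) g \<epsilon>] .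
    show "fst (b (act E g \<epsilon>)) = fst (xlo_act G \<beta>' \<beta> g (b \<epsilon>))"
      using g \<epsilon> E by (simp add: b_def xlo_act_def)
    fix c assume "c \<in> xfib \<beta>' (fst (b (act E g \<epsilon>)))"
    then have c: "c \<in> xfib \<beta>' (act (top2 S') g (p \<epsilon>))" using g \<epsilon> E by (simp add: b_def)
    have c': "act (top1 S') (inv g) c \<in> xfib \<beta>' (p \<epsilon>)"
      using xfib_act_inv[OF xb(2) g _, of "p \<epsilon>" c] c \<epsilon> H by simp
    have cc: "act (top1 S') g (act (top1 S') (inv g) c) = c"
      using xbispan_inv(1)[OF xb(2) g xfibD(1)[OF c]] by simp
    have "snd (b (act E g \<epsilon>)) c = k1 (D.sec (act E g \<epsilon>) (act (top1 S') g (act (top1 S') (inv g) c)))"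
      using c g \<epsilon> E cc by (simp add: b_def)
    also have "\<dots> = k1 (act B1 g (D.sec \<epsilon> (act (top1 S') (inv g) c)))"
      using D.sec_act[OF \<epsilon> g] c' by (simp add: xfib_of)
    also have "\<dots> = act (top2 S) g (k1 (D.sec \<epsilon> (act (top1 S') (inv g) c)))"
      using c' \<epsilon> g D.pb_pt H E by (simp add: D.sec_app xfib_of)
    finally show "snd (b (act E g \<epsilon>)) c = snd (xlo_act G \<beta>' \<beta> g (b \<epsilon>)) c"
      using c c' by (simp add: xlo_act_def b_def)
  qed
  have iso: "xiso G (of_bispan Q) (xcomp G \<beta>' \<beta>)"
  proof (rule xisoI'[where a = a and b = b])
    show "bij_betw a (up (of_bispan Q)) (up (xcomp G \<beta>' \<beta>))" "bij_betw b (lo (of_bispan Q)) (lo (xcomp G \<beta>' \<beta>))"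
      using bij_a bij_b by (simp_all add: Q)
    show "a (up_act (of_bispan Q) g c) = up_act (xcomp G \<beta>' \<beta>) g (a c)"
      if "g \<in> carrier G" "c \<in> up (of_bispan Q)" for g c
      using that H E b_act by (simp add: Q a_def)
    show "nleg (xcomp G \<beta>' \<beta>) (a c) = b (nleg (of_bispan Q) c)" if "c \<in> up (of_bispan Q)" for c
      using that by (simp add: Q a_def)
  qed (use b_act in \<open>simp_all add: Q a_def b_def\<close>)
  show "xiso G (xcomp G \<beta>' \<beta>) (of_bispan Q)"
    by (rule xiso_sym'[OF iso of_bispan_xbispans[OF QB]])
qed

text \<open>The set \<open>pg_comp\<close> must contain every Q isomorphic to the composite, not
  merely one. So the middle sets of the given Q serve as \<open>A2\<close> and E, the other
  pullbacks are arbitrary, and the maps out of \<open>A2\<close> and P are read off from the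
  isomorphism with \<open>xcomp\<close>.\<close>

lemma is_composite_conv:
  assumes Q: "Q \<in> bispans G X Z" and iso: "xiso G (of_bispan Q) (xcomp G \<beta>' \<beta>)"
  shows "is_composite G S' S Q"
proof -
  obtain a a' b b' where v: "xiso_via G (of_bispan Q) (xcomp G \<beta>' \<beta>) a a' b b'"
    "xiso_via G (xcomp G \<beta>' \<beta>) (of_bispan Q) a' a b' b"
    by (rule xiso_obtain_via[OF iso of_bispan_xbispans[OF Q]])
  note V = xiso_viaD[OF v(1), simplified] and U = xiso_viaD[OF v(2), simplified]
  define E A2 where "E = top2 Q" and "A2 = top1 Q"
  have ends: "src S = X" "tgt S = Y" "src S' = Y" "tgt S' = Z" using bispansD(1,2)[OF S] bispansD(1,2)[OF S'] by auto
  obtain B1 k1 f1 where B1: "is_pullback G B1 k1 f1 (top2 S) (tr_leg S) (top1 S') (res_leg S') Y"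
    by (rule pullback_ex[OF gs(3) gs(5) gs(4) hs(3) hs(4)])
  interpret B: pullback_square G B1 k1 f1 "top2 S" "tr_leg S" "top1 S'" "res_leg S'" Y
    by unfold_locales (rule B1)
  obtain A1 k2 g1 where A1: "is_pullback G A1 k2 g1 (top1 S) (nm_leg S) B1 k1 (top2 S)"
    by (rule pullback_ex[OF gs(2) B.pb_gsets(1) gs(3) hs(2) B.pb_gsets(5)])
  interpret A: pullback_square G A1 k2 g1 "top1 S" "nm_leg S" B1 k1 "top2 S"
    by unfold_locales (rule A1)
  have E: "finite_gset G E" and A2: "finite_gset G A2"
    using bispansD(4,5)[OF Q] by (simp_all add: E_def A2_def)
  define p where "p = (\<lambda>\<epsilon>\<in>points E. fst (b \<epsilon>))"
  have b_in: "b \<epsilon> \<in> xlo \<beta>' \<beta>" if "\<epsilon> \<in> points E" for \<epsilon> using V(5) that by (simp add: E_def)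
  have b_act: "b (act E g \<epsilon>) = xlo_act G \<beta>' \<beta> g (b \<epsilon>)" if "g \<in> carrier G" "\<epsilon> \<in> points E" for g \<epsilon>
    using V(9) that by (simp add: E_def)
  have a_act: "a (act A2 g w) = up_act (xcomp G \<beta>' \<beta>) g (a w)" if "g \<in> carrier G" "w \<in> points A2" for g w
    using V(8) that by (simp add: A2_def)
  have p: "p \<in> gset_hom G E (top2 S')"
    by (rule gset_homI)
      (use xloD(1)[OF b_in] gset_facts(3)[OF E] b_act in \<open>simp_all add: p_def xlo_act_def\<close>)
  obtain P q l1 where P: "is_pullback G P q l1 (top1 S') (nm_leg S') E p (top2 S')"
    by (rule pullback_ex[OF gs(5) E gs(6) hs(5) p])
  interpret P: pullback_square G P q l1 "top1 S'" "nm_leg S'" E p "top2 S'"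
    by unfold_locales (rule P)
  note H = hom_facts(1)[OF B.pb_gsets(5)] hom_facts(1)[OF B.pb_gsets(6)]
    hom_facts(1)[OF A.pb_gsets(5)] hom_facts(1)[OF A.pb_gsets(6)]
    hom_facts(1)[OF P.pb_gsets(5)] hom_facts(1)[OF P.pb_gsets(6)] hom_facts(1)[OF P.pb_gsets(8)]
  note GE = hom_facts(2)[OF B.pb_gsets(5)] hom_facts(2)[OF B.pb_gsets(6)]
    hom_facts(2)[OF A.pb_gsets(5)] hom_facts(2)[OF A.pb_gsets(6)]
    hom_facts(2)[OF P.pb_gsets(5)] hom_facts(2)[OF P.pb_gsets(6)] hom_facts(2)[OF P.pb_gsets(8)]
  have qfib: "q \<pi> \<in> xfib \<beta>' (fst (b (l1 \<pi>)))" if "\<pi> \<in> points P" for \<pi>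
    using P.pb_comm[OF that] that H by (simp add: xfib_of p_def)
  have sb: "snd (b \<epsilon>) c \<in> points (top2 S)" "tr_leg S (snd (b \<epsilon>) c) = res_leg S' c" "c \<in> points (top1 S')"
    if "\<epsilon> \<in> points E" "c \<in> xfib \<beta>' (fst (b \<epsilon>))" for \<epsilon> c
    using xloD(3)[OF b_in[OF that(1)] that(2)] xfibD(1)[OF that(2)] by simp_all
  define e where "e = (\<lambda>\<pi>\<in>points P. pb_pt B1 k1 f1 (snd (b (l1 \<pi>)) (q \<pi>)) (q \<pi>))"
  have e: "e \<pi> \<in> points B1" "k1 (e \<pi>) = snd (b (l1 \<pi>)) (q \<pi>)" "f1 (e \<pi>) = q \<pi>" if "\<pi> \<in> points P" for \<pi>
    using B.pb_pt[OF sb(1) sb(3) sb(2), OF H(6) qfib H(6) qfib H(6) qfib] that by (simp_all add: e_def)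
  have ehom: "e \<in> gset_hom G P B1"
  proof (rule gset_homI)
    fix g \<pi> assume g: "g \<in> carrier G" and \<pi>: "\<pi> \<in> points P"
    have gP: "act P g \<pi> \<in> points P" by (rule gset_facts(3)[OF P.pb_gsets(1) g \<pi>])
    show "e (act P g \<pi>) = act B1 g (e \<pi>)"
    proof (rule B.pb_inj)
      show "k1 (e (act P g \<pi>)) = k1 (act B1 g (e \<pi>))"
        using xlo_act_app[OF xb(2) g b_in[OF H(6)[OF \<pi>]] qfib[OF \<pi>]] g \<pi> gP e H
        by (simp add: GE b_act)
    qed (use g \<pi> gP e gset_facts(3)[OF B.pb_gsets(1) g] GE in simp_all)
  qed (simp_all add: e, simp add: e_def)
  have fe: "gset_comp P f1 e = q"
    by (rule hom_eqI[where X = P]) (simp_all add: e hom_facts(3)[OF P.pb_gsets(5)])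
  interpret D: dependent_square G P q l1 "top1 S'" "nm_leg S'" E p "top2 S'" B1 f1 e
    by unfold_locales (rule B.pb_gsets(1) B.pb_gsets(6) ehom fe)+
  have "bij_betw ((\<lambda>y. (fst y, \<lambda>c\<in>xfib \<beta>' (fst y). pb_pt B1 k1 f1 (snd y c) c)) \<circ> b) (points E)
     (dp_sections B1 f1 (top1 S') (nm_leg S') (top2 S'))"
  proof (rule bij_betw_trans[OF _ dp_sections_bij(2)[OF B1]])
    show "bij_betw b (points E) (xlo \<beta>' \<beta>)"
      by (rule bij_betw_byWitness[where f' = b']) (use V(5,6) U(5,6) in \<open>simp_all add: E_def image_subset_iff\<close>)
  qed
  moreover have "(p \<epsilon>, D.sec \<epsilon>) = ((\<lambda>y. (fst y, \<lambda>c\<in>xfib \<beta>' (fst y). pb_pt B1 k1 f1 (snd y c) c)) \<circ> b) \<epsilon>"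
    if \<epsilon>: "\<epsilon> \<in> points E" for \<epsilon>
  proof -
    have "D.sec \<epsilon> = (\<lambda>c\<in>xfib \<beta>' (fst (b \<epsilon>)). pb_pt B1 k1 f1 (snd (b \<epsilon>) c) c)"
    proof (rule extensionalityI[where A = "xfib \<beta>' (fst (b \<epsilon>))"])
      show "D.sec \<epsilon> \<in> extensional (xfib \<beta>' (fst (b \<epsilon>)))"
        using \<epsilon> by (simp add: dp_sec_def xfib_of p_def)
      fix c assume c: "c \<in> xfib \<beta>' (fst (b \<epsilon>))"
      then have c': "c \<in> points (top1 S')" "nm_leg S' c = p \<epsilon>" using \<epsilon> by (simp_all add: xfib_of p_def)
      show "D.sec \<epsilon> c = (\<lambda>c\<in>xfib \<beta>' (fst (b \<epsilon>)). pb_pt B1 k1 f1 (snd (b \<epsilon>) c) c) c"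
        using D.sec_app[OF c'] c P.pb_pt[OF c'(1) \<epsilon> c'(2)] by (simp add: e_def)
    qed simp
    then show ?thesis using \<epsilon> by (simp add: p_def)
  qed
  ultimately have "bij_betw (\<lambda>\<epsilon>. (p \<epsilon>, D.sec \<epsilon>)) (points E) (dp_sections B1 f1 (top1 S') (nm_leg S') (top2 S'))"
    by (simp cong: bij_betw_cong)
  then have DP: "is_dependent_product G B1 f1 (top1 S') (nm_leg S') (top2 S') E p P q l1 e"
    by (rule D.dp_conv)
  have a_in: "a w \<in> xup \<beta>' \<beta>" if "w \<in> points A2" for w using V(1) that by (simp add: A2_def)
  have nQ: "nm_leg Q w \<in> points E" if "w \<in> points A2" for w
    using that hom_facts(1)[OF bispansD(8)[OF Q]] by (simp add: A2_def E_def)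
  have fa: "fst (a w) = b (nm_leg Q w)" if "w \<in> points A2" for w
    using V(4) that by (simp add: A2_def)
  define g2 where "g2 = (\<lambda>w\<in>points A2. pb_pt P q l1 (fst (snd (a w))) (nm_leg Q w))"
  have ca: "fst (snd (a w)) \<in> points (top1 S')" "nm_leg S' (fst (snd (a w))) = p (nm_leg Q w)"
     "snd (snd (a w)) \<in> points (top1 S)" if "w \<in> points A2" for w
    using xupD(2,3)[OF a_in[OF that]] nQ[OF that] fa[OF that] by (simp_all add: xfib_of p_def)
  have g2: "g2 w \<in> points P" "q (g2 w) = fst (snd (a w))" "l1 (g2 w) = nm_leg Q w" if "w \<in> points A2" for w
    using P.pb_pt[OF ca(1)[OF that] nQ[OF that] ca(2)[OF that]] that by (simp_all add: g2_def)
  define e1 where "e1 = (\<lambda>w\<in>points A2. pb_pt A1 k2 g1 (snd (snd (a w))) (e (g2 w)))"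
  have ke: "nm_leg S (snd (snd (a w))) = k1 (e (g2 w))" if "w \<in> points A2" for w
    using xupD(4)[OF a_in[OF that]] e(2)[OF g2(1)[OF that]] g2[OF that] fa[OF that] by simp
  have e1: "e1 w \<in> points A1" "k2 (e1 w) = snd (snd (a w))" "g1 (e1 w) = e (g2 w)" if "w \<in> points A2" for w
    using A.pb_pt[OF ca(3)[OF that] e(1)[OF g2(1)[OF that]] ke[OF that]] that by (simp_all add: e1_def)
  have g2hom: "g2 \<in> gset_hom G A2 P"
  proof (rule gset_homI)
    fix g w assume g: "g \<in> carrier G" and w: "w \<in> points A2"
    have gw: "act A2 g w \<in> points A2" by (rule gset_facts(3)[OF A2 g w])
    show "g2 (act A2 g w) = act P g (g2 w)"
      by (rule P.pb_inj) (use g w gw g2 GE gset_facts(3)[OF P.pb_gsets(1)] a_act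
        hom_facts(2)[OF bispansD(8)[OF Q]] in \<open>simp_all add: A2_def E_def\<close>)
  qed (simp_all add: g2, simp add: g2_def)
  have e1hom: "e1 \<in> gset_hom G A2 A1"
  proof (rule gset_homI)
    fix g w assume g: "g \<in> carrier G" and w: "w \<in> points A2"
    have gw: "act A2 g w \<in> points A2" by (rule gset_facts(3)[OF A2 g w])
    show "e1 (act A2 g w) = act A1 g (e1 w)"
      by (rule A.pb_inj) (use g w gw e1 GE gset_facts(3)[OF A.pb_gsets(1)] a_act hom_facts(2)[OF g2hom]
        hom_facts(2)[OF ehom] g2 in simp_all)
  qed (simp_all add: e1, simp add: e1_def)
  have "bij_betw (\<lambda>w. (e1 w, g2 w)) (points A2)
      {(x, y). x \<in> points A1 \<and> y \<in> points P \<and> g1 x = e y}"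
  proof (rule bij_betwI')
    fix w w' assume w: "w \<in> points A2" "w' \<in> points A2"
    show "((e1 w, g2 w) = (e1 w', g2 w')) = (w = w')"
    proof
      assume "(e1 w, g2 w) = (e1 w', g2 w')"
      then have "a w = a w'"
        using e1(2)[OF w(1)] e1(2)[OF w(2)] g2[OF w(1)] g2[OF w(2)] fa[OF w(1)] fa[OF w(2)]
        by (intro prod_eqI) auto
      then show "w = w'" using V(2) w by (metis A2_def)
    qed simp
  next
    fix w assume "w \<in> points A2"
    then show "(e1 w, g2 w) \<in> {(x, y). x \<in> points A1 \<and> y \<in> points P \<and> g1 x = e y}"
      using e1 g2 by simp
  next
    fix z assume "z \<in> {(x, y). x \<in> points A1 \<and> y \<in> points P \<and> g1 x = e y}"
    then obtain \<alpha> \<pi> where z: "z = (\<alpha>, \<pi>)" "\<alpha> \<in> points A1" "\<pi> \<in> points P" "g1 \<alpha> = e \<pi>" by blast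
    have u: "(b (l1 \<pi>), q \<pi>, k2 \<alpha>) \<in> xup \<beta>' \<beta>"
      by (rule xupI) (use z H b_in qfib e A.pb_comm[OF z(2)] in simp_all)
    define w where "w = a' (b (l1 \<pi>), q \<pi>, k2 \<alpha>)"
    have w: "w \<in> points A2" "a w = (b (l1 \<pi>), q \<pi>, k2 \<alpha>)"
      using U(1,2)[OF u] by (simp_all add: w_def A2_def)
    have bl: "b (l1 \<pi>) = b (nm_leg Q w)" using fa[OF w(1)] w(2) by simp
    then have "b' (b (l1 \<pi>)) = b' (b (nm_leg Q w))" by simp
    then have l: "l1 \<pi> = nm_leg Q w" using V(6) H(6)[OF z(3)] nQ[OF w(1)] by (simp add: E_def)
    have g: "g2 w = \<pi>" by (rule P.pb_inj) (use g2[OF w(1)] w(2) l z in simp_all)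
    have "e1 w = \<alpha>" by (rule A.pb_inj) (use e1[OF w(1)] w(2) g z in simp_all)
    then show "\<exists>w\<in>points A2. z = (e1 w, g2 w)" using w(1) g z(1) by blast
  qed
  then have A2pb: "is_pullback G A2 e1 g2 A1 g1 P e B1"
    using A2 A.pb_gsets P.pb_gsets B.pb_gsets e1hom g2hom ehom by (simp add: is_pullback_def)
  have "Q = \<lparr>src = src S, top1 = A2, top2 = E, tgt = tgt S',
             res_leg = gset_comp A2 (res_leg S) (gset_comp A2 k2 e1),
             nm_leg = gset_comp A2 l1 g2,
             tr_leg = gset_comp E (tr_leg S') p\<rparr>"
  proof (rule bispan.equality)
    show "res_leg Q = res_leg \<lparr>src = src S, top1 = A2, top2 = E, tgt = tgt S',
             res_leg = gset_comp A2 (res_leg S) (gset_comp A2 k2 e1),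
             nm_leg = gset_comp A2 l1 g2, tr_leg = gset_comp E (tr_leg S') p\<rparr>"
      unfolding bispan.simps
      by (rule hom_eqI[where X = A2]) (use hom_facts(3)[OF bispansD(7)[OF Q]] e1 V(3) in \<open>simp_all add: A2_def\<close>)
    show "nm_leg Q = nm_leg \<lparr>src = src S, top1 = A2, top2 = E, tgt = tgt S',
             res_leg = gset_comp A2 (res_leg S) (gset_comp A2 k2 e1),
             nm_leg = gset_comp A2 l1 g2, tr_leg = gset_comp E (tr_leg S') p\<rparr>"
      unfolding bispan.simps
      by (rule hom_eqI[where X = A2]) (use hom_facts(3)[OF bispansD(8)[OF Q]] g2 in \<open>simp_all add: A2_def\<close>)
    show "tr_leg Q = tr_leg \<lparr>src = src S, top1 = A2, top2 = E, tgt = tgt S',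
             res_leg = gset_comp A2 (res_leg S) (gset_comp A2 k2 e1),
             nm_leg = gset_comp A2 l1 g2, tr_leg = gset_comp E (tr_leg S') p\<rparr>"
      unfolding bispan.simps
      by (rule hom_eqI[where X = E]) (use hom_facts(3)[OF bispansD(9)[OF Q]] V(7) in \<open>simp_all add: E_def p_def\<close>)
  qed (use bispansD(1,2)[OF Q] ends in \<open>simp_all add: A2_def E_def\<close>)
  then show ?thesis
    unfolding is_composite_def using B1 A1 DP A2pb ends by blast
qed

end

text \<open>The link to the definition of composition: every later composite is computed through
  \<open>xcomp\<close>.\<close>

theorem (in group) pg_comp_xclass:
  assumes \<beta>: "\<beta> \<in> xbispans G X Y" and \<beta>': "\<beta>' \<in> xbispans G Y Z"
  shows "pg_comp G (xclass G Y Z \<beta>') (xclass G X Y \<beta>) = xclass G X Z (xcomp G \<beta>' \<beta>)"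
proof (intro equalityI subsetI)
  fix Q assume "Q \<in> pg_comp G (xclass G Y Z \<beta>') (xclass G X Y \<beta>)"
  then obtain S S' where S: "S \<in> bispans G X Y" "xiso G \<beta> (of_bispan S)"
    and S': "S' \<in> bispans G Y Z" "xiso G \<beta>' (of_bispan S')" and Q: "is_composite G S' S Q"
    by (auto simp: pg_comp_def xclass_def)
  interpret C: composable G S S' X Y Z by unfold_locales (rule S S')+
  show "Q \<in> xclass G X Z (xcomp G \<beta>' \<beta>)"
    unfolding xclass_def mem_Collect_eq
    using C.is_composite_imp[OF Q] xiso_trans[OF xcomp_cong[OF \<beta> \<beta>' C.xb S(2) S'(2)]] by blast
next
  fix Q assume Q: "Q \<in> xclass G X Z (xcomp G \<beta>' \<beta>)"
  obtain S where S: "S \<in> bispans G X Y" "xiso G \<beta> (of_bispan S)" by (rule realization[OF \<beta>])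
  obtain S' where S': "S' \<in> bispans G Y Z" "xiso G \<beta>' (of_bispan S')" by (rule realization[OF \<beta>'])
  interpret C: composable G S S' X Y Z by unfold_locales (rule S S')+
  have QB: "Q \<in> bispans G X Z" and iso: "xiso G (xcomp G \<beta>' \<beta>) (of_bispan Q)"
    using Q by (simp_all add: xclass_def)
  have "xiso G (of_bispan Q) (xcomp G (of_bispan S') (of_bispan S))"
    by (rule xiso_trans[OF xiso_sym'[OF iso xcomp_xbispans[OF \<beta> \<beta>']] xcomp_cong[OF \<beta> \<beta>' C.xb S(2) S'(2)]])
  then have "is_composite G S' S Q" by (rule C.is_composite_conv[OF QB])
  then show "Q \<in> pg_comp G (xclass G Y Z \<beta>') (xclass G X Y \<beta>)"
    using S S' by (auto simp: pg_comp_def xclass_def)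
qed

lemma pair_eqI: "\<lbrakk>x = fst w; y = snd w\<rbrakk> \<Longrightarrow> (x, y) = w"
  by simp

lemma triple_eqI: "\<lbrakk>x = fst w; y = fst (snd w); z = snd (snd w)\<rbrakk> \<Longrightarrow> (x, y, z) = w"
  by simp

section \<open>Transfers, norms and restrictions\<close>

definition xT :: "'g gset \<Rightarrow> ('g point \<Rightarrow> 'g point) \<Rightarrow> ('g, 'g point, 'g point) xbispan" where
  "xT X f = \<lparr>up = points X, up_act = act X, lo = points X, lo_act = act X,
     rleg = \<lambda>x. x, nleg = \<lambda>x. x, tleg = f\<rparr>"

definition xN :: "'g gset \<Rightarrow> 'g gset \<Rightarrow> ('g point \<Rightarrow> 'g point) \<Rightarrow> ('g, 'g point, 'g point) xbispan" where
  "xN X Y f = \<lparr>up = points X, up_act = act X, lo = points Y, lo_act = act Y,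
     rleg = \<lambda>x. x, nleg = f, tleg = \<lambda>x. x\<rparr>"

definition xR :: "'g gset \<Rightarrow> ('g point \<Rightarrow> 'g point) \<Rightarrow> ('g, 'g point, 'g point) xbispan" where
  "xR X f = \<lparr>up = points X, up_act = act X, lo = points X, lo_act = act X,
     rleg = f, nleg = \<lambda>x. x, tleg = \<lambda>x. x\<rparr>"

lemma xT_simps [simp]:
  "up (xT X f) = points X" "up_act (xT X f) = act X" "lo (xT X f) = points X" "lo_act (xT X f) = act X"
  "rleg (xT X f) = (\<lambda>x. x)" "nleg (xT X f) = (\<lambda>x. x)" "tleg (xT X f) = f"
  by (simp_all add: xT_def)

lemma xN_simps [simp]:
  "up (xN X Y f) = points X" "up_act (xN X Y f) = act X" "lo (xN X Y f) = points Y"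
  "lo_act (xN X Y f) = act Y" "rleg (xN X Y f) = (\<lambda>x. x)" "nleg (xN X Y f) = f" "tleg (xN X Y f) = (\<lambda>x. x)"
  by (simp_all add: xN_def)

lemma xR_simps [simp]:
  "up (xR X f) = points X" "up_act (xR X f) = act X" "lo (xR X f) = points X" "lo_act (xR X f) = act X"
  "rleg (xR X f) = f" "nleg (xR X f) = (\<lambda>x. x)" "tleg (xR X f) = (\<lambda>x. x)"
  by (simp_all add: xR_def)

lemma (in group) xTNR_xbispans:
  assumes "finite_gset G X" "finite_gset G Y" "f \<in> gset_hom G X Y"
  shows "xT X f \<in> xbispans G X Y" "xN X Y f \<in> xbispans G X Y" "xR X f \<in> xbispans G Y X"
  by (rule xbispansI; use assms in \<open>simp add: finite_gset_iff gset_hom_iff gmap_def gact_closed\<close>)+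

text \<open>The identity legs of \<open>pg_T\<close> are extensional and those of \<open>xT\<close>
  are not; they agree on the points, which is all that \<open>xiso\<close> sees.\<close>

lemma (in group) pg_T_eq:
  assumes "finite_gset G X" "finite_gset G Y" "f \<in> gset_hom G X Y"
  shows "pg_T G X Y f = xclass G X Y (xT X f)"
proof -
  define S where "S = \<lparr>src = X, top1 = X, top2 = X, tgt = Y,
      res_leg = gset_id X, nm_leg = gset_id X, tr_leg = f\<rparr>"
  have S: "S \<in> bispans G X Y" using assms by (simp add: S_def bispans_def gset_id_hom)
  have "xiso G (of_bispan S) (xT X f)"
    by (rule xisoI[where a = id and a' = id and b = id and b' = id]) (simp_all add: S_def)
  then show ?thesis
    unfolding pg_T_def S_def[symmetric] bispan_class_eq[OF S]
    by (rule xclass_cong) (rule of_bispan_xbispans[OF S])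
qed

lemma (in group) pg_N_eq:
  assumes "finite_gset G X" "finite_gset G Y" "f \<in> gset_hom G X Y"
  shows "pg_N G X Y f = xclass G X Y (xN X Y f)"
proof -
  define S where "S = \<lparr>src = X, top1 = X, top2 = Y, tgt = Y,
      res_leg = gset_id X, nm_leg = f, tr_leg = gset_id Y\<rparr>"
  have S: "S \<in> bispans G X Y" using assms by (simp add: S_def bispans_def gset_id_hom)
  have "xiso G (of_bispan S) (xN X Y f)"
    by (rule xisoI[where a = id and a' = id and b = id and b' = id]) (simp_all add: S_def)
  then show ?thesis
    unfolding pg_N_def S_def[symmetric] bispan_class_eq[OF S]
    by (rule xclass_cong) (rule of_bispan_xbispans[OF S])
qed

lemma (in group) pg_R_eq:
  assumes "finite_gset G X" "finite_gset G Y" "f \<in> gset_hom G X Y"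
  shows "pg_R G X Y f = xclass G Y X (xR X f)"
proof -
  define S where "S = \<lparr>src = Y, top1 = X, top2 = X, tgt = X,
      res_leg = f, nm_leg = gset_id X, tr_leg = gset_id X\<rparr>"
  have S: "S \<in> bispans G Y X" using assms by (simp add: S_def bispans_def gset_id_hom)
  have "xiso G (of_bispan S) (xR X f)"
    by (rule xisoI[where a = id and a' = id and b = id and b' = id]) (simp_all add: S_def)
  then show ?thesis
    unfolding pg_R_def S_def[symmetric] bispan_class_eq[OF S]
    by (rule xclass_cong) (rule of_bispan_xbispans[OF S])
qed

text \<open>The composite of R_h with \<beta>: moving R past T and then past N pulls back the lower
  and then the upper set.\<close>

definition xpull :: "'g gset \<Rightarrow> ('g point \<Rightarrow> 'g point) \<Rightarrow> ('g, 'c, 'b) xbispan \<Rightarrow>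
    ('g, 'g point \<times> 'c, 'g point \<times> 'b) xbispan" where
  "xpull Y h \<beta> = \<lparr>up = {w. fst w \<in> points Y \<and> snd w \<in> up \<beta> \<and> h (fst w) = tleg \<beta> (nleg \<beta> (snd w))},
     up_act = \<lambda>g w. (act Y g (fst w), up_act \<beta> g (snd w)),
     lo = {w. fst w \<in> points Y \<and> snd w \<in> lo \<beta> \<and> h (fst w) = tleg \<beta> (snd w)},
     lo_act = \<lambda>g w. (act Y g (fst w), lo_act \<beta> g (snd w)),
     rleg = \<lambda>w. rleg \<beta> (snd w), nleg = \<lambda>w. (fst w, nleg \<beta> (snd w)), tleg = fst\<rparr>"

lemma xpull_simps [simp]:
  "up (xpull Y h \<beta>) = {w. fst w \<in> points Y \<and> snd w \<in> up \<beta> \<and> h (fst w) = tleg \<beta> (nleg \<beta> (snd w))}"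
  "up_act (xpull Y h \<beta>) = (\<lambda>g w. (act Y g (fst w), up_act \<beta> g (snd w)))"
  "lo (xpull Y h \<beta>) = {w. fst w \<in> points Y \<and> snd w \<in> lo \<beta> \<and> h (fst w) = tleg \<beta> (snd w)}"
  "lo_act (xpull Y h \<beta>) = (\<lambda>g w. (act Y g (fst w), lo_act \<beta> g (snd w)))"
  "rleg (xpull Y h \<beta>) = (\<lambda>w. rleg \<beta> (snd w))" "nleg (xpull Y h \<beta>) = (\<lambda>w. (fst w, nleg \<beta> (snd w)))"
  "tleg (xpull Y h \<beta>) = fst"
  by (simp_all add: xpull_def)

text \<open>The norm leg of R_h has one-point fibres, so a lift is the choice of one lower point and
  all further data in \<open>xcomp\<close> are redundant. The same holds for T_f in
  \<open>xcomp_T\<close>.\<close>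

lemma (in group) xcomp_R:
  assumes \<beta>: "\<beta> \<in> xbispans G X Y" and Y': "finite_gset G Y'" and h: "h \<in> gset_hom G Y' Y"
  shows "xiso G (xcomp G (xR Y' h) \<beta>) (xpull Y' h \<beta>)"
proof (rule xisoI)
  note F = xbispan_facts[OF \<beta>]
  have R: "xR Y' h \<in> xbispans G Y Y'" by (rule xTNR_xbispans[OF Y' xbispansD(2)[OF \<beta>] h])
  have fib: "xfib (xR Y' h) d = (if d \<in> points Y' then {d} else {})" for d by (auto simp: xfib_def)
  let ?A = "\<lambda>w :: ('a point \<times> ('a point \<Rightarrow> _)) \<times> 'a point \<times> _. (fst (fst w), snd (snd w))"
  let ?A' = "\<lambda>w. ((fst w, \<lambda>c\<in>{fst w}. nleg \<beta> (snd w)), fst w, snd w)"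
  let ?B = "\<lambda>y :: 'a point \<times> ('a point \<Rightarrow> _). (fst y, snd y (fst y))"
  let ?B' = "\<lambda>w. (fst w, \<lambda>c\<in>{fst w}. snd w)"
  show "?B y \<in> lo (xpull Y' h \<beta>) \<and> ?B' (?B y) = y" if "y \<in> lo (xcomp G (xR Y' h) \<beta>)" for y
  proof -
    have y: "y \<in> xlo (xR Y' h) \<beta>" using that by simp
    have "(\<lambda>c\<in>{fst y}. snd y (fst y)) = snd y"
      by (rule extensionalityI[where A = "{fst y}"]) (use xloD[OF y] in \<open>simp_all add: fib\<close>)
    then have "?B' (?B y) = y" by (simp add: prod_eq_iff)
    then show ?thesis using xloD[OF y] by (simp add: fib)
  qed
  show "?B' w \<in> lo (xcomp G (xR Y' h) \<beta>) \<and> ?B (?B' w) = w" if "w \<in> lo (xpull Y' h \<beta>)" for w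
    using that unfolding xcomp_simps by (intro conjI xloI) (simp_all add: fib)
  show "?A w \<in> up (xpull Y' h \<beta>) \<and> ?A' (?A w) = w" if "w \<in> up (xcomp G (xR Y' h) \<beta>)" for w
  proof -
    have w: "w \<in> xup (xR Y' h) \<beta>" using that by simp
    note y = xupD(1)[OF w]
    have d: "fst (fst w) \<in> points Y'" using xloD(1)[OF y] by simp
    have c: "fst (snd w) = fst (fst w)" using xupD(2)[OF w] d by (simp add: fib)
    have s: "snd (fst w) (fst (fst w)) = nleg \<beta> (snd (snd w))" using xupD(4)[OF w] c by simp
    have "(\<lambda>c\<in>{fst (fst w)}. nleg \<beta> (snd (snd w))) = snd (fst w)"
      by (rule extensionalityI[where A = "{fst (fst w)}"]) (use xloD[OF y] d s in \<open>simp_all add: fib\<close>)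
    then have "?A' (?A w) = w" using c by (simp add: prod_eq_iff)
    then show ?thesis using xupD(3)[OF w] d s xloD(3)[OF y, of "fst (fst w)"] by (simp add: fib)
  qed
  show "?A' w \<in> up (xcomp G (xR Y' h) \<beta>) \<and> ?A (?A' w) = w" if "w \<in> up (xpull Y' h \<beta>)" for w
    using that F(2) unfolding xcomp_simps by (intro conjI xupI xloI) (simp_all add: fib)
  show "?B (lo_act (xcomp G (xR Y' h) \<beta>) g y) = lo_act (xpull Y' h \<beta>) g (?B y)"
    if "g \<in> carrier G" "y \<in> lo (xcomp G (xR Y' h) \<beta>)" for g y
    using xlo_act_app[OF R that(1), of y \<beta> "fst y"] xloD(1)[of y "xR Y' h" \<beta>] that
    by (simp add: fib xlo_act_def)
  show "?A (up_act (xcomp G (xR Y' h) \<beta>) g w) = up_act (xpull Y' h \<beta>) g (?A w)"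
    if "g \<in> carrier G" "w \<in> up (xcomp G (xR Y' h) \<beta>)" for g w
    by (simp add: xlo_act_def)
  show "nleg (xpull Y' h \<beta>) (?A w) = ?B (nleg (xcomp G (xR Y' h) \<beta>) w)"
    if "w \<in> up (xcomp G (xR Y' h) \<beta>)" for w
    using that xupD[of w "xR Y' h" \<beta>] xloD(1)[of "fst w" "xR Y' h" \<beta>] by (simp add: fib)
qed simp_all

definition xtrans :: "('g point \<Rightarrow> 'g point) \<Rightarrow> ('g, 'c, 'b) xbispan \<Rightarrow> ('g, 'c, 'b) xbispan" where
  "xtrans f \<beta> = \<beta>\<lparr>tleg := \<lambda>b. f (tleg \<beta> b)\<rparr>"

lemma xtrans_simps [simp]:
  "up (xtrans f \<beta>) = up \<beta>" "up_act (xtrans f \<beta>) = up_act \<beta>" "lo (xtrans f \<beta>) = lo \<beta>"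
  "lo_act (xtrans f \<beta>) = lo_act \<beta>" "rleg (xtrans f \<beta>) = rleg \<beta>" "nleg (xtrans f \<beta>) = nleg \<beta>"
  "tleg (xtrans f \<beta>) b = f (tleg \<beta> b)"
  by (simp_all add: xtrans_def)

lemma (in group) xcomp_T:
  assumes \<beta>: "\<beta> \<in> xbispans G X Y" and Z: "finite_gset G Z" and f: "f \<in> gset_hom G Y Z"
  shows "xiso G (xcomp G (xT Y f) \<beta>) (xtrans f \<beta>)"
proof (rule xisoI)
  note F = xbispan_facts[OF \<beta>]
  have R: "xT Y f \<in> xbispans G Y Z" by (rule xTNR_xbispans[OF xbispansD(2)[OF \<beta>] Z f])
  have fib: "xfib (xT Y f) d = (if d \<in> points Y then {d} else {})" for d by (auto simp: xfib_def)
  let ?A = "\<lambda>w :: ('a point \<times> ('a point \<Rightarrow> _)) \<times> 'a point \<times> _. snd (snd w)"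
  let ?B' = "\<lambda>b. (tleg \<beta> b, \<lambda>c\<in>{tleg \<beta> b}. b)"
  let ?A' = "\<lambda>a. (?B' (nleg \<beta> a), tleg \<beta> (nleg \<beta> a), a)"
  let ?B = "\<lambda>y :: 'a point \<times> ('a point \<Rightarrow> _). snd y (fst y)"
  show "?B y \<in> lo (xtrans f \<beta>) \<and> ?B' (?B y) = y" if "y \<in> lo (xcomp G (xT Y f) \<beta>)" for y
  proof -
    have y: "y \<in> xlo (xT Y f) \<beta>" using that by simp
    have t: "tleg \<beta> (?B y) = fst y" "?B y \<in> lo \<beta>" using xloD[OF y] by (simp_all add: fib)
    have "(\<lambda>c\<in>{fst y}. snd y (fst y)) = snd y"
      by (rule extensionalityI[where A = "{fst y}"]) (use xloD[OF y] in \<open>simp_all add: fib\<close>)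
    then have "?B' (?B y) = y" using t by (intro pair_eqI) simp_all
    then show ?thesis using t by simp
  qed
  show "?B' w \<in> lo (xcomp G (xT Y f) \<beta>) \<and> ?B (?B' w) = w" if "w \<in> lo (xtrans f \<beta>)" for w
    using that F(3) unfolding xcomp_simps by (intro conjI xloI) (simp_all add: fib)
  show "?A w \<in> up (xtrans f \<beta>) \<and> ?A' (?A w) = w" if "w \<in> up (xcomp G (xT Y f) \<beta>)" for w
  proof -
    have w: "w \<in> xup (xT Y f) \<beta>" using that by simp
    note y = xupD(1)[OF w]
    have d: "fst (fst w) \<in> points Y" using xloD(1)[OF y] by simp
    have c: "fst (snd w) = fst (fst w)" using xupD(2)[OF w] d by (simp add: fib)
    have s: "snd (fst w) (fst (fst w)) = nleg \<beta> (snd (snd w))" using xupD(4)[OF w] c by simp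
    have t: "tleg \<beta> (nleg \<beta> (snd (snd w))) = fst (fst w)"
      using xloD(3)[OF y, of "fst (fst w)"] d s by (simp add: fib)
    have "(\<lambda>c\<in>{fst (fst w)}. nleg \<beta> (snd (snd w))) = snd (fst w)"
      by (rule extensionalityI[where A = "{fst (fst w)}"]) (use xloD[OF y] d s in \<open>simp_all add: fib\<close>)
    then have "?B' (nleg \<beta> (?A w)) = fst w" using t by (intro pair_eqI) simp_all
    then have "?A' (?A w) = w" using c t by (intro triple_eqI) simp_all
    then show ?thesis using xupD(3)[OF w] by simp
  qed
  show "?A' w \<in> up (xcomp G (xT Y f) \<beta>) \<and> ?A (?A' w) = w" if "w \<in> up (xtrans f \<beta>)" for w
    using that F(2,3) unfolding xcomp_simps by (intro conjI xupI xloI) (simp_all add: fib)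
  show "?B (lo_act (xcomp G (xT Y f) \<beta>) g y) = lo_act (xtrans f \<beta>) g (?B y)"
    if "g \<in> carrier G" "y \<in> lo (xcomp G (xT Y f) \<beta>)" for g y
    using xlo_act_app[OF R that(1), of y \<beta> "fst y"] xloD(1)[of y "xT Y f" \<beta>] that
    by (simp add: fib xlo_act_def)
  show "nleg (xtrans f \<beta>) (?A w) = ?B (nleg (xcomp G (xT Y f) \<beta>) w)"
    if "w \<in> up (xcomp G (xT Y f) \<beta>)" for w
    using that xupD[of w "xT Y f" \<beta>] xloD(1)[of "fst w" "xT Y f" \<beta>] by (simp add: fib)
  show "tleg (xtrans f \<beta>) (?B y) = tleg (xcomp G (xT Y f) \<beta>) y" if "y \<in> lo (xcomp G (xT Y f) \<beta>)" for y
    using that xloD[of y "xT Y f" \<beta>] by (simp add: fib)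
qed simp_all

text \<open>The composite N_n R_r, a bispan whose transfer is trivial.\<close>

definition xres_norm :: "'g gset \<Rightarrow> 'g gset \<Rightarrow> ('g point \<Rightarrow> 'g point) \<Rightarrow> ('g point \<Rightarrow> 'g point) \<Rightarrow>
    ('g, 'g point, 'g point) xbispan" where
  "xres_norm A B r n = (xN A B n)\<lparr>rleg := r\<rparr>"

lemma xres_norm_simps [simp]:
  "up (xres_norm A B r n) = points A" "up_act (xres_norm A B r n) = act A"
  "lo (xres_norm A B r n) = points B" "lo_act (xres_norm A B r n) = act B"
  "rleg (xres_norm A B r n) = r" "nleg (xres_norm A B r n) = n" "tleg (xres_norm A B r n) = (\<lambda>x. x)"
  by (simp_all add: xres_norm_def)

lemma (in group) xres_norm_xbispans:
  assumes "finite_gset G X" "finite_gset G A" "finite_gset G B" "r \<in> gset_hom G A X" "n \<in> gset_hom G A B"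
  shows "xres_norm A B r n \<in> xbispans G X B"
  by (rule xbispansI; use assms in \<open>simp add: finite_gset_iff gset_hom_iff gmap_def gact_closed\<close>)

text \<open>The transfer leg of R_r is the identity, so each fibre of n has exactly one lift, the
  inclusion of the fibre.\<close>

lemma (in group) xcomp_NR:
  assumes X: "finite_gset G X" and A: "finite_gset G A" and B: "finite_gset G B"
    and r: "r \<in> gset_hom G A X" and n: "n \<in> gset_hom G A B"
  shows "xiso G (xcomp G (xN A B n) (xR A r)) (xres_norm A B r n)"
proof (rule xisoI)
  have N: "xN A B n \<in> xbispans G A B" by (rule xTNR_xbispans[OF A B n])
  let ?B' = "\<lambda>b. (b, \<lambda>a\<in>xfib (xN A B n) b. a)"
  have fibD: "c \<in> points A" "n c = d" if "c \<in> xfib (xN A B n) d" for c d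
    using that by (simp_all add: xfib_def)
  have eq: "?B' (fst y) = y" if y: "y \<in> xlo (xN A B n) (xR A r)" for y
    by (rule prod_eqI; simp?; rule extensionalityI[where A = "xfib (xN A B n) (fst y)"])
      (use xloD[OF y] in simp_all)
  show "fst y \<in> lo (xres_norm A B r n) \<and> ?B' (fst y) = y" if "y \<in> lo (xcomp G (xN A B n) (xR A r))" for y
    using that eq[of y] xloD(1)[of y "xN A B n"] by simp
  show in': "?B' b \<in> lo (xcomp G (xN A B n) (xR A r)) \<and> fst (?B' b) = b" if "b \<in> lo (xres_norm A B r n)" for b
    using that fibD unfolding xcomp_simps by (intro conjI xloI) simp_all
  show "snd (snd w) \<in> up (xres_norm A B r n) \<and> (?B' (n (snd (snd w))), snd (snd w), snd (snd w)) = w"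
    if "w \<in> up (xcomp G (xN A B n) (xR A r))" for w
  proof -
    have w: "w \<in> xup (xN A B n) (xR A r)" using that by simp
    have c: "snd (snd w) = fst (snd w)" using xupD(4)[OF w] xloD(3)[OF xupD(1,2)[OF w]] by simp
    then have "n (snd (snd w)) = fst (fst w)" using fibD[OF xupD(2)[OF w]] by simp
    then have "(?B' (n (snd (snd w))), snd (snd w), snd (snd w)) = (fst w, fst (snd w), snd (snd w))"
      using eq[OF xupD(1)[OF w]] c by simp
    then show ?thesis using xupD(3)[OF w] by simp
  qed
  show "(?B' (n a), a, a) \<in> up (xcomp G (xN A B n) (xR A r)) \<and> snd (snd (?B' (n a), a, a)) = a"
    if "a \<in> up (xres_norm A B r n)" for a
    using that in'[of "n a"] hom_facts(1)[OF n] unfolding xcomp_simps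
    by (intro conjI xupI) (simp_all add: xfib_def)
  show "nleg (xres_norm A B r n) (snd (snd w)) = fst (nleg (xcomp G (xN A B n) (xR A r)) w)"
    if "w \<in> up (xcomp G (xN A B n) (xR A r))" for w
  proof -
    have w: "w \<in> xup (xN A B n) (xR A r)" using that by simp
    have c: "snd (snd w) = fst (snd w)" using xupD(4)[OF w] xloD(3)[OF xupD(1,2)[OF w]] by simp
    then show ?thesis using fibD[OF xupD(2)[OF w]] by simp
  qed
qed (simp_all add: xlo_act_def)


section \<open>Sums and products of bispans\<close>

lemma inl_point_inj [simp]: "inl_point p = inl_point q \<longleftrightarrow> p = q"
  and inr_point_inj [simp]: "inr_point p = inr_point q \<longleftrightarrow> p = q"
  and inl_ne_inr [simp]: "inl_point p \<noteq> inr_point q" "inr_point q \<noteq> inl_point p"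
  and untag_inl [simp]: "untag_point (inl_point p) = p"
  and untag_inr [simp]: "untag_point (inr_point p) = p"
  and snd_inl [simp]: "even (snd (inl_point p))"
  and snd_inr [simp]: "odd (snd (inr_point p))"
  by (simp_all add: inl_point_def inr_point_def untag_point_def prod_eq_iff) presburger+

lemma points_disjoint_union:
  "points (disjoint_union X Y) = inl_point ` points X \<union> inr_point ` points Y"
  by (simp add: disjoint_union_def Let_def)

lemma disjoint_union_cases:
  assumes "p \<in> points (disjoint_union X Y)"
  obtains x where "x \<in> points X" "p = inl_point x" | y where "y \<in> points Y" "p = inr_point y"
  using assms by (simp add: points_disjoint_union) blast

lemma disjoint_union_mem [simp]:
  "inl_point x \<in> points (disjoint_union X Y) \<longleftrightarrow> x \<in> points X"
  "inr_point y \<in> points (disjoint_union X Y) \<longleftrightarrow> y \<in> points Y"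
  by (auto simp: points_disjoint_union image_iff)

lemma act_disjoint_union [simp]:
  "x \<in> points X \<Longrightarrow> act (disjoint_union X Y) g (inl_point x) = inl_point (act X g x)"
  "y \<in> points Y \<Longrightarrow> act (disjoint_union X Y) g (inr_point y) = inr_point (act Y g y)"
  by (simp_all add: disjoint_union_def Let_def)

lemma (in group) finite_gset_disjoint_union:
  assumes X: "finite_gset G X" and Y: "finite_gset G Y"
  shows "finite_gset G (disjoint_union X Y)"
  unfolding finite_gset_iff
proof (intro conjI)
  show "finite (points (disjoint_union X Y))"
    using gset_facts(1)[OF X] gset_facts(1)[OF Y] by (simp add: points_disjoint_union)
  show "gact G (points (disjoint_union X Y)) (act (disjoint_union X Y))"
    by (rule gactI; erule disjoint_union_cases) (simp_all add: gset_facts[OF X] gset_facts[OF Y])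
  show "\<forall>g\<in>carrier G. act (disjoint_union X Y) g \<in> extensional (points (disjoint_union X Y))"
    by (simp add: disjoint_union_def Let_def)
qed

lemma incl_app [simp]:
  "x \<in> points X \<Longrightarrow> incl_left X x = inl_point x" "y \<in> points Y \<Longrightarrow> incl_right Y y = inr_point y"
  by (simp_all add: incl_left_def incl_right_def)

lemma (in group) incl_hom:
  assumes X: "finite_gset G X" and Y: "finite_gset G Y"
  shows "incl_left X \<in> gset_hom G X (disjoint_union X Y)" "incl_right Y \<in> gset_hom G Y (disjoint_union X Y)"
  by (rule gset_homI; simp add: gset_facts[OF X] gset_facts[OF Y] incl_left_def incl_right_def)+

lemma fold_app [simp]:
  "x \<in> points X \<Longrightarrow> fold_map X (inl_point x) = x" "x \<in> points X \<Longrightarrow> fold_map X (inr_point x) = x"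
  by (simp_all add: fold_map_def)

lemma (in group) fold_hom:
  assumes X: "finite_gset G X"
  shows "fold_map X \<in> gset_hom G (disjoint_union X X) X"
proof (rule gset_homI)
  show "fold_map X \<in> extensional (points (disjoint_union X X))" by (simp add: fold_map_def)
  fix p assume p: "p \<in> points (disjoint_union X X)"
  then show "fold_map X p \<in> points X" by (rule disjoint_union_cases) simp_all
  show "fold_map X (act (disjoint_union X X) g p) = act X g (fold_map X p)" if "g \<in> carrier G" for g
    using p by (rule disjoint_union_cases) (simp_all add: that gset_facts[OF X])
qed

lemma (in group) empty_gset: "finite_gset G empty_gset" "points empty_gset = {}"
  by (simp_all add: finite_gset_iff empty_gset_def gact_def restrict_def)

lemma from_empty_hom: "from_empty \<in> gset_hom G empty_gset Y"
  by (simp add: gset_hom_def from_empty_def empty_gset_def restrict_def)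

section \<open>Pairing, sum, product, zero and one of bispans\<close>

text \<open>The morphism into the product of Y and Z with components \<beta> and \<gamma>, the
  product in the category of bispans being the disjoint union.\<close>

definition xcop :: "('g, 'c, 'b) xbispan \<Rightarrow> ('g, 'e, 'd) xbispan \<Rightarrow> ('g, 'c + 'e, 'b + 'd) xbispan" where
  "xcop \<beta> \<gamma> = \<lparr>up = up \<beta> <+> up \<gamma>, up_act = \<lambda>g. map_sum (up_act \<beta> g) (up_act \<gamma> g),
     lo = lo \<beta> <+> lo \<gamma>, lo_act = \<lambda>g. map_sum (lo_act \<beta> g) (lo_act \<gamma> g),
     rleg = case_sum (rleg \<beta>) (rleg \<gamma>), nleg = map_sum (nleg \<beta>) (nleg \<gamma>),
     tleg = case_sum (\<lambda>b. inl_point (tleg \<beta> b)) (\<lambda>b. inr_point (tleg \<gamma> b))\<rparr>"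

text \<open>The pairing followed by the transfer along the fold map, hence addition
  (\<open>ev_add\<close>).\<close>

definition xsum :: "('g, 'c, 'b) xbispan \<Rightarrow> ('g, 'e, 'd) xbispan \<Rightarrow> ('g, 'c + 'e, 'b + 'd) xbispan" where
  "xsum \<beta> \<gamma> = (xcop \<beta> \<gamma>)\<lparr>tleg := case_sum (tleg \<beta>) (tleg \<gamma>)\<rparr>"

text \<open>The pairing followed by the norm along the fold map, hence multiplication
  (\<open>ev_mult\<close>). Over two lower points with the same image the upper fibres add up, like
  exponents of monomials.\<close>

definition xprod :: "('g, 'c, 'b) xbispan \<Rightarrow> ('g, 'e, 'd) xbispan \<Rightarrow>
    ('g, ('b \<times> 'd) \<times> ('c + 'e), 'b \<times> 'd) xbispan" where
  "xprod \<beta> \<gamma> =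
    \<lparr>up = {w. fst (fst w) \<in> lo \<beta> \<and> snd (fst w) \<in> lo \<gamma> \<and> tleg \<beta> (fst (fst w)) = tleg \<gamma> (snd (fst w)) \<and>
        snd w \<in> up \<beta> <+> up \<gamma> \<and> case_sum (\<lambda>a. nleg \<beta> a = fst (fst w)) (\<lambda>a. nleg \<gamma> a = snd (fst w)) (snd w)},
     up_act = \<lambda>g w. ((lo_act \<beta> g (fst (fst w)), lo_act \<gamma> g (snd (fst w))),
        map_sum (up_act \<beta> g) (up_act \<gamma> g) (snd w)),
     lo = {b. fst b \<in> lo \<beta> \<and> snd b \<in> lo \<gamma> \<and> tleg \<beta> (fst b) = tleg \<gamma> (snd b)},
     lo_act = \<lambda>g b. (lo_act \<beta> g (fst b), lo_act \<gamma> g (snd b)),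
     rleg = \<lambda>w. case_sum (rleg \<beta>) (rleg \<gamma>) (snd w), nleg = fst, tleg = \<lambda>b. tleg \<beta> (fst b)\<rparr>"

lemma xcop_simps [simp]:
  "up (xcop \<beta> \<gamma>) = up \<beta> <+> up \<gamma>" "up_act (xcop \<beta> \<gamma>) g = map_sum (up_act \<beta> g) (up_act \<gamma> g)"
  "lo (xcop \<beta> \<gamma>) = lo \<beta> <+> lo \<gamma>" "lo_act (xcop \<beta> \<gamma>) g = map_sum (lo_act \<beta> g) (lo_act \<gamma> g)"
  "rleg (xcop \<beta> \<gamma>) = case_sum (rleg \<beta>) (rleg \<gamma>)" "nleg (xcop \<beta> \<gamma>) = map_sum (nleg \<beta>) (nleg \<gamma>)"
  "tleg (xcop \<beta> \<gamma>) = case_sum (\<lambda>b. inl_point (tleg \<beta> b)) (\<lambda>b. inr_point (tleg \<gamma> b))"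
  by (simp_all add: xcop_def)

lemma xsum_simps [simp]:
  "up (xsum \<beta> \<gamma>) = up \<beta> <+> up \<gamma>" "up_act (xsum \<beta> \<gamma>) g = map_sum (up_act \<beta> g) (up_act \<gamma> g)"
  "lo (xsum \<beta> \<gamma>) = lo \<beta> <+> lo \<gamma>" "lo_act (xsum \<beta> \<gamma>) g = map_sum (lo_act \<beta> g) (lo_act \<gamma> g)"
  "rleg (xsum \<beta> \<gamma>) = case_sum (rleg \<beta>) (rleg \<gamma>)" "nleg (xsum \<beta> \<gamma>) = map_sum (nleg \<beta>) (nleg \<gamma>)"
  "tleg (xsum \<beta> \<gamma>) = case_sum (tleg \<beta>) (tleg \<gamma>)"
  by (simp_all add: xsum_def)

lemma xprod_simps [simp]:
  "up (xprod \<beta> \<gamma>) = {w. fst (fst w) \<in> lo \<beta> \<and> snd (fst w) \<in> lo \<gamma> \<and> tleg \<beta> (fst (fst w)) = tleg \<gamma> (snd (fst w)) \<and>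
        snd w \<in> up \<beta> <+> up \<gamma> \<and> case_sum (\<lambda>a. nleg \<beta> a = fst (fst w)) (\<lambda>a. nleg \<gamma> a = snd (fst w)) (snd w)}"
  "up_act (xprod \<beta> \<gamma>) = (\<lambda>g w. ((lo_act \<beta> g (fst (fst w)), lo_act \<gamma> g (snd (fst w))),
        map_sum (up_act \<beta> g) (up_act \<gamma> g) (snd w)))"
  "lo (xprod \<beta> \<gamma>) = {b. fst b \<in> lo \<beta> \<and> snd b \<in> lo \<gamma> \<and> tleg \<beta> (fst b) = tleg \<gamma> (snd b)}"
  "lo_act (xprod \<beta> \<gamma>) = (\<lambda>g b. (lo_act \<beta> g (fst b), lo_act \<gamma> g (snd b)))"
  "rleg (xprod \<beta> \<gamma>) = (\<lambda>w. case_sum (rleg \<beta>) (rleg \<gamma>) (snd w))" "nleg (xprod \<beta> \<gamma>) = fst"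
  "tleg (xprod \<beta> \<gamma>) = (\<lambda>b. tleg \<beta> (fst b))"
  by (simp_all add: xprod_def)

lemma (in group) xcop_xbispans:
  assumes \<beta>: "\<beta> \<in> xbispans G X Y" and \<gamma>: "\<gamma> \<in> xbispans G X Z"
  shows "xcop \<beta> \<gamma> \<in> xbispans G X (disjoint_union Y Z)"
proof -
  note F = xbispan_facts[OF \<beta>] xbispan_facts[OF \<gamma>]
  note D = xbispansD[OF \<beta>] and D' = xbispansD[OF \<gamma>]
  show ?thesis
    by (rule xbispansI)
      (use D(1-4) D'(2-4) finite_gset_disjoint_union[OF D(2) D'(2)] in
        \<open>auto simp: gact_def gmap_def F elim!: PlusE\<close>)
qed

lemma (in group) xsum_xbispans:
  assumes \<beta>: "\<beta> \<in> xbispans G X Y" and \<gamma>: "\<gamma> \<in> xbispans G X Y"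
  shows "xsum \<beta> \<gamma> \<in> xbispans G X Y"
proof -
  note F = xbispan_facts[OF \<beta>] xbispan_facts[OF \<gamma>]
  note D = xbispansD[OF \<beta>] and D' = xbispansD[OF \<gamma>]
  show ?thesis
    by (rule xbispansI)
      (use D(1-4) D'(3-4) in \<open>auto simp: gact_def gmap_def F elim!: PlusE\<close>)
qed

lemma (in group) xcop_left:
  assumes \<beta>: "\<beta> \<in> xbispans G X Y" and \<gamma>: "\<gamma> \<in> xbispans G X Z"
  shows "xiso G (xpull Y (incl_left Y) (xcop \<beta> \<gamma>)) \<beta>" (is "xiso G ?P _")
proof -
  note F = xbispan_facts[OF \<beta>]
  have U: "\<exists>a\<in>up \<beta>. w = (tleg \<beta> (nleg \<beta> a), Inl a)" if "w \<in> up ?P" for w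
    using that by (cases w; cases "snd w") auto
  have L: "\<exists>a\<in>lo \<beta>. w = (tleg \<beta> a, Inl a)" if "w \<in> lo ?P" for w
    using that by (cases w; cases "snd w") auto
  have U': "(tleg \<beta> (nleg \<beta> a), Inl a) \<in> up ?P" if "a \<in> up \<beta>" for a
    using that F(2,3) by (simp add: InlI InrI)
  have L': "(tleg \<beta> a, Inl a) \<in> lo ?P" if "a \<in> lo \<beta>" for a
    using that F(3) by (simp add: InlI InrI)
  show ?thesis
  proof (rule xisoI[where a = "\<lambda>w. projl (snd w)" and b = "\<lambda>w. projl (snd w)"
        and a' = "\<lambda>a. (tleg \<beta> (nleg \<beta> a), Inl a)" and b' = "\<lambda>b. (tleg \<beta> b, Inl b)"])
    fix w assume w: "w \<in> up ?P"
    show "projl (snd w) \<in> up \<beta> \<and> (tleg \<beta> (nleg \<beta> (projl (snd w))), Inl (projl (snd w))) = w"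
      "rleg \<beta> (projl (snd w)) = rleg ?P w" "nleg \<beta> (projl (snd w)) = projl (snd (nleg ?P w))"
      using U[OF w] by (elim bexE, simp)+
    show "projl (snd (up_act ?P g w)) = up_act \<beta> g (projl (snd w))" for g
      using U[OF w] by (elim bexE, simp)
  next
    fix w assume w: "w \<in> lo ?P"
    show "projl (snd w) \<in> lo \<beta> \<and> (tleg \<beta> (projl (snd w)), Inl (projl (snd w))) = w"
      "tleg \<beta> (projl (snd w)) = tleg ?P w"
      using L[OF w] by (elim bexE, simp)+
    show "projl (snd (lo_act ?P g w)) = lo_act \<beta> g (projl (snd w))" for g
      using L[OF w] by (elim bexE, simp)
  qed (use U' L' in simp_all)
qed

lemma (in group) xcop_right:
  assumes \<beta>: "\<beta> \<in> xbispans G X Y" and \<gamma>: "\<gamma> \<in> xbispans G X Z"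
  shows "xiso G (xpull Z (incl_right Z) (xcop \<beta> \<gamma>)) \<gamma>" (is "xiso G ?P _")
proof -
  note F = xbispan_facts[OF \<gamma>]
  have U: "\<exists>a\<in>up \<gamma>. w = (tleg \<gamma> (nleg \<gamma> a), Inr a)" if "w \<in> up ?P" for w
    using that by (cases w; cases "snd w") auto
  have L: "\<exists>a\<in>lo \<gamma>. w = (tleg \<gamma> a, Inr a)" if "w \<in> lo ?P" for w
    using that by (cases w; cases "snd w") auto
  have U': "(tleg \<gamma> (nleg \<gamma> a), Inr a) \<in> up ?P" if "a \<in> up \<gamma>" for a
    using that F(2,3) by (simp add: InlI InrI)
  have L': "(tleg \<gamma> a, Inr a) \<in> lo ?P" if "a \<in> lo \<gamma>" for a
    using that F(3) by (simp add: InlI InrI)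
  show ?thesis
  proof (rule xisoI[where a = "\<lambda>w. projr (snd w)" and b = "\<lambda>w. projr (snd w)"
        and a' = "\<lambda>a. (tleg \<gamma> (nleg \<gamma> a), Inr a)" and b' = "\<lambda>b. (tleg \<gamma> b, Inr b)"])
    fix w assume w: "w \<in> up ?P"
    show "projr (snd w) \<in> up \<gamma> \<and> (tleg \<gamma> (nleg \<gamma> (projr (snd w))), Inr (projr (snd w))) = w"
      "rleg \<gamma> (projr (snd w)) = rleg ?P w" "nleg \<gamma> (projr (snd w)) = projr (snd (nleg ?P w))"
      using U[OF w] by (elim bexE, simp)+
    show "projr (snd (up_act ?P g w)) = up_act \<gamma> g (projr (snd w))" for g
      using U[OF w] by (elim bexE, simp)
  next
    fix w assume w: "w \<in> lo ?P"
    show "projr (snd w) \<in> lo \<gamma> \<and> (tleg \<gamma> (projr (snd w)), Inr (projr (snd w))) = w"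
      "tleg \<gamma> (projr (snd w)) = tleg ?P w"
      using L[OF w] by (elim bexE, simp)+
    show "projr (snd (lo_act ?P g w)) = lo_act \<gamma> g (projr (snd w))" for g
      using L[OF w] by (elim bexE, simp)
  qed (use U' L' in simp_all)
qed

lemma (in group) xcop_fold:
  assumes \<beta>: "\<beta> \<in> xbispans G X Y" and \<gamma>: "\<gamma> \<in> xbispans G X Y"
  shows "xiso G (xtrans (fold_map Y) (xcop \<beta> \<gamma>)) (xsum \<beta> \<gamma>)"
  by (rule xisoI[where a = id and b = id and a' = id and b' = id])
    (auto simp: xbispan_facts[OF \<beta>] xbispan_facts[OF \<gamma>] elim!: PlusE)

text \<open>The fibre of the fold map at y consists of the two copies of y, so a lift is a pair of
  lower points over y, one from each summand. The parity of the tag tells the copies apart.\<close>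

lemma (in group) xcop_norm:
  assumes \<beta>: "\<beta> \<in> xbispans G X Y" and \<gamma>: "\<gamma> \<in> xbispans G X Y"
  shows "xiso G (xcomp G (xN (disjoint_union Y Y) Y (fold_map Y)) (xcop \<beta> \<gamma>)) (xprod \<beta> \<gamma>)"
    (is "xiso G (xcomp G ?N ?C) ?P")
proof (rule xisoI)
  note F = xbispan_facts[OF \<beta>] and F' = xbispan_facts[OF \<gamma>]
  note Y = xbispansD(2)[OF \<beta>]
  have N: "?N \<in> xbispans G (disjoint_union Y Y) Y"
    by (rule xTNR_xbispans[OF finite_gset_disjoint_union[OF Y Y] Y fold_hom[OF Y]])
  have fib: "xfib ?N y = {inl_point y, inr_point y}" if "y \<in> points Y" for y
  proof -
    have "c \<in> xfib ?N y \<longleftrightarrow> c \<in> {inl_point y, inr_point y}" for c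
    proof
      assume "c \<in> xfib ?N y"
      then have "c \<in> points (disjoint_union Y Y)" "fold_map Y c = y" by (simp_all add: xfib_def)
      then show "c \<in> {inl_point y, inr_point y}" by (elim disjoint_union_cases) simp_all
    next
      assume "c \<in> {inl_point y, inr_point y}"
      then consider "c = inl_point y" | "c = inr_point y" by blast
      then show "c \<in> xfib ?N y" using that by cases (simp_all add: xfib_def)
    qed
    then show ?thesis by blast
  qed
  let ?B = "\<lambda>y. (projl (snd y (inl_point (fst y))), projr (snd y (inr_point (fst y))))"
  let ?B' = "\<lambda>b. (tleg \<beta> (fst b), \<lambda>c\<in>xfib ?N (tleg \<beta> (fst b)). if even (snd c) then Inl (fst b) else Inr (snd b))"
  let ?A = "\<lambda>w. (?B (fst w), snd (snd w))"
  let ?A' = "\<lambda>w. (?B' (fst w), case_sum (\<lambda>_. inl_point (tleg \<beta> (fst (fst w)))) (\<lambda>_. inr_point (tleg \<beta> (fst (fst w)))) (snd w), snd w)"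
  have B: "fst y \<in> points Y" "snd y (inl_point (fst y)) = Inl (fst (?B y))"
     "snd y (inr_point (fst y)) = Inr (snd (?B y))" "fst (?B y) \<in> lo \<beta>" "snd (?B y) \<in> lo \<gamma>"
     "tleg \<beta> (fst (?B y)) = fst y" "tleg \<gamma> (snd (?B y)) = fst y" "?B' (?B y) = y"
    if y: "y \<in> xlo ?N ?C" for y
  proof -
    show 1: "fst y \<in> points Y" using xloD(1)[OF y] by simp
    have L: "snd y (inl_point (fst y)) \<in> lo \<beta> <+> lo \<gamma>" "tleg ?C (snd y (inl_point (fst y))) = inl_point (fst y)"
      and R: "snd y (inr_point (fst y)) \<in> lo \<beta> <+> lo \<gamma>" "tleg ?C (snd y (inr_point (fst y))) = inr_point (fst y)"
      using xloD(3)[OF y] by (simp_all add: fib[OF 1])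
    show l: "snd y (inl_point (fst y)) = Inl (fst (?B y))" "fst (?B y) \<in> lo \<beta>" "tleg \<beta> (fst (?B y)) = fst y"
      using L by (cases "snd y (inl_point (fst y))"; auto)+
    show r: "snd y (inr_point (fst y)) = Inr (snd (?B y))" "snd (?B y) \<in> lo \<gamma>" "tleg \<gamma> (snd (?B y)) = fst y"
      using R by (cases "snd y (inr_point (fst y))"; auto)+
    show "?B' (?B y) = y"
    proof (rule prod_eqI)
      show "snd (?B' (?B y)) = snd y"
        by (rule extensionalityI[where A = "xfib ?N (fst y)"])
          (use xloD(2)[OF y] l r in \<open>auto simp: fib[OF 1]\<close>)
    qed (use l in simp)
  qed
  show "?B y \<in> lo ?P \<and> ?B' (?B y) = y" if "y \<in> lo (xcomp G ?N ?C)" for y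
    using B[of y] that by simp
  have B': "?B' b \<in> xlo ?N ?C" "?B (?B' b) = b" if b: "b \<in> lo ?P" for b
  proof -
    have t: "tleg \<beta> (fst b) \<in> points Y" "tleg \<gamma> (snd b) = tleg \<beta> (fst b)"
      using b F(3)[of "fst b"] by simp_all
    show "?B' b \<in> xlo ?N ?C" by (rule xloI) (use b t in \<open>auto simp: fib\<close>)
    show "?B (?B' b) = b" using t by (simp add: fib)
  qed
  show "?B' b \<in> lo (xcomp G ?N ?C) \<and> ?B (?B' b) = b" if "b \<in> lo ?P" for b using B'[OF that] by simp
  show "?A w \<in> up ?P \<and> ?A' (?A w) = w" if "w \<in> up (xcomp G ?N ?C)" for w
  proof -
    have w: "w \<in> xup ?N ?C" using that by simp
    note y = xupD(1)[OF w]
    note BB = B[OF y]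
    have c: "fst (snd w) = inl_point (fst (fst w)) \<or> fst (snd w) = inr_point (fst (fst w))"
      using xupD(2)[OF w] by (simp add: fib[OF BB(1)])
    have a: "snd (snd w) \<in> up \<beta> <+> up \<gamma>" "nleg ?C (snd (snd w)) = snd (fst w) (fst (snd w))"
      using xupD(3,4)[OF w] by simp_all
    have h: "fst (snd w) = case_sum (\<lambda>_. inl_point (fst (fst w))) (\<lambda>_. inr_point (fst (fst w))) (snd (snd w)) \<and>
        case_sum (\<lambda>a. nleg \<beta> a = fst (?B (fst w))) (\<lambda>a. nleg \<gamma> a = snd (?B (fst w))) (snd (snd w))"
    proof -
      obtain u v where u: "snd (fst w) (inl_point (fst (fst w))) = Inl u"
        and v: "snd (fst w) (inr_point (fst (fst w))) = Inr v"
        using BB(2,3) by blast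
      show ?thesis using c a(2) by (cases "snd (snd w)") (auto simp: u v)
    qed
    then have "?A w \<in> up ?P" and "?A' (?A w) = w"
      subgoal using BB(4-7) a(1) by (cases "snd (snd w)") simp_all
      subgoal using BB(6,8) h by (intro triple_eqI; cases "snd (snd w)") (simp_all cong: if_cong)
      done
    then show ?thesis by blast
  qed
  show "?A' w \<in> up (xcomp G ?N ?C) \<and> ?A (?A' w) = w" if w: "w \<in> up ?P" for w
  proof -
    have b: "fst w \<in> lo ?P" using w by simp
    have t: "tleg \<beta> (fst (fst w)) \<in> points Y" using b F(3)[of "fst (fst w)"] by simp
    have "?A' w \<in> xup ?N ?C"
      by (rule xupI[OF B'(1)[OF b]]; cases "snd w") (use w t in \<open>auto simp: fib\<close>)
    moreover have "?A (?A' w) = w" using B'(2)[OF b] by (simp add: prod_eq_iff)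
    ultimately show ?thesis by simp
  qed
  show bact: "?B (lo_act (xcomp G ?N ?C) g y) = lo_act ?P g (?B y)"
    if g: "g \<in> carrier G" and y: "y \<in> lo (xcomp G ?N ?C)" for g y
  proof -
    have y: "y \<in> xlo ?N ?C" using y by simp
    note BB = B[OF y]
    have "inl_point (fst y) \<in> xfib ?N (fst y)" "inr_point (fst y) \<in> xfib ?N (fst y)"
      using fib[OF BB(1)] by auto
    note this[THEN xlo_act_app[OF N g y]]
    moreover obtain u v where "snd y (inl_point (fst y)) = Inl u" "snd y (inr_point (fst y)) = Inr v"
      using BB(2,3) by blast
    moreover have "fst (xlo_act G ?N ?C g y) = act Y g (fst y)" by (simp add: xlo_act_def)
    ultimately show ?thesis using BB(1) by simp
  qed
  show "?A (up_act (xcomp G ?N ?C) g w) = up_act ?P g (?A w)"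
    if g: "g \<in> carrier G" and w: "w \<in> up (xcomp G ?N ?C)" for g w
    using bact[OF g, of "fst w"] xupD(1)[of w ?N ?C] w by simp
  show "tleg ?P (?B y) = tleg (xcomp G ?N ?C) y" if "y \<in> lo (xcomp G ?N ?C)" for y
    using that B(6)[of y] by simp
qed simp_all

lemma (in group) xprod_xbispans:
  assumes \<beta>: "\<beta> \<in> xbispans G X Y" and \<gamma>: "\<gamma> \<in> xbispans G X Y"
  shows "xprod \<beta> \<gamma> \<in> xbispans G X Y"
proof -
  note F = xbispan_facts[OF \<beta>] and F' = xbispan_facts[OF \<gamma>]
  note D = xbispansD[OF \<beta>] and D' = xbispansD[OF \<gamma>]
  have "lo (xprod \<beta> \<gamma>) \<subseteq> lo \<beta> \<times> lo \<gamma>" by auto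
  then have 1: "finite (lo (xprod \<beta> \<gamma>))" by (rule finite_subset) (use D(4) D'(4) in auto)
  have "up (xprod \<beta> \<gamma>) \<subseteq> (lo \<beta> \<times> lo \<gamma>) \<times> (up \<beta> <+> up \<gamma>)" by auto
  then have 2: "finite (up (xprod \<beta> \<gamma>))" by (rule finite_subset) (use D(3,4) D'(3,4) in auto)
  have fst: "fst w \<in> lo (xprod \<beta> \<gamma>)" if "w \<in> up (xprod \<beta> \<gamma>)" for w using that by simp
  show ?thesis
    by (rule xbispansI[OF D(1,2) 2 1]) (auto simp: gact_def gmap_def F F' elim!: PlusE)
qed

definition xempty :: "('g, unit, unit) xbispan" where
  "xempty = \<lparr>up = {}, up_act = \<lambda>_. id, lo = {}, lo_act = \<lambda>_. id,
     rleg = \<lambda>_. undefined, nleg = \<lambda>_. undefined, tleg = \<lambda>_. undefined\<rparr>"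

text \<open>The multiplicative unit: over each point of Y a single term, the empty product.\<close>

definition xone :: "'g gset \<Rightarrow> ('g, unit, 'g point) xbispan" where
  "xone Y = \<lparr>up = {}, up_act = \<lambda>_. id, lo = points Y, lo_act = act Y,
     rleg = \<lambda>_. undefined, nleg = \<lambda>_. undefined, tleg = \<lambda>y. y\<rparr>"

lemma xempty_simps [simp]: "up xempty = {}" "lo xempty = {}"
  by (simp_all add: xempty_def)

lemma xone_simps [simp]: "up (xone Y) = {}" "lo (xone Y) = points Y" "lo_act (xone Y) = act Y"
    "tleg (xone Y) = (\<lambda>y. y)"
  by (simp_all add: xone_def)

lemma (in group) xempty_xbispans:
  "\<lbrakk>finite_gset G X; finite_gset G Y\<rbrakk> \<Longrightarrow> xempty \<in> xbispans G X Y"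
  by (rule xbispansI) (simp_all add: gact_def gmap_def)

lemma (in group) xone_xbispans:
  "\<lbrakk>finite_gset G X; finite_gset G Y\<rbrakk> \<Longrightarrow> xone Y \<in> xbispans G X Y"
  by (rule xbispansI) (simp_all add: gact_def gmap_def gset_facts)

lemma xiso_empty: "\<lbrakk>up \<beta> = {}; lo \<beta> = {}; up \<gamma> = {}; lo \<gamma> = {}\<rbrakk> \<Longrightarrow> xiso G \<beta> \<gamma>"
  by (rule xisoI) simp_all

lemma (in group) xcomp_one:
  assumes Y: "finite_gset G Y"
  shows "xiso G (xcomp G (xN empty_gset Y from_empty) xempty) (xone Y)"
proof (rule xisoI[where b = fst and b' = "\<lambda>y. (y, \<lambda>c. undefined)" and a = undefined and a' = undefined])
  have fib: "xfib (xN empty_gset Y from_empty) y = {}" for y by (simp add: xfib_def empty_gset)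
  show "fst y \<in> lo (xone Y) \<and> (fst y, \<lambda>c. undefined) = y"
    if "y \<in> lo (xcomp G (xN empty_gset Y from_empty) xempty)" for y
    using that xloD[of y "xN empty_gset Y from_empty" xempty] by (simp add: fib prod_eq_iff)
  show "(y, \<lambda>c. undefined) \<in> lo (xcomp G (xN empty_gset Y from_empty) xempty) \<and> fst (y, \<lambda>c. undefined) = y"
    if "y \<in> lo (xone Y)" for y
    unfolding xcomp_simps by (intro conjI xloI) (use that in \<open>simp_all add: fib\<close>)
qed (simp_all add: xup_def xlo_act_def)

section \<open>Identities in a Tambara functor\<close>

lemma (in group) xtrans_xbispans:
  assumes "\<beta> \<in> xbispans G X Y" "finite_gset G Z" "f \<in> gset_hom G Y Z"
  shows "xtrans f \<beta> \<in> xbispans G X Z"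
  by (rule xbispansI)
    (use xbispansD[OF assms(1)] assms(2) hom_facts[OF assms(3)] xbispan_facts[OF assms(1)] in
      \<open>simp_all add: gmap_def\<close>)

lemma (in group) xpull_xbispans:
  assumes \<beta>: "\<beta> \<in> xbispans G X Y" and W: "finite_gset G W" and h: "h \<in> gset_hom G W Y"
  shows "xpull W h \<beta> \<in> xbispans G X W"
proof -
  note F = xbispan_facts[OF \<beta>] hom_facts[OF h] gset_facts[OF W]
  have "lo (xpull W h \<beta>) \<subseteq> points W \<times> lo \<beta>" "up (xpull W h \<beta>) \<subseteq> points W \<times> up \<beta>"
    by (simp_all add: subset_iff mem_Times_iff)
  then have "finite (lo (xpull W h \<beta>))" "finite (up (xpull W h \<beta>))"
    using xbispansD(3,4)[OF \<beta>] gset_facts(1)[OF W] finite_subset by blast+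
  then show ?thesis
    by (intro xbispansI) (simp_all add: xbispansD(1)[OF \<beta>] W gact_def gmap_def F)
qed

definition subgset :: "'g gset \<Rightarrow> ('g point \<Rightarrow> bool) \<Rightarrow> 'g gset" where
  "subgset X Q = \<lparr>points = {x \<in> points X. Q x}, act = \<lambda>g. restrict (act X g) {x \<in> points X. Q x}\<rparr>"

lemma subgset_simps [simp]:
  "points (subgset X Q) = {x \<in> points X. Q x}"
  "\<lbrakk>x \<in> points X; Q x\<rbrakk> \<Longrightarrow> act (subgset X Q) g x = act X g x"
  by (simp_all add: subgset_def)

lemma (in group) finite_gset_subgset:
  assumes "finite_gset G X" "\<And>g x. \<lbrakk>g \<in> carrier G; x \<in> points X; Q x\<rbrakk> \<Longrightarrow> Q (act X g x)"
  shows "finite_gset G (subgset X Q)"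
  unfolding finite_gset_iff
  by (auto simp: gset_facts[OF assms(1)] assms(2) gact_def) (simp add: subgset_def)

lemma (in group) subgset_hom:
  assumes "finite_gset G X" "f \<in> gset_hom G X Y"
    and "\<And>g x. \<lbrakk>g \<in> carrier G; x \<in> points X; Q x\<rbrakk> \<Longrightarrow> Q (act X g x)"
  shows "restrict f (points (subgset X Q)) \<in> gset_hom G (subgset X Q) Y"
  by (rule gset_homI) (simp_all add: hom_facts[OF assms(2)] gset_facts[OF assms(1)] assms(3))

definition xrestr :: "('b \<Rightarrow> bool) \<Rightarrow> ('g, 'c, 'b) xbispan \<Rightarrow> ('g, 'c, 'b) xbispan" where
  "xrestr P \<beta> = \<beta>\<lparr>up := {a \<in> up \<beta>. P (nleg \<beta> a)}, lo := {b \<in> lo \<beta>. P b}\<rparr>"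

lemma xrestr_simps [simp]:
  "up (xrestr P \<beta>) = {a \<in> up \<beta>. P (nleg \<beta> a)}" "lo (xrestr P \<beta>) = {b \<in> lo \<beta>. P b}"
  "up_act (xrestr P \<beta>) = up_act \<beta>" "lo_act (xrestr P \<beta>) = lo_act \<beta>" "rleg (xrestr P \<beta>) = rleg \<beta>"
  "nleg (xrestr P \<beta>) = nleg \<beta>" "tleg (xrestr P \<beta>) = tleg \<beta>"
  by (simp_all add: xrestr_def)

lemma (in group) xrestr_xbispans:
  assumes \<beta>: "\<beta> \<in> xbispans G X Y"
    and P: "\<And>g b. \<lbrakk>g \<in> carrier G; b \<in> lo \<beta>; P b\<rbrakk> \<Longrightarrow> P (lo_act \<beta> g b)"
  shows "xrestr P \<beta> \<in> xbispans G X Y"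
  by (rule xbispansI) (simp_all add: xbispansD(1-4)[OF \<beta>] gact_def gmap_def xbispan_facts[OF \<beta>] P)

section \<open>Evaluation of bispans in a Tambara functor\<close>

locale tambara = group G for G (structure) +
  fixes F
  assumes tf: "tambara_functor G F"
begin

text \<open>Reads \<beta> as a polynomial operation evaluated at a: lower points are terms, the
  upper points above one of them are its factors.\<close>

definition ev where
  "ev X Y \<beta> a = farr F (xclass G X Y \<beta>) a"

abbreviation "L X \<equiv> level_ring G F X"

lemma is_functor: "is_functor G F" and prods: "product_preserving G F"
  and cring_L: "finite_gset G X \<Longrightarrow> cring (L X)"
  using tf by (auto simp: tambara_functor_def)

lemma farr_in: "\<lbrakk>finite_gset G X; finite_gset G Y; \<alpha> \<in> pg_hom G X Y; a \<in> fobj F X\<rbrakk> \<Longrightarrow> farr F \<alpha> a \<in> fobj F Y"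
  by (rule funcset_mem[of "farr F \<alpha>" "fobj F X"]) (use is_functor in \<open>unfold is_functor_def, blast\<close>)

lemma ev_in: "\<lbrakk>\<beta> \<in> xbispans G X Y; a \<in> fobj F X\<rbrakk> \<Longrightarrow> ev X Y \<beta> a \<in> fobj F Y"
  unfolding ev_def by (rule farr_in[OF _ _ xclass_pg_hom]) (auto dest: xbispansD)

lemma ev_cong: "\<lbrakk>xiso G \<beta> \<gamma>; \<beta> \<in> xbispans G X Y\<rbrakk> \<Longrightarrow> ev X Y \<beta> a = ev X Y \<gamma> a"
  unfolding ev_def by (simp add: xclass_cong)

lemma ev_comp:
  assumes "\<beta> \<in> xbispans G X Y" "\<gamma> \<in> xbispans G Y Z" "a \<in> fobj F X"
  shows "ev Y Z \<gamma> (ev X Y \<beta> a) = ev X Z (xcomp G \<gamma> \<beta>) a"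
proof -
  have "farr F (pg_comp G (xclass G Y Z \<gamma>) (xclass G X Y \<beta>)) a =
      farr F (xclass G Y Z \<gamma>) (farr F (xclass G X Y \<beta>) a)"
    using is_functor xclass_pg_hom[OF assms(1)] xclass_pg_hom[OF assms(2)] assms(3)
      xbispansD(1,2)[OF assms(1)] xbispansD(2)[OF assms(2)]
    unfolding is_functor_def by blast
  then show ?thesis by (simp add: ev_def pg_comp_xclass[OF assms(1,2)])
qed

lemma farr_ev:
  assumes "\<alpha> \<in> pg_hom G X Y"
  obtains S where "S \<in> bispans G X Y" "\<And>a. farr F \<alpha> a = ev X Y (of_bispan S) a"
proof -
  obtain S where "S \<in> bispans G X Y" "\<alpha> = xclass G X Y (of_bispan S)" by (rule pg_hom_E[OF assms])
  then show thesis using that by (simp add: ev_def)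
qed

lemma ev_T:
  assumes \<beta>: "\<beta> \<in> xbispans G X Y" and Z: "finite_gset G Z" and f: "f \<in> gset_hom G Y Z" and a: "a \<in> fobj F X"
  shows "farr F (pg_T G Y Z f) (ev X Y \<beta> a) = ev X Z (xtrans f \<beta>) a"
proof -
  note Y = xbispansD(2)[OF \<beta>]
  have T: "xT Y f \<in> xbispans G Y Z" by (rule xTNR_xbispans[OF Y Z f])
  have "farr F (pg_T G Y Z f) (ev X Y \<beta> a) = ev X Z (xcomp G (xT Y f) \<beta>) a"
    using ev_comp[OF \<beta> T a] by (simp add: pg_T_eq[OF Y Z f] ev_def)
  also have "\<dots> = ev X Z (xtrans f \<beta>) a"
    by (rule ev_cong[OF xcomp_T[OF \<beta> Z f] xcomp_xbispans[OF \<beta> T]])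
  finally show ?thesis .
qed

lemma ev_R:
  assumes \<beta>: "\<beta> \<in> xbispans G X Y" and W: "finite_gset G W" and h: "h \<in> gset_hom G W Y" and a: "a \<in> fobj F X"
  shows "farr F (pg_R G W Y h) (ev X Y \<beta> a) = ev X W (xpull W h \<beta>) a"
proof -
  note Y = xbispansD(2)[OF \<beta>]
  have R: "xR W h \<in> xbispans G Y W" by (rule xTNR_xbispans[OF W Y h])
  have "farr F (pg_R G W Y h) (ev X Y \<beta> a) = ev X W (xcomp G (xR W h) \<beta>) a"
    using ev_comp[OF \<beta> R a] by (simp add: pg_R_eq[OF W Y h] ev_def)
  also have "\<dots> = ev X W (xpull W h \<beta>) a"
    by (rule ev_cong[OF xcomp_R[OF \<beta> W h] xcomp_xbispans[OF \<beta> R]])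
  finally show ?thesis .
qed

lemma ev_N:
  assumes \<beta>: "\<beta> \<in> xbispans G X Y" and Z: "finite_gset G Z" and f: "f \<in> gset_hom G Y Z" and a: "a \<in> fobj F X"
  shows "farr F (pg_N G Y Z f) (ev X Y \<beta> a) = ev X Z (xcomp G (xN Y Z f) \<beta>) a"
proof -
  note Y = xbispansD(2)[OF \<beta>]
  have N: "xN Y Z f \<in> xbispans G Y Z" by (rule xTNR_xbispans[OF Y Z f])
  show ?thesis using ev_comp[OF \<beta> N a] by (simp add: pg_N_eq[OF Y Z f] ev_def)
qed

lemma farr_R:
  assumes "finite_gset G W" "finite_gset G Y" "h \<in> gset_hom G W Y"
  shows "farr F (pg_R G W Y h) a = ev Y W (xR W h) a"
  by (simp add: ev_def pg_R_eq[OF assms])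

lemma farr_T:
  assumes "finite_gset G W" "finite_gset G Y" "h \<in> gset_hom G W Y"
  shows "farr F (pg_T G W Y h) a = ev W Y (xT W h) a"
  by (simp add: ev_def pg_T_eq[OF assms])

lemma farr_N:
  assumes "finite_gset G W" "finite_gset G Y" "h \<in> gset_hom G W Y"
  shows "farr F (pg_N G W Y h) a = ev W Y (xN W Y h) a"
  by (simp add: ev_def pg_N_eq[OF assms])

lemma farr_TNR_in:
  assumes "finite_gset G X" "finite_gset G Y" "f \<in> gset_hom G X Y"
  shows "a \<in> fobj F X \<Longrightarrow> farr F (pg_T G X Y f) a \<in> fobj F Y"
    "a \<in> fobj F X \<Longrightarrow> farr F (pg_N G X Y f) a \<in> fobj F Y"
    "b \<in> fobj F Y \<Longrightarrow> farr F (pg_R G X Y f) b \<in> fobj F X"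
  using xTNR_xbispans[OF assms] by (simp_all add: farr_R farr_T farr_N assms ev_in)

lemma ev_NR:
  assumes X: "finite_gset G X" and A: "finite_gset G A" and B: "finite_gset G B"
    and r: "r \<in> gset_hom G A X" and n: "n \<in> gset_hom G A B" and a: "a \<in> fobj F X"
  shows "farr F (pg_N G A B n) (farr F (pg_R G A X r) a) = ev X B (xres_norm A B r n) a"
proof -
  have R: "xR A r \<in> xbispans G X A" by (rule xTNR_xbispans[OF A X r])
  have N: "xN A B n \<in> xbispans G A B" by (rule xTNR_xbispans[OF A B n])
  have "farr F (pg_N G A B n) (farr F (pg_R G A X r) a) = ev X B (xcomp G (xN A B n) (xR A r)) a"
    using ev_N[OF R B n a] by (simp add: farr_R[OF A X r])
  also have "\<dots> = ev X B (xres_norm A B r n) a"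
    by (rule ev_cong[OF xcomp_NR[OF X A B r n] xcomp_xbispans[OF R N]])
  finally show ?thesis .
qed

text \<open>Closure of a subset under all morphisms can thereby be checked for restrictions, norms
  and transfers separately.\<close>

lemma ev_TNR:
  assumes S: "S \<in> bispans G X Y" and a: "a \<in> fobj F X"
  shows "ev X Y (of_bispan S) a =
    farr F (pg_T G (top2 S) Y (tr_leg S))
      (farr F (pg_N G (top1 S) (top2 S) (nm_leg S)) (farr F (pg_R G (top1 S) X (res_leg S)) a))"
proof -
  note B = bispansD(3-9)[OF S]
  have NR: "xres_norm (top1 S) (top2 S) (res_leg S) (nm_leg S) \<in> xbispans G X (top2 S)"
    by (rule xres_norm_xbispans[OF B(1,2,3,5,6)])
  have "xiso G (xtrans (tr_leg S) (xres_norm (top1 S) (top2 S) (res_leg S) (nm_leg S))) (of_bispan S)"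
    by (rule xisoI[where a = id and b = id and a' = id and b' = id]) simp_all
  from ev_cong[OF this xtrans_xbispans[OF NR B(4,7)]] show ?thesis
    by (simp add: ev_NR[OF B(1,2,3,5,6) a] ev_T[OF NR B(4,7) a])
qed

lemma R_comp:
  assumes W: "finite_gset G W" and X: "finite_gset G X" and Y: "finite_gset G Y"
    and r: "r \<in> gset_hom G W X" and h: "h \<in> gset_hom G X Y" and a: "a \<in> fobj F Y"
  shows "farr F (pg_R G W X r) (farr F (pg_R G X Y h) a) = farr F (pg_R G W Y (gset_comp W h r)) a"
proof -
  have hr: "gset_comp W h r \<in> gset_hom G W Y" by (rule gset_comp_hom[OF W r h])
  have R: "xR X h \<in> xbispans G Y X" by (rule xTNR_xbispans[OF X Y h])
  have "xiso G (xR W (gset_comp W h r)) (xpull W r (xR X h))"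
    by (rule xisoI[where a = "\<lambda>w. (w, r w)" and b = "\<lambda>w. (w, r w)" and a' = fst and b' = fst])
      (simp_all add: hom_facts[OF r] gset_facts[OF W] prod_eq_iff)
  from ev_cong[OF this xTNR_xbispans(3)[OF W Y hr]] show ?thesis
    by (simp add: farr_R[OF X Y h] ev_R[OF R W r a] farr_R[OF W Y hr])
qed

lemma proj_pair_bij:
  "\<lbrakk>finite_gset G X; finite_gset G Y\<rbrakk> \<Longrightarrow>
    bij_betw (proj_pair G F X Y) (fobj F (disjoint_union X Y)) (fobj F X \<times> fobj F Y)"
  using prods by (simp add: product_preserving_def)

lemma proj_pair_ev:
  assumes \<beta>: "\<beta> \<in> xbispans G X Y" and \<gamma>: "\<gamma> \<in> xbispans G X Z" and a: "a \<in> fobj F X"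
  shows "proj_pair G F Y Z (ev X (disjoint_union Y Z) (xcop \<beta> \<gamma>) a) = (ev X Y \<beta> a, ev X Z \<gamma> a)"
proof -
  note YZ = xbispansD(2)[OF \<beta>] xbispansD(2)[OF \<gamma>]
  note C = xcop_xbispans[OF \<beta> \<gamma>]
  show ?thesis
    unfolding proj_pair_def ev_R[OF C YZ(1) incl_hom(1)[OF YZ] a] ev_R[OF C YZ(2) incl_hom(2)[OF YZ] a]
    using ev_cong[OF xcop_left[OF \<beta> \<gamma>] xpull_xbispans[OF C YZ(1) incl_hom(1)[OF YZ]]]
      ev_cong[OF xcop_right[OF \<beta> \<gamma>] xpull_xbispans[OF C YZ(2) incl_hom(2)[OF YZ]]] by simp
qed

lemma pairing_unique:
  assumes "finite_gset G X" "finite_gset G Y" "c \<in> fobj F (disjoint_union X Y)" "proj_pair G F X Y c = (a, b)"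
  shows "pairing G F X Y a b = c"
  unfolding pairing_def assms(4)[symmetric]
  by (rule the_inv_into_f_f) (use proj_pair_bij[OF assms(1,2)] assms(3) in \<open>auto simp: bij_betw_def\<close>)

lemma pairing:
  assumes "finite_gset G X" "finite_gset G Y" "a \<in> fobj F X" "b \<in> fobj F Y"
  shows "pairing G F X Y a b \<in> fobj F (disjoint_union X Y)" "proj_pair G F X Y (pairing G F X Y a b) = (a, b)"
proof -
  have "(a, b) \<in> proj_pair G F X Y ` fobj F (disjoint_union X Y)"
    using proj_pair_bij[OF assms(1,2)] assms(3,4) by (simp add: bij_betw_def)
  then obtain c where "c \<in> fobj F (disjoint_union X Y)" "proj_pair G F X Y c = (a, b)" by auto
  then show "pairing G F X Y a b \<in> fobj F (disjoint_union X Y)"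
    "proj_pair G F X Y (pairing G F X Y a b) = (a, b)"
    using pairing_unique[OF assms(1,2)] by auto
qed

lemma pairing_ev:
  assumes "\<beta> \<in> xbispans G X Y" "\<gamma> \<in> xbispans G X Z" "a \<in> fobj F X"
  shows "pairing G F Y Z (ev X Y \<beta> a) (ev X Z \<gamma> a) = ev X (disjoint_union Y Z) (xcop \<beta> \<gamma>) a"
  by (rule pairing_unique[OF xbispansD(2)[OF assms(1)] xbispansD(2)[OF assms(2)]
        ev_in[OF xcop_xbispans[OF assms(1,2)] assms(3)] proj_pair_ev[OF assms]])

lemma carrier_L [simp]: "carrier (L X) = fobj F X"
  by (simp add: level_ring_def)

lemma ev_add:
  assumes \<beta>: "\<beta> \<in> xbispans G X Y" and \<gamma>: "\<gamma> \<in> xbispans G X Y" and a: "a \<in> fobj F X"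
  shows "ev X Y \<beta> a \<oplus>\<^bsub>L Y\<^esub> ev X Y \<gamma> a = ev X Y (xsum \<beta> \<gamma>) a"
proof -
  note Y = xbispansD(2)[OF \<beta>]
  note C = xcop_xbispans[OF \<beta> \<gamma>]
  show ?thesis
    using ev_cong[OF xcop_fold[OF \<beta> \<gamma>] xtrans_xbispans[OF C Y fold_hom[OF Y]]]
    by (simp add: level_ring_def pairing_ev[OF assms] ev_T[OF C Y fold_hom[OF Y] a])
qed

lemma ev_mult:
  assumes \<beta>: "\<beta> \<in> xbispans G X Y" and \<gamma>: "\<gamma> \<in> xbispans G X Y" and a: "a \<in> fobj F X"
  shows "ev X Y \<beta> a \<otimes>\<^bsub>L Y\<^esub> ev X Y \<gamma> a = ev X Y (xprod \<beta> \<gamma>) a"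
proof -
  note Y = xbispansD(2)[OF \<beta>]
  note C = xcop_xbispans[OF \<beta> \<gamma>]
  have N: "xN (disjoint_union Y Y) Y (fold_map Y) \<in> xbispans G (disjoint_union Y Y) Y"
    by (rule xTNR_xbispans[OF finite_gset_disjoint_union[OF Y Y] Y fold_hom[OF Y]])
  show ?thesis
    using ev_cong[OF xcop_norm[OF \<beta> \<gamma>] xcomp_xbispans[OF C N]]
    by (simp add: level_ring_def pairing_ev[OF assms] ev_N[OF C Y fold_hom[OF Y] a])
qed

lemma fobj_empty: "c \<in> fobj F empty_gset \<Longrightarrow> the_elem (fobj F empty_gset) = c"
  using prods by (auto simp: product_preserving_def)

text \<open>Without lower points there are no upper points either, so \<beta> factors through the
  empty G-set, where F has a single element.\<close>

lemma ev_zero: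
  assumes X: "finite_gset G X" and Y: "finite_gset G Y" and a: "a \<in> fobj F X"
    and \<beta>: "\<beta> \<in> xbispans G X Y" "lo \<beta> = {}"
  shows "\<zero>\<^bsub>L Y\<^esub> = ev X Y \<beta> a"
proof -
  have E: "xempty \<in> xbispans G X empty_gset" by (rule xempty_xbispans[OF X empty_gset(1)])
  have "up \<beta> = {}" using xbispan_facts(2)[OF \<beta>(1)] \<beta>(2) by auto
  then have iso: "xiso G \<beta> (xtrans from_empty xempty)"
    using \<beta>(2) by (intro xiso_empty) simp_all
  show ?thesis
    using ev_cong[OF iso \<beta>(1)] ev_T[OF E Y from_empty_hom a]
    by (simp add: level_ring_def fobj_empty[OF ev_in[OF E a]])
qed

lemma ev_one:
  assumes X: "finite_gset G X" and Y: "finite_gset G Y" and a: "a \<in> fobj F X"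
  shows "\<one>\<^bsub>L Y\<^esub> = ev X Y (xone Y) a"
proof -
  have E: "xempty \<in> xbispans G X empty_gset" by (rule xempty_xbispans[OF X empty_gset(1)])
  have N: "xN empty_gset Y from_empty \<in> xbispans G empty_gset Y"
    by (rule xTNR_xbispans[OF empty_gset(1) Y from_empty_hom])
  show ?thesis
    using ev_cong[OF xcomp_one[OF Y] xcomp_xbispans[OF E N]] ev_N[OF E Y from_empty_hom a]
    by (simp add: level_ring_def fobj_empty[OF ev_in[OF E a]])
qed

lemma ev_split:
  assumes \<beta>: "\<beta> \<in> xbispans G X Y" and a: "a \<in> fobj F X"
    and P: "\<And>g b. \<lbrakk>g \<in> carrier G; b \<in> lo \<beta>\<rbrakk> \<Longrightarrow> P (lo_act \<beta> g b) \<longleftrightarrow> P b"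
  shows "ev X Y \<beta> a = ev X Y (xrestr P \<beta>) a \<oplus>\<^bsub>L Y\<^esub> ev X Y (xrestr (\<lambda>b. \<not> P b) \<beta>) a"
proof -
  note F = xbispan_facts[OF \<beta>]
  have 1: "xrestr P \<beta> \<in> xbispans G X Y" "xrestr (\<lambda>b. \<not> P b) \<beta> \<in> xbispans G X Y"
    by (rule xrestr_xbispans[OF \<beta>]; simp add: P)+
  have "xiso G \<beta> (xsum (xrestr P \<beta>) (xrestr (\<lambda>b. \<not> P b) \<beta>))"
    by (rule xisoI[where a = "\<lambda>a. if P (nleg \<beta> a) then Inl a else Inr a" and a' = "case_sum id id"
          and b = "\<lambda>b. if P b then Inl b else Inr b" and b' = "case_sum id id"])
      (auto simp: F P InlI InrI elim!: PlusE)
  from ev_cong[OF this \<beta>] show ?thesis by (simp add: ev_add[OF 1 a])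
qed

text \<open>Any two elements at level Y are restrictions of a single element at level Y + Y.
  Identities between arbitrary elements thus reduce to isomorphisms between bispans evaluated at one
  element.\<close>

lemma common_source:
  assumes Y: "finite_gset G Y" and u: "u \<in> fobj F Y" and v: "v \<in> fobj F Y"
  obtains c where "c \<in> fobj F (disjoint_union Y Y)"
    "u = farr F (pg_R G Y (disjoint_union Y Y) (incl_left Y)) c"
    "v = farr F (pg_R G Y (disjoint_union Y Y) (incl_right Y)) c"
    "u \<oplus>\<^bsub>L Y\<^esub> v = farr F (pg_T G (disjoint_union Y Y) Y (fold_map Y)) c"
  using pairing[OF Y Y u v] that[of "pairing G F Y Y u v"]
  by (simp add: proj_pair_def level_ring_def)

lemma common_source_ev:
  assumes Y: "finite_gset G Y" and u: "u \<in> fobj F Y" and v: "v \<in> fobj F Y"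
  obtains c where "c \<in> fobj F (disjoint_union Y Y)"
    "u = ev (disjoint_union Y Y) Y (xR Y (incl_left Y)) c"
    "v = ev (disjoint_union Y Y) Y (xR Y (incl_right Y)) c"
    "xR Y (incl_left Y) \<in> xbispans G (disjoint_union Y Y) Y"
    "xR Y (incl_right Y) \<in> xbispans G (disjoint_union Y Y) Y"
proof -
  note YY = finite_gset_disjoint_union[OF Y Y]
  show thesis
    using common_source[OF assms] that xTNR_xbispans(3)[OF Y YY incl_hom(1)[OF Y Y]]
      xTNR_xbispans(3)[OF Y YY incl_hom(2)[OF Y Y]] farr_R[OF Y YY incl_hom(1)[OF Y Y]]
      farr_R[OF Y YY incl_hom(2)[OF Y Y]] by metis
qed

text \<open>By \<open>common_source_ev\<close> both summands are values of bispans at the same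
  element, so additivity is an isomorphism of bispans. The proof of \<open>R_add\<close> follows the
  same pattern.\<close>

lemma T_add:
  assumes Y: "finite_gset G Y" and Z: "finite_gset G Z" and f: "f \<in> gset_hom G Y Z"
    and u: "u \<in> fobj F Y" and v: "v \<in> fobj F Y"
  shows "farr F (pg_T G Y Z f) (u \<oplus>\<^bsub>L Y\<^esub> v) = farr F (pg_T G Y Z f) u \<oplus>\<^bsub>L Z\<^esub> farr F (pg_T G Y Z f) v"
proof -
  obtain c \<beta> \<gamma> where c: "c \<in> fobj F (disjoint_union Y Y)"
    and u': "u = ev (disjoint_union Y Y) Y \<beta> c" and v': "v = ev (disjoint_union Y Y) Y \<gamma> c"
    and \<beta>: "(\<beta> :: ('a, 'a point, 'a point) xbispan) \<in> xbispans G (disjoint_union Y Y) Y"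
    and \<gamma>: "(\<gamma> :: ('a, 'a point, 'a point) xbispan) \<in> xbispans G (disjoint_union Y Y) Y"
    by (rule common_source_ev[OF Y u v])
  note T = xtrans_xbispans[OF _ Z f]
  have iso: "xiso G (xtrans f (xsum \<beta> \<gamma>)) (xsum (xtrans f \<beta>) (xtrans f \<gamma>))"
    by (rule xisoI[where a = id and b = id and a' = id and b' = id])
      (auto elim!: PlusE simp: InlI InrI)
  show ?thesis
    unfolding u' v' ev_add[OF \<beta> \<gamma> c] ev_T[OF xsum_xbispans[OF \<beta> \<gamma>] Z f c]
      ev_T[OF \<beta> Z f c] ev_T[OF \<gamma> Z f c] ev_add[OF T[OF \<beta>] T[OF \<gamma>] c]
    by (rule ev_cong[OF iso T[OF xsum_xbispans[OF \<beta> \<gamma>]]])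
qed

lemma R_add:
  assumes Y: "finite_gset G Y" and W: "finite_gset G W" and h: "h \<in> gset_hom G W Y"
    and u: "u \<in> fobj F Y" and v: "v \<in> fobj F Y"
  shows "farr F (pg_R G W Y h) (u \<oplus>\<^bsub>L Y\<^esub> v) = farr F (pg_R G W Y h) u \<oplus>\<^bsub>L W\<^esub> farr F (pg_R G W Y h) v"
proof -
  obtain c \<beta> \<gamma> where c: "c \<in> fobj F (disjoint_union Y Y)"
    and u': "u = ev (disjoint_union Y Y) Y \<beta> c" and v': "v = ev (disjoint_union Y Y) Y \<gamma> c"
    and \<beta>: "(\<beta> :: ('a, 'a point, 'a point) xbispan) \<in> xbispans G (disjoint_union Y Y) Y"
    and \<gamma>: "(\<gamma> :: ('a, 'a point, 'a point) xbispan) \<in> xbispans G (disjoint_union Y Y) Y"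
    by (rule common_source_ev[OF Y u v])
  note P = xpull_xbispans[OF _ W h]
  define i where "i = (\<lambda>w :: 'a point \<times> ('a point + 'a point). map_sum (Pair (fst w)) (Pair (fst w)) (snd w))"
  define j where "j = case_sum (\<lambda>w. (fst w, Inl (snd w))) (\<lambda>w :: 'a point \<times> 'a point. (fst w, Inr (snd w) :: 'a point + 'a point))"
  have ij: "i (w, Inl x) = Inl (w, x)" "i (w, Inr x) = Inr (w, x)"
    "j (Inl (w, x)) = (w, Inl x)" "j (Inr (w, x)) = (w, Inr x)" for w x
    by (simp_all add: i_def j_def)
  have U: "\<exists>w y. x = (w, y) \<and> (\<exists>a. y = Inl a \<or> y = Inr a)" for x :: "'a point \<times> ('a point + 'a point)"
    by (metis prod.exhaust sum.exhaust)
  have iso: "xiso G (xpull W h (xsum \<beta> \<gamma>)) (xsum (xpull W h \<beta>) (xpull W h \<gamma>))"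
  proof (rule xisoI[where a = i and b = i and a' = j and b' = j])
    fix x assume x: "x \<in> up (xpull W h (xsum \<beta> \<gamma>))"
    obtain w y where xe: "x = (w, y)" by (cases x)
    show "i x \<in> up (xsum (xpull W h \<beta>) (xpull W h \<gamma>)) \<and> j (i x) = x"
      "rleg (xsum (xpull W h \<beta>) (xpull W h \<gamma>)) (i x) = rleg (xpull W h (xsum \<beta> \<gamma>)) x"
      "nleg (xsum (xpull W h \<beta>) (xpull W h \<gamma>)) (i x) = i (nleg (xpull W h (xsum \<beta> \<gamma>)) x)"
      using x by (cases y; auto simp: xe ij InlI InrI elim!: PlusE)+
    show "i (up_act (xpull W h (xsum \<beta> \<gamma>)) g x) = up_act (xsum (xpull W h \<beta>) (xpull W h \<gamma>)) g (i x)" for g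
      by (cases y) (simp_all add: xe ij)
  next
    fix x assume x: "x \<in> lo (xpull W h (xsum \<beta> \<gamma>))"
    obtain w y where xe: "x = (w, y)" by (cases x)
    show "i x \<in> lo (xsum (xpull W h \<beta>) (xpull W h \<gamma>)) \<and> j (i x) = x"
      "tleg (xsum (xpull W h \<beta>) (xpull W h \<gamma>)) (i x) = tleg (xpull W h (xsum \<beta> \<gamma>)) x"
      using x by (cases y; auto simp: xe ij InlI InrI elim!: PlusE)+
    show "i (lo_act (xpull W h (xsum \<beta> \<gamma>)) g x) = lo_act (xsum (xpull W h \<beta>) (xpull W h \<gamma>)) g (i x)" for g
      by (cases y) (simp_all add: xe ij)
  next
    fix x assume x: "x \<in> up (xsum (xpull W h \<beta>) (xpull W h \<gamma>))"
    then show "j x \<in> up (xpull W h (xsum \<beta> \<gamma>)) \<and> i (j x) = x"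
      by (auto simp: ij InlI InrI)
  next
    fix x assume x: "x \<in> lo (xsum (xpull W h \<beta>) (xpull W h \<gamma>))"
    then show "j x \<in> lo (xpull W h (xsum \<beta> \<gamma>)) \<and> i (j x) = x"
      by (auto simp: ij InlI InrI)
  qed
  show ?thesis
    unfolding u' v' ev_add[OF \<beta> \<gamma> c] ev_R[OF xsum_xbispans[OF \<beta> \<gamma>] W h c]
      ev_R[OF \<beta> W h c] ev_R[OF \<gamma> W h c] ev_add[OF P[OF \<beta>] P[OF \<gamma>] c]
    by (rule ev_cong[OF iso P[OF xsum_xbispans[OF \<beta> \<gamma>]]])
qed

text \<open>Here the factors are split, whereas \<open>ev_split\<close> splits the terms. The two
  bispans on the right have identity transfers, so the lower set of their product is the diagonal of
  B.\<close>

lemma ev_usplit: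
  assumes X: "finite_gset G X" and A: "finite_gset G A" and B: "finite_gset G B"
    and r: "r \<in> gset_hom G A X" and n: "n \<in> gset_hom G A B" and a: "a \<in> fobj F X"
    and Q: "\<And>g x. \<lbrakk>g \<in> carrier G; x \<in> points A\<rbrakk> \<Longrightarrow> Q (act A g x) \<longleftrightarrow> Q x"
  defines "A0 \<equiv> subgset A Q" and "A1 \<equiv> subgset A (\<lambda>x. \<not> Q x)"
  shows "ev X B (xres_norm A B r n) a =
      ev X B (xres_norm A0 B (restrict r (points A0)) (restrict n (points A0))) a \<otimes>\<^bsub>L B\<^esub>
      ev X B (xres_norm A1 B (restrict r (points A1)) (restrict n (points A1))) a"
proof -
  let ?\<beta> = "xres_norm A B r n"
    and ?\<gamma> = "xres_norm A0 B (restrict r (points A0)) (restrict n (points A0))"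
    and ?\<delta> = "xres_norm A1 B (restrict r (points A1)) (restrict n (points A1))"
  have A01: "finite_gset G A0" "finite_gset G A1"
    unfolding A0_def A1_def by (rule finite_gset_subgset[OF A]; simp add: Q)+
  have r01: "restrict r (points A0) \<in> gset_hom G A0 X" "restrict r (points A1) \<in> gset_hom G A1 X"
    "restrict n (points A0) \<in> gset_hom G A0 B" "restrict n (points A1) \<in> gset_hom G A1 B"
    using subgset_hom[OF A r, of Q] subgset_hom[OF A r, of "\<lambda>x. \<not> Q x"]
      subgset_hom[OF A n, of Q] subgset_hom[OF A n, of "\<lambda>x. \<not> Q x"] Q
    unfolding A0_def A1_def by simp_all
  have \<beta>: "?\<beta> \<in> xbispans G X B" by (rule xres_norm_xbispans[OF X A B r n])
  have \<beta>0: "?\<gamma> \<in> xbispans G X B" by (rule xres_norm_xbispans[OF X A01(1) B r01(1,3)])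
  have \<beta>1: "?\<delta> \<in> xbispans G X B" by (rule xres_norm_xbispans[OF X A01(2) B r01(2,4)])
  have iso: "xiso G ?\<beta> (xprod ?\<gamma> ?\<delta>)"
  proof (rule xisoI[where a = "\<lambda>x. ((n x, n x), if Q x then Inl x else Inr x)"
        and a' = "\<lambda>w. case_sum id id (snd w)" and b = "\<lambda>x. (x, x)" and b' = fst])
    fix w assume "w \<in> up (xprod ?\<gamma> ?\<delta>)"
    then show "case_sum id id (snd w) \<in> up ?\<beta> \<and>
       ((n (case_sum id id (snd w)), n (case_sum id id (snd w))),
         if Q (case_sum id id (snd w)) then Inl (case_sum id id (snd w)) else Inr (case_sum id id (snd w))) = w"
      by (cases w; cases "snd w"; cases "fst w") (simp_all add: A0_def A1_def InlI InrI Plus_def image_iff)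
  next
    fix w assume "w \<in> lo (xprod ?\<gamma> ?\<delta>)"
    then show "fst w \<in> lo ?\<beta> \<and> (fst w, fst w) = w" by (cases w) simp
  qed (use hom_facts[OF n] Q in \<open>simp_all add: A0_def A1_def InlI InrI gset_facts[OF A]\<close>)
  show ?thesis using ev_cong[OF iso \<beta>] by (simp add: ev_mult[OF \<beta>0 \<beta>1 a])
qed

end

section \<open>The sub-Tambara functor generated by an element\<close>

locale tambara_elt = tambara +
  fixes P x
  assumes P: "finite_gset G P" and x: "x \<in> fobj F P"
begin

text \<open>Closed under all operations except negation: a morphism of bispans cannot produce an
  additive inverse by itself.\<close>

definition V where "V X = {farr F \<alpha> x | \<alpha>. \<alpha> \<in> pg_hom G P X}"

text \<open>Differences of elements of \<open>V\<close>, with the subtrahend moved to the other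
  side, so that additivity of transfers and restrictions applies to the equation as it
  stands.\<close>

definition D where "D X = {c \<in> fobj F X. \<exists>u\<in>V X. \<exists>v\<in>V X. c \<oplus>\<^bsub>L X\<^esub> v = u}"

lemma V_ev: "\<beta> \<in> xbispans G P X \<Longrightarrow> ev P X \<beta> x \<in> V X"
  unfolding V_def ev_def using xclass_pg_hom by blast

lemma V_E:
  assumes "u \<in> V X"
  obtains S where "S \<in> bispans G P X" "of_bispan S \<in> xbispans G P X" "u = ev P X (of_bispan S) x"
proof -
  from assms obtain \<alpha> where "\<alpha> \<in> pg_hom G P X" "u = farr F \<alpha> x" by (auto simp: V_def)
  then show thesis using that farr_ev[of \<alpha> P X] of_bispan_xbispans by metis
qed

lemma V_in: "u \<in> V X \<Longrightarrow> u \<in> fobj F X"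
  by (elim V_E) (simp add: ev_in x)

lemma V_comp:
  assumes "\<alpha> \<in> pg_hom G X Y" "u \<in> V X"
  shows "farr F \<alpha> u \<in> V Y"
proof -
  obtain S where S: "of_bispan S \<in> xbispans G P X" "u = ev P X (of_bispan S) x"
    using V_E[OF assms(2)] by metis
  obtain S' where S': "S' \<in> bispans G X Y" "\<And>a. farr F \<alpha> a = ev X Y (of_bispan S') a"
    using farr_ev[OF assms(1)] by metis
  show ?thesis
    using V_ev[OF xcomp_xbispans[OF S(1) of_bispan_xbispans[OF S'(1)]]]
      ev_comp[OF S(1) of_bispan_xbispans[OF S'(1)] x] S(2) S'(2) by simp
qed

lemma pg_TNR_hom:
  assumes "finite_gset G X" "finite_gset G Y" "f \<in> gset_hom G X Y"
  shows "pg_T G X Y f \<in> pg_hom G X Y" "pg_N G X Y f \<in> pg_hom G X Y" "pg_R G X Y f \<in> pg_hom G Y X"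
  using xTNR_xbispans[OF assms] by (simp_all add: pg_T_eq pg_N_eq pg_R_eq assms xclass_pg_hom)

lemma V_add: "\<lbrakk>u \<in> V X; v \<in> V X\<rbrakk> \<Longrightarrow> u \<oplus>\<^bsub>L X\<^esub> v \<in> V X"
  by (elim V_E) (simp add: ev_add x V_ev xsum_xbispans)

lemma V_mult: "\<lbrakk>u \<in> V X; v \<in> V X\<rbrakk> \<Longrightarrow> u \<otimes>\<^bsub>L X\<^esub> v \<in> V X"
  by (elim V_E) (simp add: ev_mult x V_ev xprod_xbispans)

lemma V_zero: "finite_gset G X \<Longrightarrow> \<zero>\<^bsub>L X\<^esub> \<in> V X"
  using ev_zero[OF P _ x xempty_xbispans[OF P]] V_ev[OF xempty_xbispans[OF P]] by simp

lemma V_one: "finite_gset G X \<Longrightarrow> \<one>\<^bsub>L X\<^esub> \<in> V X"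
  using ev_one[OF P _ x] V_ev[OF xone_xbispans[OF P]] by simp

lemma D_in: "c \<in> D X \<Longrightarrow> c \<in> fobj F X"
  by (simp add: D_def)

lemma DI: "\<lbrakk>c \<in> fobj F X; u \<in> V X; v \<in> V X; c \<oplus>\<^bsub>L X\<^esub> v = u\<rbrakk> \<Longrightarrow> c \<in> D X"
  by (auto simp: D_def)

lemma D_E:
  assumes "c \<in> D X"
  obtains u v where "u \<in> V X" "v \<in> V X" "c \<oplus>\<^bsub>L X\<^esub> v = u"
  using assms by (auto simp: D_def)

context
  fixes X assumes X: "finite_gset G X"
begin

interpretation R: cring "L X" by (rule cring_L[OF X])

lemma V_D: "u \<in> V X \<Longrightarrow> u \<in> D X"
  using R.r_zero[of u] V_in by (intro DI[OF _ _ V_zero[OF X]]) auto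

lemma D_add:
  assumes "c \<in> D X" "d \<in> D X"
  shows "c \<oplus>\<^bsub>L X\<^esub> d \<in> D X"
proof -
  obtain u v where 1: "u \<in> V X" "v \<in> V X" "c \<oplus>\<^bsub>L X\<^esub> v = u" using assms(1) by (rule D_E)
  obtain s t where 2: "s \<in> V X" "t \<in> V X" "d \<oplus>\<^bsub>L X\<^esub> t = s" using assms(2) by (rule D_E)
  have c: "c \<in> carrier (L X)" "d \<in> carrier (L X)" "v \<in> carrier (L X)" "t \<in> carrier (L X)"
    using assms 1 2 by (simp_all add: D_in V_in)
  show ?thesis
  proof (rule DI)
    show "(c \<oplus>\<^bsub>L X\<^esub> d) \<oplus>\<^bsub>L X\<^esub> (v \<oplus>\<^bsub>L X\<^esub> t) = u \<oplus>\<^bsub>L X\<^esub> s"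
      unfolding 1(3)[symmetric] 2(3)[symmetric] using c by (simp only: R.a_ac R.add.m_closed)
    show "c \<oplus>\<^bsub>L X\<^esub> d \<in> fobj F X" using R.add.m_closed[OF c(1,2)] by simp
  qed (use 1 2 V_add in auto)
qed

lemma D_neg:
  assumes "c \<in> D X"
  shows "\<ominus>\<^bsub>L X\<^esub> c \<in> D X"
proof -
  obtain u v where 1: "u \<in> V X" "v \<in> V X" "c \<oplus>\<^bsub>L X\<^esub> v = u" using assms(1) by (rule D_E)
  have c: "c \<in> carrier (L X)" "v \<in> carrier (L X)"
    using assms 1 by (simp_all add: D_in V_in)
  show ?thesis
  proof (rule DI[OF _ 1(2,1)])
    show "\<ominus>\<^bsub>L X\<^esub> c \<in> fobj F X" using R.a_inv_closed[OF c(1)] by simp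
    show "\<ominus>\<^bsub>L X\<^esub> c \<oplus>\<^bsub>L X\<^esub> u = v" unfolding 1(3)[symmetric] using c by (rule R.r_neg1)
  qed
qed

lemma D_diff:
  assumes "c \<in> fobj F X" "d \<in> D X" "c \<oplus>\<^bsub>L X\<^esub> d \<in> D X"
  shows "c \<in> D X"
proof -
  have "c \<in> carrier (L X)" "d \<in> carrier (L X)" using assms by (simp_all add: D_in)
  then have "(c \<oplus>\<^bsub>L X\<^esub> d) \<oplus>\<^bsub>L X\<^esub> \<ominus>\<^bsub>L X\<^esub> d = c"
    by (simp only: R.a_assoc R.a_inv_closed R.r_neg R.r_zero)
  then show ?thesis using D_add[OF assms(3) D_neg[OF assms(2)]] by simp
qed

lemma D_mult_V:
  assumes "c \<in> D X" "t \<in> V X"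
  shows "c \<otimes>\<^bsub>L X\<^esub> t \<in> D X"
proof -
  obtain u v where 1: "u \<in> V X" "v \<in> V X" "c \<oplus>\<^bsub>L X\<^esub> v = u" using assms(1) by (rule D_E)
  have c: "c \<in> carrier (L X)" "v \<in> carrier (L X)" "t \<in> carrier (L X)"
    using assms 1 by (simp_all add: D_in V_in)
  show ?thesis
    by (rule DI[OF _ V_mult[OF 1(1) assms(2)] V_mult[OF 1(2) assms(2)]])
      (use R.l_distr[OF c] R.m_closed[OF c(1,3)] 1(3) in simp_all)
qed

text \<open>With d = s - t the product c d is c s - c t, and \<open>D_mult_V\<close> covers both
  products.\<close>

lemma D_mult:
  assumes "c \<in> D X" "d \<in> D X"
  shows "c \<otimes>\<^bsub>L X\<^esub> d \<in> D X"
proof -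
  obtain s t where 2: "s \<in> V X" "t \<in> V X" "d \<oplus>\<^bsub>L X\<^esub> t = s" using assms(2) by (rule D_E)
  have c: "c \<in> carrier (L X)" "d \<in> carrier (L X)" "t \<in> carrier (L X)"
    using assms 2 by (simp_all add: D_in V_in)
  show ?thesis
  proof (rule D_diff[OF _ D_mult_V[OF assms(1) 2(2)]])
    show "c \<otimes>\<^bsub>L X\<^esub> d \<oplus>\<^bsub>L X\<^esub> c \<otimes>\<^bsub>L X\<^esub> t \<in> D X"
      using R.r_distr[OF c(2,3,1)] D_mult_V[OF assms(1) 2(1)] 2(3) by simp
  qed (use R.m_closed[OF c(1,2)] in simp)
qed

lemma subcring_D: "subcring (D X) (L X)"
  by (rule R.subcringI'[OF R.subringI]) (auto simp: D_in D_add D_neg D_mult V_D V_one X)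

end

lemma T_D:
  assumes X: "finite_gset G X" and Y: "finite_gset G Y" and f: "f \<in> gset_hom G X Y" and c: "c \<in> D X"
  shows "farr F (pg_T G X Y f) c \<in> D Y"
proof -
  obtain u v where 1: "u \<in> V X" "v \<in> V X" "c \<oplus>\<^bsub>L X\<^esub> v = u" using c by (rule D_E)
  show ?thesis
    by (rule DI[OF farr_TNR_in(1)[OF X Y f D_in[OF c]] V_comp[OF pg_TNR_hom(1)[OF X Y f] 1(1)]
        V_comp[OF pg_TNR_hom(1)[OF X Y f] 1(2)]])
      (use T_add[OF X Y f D_in[OF c] V_in[OF 1(2)]] 1(3) in simp)
qed

lemma R_D:
  assumes X: "finite_gset G X" and Y: "finite_gset G Y" and f: "f \<in> gset_hom G X Y" and c: "c \<in> D Y"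
  shows "farr F (pg_R G X Y f) c \<in> D X"
proof -
  obtain u v where 1: "u \<in> V Y" "v \<in> V Y" "c \<oplus>\<^bsub>L Y\<^esub> v = u" using c by (rule D_E)
  show ?thesis
    by (rule DI[OF farr_TNR_in(3)[OF X Y f D_in[OF c]] V_comp[OF pg_TNR_hom(3)[OF X Y f] 1(1)]
        V_comp[OF pg_TNR_hom(3)[OF X Y f] 1(2)]])
      (use R_add[OF Y X f D_in[OF c] V_in[OF 1(2)]] 1(3) in simp)
qed

lemma act_disjoint_union_parity:
  assumes "w \<in> points (disjoint_union X Y)"
  shows "even (snd (act (disjoint_union X Y) h w)) \<longleftrightarrow> even (snd w)"
  using assms by (rule disjoint_union_cases) simp_all

text \<open>
  Write \<open>u = a - b\<close> with \<open>a\<close> and \<open>b\<close> in \<open>V X\<close>. Expanding the norm of \<open>u + b = a\<close> over the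
  functions from the fibres of \<open>g\<close> to \<open>{u, b}\<close>, the constant functions \<open>u\<close> contribute the norm of
  \<open>u\<close>, and all other terms involve norms of \<open>u\<close> along maps with smaller fibres only.
\<close>

lemma N_D_aux:
  assumes "finite_gset G X" "finite_gset G Z" "g \<in> gset_hom G X Z" "u \<in> D X"
    and "\<And>z. z \<in> points Z \<Longrightarrow> card {y \<in> points X. g y = z} < n"
  shows "farr F (pg_N G X Z g) u \<in> D Z"
  using assms
proof (induction n arbitrary: X Z g u)
  case 0
  note X = 0(1) and Z = 0(2) and g = 0(3) and u = 0(4)
  have Z0: "points Z = {}" using 0(5) by auto
  interpret cring "L Z" by (rule cring_L[OF Z])
  \<comment> \<open>The strict bound 0 forces Z to be empty; over the empty G-set the unit has no
    terms, so 1 = 0 and the ring is trivial.\<close>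
  have "\<one>\<^bsub>L Z\<^esub> = \<zero>\<^bsub>L Z\<^esub>"
    using ev_one[OF P Z x] ev_zero[OF P Z x xone_xbispans[OF P Z]] Z0 by simp
  moreover have "farr F (pg_N G X Z g) u \<in> carrier (L Z)"
    using farr_TNR_in(2)[OF X Z g D_in[OF u]] by simp
  ultimately have "farr F (pg_N G X Z g) u = \<zero>\<^bsub>L Z\<^esub>"
    using r_one r_null by metis
  then show ?case using V_D[OF Z V_zero[OF Z]] by simp
next
  case (Suc n)
  note X = Suc.prems(1) and Z = Suc.prems(2) and g = Suc.prems(3) and u = Suc.prems(4)
  define XX where "XX = disjoint_union X X"
  have XX: "finite_gset G XX" unfolding XX_def by (rule finite_gset_disjoint_union[OF X X])
  have fold: "fold_map X \<in> gset_hom G XX X" unfolding XX_def by (rule fold_hom[OF X])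
  have incl: "incl_left X \<in> gset_hom G X XX" "incl_right X \<in> gset_hom G X XX"
    unfolding XX_def by (rule incl_hom[OF X X])+
  obtain a b where ab: "a \<in> V X" "b \<in> V X" "u \<oplus>\<^bsub>L X\<^esub> b = a" using u by (rule D_E)
  obtain c where c: "c \<in> fobj F XX"
    and uc: "u = farr F (pg_R G X XX (incl_left X)) c"
    and bc: "b = farr F (pg_R G X XX (incl_right X)) c"
    and ac: "a = farr F (pg_T G XX X (fold_map X)) c"
    using common_source[OF X D_in[OF u] V_in[OF ab(2)]] ab(3) unfolding XX_def by metis
  define \<nu> where "\<nu> = xN X Z g"
  define \<tau> where "\<tau> = xT XX (fold_map X)"
  have \<nu>: "\<nu> \<in> xbispans G X Z" unfolding \<nu>_def by (rule xTNR_xbispans[OF X Z g])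
  have \<tau>: "\<tau> \<in> xbispans G XX X" unfolding \<tau>_def by (rule xTNR_xbispans[OF XX X fold])
  \<comment> \<open>A lower point of \<kappa> is a point z with a choice, for each element of the
    fibre of g at z, of the left copy (factor u) or the right copy (factor b). These are the terms
    of the expanded norm of u + b.\<close>
  define \<kappa> where "\<kappa> = xcomp G \<nu> \<tau>"
  have \<kappa>: "\<kappa> \<in> xbispans G XX Z" unfolding \<kappa>_def by (rule xcomp_xbispans[OF \<tau> \<nu>])
  have Na: "farr F (pg_N G X Z g) a = ev XX Z \<kappa> c"
    unfolding \<kappa>_def ev_comp[OF \<tau> \<nu> c, symmetric]
    by (simp add: ac farr_N[OF X Z g] farr_T[OF XX X fold] \<nu>_def \<tau>_def)
  have fib: "xfib \<nu> z = {y \<in> points X. g y = z}" for z by (simp add: xfib_def \<nu>_def)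
  have sec: "snd y k \<in> points XX" "snd y k = inl_point k \<or> snd y k = inr_point k"
    "even (snd (snd y k)) \<Longrightarrow> snd y k = inl_point k"
    if y: "y \<in> xlo \<nu> \<tau>" and k: "k \<in> xfib \<nu> (fst y)" for y k
  proof -
    have "snd y k \<in> points (disjoint_union X X)" "fold_map X (snd y k) = k"
      using xloD(3)[OF y k] by (simp_all add: \<nu>_def \<tau>_def XX_def)
    then show 1: "snd y k \<in> points XX" "snd y k = inl_point k \<or> snd y k = inr_point k"
      unfolding XX_def by (simp, elim disjoint_union_cases) simp_all
    show "even (snd (snd y k)) \<Longrightarrow> snd y k = inl_point k" using 1(2) by auto
  qed
  \<comment> \<open>The constant choice u. Left copies are the points with an even tag.\<close>
  define Q where "Q y \<longleftrightarrow> (\<forall>k\<in>xfib \<nu> (fst y). even (snd (snd y k)))"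
    for y :: "'a point \<times> ('a point \<Rightarrow> 'a point)"
  have Qact: "Q (lo_act \<kappa> h y) \<longleftrightarrow> Q y" if h: "h \<in> carrier G" and y: "y \<in> lo \<kappa>" for h y
  proof -
    have y: "y \<in> xlo \<nu> \<tau>" using y by (simp add: \<kappa>_def)
    have f: "fst (xlo_act G \<nu> \<tau> h y) = lo_act \<nu> h (fst y)" by (simp add: xlo_act_def)
    have par: "even (snd (snd (xlo_act G \<nu> \<tau> h y) (up_act \<nu> h k))) \<longleftrightarrow> even (snd (snd y k))"
      if k: "k \<in> xfib \<nu> (fst y)" for k
      unfolding xlo_act_app[OF \<nu> h y k]
      using act_disjoint_union_parity[of "snd y k" X X h] sec(1)[OF y k] by (simp add: \<tau>_def XX_def)
    show ?thesis
    proof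
      assume q: "Q (lo_act \<kappa> h y)"
      show "Q y" unfolding Q_def
      proof
        fix k assume k: "k \<in> xfib \<nu> (fst y)"
        then show "even (snd (snd y k))"
          using q xfib_act[OF \<nu> h k] par[OF k] by (simp add: Q_def \<kappa>_def f)
      qed
    next
      assume q: "Q y"
      show "Q (lo_act \<kappa> h y)" unfolding Q_def
      proof
        fix k assume "k \<in> xfib \<nu> (fst (lo_act \<kappa> h y))"
        then have k: "k \<in> xfib \<nu> (lo_act \<nu> h (fst y))" by (simp add: \<kappa>_def f)
        have k': "up_act \<nu> (inv h) k \<in> xfib \<nu> (fst y)"
          by (rule xfib_act_inv[OF \<nu> h xloD(1)[OF y] k])
        show "even (snd (snd (lo_act \<kappa> h y) k))"
          using q par[OF k'] k' xbispan_inv(1)[OF \<nu> h xfibD(1)[OF k]] by (simp add: Q_def \<kappa>_def)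
      qed
    qed
  qed
  have split: "farr F (pg_N G X Z g) a =
      ev XX Z (xrestr Q \<kappa>) c \<oplus>\<^bsub>L Z\<^esub> ev XX Z (xrestr (\<lambda>y. \<not> Q y) \<kappa>) c"
    unfolding Na by (rule ev_split[OF \<kappa> c Qact])
  have first: "ev XX Z (xrestr Q \<kappa>) c = farr F (pg_N G X Z g) u"
  proof -
    let ?s = "\<lambda>z. (z, \<lambda>k\<in>xfib \<nu> z. inl_point k)"
    have s_in: "?s z \<in> xlo \<nu> \<tau>" "Q (?s z)" if "z \<in> points Z" for z
    proof -
      show "?s z \<in> xlo \<nu> \<tau>"
        by (rule xloI) (use that in \<open>simp_all add: fib \<tau>_def XX_def\<close>, simp_all add: \<nu>_def)
      show "Q (?s z)" by (simp add: Q_def)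
    qed
    have s_eq: "?s (fst y) = y" if y: "y \<in> xlo \<nu> \<tau>" "Q y" for y
    proof (rule pair_eqI)
      show "(\<lambda>k\<in>xfib \<nu> (fst y). inl_point k) = snd y"
        by (rule extensionalityI[where A = "xfib \<nu> (fst y)"])
          (use xloD(2)[OF y(1)] sec(3)[OF y(1)] y(2) in \<open>simp_all add: Q_def\<close>)
    qed simp
    have s_act: "?s (act Z h z) = xlo_act G \<nu> \<tau> h (?s z)"
      if h: "h \<in> carrier G" and z: "z \<in> points Z" for h z
    proof (rule xlo_eqI[OF s_in(1) xlo_act_in[OF \<tau> \<nu> h s_in(1)[OF z]]])
      show "act Z h z \<in> points Z" by (rule gset_facts(3)[OF Z h z])
      show "fst (?s (act Z h z)) = fst (xlo_act G \<nu> \<tau> h (?s z))"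
        by (simp add: xlo_act_def \<nu>_def)
      fix k assume "k \<in> xfib \<nu> (fst (?s (act Z h z)))"
      then have k: "k \<in> xfib \<nu> (lo_act \<nu> h z)" by (simp add: \<nu>_def)
      have k': "up_act \<nu> (inv h) k \<in> xfib \<nu> z"
        by (rule xfib_act_inv[OF \<nu> h _ k]) (use z in \<open>simp add: \<nu>_def\<close>)
      have "act XX h (inl_point (act X (inv h) k)) = inl_point (act X h (act X (inv h) k))"
        using k' unfolding XX_def by (intro act_disjoint_union) (simp add: fib, simp add: \<nu>_def)
      also have "\<dots> = inl_point k"
        using xbispan_inv(1)[OF \<nu> h xfibD(1)[OF k]] by (simp add: \<nu>_def)
      finally show "snd (?s (act Z h z)) k = snd (xlo_act G \<nu> \<tau> h (?s z)) k"
        using k k' by (simp add: xlo_act_def) (simp add: \<nu>_def \<tau>_def)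
    qed
    have iso: "xiso G (xres_norm X Z (incl_left X) g) (xrestr Q \<kappa>)"
    proof (rule xisoI[where b = ?s and b' = fst and a = "\<lambda>y. (?s (g y), y, inl_point y)"
          and a' = "\<lambda>w. fst (snd w)"])
      fix y assume "y \<in> up (xres_norm X Z (incl_left X) g)"
      then have y: "y \<in> points X" "g y \<in> points Z" using hom_facts(1)[OF g] by simp_all
      have "(?s (g y), y, inl_point y) \<in> xup \<nu> \<tau>"
        by (rule xupI[OF s_in(1)[OF y(2)]]) (use y in \<open>simp_all add: fib \<tau>_def XX_def\<close>)
      then show "(?s (g y), y, inl_point y) \<in> up (xrestr Q \<kappa>) \<and> fst (snd (?s (g y), y, inl_point y)) = y"
        using s_in(2)[OF y(2)] by (simp add: \<kappa>_def)
      show "nleg (xrestr Q \<kappa>) (?s (g y), y, inl_point y) = ?s (nleg (xres_norm X Z (incl_left X) g) y)"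
        "rleg (xrestr Q \<kappa>) (?s (g y), y, inl_point y) = rleg (xres_norm X Z (incl_left X) g) y"
        using y by (simp_all add: \<kappa>_def \<tau>_def)
      fix h assume h: "h \<in> carrier G"
      have "?s (act Z h (g y)) = xlo_act G \<nu> \<tau> h (?s (g y))" by (rule s_act[OF h y(2)])
      then show "(?s (g (up_act (xres_norm X Z (incl_left X) g) h y)),
          up_act (xres_norm X Z (incl_left X) g) h y, inl_point (up_act (xres_norm X Z (incl_left X) g) h y)) =
          up_act (xrestr Q \<kappa>) h (?s (g y), y, inl_point y)"
        using y h hom_facts(2)[OF g] by (simp add: \<kappa>_def \<tau>_def XX_def) (simp add: \<nu>_def)
    next
      fix w assume "w \<in> up (xrestr Q \<kappa>)"
      then have w: "w \<in> xup \<nu> \<tau>" "Q (fst w)" by (simp_all add: \<kappa>_def)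
      have k: "fst (snd w) \<in> xfib \<nu> (fst (fst w))" by (rule xupD(2)[OF w(1)])
      have e: "snd (snd w) = inl_point (fst (snd w))"
        using xupD(4)[OF w(1)] sec(3)[OF xupD(1)[OF w(1)] k] w(2) k by (simp add: Q_def \<tau>_def)
      have gz: "g (fst (snd w)) = fst (fst w)" "fst (snd w) \<in> points X" using k by (simp_all add: fib)
      show "fst (snd w) \<in> up (xres_norm X Z (incl_left X) g) \<and>
          (?s (g (fst (snd w))), fst (snd w), inl_point (fst (snd w))) = w"
        using gz e s_eq[OF xupD(1)[OF w(1)] w(2)] by (simp add: triple_eqI)
    next
      fix z assume z: "z \<in> lo (xres_norm X Z (incl_left X) g)"
      then show "?s z \<in> lo (xrestr Q \<kappa>) \<and> fst (?s z) = z" using s_in[of z] by (simp add: \<kappa>_def)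
      show "tleg (xrestr Q \<kappa>) (?s z) = tleg (xres_norm X Z (incl_left X) g) z" by (simp add: \<kappa>_def \<nu>_def)
      fix h assume h: "h \<in> carrier G"
      have z: "z \<in> points Z" using z by simp
      have "?s (act Z h z) = xlo_act G \<nu> \<tau> h (?s z)" by (rule s_act[OF h z])
      then show "?s (lo_act (xres_norm X Z (incl_left X) g) h z) = lo_act (xrestr Q \<kappa>) h (?s z)"
        by (simp add: \<kappa>_def)
    next
      fix y assume "y \<in> lo (xrestr Q \<kappa>)"
      then have y: "y \<in> xlo \<nu> \<tau>" "Q y" by (simp_all add: \<kappa>_def)
      show "fst y \<in> lo (xres_norm X Z (incl_left X) g) \<and> ?s (fst y) = y"
        using s_eq[OF y] xloD(1)[OF y(1)] by (simp add: \<nu>_def)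
    qed
    show ?thesis
      unfolding uc ev_NR[OF XX X Z incl(1) g c]
      by (rule ev_cong[OF iso xres_norm_xbispans[OF XX X Z incl(1) g], symmetric])
  qed
  have \<kappa>': "xrestr (\<lambda>y. \<not> Q y) \<kappa> \<in> xbispans G XX Z" by (rule xrestr_xbispans[OF \<kappa>]) (simp add: Qact)
  \<comment> \<open>The other terms are realized by a genuine bispan, so that its middle sets are
    G-sets to which the functor can be applied.\<close>
  obtain S where S: "S \<in> bispans G XX Z" "xiso G (xrestr (\<lambda>y. \<not> Q y) \<kappa>) (of_bispan S)"
    by (rule realization[OF \<kappa>'])
  define A B r m where "A = top1 S" and "B = top2 S" and "r = res_leg S" and "m = nm_leg S"
  note BS = bispansD(3-9)[OF S(1), folded A_def B_def r_def m_def]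
  have A: "finite_gset G A" and B: "finite_gset G B" and r: "r \<in> gset_hom G A XX"
    and m: "m \<in> gset_hom G A B" and t: "tr_leg S \<in> gset_hom G B Z"
    using BS by blast+
  define q where "q a \<longleftrightarrow> even (snd (r a))" for a
  have qact: "q (act A h a) \<longleftrightarrow> q a" if "h \<in> carrier G" "a \<in> points A" for h a
    using act_disjoint_union_parity[of "r a" X X h] hom_facts[OF r] that by (simp add: q_def XX_def)
  \<comment> \<open>\<open>A0\<close> holds the factors u and \<open>A1\<close> the factors b of the
    remaining terms.\<close>
  define A0 A1 where "A0 = subgset A q" and "A1 = subgset A (\<lambda>a. \<not> q a)"
  define r0 r1 m0 m1 where "r0 = restrict r (points A0)" and "r1 = restrict r (points A1)"
    and "m0 = restrict m (points A0)" and "m1 = restrict m (points A1)"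
  have A01: "finite_gset G A0" "finite_gset G A1"
    unfolding A0_def A1_def by (rule finite_gset_subgset[OF A]; simp add: qact)+
  have hom01: "r0 \<in> gset_hom G A0 XX" "r1 \<in> gset_hom G A1 XX" "m0 \<in> gset_hom G A0 B" "m1 \<in> gset_hom G A1 B"
    using subgset_hom[OF A r, of q] subgset_hom[OF A r, of "\<lambda>a. \<not> q a"]
      subgset_hom[OF A m, of q] subgset_hom[OF A m, of "\<lambda>a. \<not> q a"] qact
    unfolding A0_def A1_def r0_def r1_def m0_def m1_def by simp_all
  have second: "ev XX Z (xrestr (\<lambda>y. \<not> Q y) \<kappa>) c =
      farr F (pg_T G B Z (tr_leg S)) (farr F (pg_N G A0 B m0) (farr F (pg_R G A0 XX r0) c) \<otimes>\<^bsub>L B\<^esub>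
        farr F (pg_N G A1 B m1) (farr F (pg_R G A1 XX r1) c))"
    unfolding ev_cong[OF S(2) \<kappa>'] ev_TNR[OF S(1) c] A_def[symmetric] B_def[symmetric]
      r_def[symmetric] m_def[symmetric] ev_NR[OF XX A B r m c]
      ev_NR[OF XX A01(1) B hom01(1,3) c] ev_NR[OF XX A01(2) B hom01(2,4) c]
    using ev_usplit[OF XX A B r m c, of q] qact by (simp add: A0_def A1_def r0_def r1_def m0_def m1_def)
  define \<rho>0 \<rho>1 where "\<rho>0 = (\<lambda>a\<in>points A0. untag_point (r a))" and "\<rho>1 = (\<lambda>a\<in>points A1. untag_point (r a))"
  have rc: "r a = inl_point (untag_point (r a)) \<and> untag_point (r a) \<in> points X" if "a \<in> points A" "q a" for a
    using hom_facts(1)[OF r that(1)] that(2) unfolding XX_def q_def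
    by (elim disjoint_union_cases) simp_all
  have rc': "r a = inr_point (untag_point (r a)) \<and> untag_point (r a) \<in> points X" if "a \<in> points A" "\<not> q a" for a
    using hom_facts(1)[OF r that(1)] that(2) unfolding XX_def q_def
    by (elim disjoint_union_cases) simp_all
  have unt: "untag_point (act XX h w) = act X h (untag_point w)" if "w \<in> points XX" for h w
    using that unfolding XX_def by (elim disjoint_union_cases) simp_all
  have \<rho>0: "\<rho>0 \<in> gset_hom G A0 X"
    by (rule gset_homI)
      (use rc qact in \<open>simp_all add: \<rho>0_def A0_def hom_facts[OF r] gset_facts[OF A] unt\<close>)
  have \<rho>1: "\<rho>1 \<in> gset_hom G A1 X"
    by (rule gset_homI)
      (use rc' qact in \<open>simp_all add: \<rho>1_def A1_def hom_facts[OF r] gset_facts[OF A] unt\<close>)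
  have "gset_comp A0 (incl_left X) \<rho>0 = r0"
  proof (rule hom_eqI[where X = A0])
    fix a assume "a \<in> points A0"
    then have a: "a \<in> points A0" "a \<in> points A" "q a" by (simp_all add: A0_def)
    show "gset_comp A0 (incl_left X) \<rho>0 a = r0 a"
      using a rc[OF a(2,3)] by (simp add: \<rho>0_def r0_def)
  qed (simp_all add: r0_def)
  then have R0: "farr F (pg_R G A0 XX r0) c = farr F (pg_R G A0 X \<rho>0) u"
    using R_comp[OF A01(1) X XX \<rho>0 incl(1) c] uc by simp
  have "gset_comp A1 (incl_right X) \<rho>1 = r1"
  proof (rule hom_eqI[where X = A1])
    fix a assume "a \<in> points A1"
    then have a: "a \<in> points A1" "a \<in> points A" "\<not> q a" by (simp_all add: A1_def)
    show "gset_comp A1 (incl_right X) \<rho>1 a = r1 a"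
      using a rc'[OF a(2,3)] by (simp add: \<rho>1_def r1_def)
  qed (simp_all add: r1_def)
  then have R1: "farr F (pg_R G A1 XX r1) c = farr F (pg_R G A1 X \<rho>1) b"
    using R_comp[OF A01(2) X XX \<rho>1 incl(2) c] bc by simp
  \<comment> \<open>A fibre of \<open>A0\<close> injects into the elements of a fibre of g at which
    the choice is u. At least one element is missing since the choice is not constantly u, and so
    the induction hypothesis applies to the norm along \<open>m0\<close>.\<close>
  have small: "card {a \<in> points A0. m0 a = \<epsilon>} < n" if \<epsilon>: "\<epsilon> \<in> points B" for \<epsilon>
  proof -
    obtain i i' j j' where v: "xiso_via G (of_bispan S) (xrestr (\<lambda>y. \<not> Q y) \<kappa>) i i' j j'"
      using xiso_obtain_via[OF S(2) \<kappa>'] by metis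
    note W = xiso_viaD[OF v, simplified, folded A_def B_def r_def m_def]
    have j: "j \<epsilon> \<in> xlo \<nu> \<tau>" "\<not> Q (j \<epsilon>)" using W(5)[OF \<epsilon>] by (simp_all add: \<kappa>_def)
    define K where "K = {k \<in> xfib \<nu> (fst (j \<epsilon>)). even (snd (snd (j \<epsilon>) k))}"
    have finK: "finite (xfib \<nu> (fst (j \<epsilon>)))" using gset_facts(1)[OF X] by (simp add: fib)
    have ia: "fst (i a) = j \<epsilon>" "fst (snd (i a)) \<in> K" "snd (snd (i a)) = snd (j \<epsilon>) (fst (snd (i a)))"
      if "a \<in> {a \<in> points A0. m0 a = \<epsilon>}" for a
    proof -
      have a: "a \<in> points A" "q a" using that by (simp_all add: A0_def)
      have am: "m a = \<epsilon>" using that a by (simp add: A0_def m0_def)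
      have w: "i a \<in> xup \<nu> \<tau>" using W(1)[OF a(1)] by (simp add: \<kappa>_def)
      show 1: "fst (i a) = j \<epsilon>" using W(4)[OF a(1)] am by (simp add: \<kappa>_def)
      show 2: "snd (snd (i a)) = snd (j \<epsilon>) (fst (snd (i a)))"
        using xupD(4)[OF w] 1 by (simp add: \<tau>_def)
      have "r a = snd (snd (i a))" using W(3)[OF a(1)] by (simp add: \<kappa>_def \<tau>_def)
      then show "fst (snd (i a)) \<in> K" using a(2) xupD(2)[OF w] 1 2 by (simp add: K_def q_def)
    qed
    have "inj_on (\<lambda>a. fst (snd (i a))) {a \<in> points A0. m0 a = \<epsilon>}"
    proof (rule inj_onI)
      fix a a' assume a: "a \<in> {a \<in> points A0. m0 a = \<epsilon>}" "a' \<in> {a \<in> points A0. m0 a = \<epsilon>}"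
        and e: "fst (snd (i a)) = fst (snd (i a'))"
      have "i a = i a'"
        by (intro prod_eqI) (simp_all only: ia[OF a(1)] ia[OF a(2)] e)
      moreover have "a \<in> points A" "a' \<in> points A" using a by (simp_all add: A0_def)
      ultimately show "a = a'" using W(2) by metis
    qed
    then have "card {a \<in> points A0. m0 a = \<epsilon>} \<le> card K"
      by (rule card_inj_on_le) (use ia finK in \<open>auto simp: K_def\<close>)
    also have "K \<subset> xfib \<nu> (fst (j \<epsilon>))" using j(2) by (auto simp: K_def Q_def)
    then have "card K < card (xfib \<nu> (fst (j \<epsilon>)))" using finK by (simp add: psubset_card_mono)
    also have "card (xfib \<nu> (fst (j \<epsilon>))) \<le> n"
      using Suc.prems(5)[of "fst (j \<epsilon>)"] xloD(1)[OF j(1)] by (simp add: fib) (simp add: \<nu>_def)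
    finally show ?thesis .
  qed
  have N0: "farr F (pg_N G A0 B m0) (farr F (pg_R G A0 X \<rho>0) u) \<in> D B"
    by (rule Suc.IH[OF A01(1) B hom01(3) R_D[OF A01(1) X \<rho>0 u] small])
  have N1: "farr F (pg_N G A1 B m1) (farr F (pg_R G A1 X \<rho>1) b) \<in> V B"
    by (rule V_comp[OF pg_TNR_hom(2)[OF A01(2) B hom01(4)] V_comp[OF pg_TNR_hom(3)[OF A01(2) X \<rho>1] ab(2)]])
  have rest: "ev XX Z (xrestr (\<lambda>y. \<not> Q y) \<kappa>) c \<in> D Z"
    unfolding second R0 R1 by (rule T_D[OF B Z t D_mult_V[OF B N0 N1]])
  have "farr F (pg_N G X Z g) a \<in> D Z"
    by (rule V_D[OF Z V_comp[OF pg_TNR_hom(2)[OF X Z g] ab(1)]])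
  then show ?case
    using D_diff[OF Z farr_TNR_in(2)[OF X Z g D_in[OF u]] rest] split first by simp
qed

lemma N_D:
  assumes "finite_gset G X" "finite_gset G Z" "g \<in> gset_hom G X Z" "u \<in> D X"
  shows "farr F (pg_N G X Z g) u \<in> D Z"
proof (rule N_D_aux[OF assms, where n = "Suc (card (points X))"])
  show "card {y \<in> points X. g y = z} < Suc (card (points X))" for z
    using gset_facts(1)[OF assms(1)] by (simp add: less_Suc_eq_le card_mono)
qed

lemma arr_D:
  assumes "\<alpha> \<in> pg_hom G X Y" "u \<in> D X"
  shows "farr F \<alpha> u \<in> D Y"
proof -
  obtain S where S: "S \<in> bispans G X Y" "\<And>a. farr F \<alpha> a = ev X Y (of_bispan S) a"
    using farr_ev[OF assms(1)] by metis
  note B = bispansD(3-9)[OF S(1)]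
  show ?thesis
    unfolding S(2) ev_TNR[OF S(1) D_in[OF assms(2)]]
    by (rule T_D[OF B(3,4,7) N_D[OF B(2,3,6) R_D[OF B(2,1,5) assms(2)]]])
qed

text \<open>With a = u - v and b = s - t, the pairings of (u, s) and of (v, t) lie in
  \<open>V\<close>. Restrictions are additive and the two projections jointly injective, so the
  pairing of a and b is the difference of these two.\<close>

lemma D_pairing:
  assumes X: "finite_gset G X" and Y: "finite_gset G Y" and a: "a \<in> D X" and b: "b \<in> D Y"
  shows "pairing G F X Y a b \<in> D (disjoint_union X Y)"
proof -
  let ?XY = "disjoint_union X Y"
  note XY = finite_gset_disjoint_union[OF X Y]
  obtain u v where 1: "u \<in> V X" "v \<in> V X" "a \<oplus>\<^bsub>L X\<^esub> v = u" using a by (rule D_E)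
  obtain s t where 2: "s \<in> V Y" "t \<in> V Y" "b \<oplus>\<^bsub>L Y\<^esub> t = s" using b by (rule D_E)
  have ex: "\<exists>w\<in>V ?XY. proj_pair G F X Y w = (p, q)" if "p \<in> V X" "q \<in> V Y" for p q
    using that by (elim V_E) (metis proj_pair_ev x V_ev xcop_xbispans)
  obtain U where U: "U \<in> V ?XY" "proj_pair G F X Y U = (u, s)" using ex[OF 1(1) 2(1)] by blast
  obtain W where W: "W \<in> V ?XY" "proj_pair G F X Y W = (v, t)" using ex[OF 1(2) 2(2)] by blast
  note p = pairing[OF X Y D_in[OF a] D_in[OF b]]
  interpret R: cring "L ?XY" by (rule cring_L[OF XY])
  have add: "pairing G F X Y a b \<oplus>\<^bsub>L ?XY\<^esub> W \<in> fobj F ?XY"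
    using R.add.m_closed[of "pairing G F X Y a b" W] p(1) V_in[OF W(1)] by simp
  have "proj_pair G F X Y (pairing G F X Y a b \<oplus>\<^bsub>L ?XY\<^esub> W) = proj_pair G F X Y U"
    using p(2) W(2) U(2) 1(3) 2(3)
    unfolding proj_pair_def R_add[OF XY X incl_hom(1)[OF X Y] p(1) V_in[OF W(1)]]
      R_add[OF XY Y incl_hom(2)[OF X Y] p(1) V_in[OF W(1)]] by simp
  then have "pairing G F X Y a b \<oplus>\<^bsub>L ?XY\<^esub> W = U"
    using proj_pair_bij[OF X Y] add V_in[OF U(1)] by (auto simp: bij_betw_def inj_on_def)
  then show ?thesis using DI[OF p(1) U(1) W(1)] by simp
qed

section \<open>The subfunctor of differences\<close>

definition F0 where "F0 = \<lparr>fobj = D, farr = farr F\<rparr>"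

lemma F0_simps [simp]: "fobj F0 = D" "farr F0 = farr F" "proj_pair G F0 = proj_pair G F"
  by (simp_all add: F0_def proj_pair_def fun_eq_iff)

lemma pairing_F0:
  assumes X: "finite_gset G X" and Y: "finite_gset G Y" and a: "a \<in> D X" and b: "b \<in> D Y"
  shows "pairing G F0 X Y a b = pairing G F X Y a b"
proof -
  note p = pairing[OF X Y D_in[OF a] D_in[OF b]]
  have "inj_on (proj_pair G F X Y) (D (disjoint_union X Y))"
    using proj_pair_bij[OF X Y] D_in unfolding bij_betw_def by (meson inj_on_subset subsetI)
  then have "the_inv_into (D (disjoint_union X Y)) (proj_pair G F X Y) (proj_pair G F X Y (pairing G F X Y a b))
      = pairing G F X Y a b"
    by (rule the_inv_into_f_f) (rule D_pairing[OF assms])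
  then show ?thesis by (simp add: pairing_def[of G F0] p(2))
qed

lemma empty_D: "fobj F empty_gset = D empty_gset"
proof -
  obtain e where e: "fobj F empty_gset = {e}" using prods by (auto simp: product_preserving_def)
  have "D empty_gset \<subseteq> {e}" using D_in e by blast
  moreover have "\<zero>\<^bsub>L empty_gset\<^esub> \<in> D empty_gset"
    by (rule V_D[OF empty_gset(1) V_zero[OF empty_gset(1)]])
  ultimately show ?thesis unfolding e by (metis subset_singletonD empty_iff)
qed

lemma cring_F0:
  assumes X: "finite_gset G X"
  shows "cring (level_ring G F0 X)"
proof -
  interpret R: cring "L X" by (rule cring_L[OF X])
  have c: "cring (L X \<lparr>carrier := D X\<rparr>)"
    using R.subcring_iff[of "D X"] subcring_D[OF X] D_in by auto
  \<comment> \<open>The operations of the two rings need only agree on \<open>D X\<close>, since the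
    pairings of F and \<open>F0\<close> may differ elsewhere. Hence an isomorphism in place of an
    equation.\<close>
  have "(\<lambda>a. a) \<in> ring_iso (L X \<lparr>carrier := D X\<rparr>) (level_ring G F0 X)"
    by (rule ring_iso_memI) (simp_all add: level_ring_def pairing_F0[OF X X] empty_D bij_betw_def)
  from cring.ring_iso_imp_img_cring[OF c this] show ?thesis
    by (simp add: level_ring_def empty_D)
qed

lemma tambara_F0: "tambara_functor G F0"
  unfolding tambara_functor_def
proof (intro conjI allI impI)
  show "is_functor G F0"
    using is_functor arr_D D_in unfolding is_functor_def by (simp add: Pi_iff)
  show "product_preserving G F0"
    unfolding product_preserving_def
  proof (intro conjI allI impI)
    show "\<exists>a. fobj F0 empty_gset = {a}"
      using prods by (simp add: product_preserving_def empty_D)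
    fix X Y :: "'a gset" assume X: "finite_gset G X" and Y: "finite_gset G Y"
    note XY = finite_gset_disjoint_union[OF X Y]
    have "inj_on (proj_pair G F X Y) (D (disjoint_union X Y))"
      using proj_pair_bij[OF X Y] D_in unfolding bij_betw_def by (meson inj_on_subset subsetI)
    moreover have "proj_pair G F X Y ` D (disjoint_union X Y) = D X \<times> D Y"
    proof (intro equalityI subsetI)
      fix z assume "z \<in> proj_pair G F X Y ` D (disjoint_union X Y)"
      then show "z \<in> D X \<times> D Y"
        using R_D[OF X XY incl_hom(1)[OF X Y]] R_D[OF Y XY incl_hom(2)[OF X Y]]
        by (auto simp: proj_pair_def)
    next
      fix z assume "z \<in> D X \<times> D Y"
      then obtain a b where z: "z = (a, b)" "a \<in> D X" "b \<in> D Y" by blast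
      then show "z \<in> proj_pair G F X Y ` D (disjoint_union X Y)"
        using D_pairing[OF X Y z(2,3)] pairing(2)[OF X Y D_in[OF z(2)] D_in[OF z(3)]]
        by (intro image_eqI[of _ _ "pairing G F X Y a b"]) simp_all
    qed
    ultimately show "bij_betw (proj_pair G F0 X Y) (fobj F0 (disjoint_union X Y)) (fobj F0 X \<times> fobj F0 Y)"
      by (simp add: bij_betw_def)
  qed
qed (rule cring_F0)

end

text \<open>The map \<eta> into the subfunctor that classifies x, followed by the inclusion
  \<theta>, again classifies x. By injectivity of \<Phi> it is the identity \<iota>, so the
  inclusion is onto. The subfunctor takes its values in the same type as A, so \<Phi> applies to
  it.\<close>

lemma free_tambara_generated:
  assumes G: "group G" and free: "free_tambara_functor G A"
    and pt: "finite_gset G (coset_gset G (carrier G))"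
  obtains x where "x \<in> fobj A (coset_gset G (carrier G))"
    "\<And>X. finite_gset G X \<Longrightarrow> fobj A X = tambara_elt.D G A (coset_gset G (carrier G)) x X"
proof -
  define Pt where "Pt = coset_gset G (carrier G)"
  have tA: "tambara_functor G A" using free by (simp add: free_tambara_functor_def)
  interpret T: tambara G A using G tA by (simp add: tambara_def tambara_axioms_def)
  from free obtain \<Phi> :: "('a, 'c) pg_functor \<Rightarrow> ('a gset \<Rightarrow> 'c \<Rightarrow> 'c) \<Rightarrow> 'c"
    where bij: "\<And>T. tambara_functor G T \<Longrightarrow> bij_betw (\<Phi> T) (tambara_hom G A T) (fobj T Pt)"
      and nat: "\<And>T T' \<theta> \<eta>. \<lbrakk>tambara_functor G T; tambara_functor G T'; \<theta> \<in> tambara_hom G T T';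
        \<eta> \<in> tambara_hom G A T\<rbrakk> \<Longrightarrow> \<Phi> T' (tambara_comp G A \<theta> \<eta>) = \<theta> Pt (\<Phi> T \<eta>)"
    unfolding free_tambara_functor_def Pt_def by blast
  define \<iota> where "\<iota> = (\<lambda>X\<in>{X. finite_gset G X}. \<lambda>a\<in>fobj A X. a)"
  have \<iota>: "\<iota> \<in> tambara_hom G A A"
    using T.farr_in by (auto simp: tambara_hom_def \<iota>_def)
  define x where "x = \<Phi> A \<iota>"
  have x: "x \<in> fobj A Pt" using bij[OF tA] \<iota> by (auto simp: x_def bij_betw_def)
  interpret E: tambara_elt G A Pt x
    by unfold_locales (use pt x Pt_def in auto)
  define \<theta> where "\<theta> = (\<lambda>X\<in>{X. finite_gset G X}. \<lambda>a\<in>E.D X. a)"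
  have \<theta>: "\<theta> \<in> tambara_hom G E.F0 A"
    using E.arr_D E.D_in by (auto simp: tambara_hom_def \<theta>_def)
  have xD: "x \<in> E.D Pt"
  proof -
    have i: "gset_id Pt \<in> gset_hom G Pt Pt" by (rule T.gset_id_hom[OF E.P])
    \<comment> \<open>x is its own value under the identity bispan, which is also the transfer along
      the identity map.\<close>
    have "pg_id G Pt = pg_T G Pt Pt (gset_id Pt)" by (simp add: pg_id_def pg_T_def)
    moreover have "farr A (pg_id G Pt) x = x"
      using T.is_functor E.P x unfolding is_functor_def by blast
    ultimately have "farr A (pg_T G Pt Pt (gset_id Pt)) x = x" by simp
    then show ?thesis
      using E.V_D[OF E.P] E.pg_TNR_hom(1)[OF E.P E.P i] unfolding E.V_def by force
  qed
  have "x \<in> \<Phi> E.F0 ` tambara_hom G A E.F0"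
    using bij_betw_imp_surj_on[OF bij[OF E.tambara_F0]] xD by simp
  then obtain \<eta> where "x = \<Phi> E.F0 \<eta>" and \<eta>: "\<eta> \<in> tambara_hom G A E.F0"
    by (rule imageE)
  then have \<eta>x: "\<Phi> E.F0 \<eta> = x" by simp
  have comp: "tambara_comp G A \<theta> \<eta> \<in> tambara_hom G A A"
  proof -
    have \<eta>X: "\<eta> X a \<in> E.D X" if "finite_gset G X" "a \<in> fobj A X" for X a
      using \<eta> that by (auto simp: tambara_hom_def PiE_iff)
    have "\<eta> Y (farr A \<alpha> a) = farr A \<alpha> (\<eta> X a)"
      if "finite_gset G X" "finite_gset G Y" "\<alpha> \<in> pg_hom G X Y" "a \<in> fobj A X" for X Y \<alpha> a
      using \<eta> that by (simp add: tambara_hom_def)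
    then show ?thesis
      using \<eta>X E.D_in T.farr_in E.arr_D
      by (auto simp: tambara_hom_def tambara_comp_def \<theta>_def compose_def)
  qed
  have "\<Phi> A (tambara_comp G A \<theta> \<eta>) = \<theta> Pt (\<Phi> E.F0 \<eta>)"
    by (rule nat[OF E.tambara_F0 tA \<theta> \<eta>])
  also have "\<dots> = x" using xD E.P by (simp add: \<eta>x \<theta>_def)
  finally have "\<Phi> A (tambara_comp G A \<theta> \<eta>) = \<Phi> A \<iota>" unfolding x_def .
  then have eq: "tambara_comp G A \<theta> \<eta> = \<iota>"
    using bij[OF tA] comp \<iota> by (auto simp: bij_betw_def inj_on_def)
  have "fobj A X = E.D X" if X: "finite_gset G X" for X
  proof (intro equalityI subsetI)
    fix a assume a: "a \<in> fobj A X"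
    have \<eta>a: "\<eta> X a \<in> E.D X" using \<eta> X a by (auto simp: tambara_hom_def PiE_iff)
    have "tambara_comp G A \<theta> \<eta> X a = \<eta> X a" using X a \<eta>a by (simp add: tambara_comp_def \<theta>_def compose_def)
    then show "a \<in> E.D X" using \<eta>a eq X a by (simp add: \<iota>_def)
  qed (rule E.D_in)
  then show thesis using that x by (simp add: Pt_def)
qed

section \<open>The relation between multiples of an orbit\<close>

text \<open>
  Below, \<open>\<beta>\<close> is \<open>E \<rightarrow> B \<rightarrow> X\<close>, \<open>\<Gamma> k\<close> is \<open>C + k D' \<rightarrow> B \<rightarrow> X\<close>, and \<open>\<Psi> i\<close> is the part of \<open>D'\<close> over \<open>S\<close>, with
  \<open>S\<close> running through the \<open>i\<close>-element subsets of the fibres of \<open>B \<rightarrow> X\<close>. The product of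
  \<open>\<Gamma> (d - i)\<close> and \<open>\<Psi> i\<close> is \<open>W i\<close>, which lies over the pairs \<open>(b, S)\<close> with \<open>b\<close> and \<open>S\<close> in the same fibre.
  Its pairs are sorted by whether the stabilizer of \<open>b\<close> fixes \<open>S\<close> (\<open>fixd\<close>) and whether \<open>b \<in> S\<close> (\<open>memb\<close>).
\<close>

datatype 'c part = Rest 'c | Copy 'c nat | Sel 'c

text \<open>Since P has only one point, the restriction leg carries no information
  (\<open>rleg_o0\<close>), and factors are distinguished only by the lower point beneath them and
  the action.\<close>

locale orbit_relation = tambara_elt +
  fixes X and \<beta> :: "('a, 'p, 'q) xbispan" and C D' :: "'p set" and d :: nat
  assumes \<beta>: "\<beta> \<in> xbispans G P X"
    and C: "C \<subseteq> up \<beta>" "\<And>g c. \<lbrakk>g \<in> carrier G; c \<in> C\<rbrakk> \<Longrightarrow> up_act \<beta> g c \<in> C"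
    and D': "D' \<subseteq> up \<beta>" "\<And>g c. \<lbrakk>g \<in> carrier G; c \<in> D'\<rbrakk> \<Longrightarrow> up_act \<beta> g c \<in> D'"
    and P1: "is_singleton (points P)"
begin

abbreviation "m \<equiv> nleg \<beta>"
abbreviation "t \<equiv> tleg \<beta>"
abbreviation "ua \<equiv> up_act \<beta>"
abbreviation "la \<equiv> lo_act \<beta>"

lemmas XF = xbispan_facts[OF \<beta>]
lemmas XD = xbispansD[OF \<beta>]

definition o0 where "o0 = the_elem (points P)"

lemma o0: "points P = {o0}"
  using P1 by (simp add: o0_def is_singleton_the_elem)

lemma act_o0: "g \<in> carrier G \<Longrightarrow> act P g o0 = o0"
  using gset_facts(3)[OF P, of g o0] o0 by simp

lemma rleg_o0: "a \<in> up \<beta> \<Longrightarrow> rleg \<beta> a = o0"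
  using XF(1)[of a] o0 by simp

fun pmap :: "('p \<Rightarrow> 'p) \<Rightarrow> 'p part \<Rightarrow> 'p part" where
  "pmap f (Rest c) = Rest (f c)" | "pmap f (Copy c j) = Copy (f c) j" | "pmap f (Sel c) = Sel (f c)"

text \<open>The fibre over (b, S) in the upper set of \<open>W\<close>: the fibre of C at b, k
  copies of the fibre of D' at b, and one fibre of D' for each element of S. For empty S no
  \<open>Sel\<close> occurs, and the fibre of \<open>\<Gamma> k\<close> at b remains.\<close>

fun okpart :: "nat \<Rightarrow> 'q \<Rightarrow> 'q set \<Rightarrow> 'p part \<Rightarrow> bool" where
  "okpart k b S (Rest c) \<longleftrightarrow> c \<in> C \<and> m c = b"
| "okpart k b S (Copy c j) \<longleftrightarrow> c \<in> D' \<and> m c = b \<and> j < k"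
| "okpart k b S (Sel c) \<longleftrightarrow> c \<in> D' \<and> m c \<in> S"

definition subs :: "nat \<Rightarrow> 'a point \<Rightarrow> 'q set set" where
  "subs i y = {S. S \<subseteq> {b \<in> lo \<beta>. t b = y} \<and> card S = i}"

definition W :: "nat \<Rightarrow> ('a, ('q \<times> 'q set) \<times> 'p part, 'q \<times> 'q set) xbispan" where
  "W i = \<lparr>up = {w. fst (fst w) \<in> lo \<beta> \<and> snd (fst w) \<in> subs i (t (fst (fst w))) \<and>
              okpart (d - i) (fst (fst w)) (snd (fst w)) (snd w)},
     up_act = \<lambda>g w. ((la g (fst (fst w)), la g ` snd (fst w)), pmap (ua g) (snd w)),
     lo = {y. fst y \<in> lo \<beta> \<and> snd y \<in> subs i (t (fst y))},
     lo_act = \<lambda>g y. (la g (fst y), la g ` snd y),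
     rleg = \<lambda>_. o0, nleg = fst, tleg = \<lambda>y. t (fst y)\<rparr>"

definition \<Gamma> :: "nat \<Rightarrow> ('a, 'q \<times> 'p part, 'q) xbispan" where
  "\<Gamma> k = \<lparr>up = {w. fst w \<in> lo \<beta> \<and> okpart k (fst w) {} (snd w)},
     up_act = \<lambda>g w. (la g (fst w), pmap (ua g) (snd w)), lo = lo \<beta>, lo_act = la,
     rleg = \<lambda>_. o0, nleg = fst, tleg = t\<rparr>"

definition \<Psi> :: "nat \<Rightarrow> ('a, ('a point \<times> 'q set) \<times> 'p, 'a point \<times> 'q set) xbispan" where
  "\<Psi> i = \<lparr>up = {w. fst (fst w) \<in> points X \<and> snd (fst w) \<in> subs i (fst (fst w)) \<and>
              snd w \<in> D' \<and> m (snd w) \<in> snd (fst w)},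
     up_act = \<lambda>g w. ((act X g (fst (fst w)), la g ` snd (fst w)), ua g (snd w)),
     lo = {y. fst y \<in> points X \<and> snd y \<in> subs i (fst y)},
     lo_act = \<lambda>g y. (act X g (fst y), la g ` snd y),
     rleg = \<lambda>_. o0, nleg = fst, tleg = fst\<rparr>"

lemma W_simps [simp]:
  "up (W i) = {w. fst (fst w) \<in> lo \<beta> \<and> snd (fst w) \<in> subs i (t (fst (fst w))) \<and>
              okpart (d - i) (fst (fst w)) (snd (fst w)) (snd w)}"
  "up_act (W i) = (\<lambda>g w. ((la g (fst (fst w)), la g ` snd (fst w)), pmap (ua g) (snd w)))"
  "lo (W i) = {y. fst y \<in> lo \<beta> \<and> snd y \<in> subs i (t (fst y))}"
  "lo_act (W i) = (\<lambda>g y. (la g (fst y), la g ` snd y))"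
  "rleg (W i) = (\<lambda>_. o0)" "nleg (W i) = fst" "tleg (W i) = (\<lambda>y. t (fst y))"
  by (simp_all add: W_def)

lemma \<Gamma>_simps [simp]:
  "up (\<Gamma> k) = {w. fst w \<in> lo \<beta> \<and> okpart k (fst w) {} (snd w)}"
  "up_act (\<Gamma> k) = (\<lambda>g w. (la g (fst w), pmap (ua g) (snd w)))" "lo (\<Gamma> k) = lo \<beta>" "lo_act (\<Gamma> k) = la"
  "rleg (\<Gamma> k) = (\<lambda>_. o0)" "nleg (\<Gamma> k) = fst" "tleg (\<Gamma> k) = t"
  by (simp_all add: \<Gamma>_def)

lemma \<Psi>_simps [simp]:
  "up (\<Psi> i) = {w. fst (fst w) \<in> points X \<and> snd (fst w) \<in> subs i (fst (fst w)) \<and>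
              snd w \<in> D' \<and> m (snd w) \<in> snd (fst w)}"
  "up_act (\<Psi> i) = (\<lambda>g w. ((act X g (fst (fst w)), la g ` snd (fst w)), ua g (snd w)))"
  "lo (\<Psi> i) = {y. fst y \<in> points X \<and> snd y \<in> subs i (fst y)}"
  "lo_act (\<Psi> i) = (\<lambda>g y. (act X g (fst y), la g ` snd y))"
  "rleg (\<Psi> i) = (\<lambda>_. o0)" "nleg (\<Psi> i) = fst" "tleg (\<Psi> i) = fst"
  by (simp_all add: \<Psi>_def)

lemma subsD:
  assumes "S \<in> subs i y"
  shows "S \<subseteq> lo \<beta>" "\<And>b. b \<in> S \<Longrightarrow> b \<in> lo \<beta>" "\<And>b. b \<in> S \<Longrightarrow> t b = y" "card S = i" "finite S"
  using assms XD(4) finite_subset[of S "lo \<beta>"] by (auto simp: subs_def)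

lemma subs_fin: "subs i y \<subseteq> Pow (lo \<beta>)"
  by (auto simp: subs_def)

lemma la_inj: "\<lbrakk>g \<in> carrier G; b \<in> lo \<beta>; b' \<in> lo \<beta>; la g b = la g b'\<rbrakk> \<Longrightarrow> b = b'"
  by (rule gact_inj[OF XD(6)])

lemma subs_act:
  assumes "S \<in> subs i y" "g \<in> carrier G"
  shows "la g ` S \<in> subs i (act X g y)"
proof -
  have "inj_on (la g) S" using subsD(2)[OF assms(1)] la_inj[OF assms(2)] by (auto simp: inj_on_def)
  then have "card (la g ` S) = i" using subsD(4)[OF assms(1)] by (simp add: card_image)
  moreover have "la g ` S \<subseteq> {b \<in> lo \<beta>. t b = act X g y}"
  proof
    fix z assume "z \<in> la g ` S"
    then obtain b where b: "b \<in> S" "z = la g b" by blast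
    then show "z \<in> {b \<in> lo \<beta>. t b = act X g y}"
      using XF(5,10)[OF assms(2) subsD(2)[OF assms(1) b(1)]] subsD(3)[OF assms(1) b(1)] by simp
  qed
  ultimately show ?thesis by (simp add: subs_def)
qed

lemma la_image_one: "S \<subseteq> lo \<beta> \<Longrightarrow> la \<one> ` S = S"
  using image_cong[OF refl, of S "la \<one>" "\<lambda>b. b"] XF(7) by (simp add: subset_iff)

lemma la_image_mult:
  assumes "g \<in> carrier G" "h \<in> carrier G" "S \<subseteq> lo \<beta>"
  shows "la (g \<otimes> h) ` S = la g ` la h ` S"
  unfolding image_image by (rule image_cong[OF refl]) (use XF(12)[OF assms(1,2)] assms(3) in blast)

lemma C_up: "c \<in> C \<Longrightarrow> c \<in> up \<beta>" and D_up: "c \<in> D' \<Longrightarrow> c \<in> up \<beta>"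
  using C(1) D'(1) by auto

lemma okpart_act:
  assumes "okpart k b S q" "g \<in> carrier G"
  shows "okpart k (la g b) (la g ` S) (pmap (ua g) q)"
  using assms by (cases q) (auto simp: C D' XF(9) C_up D_up)

lemma pmap_one: "okpart k b S q \<Longrightarrow> pmap (ua \<one>) q = q"
  by (cases q) (auto simp: XF(6) C_up D_up)

lemma pmap_mult:
  "\<lbrakk>okpart k b S q; g \<in> carrier G; h \<in> carrier G\<rbrakk> \<Longrightarrow> pmap (ua (g \<otimes> h)) q = pmap (ua g) (pmap (ua h) q)"
  by (cases q) (auto simp: XF(11) C_up D_up)

definition parts :: "nat \<Rightarrow> 'p part set" where
  "parts k = Rest ` C \<union> (\<lambda>w. Copy (fst w) (snd w)) ` (D' \<times> {..<k}) \<union> Sel ` D'"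

lemma parts_finite: "finite (parts k)"
  using finite_subset[OF C(1) XD(3)] finite_subset[OF D'(1) XD(3)] by (simp add: parts_def)

lemma okpart_parts: "okpart k b S q \<Longrightarrow> q \<in> parts k"
  by (cases q) (force simp: parts_def)+

lemma W_xbispans: "W i \<in> xbispans G P X"
proof (rule xbispansI[OF P XD(2)])
  have "lo (W i) \<subseteq> lo \<beta> \<times> Pow (lo \<beta>)"
  proof
    fix y assume "y \<in> lo (W i)"
    then show "y \<in> lo \<beta> \<times> Pow (lo \<beta>)"
      using subsD(1)[of "snd y" i "t (fst y)"] by (simp add: mem_Times_iff)
  qed
  then show l: "finite (lo (W i))" by (rule finite_subset) (simp add: XD(4))
  have "up (W i) \<subseteq> lo (W i) \<times> parts (d - i)" 
  proof
    fix w assume "w \<in> up (W i)"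
    then show "w \<in> lo (W i) \<times> parts (d - i)"
      using okpart_parts[of "d - i" "fst (fst w)" "snd (fst w)" "snd w"] by (simp add: mem_Times_iff)
  qed
  then show "finite (up (W i))" by (rule finite_subset) (use l parts_finite in blast)
  show "gact G (up (W i)) (up_act (W i))"
  proof (rule gactI)
    fix b assume b: "b \<in> up (W i)"
    have S: "snd (fst b) \<subseteq> lo \<beta>" using b subsD(1)[of "snd (fst b)" i "t (fst (fst b))"] by simp
    show "up_act (W i) \<one> b = b"
      using b S pmap_one[of "d - i" "fst (fst b)" "snd (fst b)"]
      by (cases b; cases "fst b") (simp add: XF la_image_one)
    show "up_act (W i) g b \<in> up (W i)" if "g \<in> carrier G" for g
      using b that by (simp add: XF subs_act okpart_act)
    show "up_act (W i) (g \<otimes> h) b = up_act (W i) g (up_act (W i) h b)"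
      if "g \<in> carrier G" "h \<in> carrier G" for g h
      using b S that pmap_mult[of "d - i" "fst (fst b)" "snd (fst b)"] by (simp add: XF la_image_mult)
  qed
  show "gact G (lo (W i)) (lo_act (W i))"
  proof (rule gactI)
    fix b assume b: "b \<in> lo (W i)"
    have S: "snd b \<subseteq> lo \<beta>" using b subsD(1)[of "snd b" i "t (fst b)"] by simp
    show "lo_act (W i) \<one> b = b" using b S by (simp add: XF la_image_one)
    show "lo_act (W i) g b \<in> lo (W i)" if "g \<in> carrier G" for g
      using b that by (simp add: XF subs_act)
    show "lo_act (W i) (g \<otimes> h) b = lo_act (W i) g (lo_act (W i) h b)"
      if "g \<in> carrier G" "h \<in> carrier G" for g h
      using b S that by (simp add: XF la_image_mult)
  qed
qed (simp_all add: gmap_def o0 act_o0 XF)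

lemma \<Gamma>_xbispans: "\<Gamma> k \<in> xbispans G P X"
proof (rule xbispansI[OF P XD(2)])
  have "up (\<Gamma> k) \<subseteq> lo \<beta> \<times> parts k" using okpart_parts by auto
  then show "finite (up (\<Gamma> k))" by (rule finite_subset) (use XD(4) parts_finite in blast)
  show "gact G (up (\<Gamma> k)) (up_act (\<Gamma> k))"
    using okpart_act[where S = "{}"]
    by (intro gactI) (auto simp: XF pmap_one pmap_mult prod_eq_iff)
qed (auto simp: gmap_def o0 act_o0 XF XD)

lemma \<Psi>_xbispans: "\<Psi> i \<in> xbispans G P X"
proof (rule xbispansI[OF P XD(2)])
  note X = XD(2)
  have "lo (\<Psi> i) \<subseteq> points X \<times> Pow (lo \<beta>)" using subs_fin by (simp add: subset_iff mem_Times_iff) blast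
  then show l: "finite (lo (\<Psi> i))" by (rule finite_subset) (simp add: XD(4) gset_facts(1)[OF X])
  have "up (\<Psi> i) \<subseteq> lo (\<Psi> i) \<times> D'" by (simp add: subset_iff mem_Times_iff)
  then show "finite (up (\<Psi> i))"
    by (rule finite_subset) (use l finite_subset[OF D'(1) XD(3)] in blast)
  show "gact G (up (\<Psi> i)) (up_act (\<Psi> i))"
  proof (rule gactI)
    fix b assume b: "b \<in> up (\<Psi> i)"
    have S: "snd (fst b) \<subseteq> lo \<beta>" using b subsD(1)[of "snd (fst b)" i "fst (fst b)"] by simp
    show "up_act (\<Psi> i) \<one> b = b"
      using b S by (cases b; cases "fst b") (simp add: XF D_up gset_facts[OF X] la_image_one)
    show "up_act (\<Psi> i) g b \<in> up (\<Psi> i)" if "g \<in> carrier G" for g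
      using b that by (simp add: XF subs_act D' D_up gset_facts[OF X])
    show "up_act (\<Psi> i) (g \<otimes> h) b = up_act (\<Psi> i) g (up_act (\<Psi> i) h b)"
      if "g \<in> carrier G" "h \<in> carrier G" for g h
      using b S that by (simp add: XF D_up la_image_mult gset_facts[OF X])
  qed
  show "gact G (lo (\<Psi> i)) (lo_act (\<Psi> i))"
  proof (rule gactI)
    fix b assume b: "b \<in> lo (\<Psi> i)"
    have S: "snd b \<subseteq> lo \<beta>" using b subsD(1)[of "snd b" i "fst b"] by simp
    show "lo_act (\<Psi> i) \<one> b = b" using b S by (simp add: la_image_one gset_facts[OF X])
    show "lo_act (\<Psi> i) g b \<in> lo (\<Psi> i)" if "g \<in> carrier G" for g
      using b that by (simp add: subs_act gset_facts[OF X])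
    show "lo_act (\<Psi> i) (g \<otimes> h) b = lo_act (\<Psi> i) g (lo_act (\<Psi> i) h b)"
      if "g \<in> carrier G" "h \<in> carrier G" for g h
      using b S that by (simp add: la_image_mult gset_facts[OF X])
  qed
qed (simp_all add: gmap_def o0 act_o0)

lemma \<Gamma>\<Psi>_iso: "xiso G (xprod (\<Gamma> (d - i)) (\<Psi> i)) (W i)"
proof (rule xisoI[where b = "\<lambda>y. (fst y, snd (snd y))" and b' = "\<lambda>y. (fst y, (t (fst y), snd y))"
      and a = "\<lambda>w. ((fst (fst w), snd (snd (fst w))), case_sum snd (\<lambda>z. Sel (snd z)) (snd w))"
      and a' = "\<lambda>w. ((fst (fst w), (t (fst (fst w)), snd (fst w))),
        case snd w of Sel c \<Rightarrow> Inr ((t (fst (fst w)), snd (fst w)), c) | _ \<Rightarrow> Inl (fst (fst w), snd w))"])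
  have np: "okpart k b S q" if "okpart k b {} q" for k b S q using that by (cases q) auto
  have ns: "\<not> okpart k b {} (Sel c)" for k b c by simp
  fix w assume w: "w \<in> up (xprod (\<Gamma> (d - i)) (\<Psi> i))"
  obtain b y S z where we: "w = ((b, (y, S)), z)" by (metis prod.exhaust)
  show "((fst (fst w), snd (snd (fst w))), case_sum snd (\<lambda>z. Sel (snd z)) (snd w)) \<in> up (W i) \<and>
     (\<lambda>w. ((fst (fst w), (t (fst (fst w)), snd (fst w))),
        case snd w of Sel c \<Rightarrow> Inr ((t (fst (fst w)), snd (fst w)), c) | _ \<Rightarrow> Inl (fst (fst w), snd w)))
      ((fst (fst w), snd (snd (fst w))), case_sum snd (\<lambda>z. Sel (snd z)) (snd w)) = w"
  proof (cases z)
    case (Inl u)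
    obtain b' q where u: "u = (b', q)" by (cases u)
    have h: "b \<in> lo \<beta>" "S \<in> subs i y" "t b = y" "b' = b" "okpart (d - i) b {} q"
      using w by (auto simp: we Inl u InlI elim!: PlusE)
    then show ?thesis using np[OF h(5)] ns by (cases q) (simp_all add: we Inl u)
  next
    case (Inr v)
    obtain y' S' c where v: "v = ((y', S'), c)" by (metis prod.exhaust)
    have h: "b \<in> lo \<beta>" "S \<in> subs i y" "t b = y" "y' = y" "S' = S" "c \<in> D'" "m c \<in> S"
      using w by (auto simp: we Inr v elim!: PlusE)
    then show ?thesis by (simp add: we Inr v)
  qed
  show "nleg (W i) ((fst (fst w), snd (snd (fst w))), case_sum snd (\<lambda>z. Sel (snd z)) (snd w)) =
      (fst (nleg (xprod (\<Gamma> (d - i)) (\<Psi> i)) w), snd (snd (nleg (xprod (\<Gamma> (d - i)) (\<Psi> i)) w)))"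
    by simp
  show "rleg (W i) ((fst (fst w), snd (snd (fst w))), case_sum snd (\<lambda>z. Sel (snd z)) (snd w)) =
      rleg (xprod (\<Gamma> (d - i)) (\<Psi> i)) w"
    by (simp split: sum.split)
  show "((fst (fst (up_act (xprod (\<Gamma> (d - i)) (\<Psi> i)) g w)), snd (snd (fst (up_act (xprod (\<Gamma> (d - i)) (\<Psi> i)) g w)))),
      case_sum snd (\<lambda>z. Sel (snd z)) (snd (up_act (xprod (\<Gamma> (d - i)) (\<Psi> i)) g w))) =
    up_act (W i) g ((fst (fst w), snd (snd (fst w))), case_sum snd (\<lambda>z. Sel (snd z)) (snd w))" for g
    by (cases "snd w") simp_all
next
  have np: "okpart k b {} q" if "okpart k b S q" "\<forall>c. q \<noteq> Sel c" for k b S q using that by (cases q) auto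
  fix w assume w: "w \<in> up (W i)"
  obtain b S q where we: "w = ((b, S), q)" by (metis prod.exhaust)
  have h: "b \<in> lo \<beta>" "S \<in> subs i (t b)" "okpart (d - i) b S q" using w by (simp_all add: we)
  show "((fst (fst w), (t (fst (fst w)), snd (fst w))),
        case snd w of Sel c \<Rightarrow> Inr ((t (fst (fst w)), snd (fst w)), c) | _ \<Rightarrow> Inl (fst (fst w), snd w))
       \<in> up (xprod (\<Gamma> (d - i)) (\<Psi> i)) \<and>
     (\<lambda>w. ((fst (fst w), snd (snd (fst w))), case_sum snd (\<lambda>z. Sel (snd z)) (snd w)))
      ((fst (fst w), (t (fst (fst w)), snd (fst w))),
        case snd w of Sel c \<Rightarrow> Inr ((t (fst (fst w)), snd (fst w)), c) | _ \<Rightarrow> Inl (fst (fst w), snd w)) = w"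
    using h XF(3)[OF h(1)] by (cases q) (simp_all add: we InlI InrI)
next
  fix y assume "y \<in> lo (xprod (\<Gamma> (d - i)) (\<Psi> i))"
  then show "(fst y, snd (snd y)) \<in> lo (W i) \<and>
     (\<lambda>y. (fst y, (t (fst y), snd y))) (fst y, snd (snd y)) = y"
    by (cases y; cases "snd y") simp
qed (simp_all add: XF(3))

section \<open>Sorting the pairs (b, S)\<close>

definition fixd :: "'q \<times> 'q set \<Rightarrow> bool" where
  "fixd y \<longleftrightarrow> (\<forall>g\<in>carrier G. la g (fst y) = fst y \<longrightarrow> la g ` snd y = snd y)"

definition memb :: "'q \<times> 'q set \<Rightarrow> bool" where
  "memb y \<longleftrightarrow> fst y \<in> snd y"

lemma memb_act:
  assumes g: "g \<in> carrier G" and y: "y \<in> lo (W i)"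
  shows "memb (lo_act (W i) g y) \<longleftrightarrow> memb y"
proof -
  have "la g (fst y) \<in> la g ` snd y \<longleftrightarrow> fst y \<in> snd y"
    using y la_inj[OF g] subsD(2)[of "snd y" i "t (fst y)"] by auto
  then show ?thesis by (simp add: memb_def)
qed

lemma fixd_act1:
  assumes g: "g \<in> carrier G" and y: "y \<in> lo (W i)" and f: "fixd y"
  shows "fixd (lo_act (W i) g y)"
  unfolding fixd_def
proof (intro ballI impI)
  have b: "fst y \<in> lo \<beta>" and S: "snd y \<subseteq> lo \<beta>"
    using y subsD(1)[of "snd y" i "t (fst y)"] by simp_all
  have gS: "la g ` snd y \<subseteq> lo \<beta>" using S XF(5)[OF g] by blast
  fix h assume h: "h \<in> carrier G" and e: "la h (fst (lo_act (W i) g y)) = fst (lo_act (W i) g y)"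
  \<comment> \<open>Conjugation by g carries the stabilizer of the translate of b back to the
    stabilizer of b.\<close>
  define k where "k = inv g \<otimes> (h \<otimes> g)"
  have k: "k \<in> carrier G" using g h by (simp add: k_def)
  have hg: "h \<otimes> g = g \<otimes> k" using g h m_assoc[of g "inv g" "h \<otimes> g"] by (simp add: k_def)
  have "la g (la k (fst y)) = la g (fst y)"
    using e b g h k by (simp flip: XF(12) add: hg)
  then have "la k (fst y) = fst y" using la_inj[OF g] XF(5)[OF k b] b by blast
  then have "la k ` snd y = snd y" using f k by (simp add: fixd_def)
  then show "la h ` snd (lo_act (W i) g y) = snd (lo_act (W i) g y)"
    using la_image_mult[OF h g S] la_image_mult[OF g k S] by (simp add: hg)
qed

lemma fixd_act:
  assumes g: "g \<in> carrier G" and y: "y \<in> lo (W i)"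
  shows "fixd (lo_act (W i) g y) \<longleftrightarrow> fixd y"
proof
  have W: "gact G (lo (W i)) (lo_act (W i))" by (rule xbispansD(6)[OF W_xbispans])
  assume "fixd (lo_act (W i) g y)"
  then have "fixd (lo_act (W i) (inv g) (lo_act (W i) g y))"
    by (rule fixd_act1[OF inv_closed[OF g] gact_closed[OF W g y]])
  then show "fixd y" using gact_inv(1)[OF W g y] by simp
qed (rule fixd_act1[OF g y])

abbreviation "W0 i \<equiv> xrestr (\<lambda>y. \<not> memb y) (xrestr fixd (W i))"
abbreviation "W1 i \<equiv> xrestr memb (xrestr fixd (W i))"
abbreviation "Wbad i \<equiv> xrestr (\<lambda>y. \<not> fixd y) (W i)"

lemma Wfix_xbispans: "xrestr fixd (W i) \<in> xbispans G P X" "Wbad i \<in> xbispans G P X"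
  by (rule xrestr_xbispans[OF W_xbispans], use fixd_act in blast)+

lemma Wfix_memb: "\<lbrakk>g \<in> carrier G; y \<in> lo (xrestr fixd (W i))\<rbrakk> \<Longrightarrow>
    memb (lo_act (xrestr fixd (W i)) g y) \<longleftrightarrow> memb y"
  using memb_act[of g y i] by simp

lemma W01_xbispans: "W0 i \<in> xbispans G P X" "W1 i \<in> xbispans G P X"
  by (rule xrestr_xbispans[OF Wfix_xbispans(1)], use Wfix_memb in blast)+

text \<open>Since \<open>W0 i\<close> is isomorphic to \<open>W1 (Suc i)\<close> by
  \<open>insert_iso\<close>, these relations telescope: the one for \<open>Suc i\<close> expresses
  \<open>W0 i\<close> by \<open>W0 (Suc i)\<close>, a product and bad pairs.\<close>

lemma product_relation:
  "ev P X (\<Gamma> (d - i)) x \<otimes>\<^bsub>L X\<^esub> ev P X (\<Psi> i) x =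
    (ev P X (W1 i) x \<oplus>\<^bsub>L X\<^esub> ev P X (W0 i) x) \<oplus>\<^bsub>L X\<^esub> ev P X (Wbad i) x"
proof -
  have "ev P X (\<Gamma> (d - i)) x \<otimes>\<^bsub>L X\<^esub> ev P X (\<Psi> i) x = ev P X (W i) x"
    using ev_mult[OF \<Gamma>_xbispans \<Psi>_xbispans x] ev_cong[OF \<Gamma>\<Psi>_iso xprod_xbispans[OF \<Gamma>_xbispans \<Psi>_xbispans]]
    by simp
  also have "\<dots> = ev P X (xrestr fixd (W i)) x \<oplus>\<^bsub>L X\<^esub> ev P X (Wbad i) x"
    by (rule ev_split[OF W_xbispans x fixd_act])
  also have "ev P X (xrestr fixd (W i)) x = ev P X (W1 i) x \<oplus>\<^bsub>L X\<^esub> ev P X (W0 i) x"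
    by (rule ev_split[OF Wfix_xbispans(1) x Wfix_memb])
  finally show ?thesis .
qed

text \<open>Adding \<open>b\<close> to \<open>S\<close> trades one of the \<open>d - i\<close> copies of the fibre of \<open>D'\<close> over \<open>b\<close> for the
  fibre over the new element of \<open>S\<close>.\<close>

lemma insert_iso:
  assumes i: "i < d"
  shows "xiso G (W0 i) (W1 (Suc i))"
proof -
  define k where "k = d - Suc i"
  have dk: "d - i = Suc k" "d - Suc i = k" using i by (simp_all add: k_def)
  \<comment> \<open>Only the last of the d - i copies, the one with index k, becomes
    \<open>Sel\<close>. The action preserves indices, so f is equivariant.\<close>
  define f where "f = (\<lambda>q :: 'p part. case q of Copy c j \<Rightarrow> if j < k then Copy c j else Sel c | _ \<Rightarrow> q)"
  define f' where "f' = (\<lambda>(b :: 'q) (q :: 'p part). case q of Sel c \<Rightarrow> if m c = b then Copy c k else Sel c | _ \<Rightarrow> q)"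
  have f1: "okpart k b (insert b S) (f q)" "f' b (f q) = q" if "okpart (Suc k) b S q" "b \<notin> S" for b S q
    using that by (cases q; auto simp: f_def f'_def)+
  have f2: "okpart (Suc k) b (S - {b}) (f' b q)" "f (f' b q) = q" if "okpart k b S q" "b \<in> S" for b S q
    using that by (cases q; auto simp: f_def f'_def)+
  have fact: "f (pmap h q) = pmap h (f q)" for h q by (cases q) (simp_all add: f_def)
  \<comment> \<open>A group element fixing b, where b is not in S, fixes S exactly when it fixes S
    with b added. So \<open>fixd\<close> passes in both directions, here and in
    \<open>rem\<close>.\<close>
  have ins: "insert b S \<in> subs (Suc i) (t b)" "fixd (b, insert b S)"
    if "b \<in> lo \<beta>" "S \<in> subs i (t b)" "fixd (b, S)" "b \<notin> S" for b S
  proof -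
    have "finite S" by (rule subsD(5)[OF that(2)])
    then show "insert b S \<in> subs (Suc i) (t b)" using that(1,2,4) by (simp add: subs_def)
    show "fixd (b, insert b S)" using that(3) by (simp add: fixd_def)
  qed
  have rem: "S - {b} \<in> subs i (t b)" "fixd (b, S - {b})"
    if "b \<in> lo \<beta>" "S \<in> subs (Suc i) (t b)" "fixd (b, S)" "b \<in> S" for b S
  proof -
    have "finite S" by (rule subsD(5)[OF that(2)])
    moreover have "S - {b} \<subseteq> {b' \<in> lo \<beta>. t b' = t b}" using that(2) unfolding subs_def by blast
    ultimately show "S - {b} \<in> subs i (t b)" using that(2,4) by (simp add: subs_def)
    show "fixd (b, S - {b})" unfolding fixd_def
    proof (intro ballI impI)
      fix g assume g: "g \<in> carrier G" and "la g (fst (b, S - {b})) = fst (b, S - {b})"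
      then have gb: "la g b = b" by simp
      then have gS: "la g ` S = S" using that(3) g by (simp add: fixd_def)
      have "la g ` (S - {b}) = la g ` S - la g ` {b}"
        by (rule inj_on_image_set_diff[where C = "lo \<beta>"])
          (use la_inj[OF g] subsD(1)[OF that(2)] that(1) in \<open>auto simp: inj_on_def\<close>)
      then show "la g ` snd (b, S - {b}) = snd (b, S - {b})" using gb gS by simp
    qed
  qed
  show ?thesis
  proof (rule xisoI[where b = "\<lambda>y. (fst y, insert (fst y) (snd y))" and b' = "\<lambda>y. (fst y, snd y - {fst y})"
      and a = "\<lambda>w. ((fst (fst w), insert (fst (fst w)) (snd (fst w))), f (snd w))"
      and a' = "\<lambda>w. ((fst (fst w), snd (fst w) - {fst (fst w)}), f' (fst (fst w)) (snd w))"])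
    fix w assume w: "w \<in> up (W0 i)"
    obtain b S q where we: "w = ((b, S), q)" by (metis prod.exhaust)
    have h: "b \<in> lo \<beta>" "S \<in> subs i (t b)" "okpart (Suc k) b S q" "fixd (b, S)" "b \<notin> S"
      using w by (simp_all add: we dk memb_def)
    show "((fst (fst w), insert (fst (fst w)) (snd (fst w))), f (snd w)) \<in> up (W1 (Suc i)) \<and>
      (\<lambda>w. ((fst (fst w), snd (fst w) - {fst (fst w)}), f' (fst (fst w)) (snd w)))
       ((fst (fst w), insert (fst (fst w)) (snd (fst w))), f (snd w)) = w"
      using h f1[OF h(3,5)] ins[OF h(1,2,4,5)] by (simp add: we dk memb_def)
  next
    fix w assume w: "w \<in> up (W1 (Suc i))"
    obtain b S q where we: "w = ((b, S), q)" by (metis prod.exhaust)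
    have h: "b \<in> lo \<beta>" "S \<in> subs (Suc i) (t b)" "okpart k b S q" "fixd (b, S)" "b \<in> S"
      using w by (simp_all add: we dk memb_def)
    show "((fst (fst w), snd (fst w) - {fst (fst w)}), f' (fst (fst w)) (snd w)) \<in> up (W0 i) \<and>
      (\<lambda>w. ((fst (fst w), insert (fst (fst w)) (snd (fst w))), f (snd w)))
       ((fst (fst w), snd (fst w) - {fst (fst w)}), f' (fst (fst w)) (snd w)) = w"
      using h f2[OF h(3,5)] rem[OF h(1,2,4,5)] by (simp add: we dk memb_def insert_absorb)
  next
    fix y assume y: "y \<in> lo (W0 i)"
    obtain b S where ye: "y = (b, S)" by (cases y)
    have h: "b \<in> lo \<beta>" "S \<in> subs i (t b)" "fixd (b, S)" "b \<notin> S"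
      using y by (simp_all add: ye memb_def)
    show "(fst y, insert (fst y) (snd y)) \<in> lo (W1 (Suc i)) \<and>
      (\<lambda>y. (fst y, snd y - {fst y})) (fst y, insert (fst y) (snd y)) = y"
      using h ins[OF h] by (simp add: ye memb_def)
  next
    fix y assume y: "y \<in> lo (W1 (Suc i))"
    obtain b S where ye: "y = (b, S)" by (cases y)
    have h: "b \<in> lo \<beta>" "S \<in> subs (Suc i) (t b)" "fixd (b, S)" "b \<in> S"
      using y by (simp_all add: ye memb_def)
    show "(fst y, snd y - {fst y}) \<in> lo (W0 i) \<and>
      (\<lambda>y. (fst y, insert (fst y) (snd y))) (fst y, snd y - {fst y}) = y"
      using h rem[OF h] by (simp add: ye memb_def insert_absorb)
  qed (simp_all add: fact)
qed

text \<open>The end of the telescope: a subset with d elements exhausts \<open>lo \<beta>\<close>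
  and cannot miss b.\<close>

lemma W0_top:
  assumes "card (lo \<beta>) \<le> d"
  shows "lo (W0 d) = {}"
proof -
  have "b \<in> S" if "b \<in> lo \<beta>" "S \<in> subs d (t b)" for b S
  proof -
    have "S = lo \<beta>" by (rule card_seteq[OF XD(4) subsD(1)[OF that(2)]]) (simp add: subsD(4)[OF that(2)] assms)
    then show ?thesis using that(1) by simp
  qed
  then show ?thesis by (auto simp: memb_def)
qed

text \<open>The beginning of the telescope: the only subset with no elements is empty, it is fixed
  by everything and misses b.\<close>

lemma W0_zero: "xiso G (\<Gamma> d) (W0 0)"
proof -
  have "S = {}" if "S \<in> subs 0 y" for S y using subsD(4,5)[OF that] by simp
  moreover have "{} \<in> subs 0 y" for y by (simp add: subs_def)
  ultimately have subs0: "subs 0 y = {{}}" for y by blast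
  have h: "fixd (b, {})" "\<not> memb (b, {})" for b by (simp_all add: fixd_def memb_def)
  show ?thesis
    by (rule xisoI[where b = "\<lambda>b. (b, {})" and b' = fst and a = "\<lambda>w. ((fst w, {}), snd w)"
          and a' = "\<lambda>w. (fst (fst w), snd w)"])
      (auto simp: subs0 h)
qed

end

section \<open>Finite generation\<close>

text \<open>Equal stabilizers make the map that sends the translate of a by g to the translate of a'
  by g well defined, so the two orbits are isomorphic. With a and a' exchanged it gives
  injectivity.\<close>

lemma (in group) gact_stab_eq:
  assumes "gact G B \<phi>" "a \<in> B" "a' \<in> B" "g \<in> carrier G" "h \<in> carrier G"
    and "{k \<in> carrier G. \<phi> k a = a} = {k \<in> carrier G. \<phi> k a' = a'}" and "\<phi> g a = \<phi> h a"
  shows "\<phi> g a' = \<phi> h a'"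
proof -
  have "\<phi> (inv h \<otimes> g) a = a"
    using assms(1-5,7) gact_inv(1)[OF assms(1,5,2)] by (simp add: gact_mult[OF assms(1)])
  then have "inv h \<otimes> g \<in> {k \<in> carrier G. \<phi> k a' = a'}" using assms(4-6) by blast
  then have "\<phi> h (\<phi> (inv h \<otimes> g) a') = \<phi> h a'" by simp
  moreover have "h \<otimes> (inv h \<otimes> g) = g" using assms(4,5) m_assoc[of h "inv h" g] by simp
  ultimately show ?thesis
    using assms(3-5) gact_mult[OF assms(1), of h "inv h \<otimes> g" a'] by simp
qed

definition gorb :: "('g, 'm) monoid_scheme \<Rightarrow> ('g \<Rightarrow> 'b \<Rightarrow> 'b) \<Rightarrow> 'b \<Rightarrow> 'b set" where
  "gorb G \<phi> b = (\<lambda>g. \<phi> g b) ` carrier G"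

lemma (in group) gorb_self: "\<lbrakk>gact G B \<phi>; b \<in> B\<rbrakk> \<Longrightarrow> b \<in> gorb G \<phi> b"
  unfolding gorb_def by (rule image_eqI[of _ _ \<one>]) (simp_all add: gact_one)

lemma (in group) gorb_sub: "\<lbrakk>gact G B \<phi>; b \<in> B\<rbrakk> \<Longrightarrow> gorb G \<phi> b \<subseteq> B"
  unfolding gorb_def by (auto simp: gact_closed)

lemma (in group) gorb_act:
  assumes "gact G B \<phi>" "b \<in> B" "g \<in> carrier G"
  shows "gorb G \<phi> (\<phi> g b) = gorb G \<phi> b"
proof (intro equalityI subsetI)
  fix y assume "y \<in> gorb G \<phi> (\<phi> g b)"
  then obtain h where "h \<in> carrier G" "y = \<phi> h (\<phi> g b)" by (auto simp: gorb_def)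
  then show "y \<in> gorb G \<phi> b"
    unfolding gorb_def using assms by (intro image_eqI[of _ _ "h \<otimes> g"]) (simp_all add: gact_mult)
next
  fix y assume "y \<in> gorb G \<phi> b"
  then obtain h where h: "h \<in> carrier G" "y = \<phi> h b" by (auto simp: gorb_def)
  have "\<phi> (h \<otimes> inv g) (\<phi> g b) = y"
    using assms h gact_inv(1)[OF assms(1,3,2)] gact_closed[OF assms(1,3,2)] by (simp add: gact_mult[OF assms(1)])
  then show "y \<in> gorb G \<phi> (\<phi> g b)"
    unfolding gorb_def using assms h by (intro image_eqI[of _ _ "h \<otimes> inv g"]) simp_all
qed

lemma (in group) gorb_mem_act:
  assumes "gact G B \<phi>" "b \<in> B" "y \<in> B" "g \<in> carrier G"
  shows "\<phi> g y \<in> gorb G \<phi> b \<longleftrightarrow> y \<in> gorb G \<phi> b"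
proof -
  have *: "z \<in> gorb G \<phi> b \<longleftrightarrow> gorb G \<phi> z = gorb G \<phi> b" if "z \<in> B" for z
  proof
    assume "z \<in> gorb G \<phi> b"
    then obtain h where "h \<in> carrier G" "z = \<phi> h b" by (auto simp: gorb_def)
    then show "gorb G \<phi> z = gorb G \<phi> b" using gorb_act[OF assms(1,2)] by simp
  qed (use gorb_self[OF assms(1) that] in blast)
  show ?thesis
    using *[OF assms(3)] *[OF gact_closed[OF assms(1,4,3)]] gorb_act[OF assms(1,3,4)] by simp
qed

text \<open>The parameter of the outermost induction: bad pairs decrease it.\<close>

definition stab_le :: "('g, 'm) monoid_scheme \<Rightarrow> nat \<Rightarrow> ('g, 'c, 'b) xbispan \<Rightarrow> bool" where
  "stab_le G n \<beta> \<longleftrightarrow> (\<forall>b\<in>lo \<beta>. card {g \<in> carrier G. lo_act \<beta> g b = b} \<le> n)"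

definition transitive_lo :: "('g, 'm) monoid_scheme \<Rightarrow> ('g, 'c, 'b) xbispan \<Rightarrow> bool" where
  "transitive_lo G \<beta> \<longleftrightarrow> (\<exists>b\<in>lo \<beta>. lo \<beta> \<subseteq> gorb G (lo_act \<beta>) b)"

lemma (in group) xiso_invariants:
  assumes "xiso G \<beta> \<gamma>" "\<beta> \<in> xbispans G X Y" "finite (carrier G)"
  shows "stab_le G n \<beta> \<Longrightarrow> stab_le G n \<gamma>" "transitive_lo G \<beta> \<Longrightarrow> transitive_lo G \<gamma>"
    "card (up \<gamma>) = card (up \<beta>)" "card (lo \<gamma>) = card (lo \<beta>)"
proof -
  obtain a a' b b' where v: "xiso_via G \<beta> \<gamma> a a' b b'" "xiso_via G \<gamma> \<beta> a' a b' b"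
    by (rule xiso_obtain_via[OF assms(1,2)])
  note V = xiso_viaD[OF v(1)] and U = xiso_viaD[OF v(2)]
  show "stab_le G n \<gamma>" if "stab_le G n \<beta>"
    unfolding stab_le_def
  proof
    fix c assume c: "c \<in> lo \<gamma>"
    have "{g \<in> carrier G. lo_act \<gamma> g c = c} \<subseteq> {g \<in> carrier G. lo_act \<beta> g (b' c) = b' c}"
    proof
      fix g assume "g \<in> {g \<in> carrier G. lo_act \<gamma> g c = c}"
      then show "g \<in> {g \<in> carrier G. lo_act \<beta> g (b' c) = b' c}" using U(9)[of g c] c by simp
    qed
    then have "card {g \<in> carrier G. lo_act \<gamma> g c = c} \<le> card {g \<in> carrier G. lo_act \<beta> g (b' c) = b' c}"
      by (rule card_mono[rotated]) (use assms(3) in simp)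
    also have "\<dots> \<le> n" using that U(5)[OF c] by (simp add: stab_le_def)
    finally show "card {g \<in> carrier G. lo_act \<gamma> g c = c} \<le> n" .
  qed
  show "transitive_lo G \<gamma>" if tr: "transitive_lo G \<beta>"
  proof -
    obtain c where c: "c \<in> lo \<beta>" "lo \<beta> \<subseteq> gorb G (lo_act \<beta>) c" using tr by (auto simp: transitive_lo_def)
    have "lo \<gamma> \<subseteq> gorb G (lo_act \<gamma>) (b c)"
    proof
      fix y assume y: "y \<in> lo \<gamma>"
      then have "b' y \<in> gorb G (lo_act \<beta>) c" using c(2) U(5) by blast
      then obtain g where g: "g \<in> carrier G" "b' y = lo_act \<beta> g c" by (auto simp: gorb_def)
      then have "y = lo_act \<gamma> g (b c)" using U(6)[OF y] V(9)[OF g(1) c(1)] by simp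
      then show "y \<in> gorb G (lo_act \<gamma>) (b c)" using g(1) by (auto simp: gorb_def)
    qed
    then show ?thesis using V(5)[OF c(1)] by (auto simp: transitive_lo_def)
  qed
  show "card (up \<gamma>) = card (up \<beta>)" "card (lo \<gamma>) = card (lo \<beta>)"
    using assms(1) unfolding xiso_def by (metis bij_betw_same_card)+
qed

text \<open>The origin of the bound is a triple pigeonhole. Translates of the fibre over
  \<open>b0\<close> by the |G| group elements cover \<open>up \<beta>\<close>; the points of this
  fibre have at most 2^|G| different stabilizers; and an orbit has at most |G| points. Equality of
  stabilizers, not just conjugacy, makes the chosen orbits isomorphic over
  \<open>lo \<beta>\<close>.\<close>

lemma (in group) many_orbits:
  fixes d :: nat
  assumes fin: "finite (carrier G)" and \<beta>: "\<beta> \<in> xbispans G P X" and b0: "b0 \<in> lo \<beta>"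
    and tr: "lo \<beta> \<subseteq> gorb G (lo_act \<beta>) b0"
    and big: "card (carrier G) * (2 ^ card (carrier G) * (card (carrier G) * d)) < card (up \<beta>)"
  obtains \<delta> :: "nat \<Rightarrow> _" where
    "\<And>j. j < d \<Longrightarrow> \<delta> j \<in> up \<beta> \<and> nleg \<beta> (\<delta> j) = b0"
    "\<And>i j. \<lbrakk>i < d; j < d\<rbrakk> \<Longrightarrow>
       {k \<in> carrier G. up_act \<beta> k (\<delta> i) = \<delta> i} = {k \<in> carrier G. up_act \<beta> k (\<delta> j) = \<delta> j}"
    "\<And>i j. \<lbrakk>i < d; j < d; gorb G (up_act \<beta>) (\<delta> i) = gorb G (up_act \<beta>) (\<delta> j)\<rbrakk> \<Longrightarrow> i = j"
proof -
  note F = xbispan_facts[OF \<beta>] and D = xbispansD[OF \<beta>]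
  define c where "c = card (carrier G)"
  define A where "A = {a \<in> up \<beta>. nleg \<beta> a = b0}"
  define st where "st a = {k \<in> carrier G. up_act \<beta> k a = a}" for a
  define E where "E L = {a \<in> A. st a = L}" for L
  have finA: "finite A" using D(3) by (simp add: A_def)
  have "up \<beta> \<subseteq> (\<Union>g\<in>carrier G. up_act \<beta> g ` A)"
  proof
    fix a assume a: "a \<in> up \<beta>"
    then have "nleg \<beta> a \<in> gorb G (lo_act \<beta>) b0" using tr F(2) by blast
    then obtain g where g: "g \<in> carrier G" "nleg \<beta> a = lo_act \<beta> g b0" by (auto simp: gorb_def)
    have "nleg \<beta> (up_act \<beta> (inv g) a) = b0"
      using F(9)[OF inv_closed[OF g(1)] a] g(2) xbispan_inv(4)[OF \<beta> g(1) b0] by simp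
    then have "up_act \<beta> (inv g) a \<in> A" using F(4)[OF inv_closed[OF g(1)] a] by (simp add: A_def)
    moreover have "a = up_act \<beta> g (up_act \<beta> (inv g) a)" using xbispan_inv(1)[OF \<beta> g(1) a] by simp
    ultimately show "a \<in> (\<Union>g\<in>carrier G. up_act \<beta> g ` A)" using g(1) by blast
  qed
  then have "card (up \<beta>) \<le> card (\<Union>g\<in>carrier G. up_act \<beta> g ` A)"
    by (rule card_mono[rotated]) (use fin finA in simp)
  also have "\<dots> \<le> (\<Sum>g\<in>carrier G. card (up_act \<beta> g ` A))" by (rule card_UN_le[OF fin])
  also have "\<dots> \<le> (\<Sum>g\<in>carrier G. card A)" by (rule sum_mono) (rule card_image_le[OF finA])
  finally have 1: "card (up \<beta>) \<le> c * card A" by (simp add: c_def)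
  obtain L where L: "c * d < card (E L)"
  proof (rule ccontr)
    assume "\<not> thesis"
    then have le: "card (E L) \<le> c * d" for L using that by (meson not_le)
    have "st a \<in> Pow (carrier G)" for a unfolding st_def by blast
    moreover have "a \<in> E (st a)" if "a \<in> A" for a using that by (simp add: E_def)
    ultimately have "A \<subseteq> (\<Union>L\<in>Pow (carrier G). E L)" by blast
    then have "card A \<le> card (\<Union>L\<in>Pow (carrier G). E L)"
      by (rule card_mono[rotated]) (use fin finA in \<open>simp add: E_def\<close>)
    also have "\<dots> \<le> (\<Sum>L\<in>Pow (carrier G). card (E L))" by (rule card_UN_le) (use fin in simp)
    also have "\<dots> \<le> (\<Sum>L\<in>Pow (carrier G). c * d)" by (rule sum_mono) (rule le)
    also have "\<dots> = 2 ^ c * (c * d)" using fin by (simp add: card_Pow c_def)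
    finally have "c * card A \<le> c * (2 ^ c * (c * d))" by (rule mult_le_mono2)
    then show False using 1 big unfolding c_def by linarith
  qed
  \<comment> \<open>More than |G| d points with stabilizer L meet more than d orbits.\<close>
  define Or where "Or = gorb G (up_act \<beta>) ` E L"
  have finE: "finite (E L)" using finA by (simp add: E_def)
  have Eup: "a \<in> up \<beta>" if "a \<in> E L" for a using that by (simp add: E_def A_def)
  have "E L \<subseteq> \<Union> Or"
    using gorb_self[OF D(5)] Eup by (auto simp: Or_def)
  moreover have finOr: "finite Or" "\<And>Z. Z \<in> Or \<Longrightarrow> finite Z \<and> card Z \<le> c"
    using finE fin by (auto simp: Or_def gorb_def c_def card_image_le)
  ultimately have "card (E L) \<le> card (\<Union> Or)" by (intro card_mono) auto
  also have "\<dots> \<le> sum card Or" by (rule card_Union_le_sum_card)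
  also have "\<dots> \<le> (\<Sum>Z\<in>Or. c)" by (rule sum_mono) (use finOr in simp)
  also have "\<dots> = c * card Or" by simp
  finally have "c * d < c * card Or" using L by linarith
  then have "d \<le> card Or" by simp
  then obtain T where T: "T \<subseteq> Or" "card T = d" "finite T"
    using obtain_subset_with_card_n by metis
  obtain e where e: "bij_betw e {0..<d} T" using ex_bij_betw_nat_finite[OF T(3)] T(2) by blast
  define \<delta> where "\<delta> j = (SOME a. a \<in> E L \<and> gorb G (up_act \<beta>) a = e j)" for j
  have \<delta>: "\<delta> j \<in> E L \<and> gorb G (up_act \<beta>) (\<delta> j) = e j" if "j < d" for j
  proof -
    have "e j \<in> Or" using e T(1) that by (auto simp: bij_betw_def)
    then have "\<exists>a. a \<in> E L \<and> gorb G (up_act \<beta>) a = e j" by (auto simp: Or_def)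
    then show ?thesis unfolding \<delta>_def by (rule someI_ex)
  qed
  show thesis
  proof (rule that)
    show "\<delta> j \<in> up \<beta> \<and> nleg \<beta> (\<delta> j) = b0" if "j < d" for j
      using \<delta>[OF that] by (simp add: E_def A_def)
    show "{k \<in> carrier G. up_act \<beta> k (\<delta> i) = \<delta> i} = {k \<in> carrier G. up_act \<beta> k (\<delta> j) = \<delta> j}"
      if "i < d" "j < d" for i j
      using \<delta>[OF that(1)] \<delta>[OF that(2)] by (simp add: E_def st_def)
    show "i = j" if "i < d" "j < d" "gorb G (up_act \<beta>) (\<delta> i) = gorb G (up_act \<beta>) (\<delta> j)" for i j
    proof -
      have "e i = e j" using \<delta>[OF that(1)] \<delta>[OF that(2)] that(3) by simp
      then show ?thesis using e that(1,2) by (auto simp: bij_betw_def inj_on_def)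
    qed
  qed
qed

text \<open>The points \<open>\<delta> j\<close> have the same stabilizer and the same image
  \<open>b0\<close>, so their orbits are d disjoint copies of the orbit of \<open>\<delta> 0\<close>
  over \<open>lo \<beta>\<close>. With C as the rest of the upper set, \<beta> takes the shape
  \<open>\<Gamma> d\<close>.\<close>

lemma (in tambara_elt) repeated_orbit:
  fixes \<delta> :: "nat \<Rightarrow> 'p" and \<beta> :: "('a, 'p, 'q) xbispan"
  assumes \<beta>: "\<beta> \<in> xbispans G P X" and P1: "is_singleton (points P)" and d: "0 < d"
    and \<delta>: "\<And>j. j < d \<Longrightarrow> \<delta> j \<in> up \<beta> \<and> nleg \<beta> (\<delta> j) = b0"
    and st: "\<And>i j. \<lbrakk>i < d; j < d\<rbrakk> \<Longrightarrow>
       {k \<in> carrier G. up_act \<beta> k (\<delta> i) = \<delta> i} = {k \<in> carrier G. up_act \<beta> k (\<delta> j) = \<delta> j}"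
    and orb: "\<And>i j. \<lbrakk>i < d; j < d; gorb G (up_act \<beta>) (\<delta> i) = gorb G (up_act \<beta>) (\<delta> j)\<rbrakk> \<Longrightarrow> i = j"
  defines "D' \<equiv> gorb G (up_act \<beta>) (\<delta> 0)"
    and "C \<equiv> {a \<in> up \<beta>. \<forall>j<d. a \<notin> gorb G (up_act \<beta>) (\<delta> j)}"
  shows "orbit_relation G F P x X \<beta> C D'"
    and "xiso G (orbit_relation.\<Gamma> P \<beta> C D' d) \<beta>"
proof -
  note XF = xbispan_facts[OF \<beta>] and XD = xbispansD[OF \<beta>]
  note up = XD(5)
  have orb_mem: "up_act \<beta> g a \<in> gorb G (up_act \<beta>) (\<delta> j) \<longleftrightarrow> a \<in> gorb G (up_act \<beta>) (\<delta> j)"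
    if "g \<in> carrier G" "a \<in> up \<beta>" "j < d" for g a j
    using gorb_mem_act[OF up _ that(2,1)] \<delta>[OF that(3)] by blast
  show rel: "orbit_relation G F P x X \<beta> C D'"
  proof unfold_locales
    show "D' \<subseteq> up \<beta>" unfolding D'_def by (rule gorb_sub[OF up]) (use \<delta>[OF d] in blast)
    then show "up_act \<beta> g c \<in> D'" if "g \<in> carrier G" "c \<in> D'" for g c
      using that orb_mem[OF that(1) _ d] unfolding D'_def by blast
    show "up_act \<beta> g c \<in> C" if "g \<in> carrier G" "c \<in> C" for g c
      using that orb_mem[OF that(1)] XF(4)[OF that(1)] by (simp add: C_def)
  qed (use \<beta> P1 in \<open>auto simp: C_def\<close>)
  interpret B: orbit_relation G F P x X \<beta> C D' d by (rule rel)
  \<comment> \<open>The isomorphism from the orbit of \<open>\<delta> 0\<close> to that of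
    \<open>\<delta> j\<close>; by \<open>gact_stab_eq\<close> the chosen group element does not
    matter.\<close>
  define \<kappa> where "\<kappa> j c = up_act \<beta> (SOME g. g \<in> carrier G \<and> c = up_act \<beta> g (\<delta> 0)) (\<delta> j)" for j c
  have \<kappa>: "\<kappa> j (up_act \<beta> g (\<delta> 0)) = up_act \<beta> g (\<delta> j)" if g: "g \<in> carrier G" and j: "j < d" for g j
  proof -
    have "\<exists>h. h \<in> carrier G \<and> up_act \<beta> g (\<delta> 0) = up_act \<beta> h (\<delta> 0)" using g by blast
    from someI_ex[OF this] show ?thesis unfolding \<kappa>_def
      using gact_stab_eq[OF up _ _ _ g st[OF d j]] \<delta>[OF d] \<delta>[OF j] by metis
  qed
  have D'_E: "\<exists>g\<in>carrier G. c = up_act \<beta> g (\<delta> 0)" if "c \<in> D'" for c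
    using that by (auto simp: D'_def gorb_def)
  have \<kappa>_orb: "\<kappa> j c \<in> gorb G (up_act \<beta>) (\<delta> j)" "\<kappa> j c \<in> up \<beta>" "nleg \<beta> (\<kappa> j c) = nleg \<beta> c"
    "g \<in> carrier G \<Longrightarrow> \<kappa> j (up_act \<beta> g c) = up_act \<beta> g (\<kappa> j c)" if c: "c \<in> D'" and j: "j < d" for c j g
  proof -
    obtain h where h: "h \<in> carrier G" "c = up_act \<beta> h (\<delta> 0)" using D'_E[OF c] by blast
    have \<kappa>c: "\<kappa> j c = up_act \<beta> h (\<delta> j)" using \<kappa>[OF h(1) j] h(2) by simp
    show "\<kappa> j c \<in> gorb G (up_act \<beta>) (\<delta> j)" using \<kappa>c h(1) by (simp add: gorb_def)
    show "\<kappa> j c \<in> up \<beta>" unfolding \<kappa>c using \<delta>[OF j] h(1) XF(4) by simp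
    show "nleg \<beta> (\<kappa> j c) = nleg \<beta> c"
      unfolding \<kappa>c using \<delta>[OF j] \<delta>[OF d] h(1) XF(9) by (simp add: h(2))
    show "\<kappa> j (up_act \<beta> g c) = up_act \<beta> g (\<kappa> j c)" if g: "g \<in> carrier G"
    proof -
      have "up_act \<beta> g c = up_act \<beta> (g \<otimes> h) (\<delta> 0)" using XF(11)[OF g h(1)] \<delta>[OF d] h(2) by simp
      then have "\<kappa> j (up_act \<beta> g c) = up_act \<beta> (g \<otimes> h) (\<delta> j)"
        using \<kappa>[OF m_closed[OF g h(1)] j] by simp
      then show ?thesis unfolding \<kappa>c using XF(11)[OF g h(1)] \<delta>[OF j] by simp
    qed
  qed
  have \<kappa>_inj: "i = j \<and> c = c'" if c: "c \<in> D'" "c' \<in> D'" "i < d" "j < d" "\<kappa> i c = \<kappa> j c'" for c c' i j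
  proof -
    obtain g where g: "g \<in> carrier G" "c = up_act \<beta> g (\<delta> 0)" using D'_E[OF c(1)] by blast
    obtain h where h: "h \<in> carrier G" "c' = up_act \<beta> h (\<delta> 0)" using D'_E[OF c(2)] by blast
    have eq: "up_act \<beta> g (\<delta> i) = up_act \<beta> h (\<delta> j)"
      using c(5) \<kappa>[OF g(1) c(3)] \<kappa>[OF h(1) c(4)] g(2) h(2) by simp
    have "gorb G (up_act \<beta>) (\<delta> i) = gorb G (up_act \<beta>) (\<delta> j)"
      using gorb_act[OF up _ g(1), of "\<delta> i"] gorb_act[OF up _ h(1), of "\<delta> j"] eq \<delta>[OF c(3)] \<delta>[OF c(4)] by simp
    then have ij: "i = j" by (rule orb[OF c(3,4)])
    then have "up_act \<beta> g (\<delta> 0) = up_act \<beta> h (\<delta> 0)"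
      using gact_stab_eq[OF up _ _ g(1) h(1) st[OF c(4) d]] eq \<delta>[OF c(4)] \<delta>[OF d] by blast
    then show ?thesis using ij g(2) h(2) by simp
  qed
  define f where "f w = (case snd w of Rest c \<Rightarrow> c | Copy c j \<Rightarrow> \<kappa> j c | Sel c \<Rightarrow> c)" for w :: "'q \<times> 'p part"
  have f: "f (b, Rest c) = c" "f (b, Copy c j) = \<kappa> j c" for b c j by (simp_all add: f_def)
  have fm: "f w \<in> up \<beta> \<and> nleg \<beta> (f w) = fst w" if w: "w \<in> up (B.\<Gamma> d)" for w
  proof -
    obtain b q where we: "w = (b, q)" by (cases w)
    show ?thesis using w \<kappa>_orb(2,3) B.C_up by (cases q) (simp_all add: we f)
  qed
  have CE: "a \<notin> gorb G (up_act \<beta>) (\<delta> j)" if "a \<in> C" "j < d" for a j using that by (simp add: C_def)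
  show "xiso G (B.\<Gamma> d) \<beta>"
  proof (rule xisoI'[where a = f and b = "\<lambda>b. b"])
    show "bij_betw f (up (B.\<Gamma> d)) (up \<beta>)"
    proof (rule bij_betwI')
      fix w w' assume w: "w \<in> up (B.\<Gamma> d)" "w' \<in> up (B.\<Gamma> d)"
      show "(f w = f w') = (w = w')"
      proof
        assume e: "f w = f w'"
        obtain b q where we: "w = (b, q)" by (cases w)
        obtain b' q' where we': "w' = (b', q')" by (cases w')
        have "b = b'" using fm[OF w(1)] fm[OF w(2)] e by (simp add: we we')
        moreover have "q = q'"
          using w e CE \<kappa>_orb(1) \<kappa>_inj by (cases q; cases q'; simp add: we we' f) (metis, metis, metis)
        ultimately show "w = w'" by (simp add: we we')
      qed simp
    next
      fix w assume "w \<in> up (B.\<Gamma> d)" then show "f w \<in> up \<beta>" using fm by blast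
    next
      fix a assume a: "a \<in> up \<beta>"
      show "\<exists>w\<in>up (B.\<Gamma> d). a = f w"
      proof (cases "a \<in> C")
        case True
        then show ?thesis using XF(2)[OF a] by (intro bexI[of _ "(nleg \<beta> a, Rest a)"]) (simp_all add: f)
      next
        case False
        then obtain j where j: "j < d" "a \<in> gorb G (up_act \<beta>) (\<delta> j)" using a by (auto simp: C_def)
        then obtain g where g: "g \<in> carrier G" "a = up_act \<beta> g (\<delta> j)" by (auto simp: gorb_def)
        have c: "up_act \<beta> g (\<delta> 0) \<in> D'" using g(1) by (simp add: D'_def gorb_def)
        have e: "a = \<kappa> j (up_act \<beta> g (\<delta> 0))" using \<kappa>[OF g(1) j(1)] g(2) by simp
        then have "nleg \<beta> (up_act \<beta> g (\<delta> 0)) = nleg \<beta> a" using \<kappa>_orb(3)[OF c j(1)] by simp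
        then show ?thesis using e c j(1) XF(2)[OF a]
          by (intro bexI[of _ "(nleg \<beta> a, Copy (up_act \<beta> g (\<delta> 0)) j)"]) (simp_all add: f)
      qed
    qed
    show "bij_betw (\<lambda>b. b) (lo (B.\<Gamma> d)) (lo \<beta>)" by (simp add: bij_betw_def)
    show "f (up_act (B.\<Gamma> d) g w) = up_act \<beta> g (f w)" if "g \<in> carrier G" "w \<in> up (B.\<Gamma> d)" for g w
    proof -
      obtain b q where we: "w = (b, q)" by (cases w)
      show ?thesis using that \<kappa>_orb(4) by (cases q) (simp_all add: we f)
    qed
    show "rleg \<beta> (f w) = rleg (B.\<Gamma> d) w" if "w \<in> up (B.\<Gamma> d)" for w
      using fm[OF that] B.rleg_o0 by simp
    show "nleg \<beta> (f w) = nleg (B.\<Gamma> d) w" if "w \<in> up (B.\<Gamma> d)" for w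
      using fm[OF that] by simp
  qed simp_all
qed

section \<open>The generators and the induction\<close>

locale generated_level = tambara_elt +
  fixes X
  assumes X: "finite_gset G X" and fin: "finite (carrier G)" and P1: "is_singleton (points P)"
begin

text \<open>The first summand is the bound of \<open>many_orbits\<close> for d = |G|; the second
  bounds a lower set that is a single orbit. The third bounds the lower set of
  \<open>\<Psi> i\<close>, pairs of a point of X and a subset of an orbit, and the fourth its upper
  set, since D' is an orbit too.\<close>

definition N where
  "N = card (carrier G) * (2 ^ card (carrier G) * (card (carrier G) * card (carrier G))) + card (carrier G)
     + card (points X) * 2 ^ card (carrier G) + card (points X) * 2 ^ card (carrier G) * card (carrier G)"

definition gens where
  "gens = {ev P X (of_bispan S) x | S. S \<in> bispans G P X \<and> card (points (top1 S)) \<le> N \<and> card (points (top2 S)) \<le> N}"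

definition A where "A = generate_ring (L X) gens"

sublocale R: cring "L X" by (rule cring_L[OF X])

lemma gens_carrier: "gens \<subseteq> carrier (L X)"
  by (auto simp: gens_def intro!: ev_in of_bispan_xbispans x)

text \<open>Up to isomorphism the middle sets are initial segments of the natural numbers, and on
  these there are only finitely many extensional actions and legs.\<close>

lemma finite_gens: "finite gens"
proof -
  define mk :: "(nat \<times> nat) \<times> _ \<Rightarrow> ('a, nat, nat) xbispan" where
    "mk = (\<lambda>((k, l), ua, la, r, n, t). \<lparr>up = {..<k}, up_act = ua, lo = {..<l}, lo_act = la,
       rleg = r, nleg = n, tleg = t\<rparr>)"
  define codes where "codes = Sigma ({..N} \<times> {..N}) (\<lambda>(k, l).
     (carrier G \<rightarrow>\<^sub>E ({..<k} \<rightarrow>\<^sub>E {..<k})) \<times> (carrier G \<rightarrow>\<^sub>E ({..<l} \<rightarrow>\<^sub>E {..<l})) \<times>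
     ({..<k} \<rightarrow>\<^sub>E points P) \<times> ({..<k} \<rightarrow>\<^sub>E {..<l}) \<times> ({..<l} \<rightarrow>\<^sub>E points X))"
  have "finite codes"
    unfolding codes_def
    by (intro finite_SigmaI finite_cartesian_product)
      (auto intro!: finite_cartesian_product finite_PiE simp: fin gset_facts(1)[OF P] gset_facts(1)[OF X])
  moreover have "gens \<subseteq> (\<lambda>\<gamma>. ev P X \<gamma> x) ` mk ` codes"
  proof
    fix u assume "u \<in> gens"
    then obtain S where S: "S \<in> bispans G P X" "card (points (top1 S)) \<le> N" "card (points (top2 S)) \<le> N"
      and u: "u = ev P X (of_bispan S) x" by (auto simp: gens_def)
    have \<beta>: "of_bispan S \<in> xbispans G P X" by (rule of_bispan_xbispans[OF S(1)])
    define k l where "k = card (points (top1 S))" and "l = card (points (top2 S))"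
    obtain e where e: "bij_betw e (up (of_bispan S)) {..<k}"
      using ex_bij_betw_finite_nat[OF xbispansD(3)[OF \<beta>]] by (auto simp: k_def atLeast0LessThan)
    obtain d where d: "bij_betw d (lo (of_bispan S)) {..<l}"
      using ex_bij_betw_finite_nat[OF xbispansD(4)[OF \<beta>]] by (auto simp: l_def atLeast0LessThan)
    obtain \<gamma> where \<gamma>: "\<gamma> \<in> xbispans G P X" "xiso G (of_bispan S) \<gamma>" "up \<gamma> = {..<k}" "lo \<gamma> = {..<l}"
      "up_act \<gamma> \<in> carrier G \<rightarrow>\<^sub>E ({..<k} \<rightarrow>\<^sub>E {..<k})" "lo_act \<gamma> \<in> carrier G \<rightarrow>\<^sub>E ({..<l} \<rightarrow>\<^sub>E {..<l})"
      "rleg \<gamma> \<in> {..<k} \<rightarrow>\<^sub>E points P" "nleg \<gamma> \<in> {..<k} \<rightarrow>\<^sub>E {..<l}" "tleg \<gamma> \<in> {..<l} \<rightarrow>\<^sub>E points X"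
      by (rule xbispan_transport[OF \<beta> e d])
    have "((k, l), up_act \<gamma>, lo_act \<gamma>, rleg \<gamma>, nleg \<gamma>, tleg \<gamma>) \<in> codes"
      unfolding codes_def using \<gamma>(5-9) S(2,3) by (intro SigmaI) (simp_all add: k_def l_def)
    moreover have "\<gamma> = mk ((k, l), up_act \<gamma>, lo_act \<gamma>, rleg \<gamma>, nleg \<gamma>, tleg \<gamma>)"
      by (simp add: mk_def \<gamma>(3,4)[symmetric])
    ultimately have "\<gamma> \<in> mk ` codes" by blast
    moreover have "u = ev P X \<gamma> x" unfolding u by (rule ev_cong[OF \<gamma>(2) \<beta>])
    ultimately show "u \<in> (\<lambda>\<gamma>. ev P X \<gamma> x) ` mk ` codes" by blast
  qed
  ultimately show ?thesis by (meson finite_imageI finite_subset)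
qed

lemma subring_A: "subring A (L X)"
  unfolding A_def by (rule R.generate_ring_is_subring[OF gens_carrier])

lemmas A_closed = subringE(1-3,5-7)[OF subring_A]

lemma A_cancel:
  assumes "u \<in> carrier (L X)" "v \<in> A" "u \<oplus>\<^bsub>L X\<^esub> v \<in> A"
  shows "u \<in> A"
proof -
  have "v \<in> carrier (L X)" using assms(2) A_closed(1) by blast
  then have "(u \<oplus>\<^bsub>L X\<^esub> v) \<oplus>\<^bsub>L X\<^esub> \<ominus>\<^bsub>L X\<^esub> v = u"
    using assms(1) by (simp only: R.a_assoc R.a_inv_closed R.r_neg R.r_zero)
  then show ?thesis using A_closed(6)[OF assms(3) A_closed(4)[OF assms(2)]] by simp
qed

lemma small_A:
  assumes "\<beta> \<in> xbispans G P X" "card (up \<beta>) \<le> N" "card (lo \<beta>) \<le> N"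
  shows "ev P X \<beta> x \<in> A"
proof -
  obtain S where S: "S \<in> bispans G P X" "xiso G \<beta> (of_bispan S)" by (rule realization[OF assms(1)])
  have "ev P X (of_bispan S) x \<in> gens"
    unfolding gens_def
    using S(1) xiso_invariants(3,4)[OF S(2) assms(1) fin] assms(2,3) by auto
  then show ?thesis
    using ev_cong[OF S(2) assms(1)] by (simp add: A_def generate_ring.incl)
qed

lemma transitive_card:
  assumes "\<beta> \<in> xbispans G P X" "transitive_lo G \<beta>"
  shows "card (lo \<beta>) \<le> card (carrier G)"
proof -
  obtain b where "lo \<beta> \<subseteq> gorb G (lo_act \<beta>) b" using assms(2) by (auto simp: transitive_lo_def)
  then have "card (lo \<beta>) \<le> card (gorb G (lo_act \<beta>) b)"
    by (rule card_mono[rotated]) (simp add: gorb_def fin)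
  also have "\<dots> \<le> card (carrier G)" unfolding gorb_def by (rule card_image_le[OF fin])
  finally show ?thesis .
qed

lemma carrier_pos: "0 < card (carrier G)"
  using fin one_closed card_gt_0_iff by blast

text \<open>The bispans in \<open>lower\<close> and \<open>IH\<close> have the types on which
  \<open>Wbad\<close> and \<open>\<Gamma>\<close> live. An induction hypothesis cannot range over
  types, so \<open>all_A\<close> runs its inductions over genuine bispans and supplies these two
  assumptions through \<open>realize_A\<close>. No transitivity is required in \<open>lower\<close>,
  because the bad pairs may form several orbits.\<close>

lemma transitive_step:
  fixes \<beta> :: "('a, 'p, 'q) xbispan"
  assumes \<beta>: "\<beta> \<in> xbispans G P X" and st: "stab_le G (Suc n) \<beta>" and tr: "transitive_lo G \<beta>"
    and lower: "\<And>\<gamma> :: ('a, ('q \<times> 'q set) \<times> 'p part, 'q \<times> 'q set) xbispan.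
      \<lbrakk>\<gamma> \<in> xbispans G P X; stab_le G n \<gamma>\<rbrakk> \<Longrightarrow> ev P X \<gamma> x \<in> A"
    and IH: "\<And>\<gamma> :: ('a, 'q \<times> 'p part, 'q) xbispan. \<lbrakk>\<gamma> \<in> xbispans G P X; stab_le G (Suc n) \<gamma>;
      transitive_lo G \<gamma>; card (up \<gamma>) < card (up \<beta>)\<rbrakk> \<Longrightarrow> ev P X \<gamma> x \<in> A"
  shows "ev P X \<beta> x \<in> A"
proof (cases "card (up \<beta>) \<le> N")
  case True
  then show ?thesis using small_A[OF \<beta>] transitive_card[OF \<beta> tr] by (simp add: N_def)
next
  case False
  note XF = xbispan_facts[OF \<beta>] and XD = xbispansD[OF \<beta>]
  define d where "d = card (carrier G)"
  have d: "0 < d" using carrier_pos by (simp add: d_def)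
  obtain b0 where b0: "b0 \<in> lo \<beta>" "lo \<beta> \<subseteq> gorb G (lo_act \<beta>) b0" using tr by (auto simp: transitive_lo_def)
  have big: "card (carrier G) * (2 ^ card (carrier G) * (card (carrier G) * d)) < card (up \<beta>)"
    using False by (simp add: N_def d_def)
  obtain \<delta> where \<delta>: "\<And>j. j < d \<Longrightarrow> \<delta> j \<in> up \<beta> \<and> nleg \<beta> (\<delta> j) = b0"
    and \<delta>st: "\<And>i j. \<lbrakk>i < d; j < d\<rbrakk> \<Longrightarrow>
       {k \<in> carrier G. up_act \<beta> k (\<delta> i) = \<delta> i} = {k \<in> carrier G. up_act \<beta> k (\<delta> j) = \<delta> j}"
    and \<delta>orb: "\<And>i j. \<lbrakk>i < d; j < d; gorb G (up_act \<beta>) (\<delta> i) = gorb G (up_act \<beta>) (\<delta> j)\<rbrakk> \<Longrightarrow> i = j"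
    by (rule many_orbits[OF fin \<beta> b0 big]) blast
  define D' where "D' = gorb G (up_act \<beta>) (\<delta> 0)"
  define C where "C = {a \<in> up \<beta>. \<forall>j<d. a \<notin> gorb G (up_act \<beta>) (\<delta> j)}"
  have rep: "orbit_relation G F P x X \<beta> C D'" "xiso G (orbit_relation.\<Gamma> P \<beta> C D' d) \<beta>"
    unfolding C_def D'_def
    by (rule repeated_orbit[OF \<beta> P1 d], use \<delta> in blast, use \<delta>st in blast, use \<delta>orb in blast)+
  interpret B: orbit_relation G F P x X \<beta> C D' d by (rule rep(1))
  have \<delta>0: "\<delta> 0 \<in> D'" unfolding D'_def by (rule gorb_self[OF XD(5)]) (use \<delta>[OF d] in blast)
  have lo_card: "card (lo \<beta>) \<le> d" using transitive_card[OF \<beta> tr] by (simp add: d_def)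
  have \<Gamma>_A: "ev P X (B.\<Gamma> k) x \<in> A" if k: "k < d" for k
  proof (rule IH[OF B.\<Gamma>_xbispans])
    show "stab_le G (Suc n) (B.\<Gamma> k)" "transitive_lo G (B.\<Gamma> k)"
      using st tr by (simp_all add: stab_le_def transitive_lo_def)
    have "B.okpart d b {} q" if "B.okpart k b {} q" for b q using that k by (cases q) auto
    then have "up (B.\<Gamma> k) \<subseteq> up (B.\<Gamma> d)" by auto
    moreover have "(b0, Copy (\<delta> 0) k) \<in> up (B.\<Gamma> d) - up (B.\<Gamma> k)"
      using b0(1) \<delta>0 \<delta>[OF d] k by simp
    ultimately have "up (B.\<Gamma> k) \<subset> up (B.\<Gamma> d)" by blast
    then have "card (up (B.\<Gamma> k)) < card (up (B.\<Gamma> d))"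
      by (rule psubset_card_mono[OF xbispansD(3)[OF B.\<Gamma>_xbispans]])
    also have "\<dots> = card (up \<beta>)" using xiso_invariants(3)[OF rep(2) B.\<Gamma>_xbispans fin] by simp
    finally show "card (up (B.\<Gamma> k)) < card (up \<beta>)" .
  qed
  have \<Psi>_A: "ev P X (B.\<Psi> i) x \<in> A" for i
  proof (rule small_A[OF B.\<Psi>_xbispans])
    have "lo (B.\<Psi> i) \<subseteq> points X \<times> Pow (lo \<beta>)"
      using B.subs_fin by (simp add: subset_iff mem_Times_iff) blast
    then have "card (lo (B.\<Psi> i)) \<le> card (points X \<times> Pow (lo \<beta>))"
      by (rule card_mono[rotated]) (simp add: gset_facts(1)[OF X] XD(4))
    also have "\<dots> = card (points X) * 2 ^ card (lo \<beta>)" by (simp add: card_cartesian_product card_Pow XD(4))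
    also have "\<dots> \<le> card (points X) * 2 ^ d" using lo_card by simp
    finally have l: "card (lo (B.\<Psi> i)) \<le> card (points X) * 2 ^ d" .
    then show "card (lo (B.\<Psi> i)) \<le> N" by (simp add: N_def d_def)
    have finD: "finite D'" "card D' \<le> d" unfolding D'_def gorb_def d_def using fin by (simp_all add: card_image_le)
    have "up (B.\<Psi> i) \<subseteq> lo (B.\<Psi> i) \<times> D'" by (simp add: subset_iff mem_Times_iff)
    then have "card (up (B.\<Psi> i)) \<le> card (lo (B.\<Psi> i) \<times> D')"
      by (rule card_mono[rotated]) (use finD xbispansD(4)[OF B.\<Psi>_xbispans] in blast)
    also have "\<dots> \<le> card (points X) * 2 ^ d * d"
      using mult_le_mono[OF l finD(2)] by (simp add: card_cartesian_product)
    finally show "card (up (B.\<Psi> i)) \<le> N" by (simp add: N_def d_def)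
  qed
  have bad_A: "ev P X (B.Wbad i) x \<in> A" for i
  proof (rule lower[OF B.Wfix_xbispans(2)])
    show "stab_le G n (B.Wbad i)"
      unfolding stab_le_def
    proof
      fix y assume y: "y \<in> lo (B.Wbad i)"
      then have b: "fst y \<in> lo \<beta>" and nf: "\<not> B.fixd y" by simp_all
      obtain g where g: "g \<in> carrier G" "lo_act \<beta> g (fst y) = fst y" "lo_act \<beta> g ` snd y \<noteq> snd y"
        using nf by (auto simp: B.fixd_def)
      have eq: "lo_act (B.Wbad i) h y = y \<longleftrightarrow> lo_act \<beta> h (fst y) = fst y \<and> lo_act \<beta> h ` snd y = snd y" for h
        by (simp add: prod_eq_iff)
      \<comment> \<open>The stabilizer of (b, S) consists of those elements of the stabilizer of b
        that fix S. It is a proper part of it, as some element moves S.\<close>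
      have "{g \<in> carrier G. lo_act (B.Wbad i) g y = y} \<subset> {g \<in> carrier G. lo_act \<beta> g (fst y) = fst y}"
        unfolding eq using g by blast
      then have "card {g \<in> carrier G. lo_act (B.Wbad i) g y = y} < card {g \<in> carrier G. lo_act \<beta> g (fst y) = fst y}"
        by (rule psubset_card_mono[rotated]) (use fin in simp)
      also have "\<dots> \<le> Suc n" using st b by (simp add: stab_le_def)
      finally show "card {g \<in> carrier G. lo_act (B.Wbad i) g y = y} \<le> n" by simp
    qed
  qed
  have W_car: "ev P X (B.W0 i) x \<in> carrier (L X)" "ev P X (B.W1 i) x \<in> carrier (L X)" for i
    using ev_in[OF B.W01_xbispans(1) x] ev_in[OF B.W01_xbispans(2) x] by simp_all
  \<comment> \<open>Descent from the empty \<open>W0 d\<close> to \<open>W0 0\<close>, which is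
    \<open>\<Gamma> d\<close> and hence \<beta>. Each step solves \<open>product_relation\<close>
    for \<open>W1 (Suc i)\<close> and identifies the latter with \<open>W0 i\<close>.\<close>
  have "ev P X (B.W0 (d - j)) x \<in> A" if "j \<le> d" for j
    using that
  proof (induction j)
    case 0
    have "\<zero>\<^bsub>L X\<^esub> = ev P X (B.W0 d) x"
      by (rule ev_zero[OF P X x B.W01_xbispans(1) B.W0_top[OF lo_card]])
    then show ?case using A_closed(2) by simp
  next
    case (Suc j)
    define i where "i = d - Suc j"
    \<comment> \<open>Since Suc i is positive, only products with fewer than d copies of D' occur,
      and \<open>\<Gamma>_A\<close> covers these.\<close>
    have i: "i < d" "d - j = Suc i" "d - Suc i < d" using Suc.prems by (auto simp: i_def)
    have W0: "ev P X (B.W0 (Suc i)) x \<in> A" using Suc i(2) by simp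
    have "ev P X (B.W1 (Suc i)) x \<oplus>\<^bsub>L X\<^esub> ev P X (B.W0 (Suc i)) x \<in> A"
      by (rule A_cancel[OF R.add.m_closed[OF W_car(2,1)] bad_A[of "Suc i"]])
        (unfold B.product_relation[symmetric], rule A_closed(5)[OF \<Gamma>_A[OF i(3)] \<Psi>_A])
    then have "ev P X (B.W1 (Suc i)) x \<in> A" by (rule A_cancel[OF W_car(2) W0])
    then show ?case
      using ev_cong[OF B.insert_iso[OF i(1)] B.W01_xbispans(1)] by (simp add: i_def)
  qed
  from this[of d] have "ev P X (B.\<Gamma> d) x \<in> A"
    using ev_cong[OF B.W0_zero B.\<Gamma>_xbispans] by simp
  then show ?thesis using ev_cong[OF rep(2) B.\<Gamma>_xbispans] by simp
qed

text \<open>Carries an induction hypothesis for genuine bispans over to bispans of any type. Q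
  switches the transitivity requirement on or off, and k and l keep track of the sizes on which the
  inductions run.\<close>

lemma realize_A:
  assumes H: "\<And>S. \<lbrakk>S \<in> bispans G P X; stab_le G n (of_bispan S); Q \<longrightarrow> transitive_lo G (of_bispan S);
      card (points (top1 S)) = k; card (points (top2 S)) = l\<rbrakk> \<Longrightarrow> ev P X (of_bispan S) x \<in> A"
    and "\<gamma> \<in> xbispans G P X" "stab_le G n \<gamma>" "Q \<longrightarrow> transitive_lo G \<gamma>" "card (up \<gamma>) = k" "card (lo \<gamma>) = l"
  shows "ev P X \<gamma> x \<in> A"
proof -
  obtain S where S: "S \<in> bispans G P X" "xiso G \<gamma> (of_bispan S)" by (rule realization[OF assms(2)])
  have "ev P X (of_bispan S) x \<in> A"
    by (rule H[OF S(1)]) (use xiso_invariants[OF S(2) assms(2) fin] assms(3-) in simp_all)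
  then show ?thesis using ev_cong[OF S(2) assms(2)] by simp
qed

text \<open>Three inductions: on the bound for the stabilizers; for a single orbit, on the size of
  the upper set; and in general on the number of lower points, splitting off one orbit at a
  time.\<close>

lemma all_A: "\<lbrakk>S \<in> bispans G P X; stab_le G n (of_bispan S)\<rbrakk> \<Longrightarrow> ev P X (of_bispan S) x \<in> A"
proof (induction n arbitrary: S)
  case 0
  have \<beta>: "of_bispan S \<in> xbispans G P X" by (rule of_bispan_xbispans[OF 0(1)])
  have "b \<notin> lo (of_bispan S)" for b
  proof
    assume b: "b \<in> lo (of_bispan S)"
    then have "card {g \<in> carrier G. lo_act (of_bispan S) g b = b} = 0" using 0(2) by (simp add: stab_le_def)
    \<comment> \<open>Every stabilizer contains the unit, so the bound 0 leaves no lower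
      points.\<close>
    moreover have "\<one> \<in> {g \<in> carrier G. lo_act (of_bispan S) g b = b}" using xbispan_facts(7)[OF \<beta> b] by simp
    ultimately show False using fin by (metis (no_types, lifting) card_0_eq empty_iff finite_Collect_conjI finite_subset mem_Collect_eq subsetI)
  qed
  then have "lo (of_bispan S) = {}" by blast
  from ev_zero[OF P X x \<beta> this] show ?case using A_closed(2) by simp
next
  case (Suc n)
  have trans: "ev P X (of_bispan T) x \<in> A"
    if "T \<in> bispans G P X" "stab_le G (Suc n) (of_bispan T)" "transitive_lo G (of_bispan T)" for T
    using that
  proof (induction "card (points (top1 T))" arbitrary: T rule: less_induct)
    case (less T)
    have \<beta>: "of_bispan T \<in> xbispans G P X" by (rule of_bispan_xbispans[OF less.prems(1)])
    show ?case
    proof (rule transitive_step[OF \<beta> less.prems(2,3)])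
      fix \<gamma> :: "('a, ('a point \<times> 'a point set) \<times> 'a point part, 'a point \<times> 'a point set) xbispan"
      assume \<gamma>: "\<gamma> \<in> xbispans G P X" "stab_le G n \<gamma>"
      show "ev P X \<gamma> x \<in> A"
        by (rule realize_A[where Q = False, OF Suc.IH \<gamma>]) simp_all
    next
      fix \<gamma> :: "('a, 'a point \<times> 'a point part, 'a point) xbispan"
      assume \<gamma>: "\<gamma> \<in> xbispans G P X" "stab_le G (Suc n) \<gamma>" "transitive_lo G \<gamma>"
        "card (up \<gamma>) < card (up (of_bispan T))"
      show "ev P X \<gamma> x \<in> A"
        by (rule realize_A[where Q = True, OF less.hyps \<gamma>(1,2)]) (use \<gamma>(3,4) in simp_all)
    qed
  qed
  show ?case using Suc.prems
  proof (induction "card (points (top2 S))" arbitrary: S rule: less_induct)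
    case (less S)
    define \<beta> where "\<beta> = of_bispan S"
    have \<beta>: "\<beta> \<in> xbispans G P X" unfolding \<beta>_def by (rule of_bispan_xbispans[OF less.prems(1)])
    have st: "stab_le G (Suc n) \<beta>" using less.prems(2) by (simp add: \<beta>_def)
    note XD = xbispansD[OF \<beta>]
    show ?case
    proof (cases "lo \<beta> = {}")
      case True
      from ev_zero[OF P X x \<beta> this] show ?thesis using A_closed(2) by (simp add: \<beta>_def)
    next
      case False
      then obtain b where b: "b \<in> lo \<beta>" by blast
      define Q where "Q y \<longleftrightarrow> y \<in> gorb G (lo_act \<beta>) b" for y
      have Q: "Q (lo_act \<beta> g y) \<longleftrightarrow> Q y" if "g \<in> carrier G" "y \<in> lo \<beta>" for g y
        unfolding Q_def by (rule gorb_mem_act[OF XD(6) b that(2,1)])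
      have 1: "xrestr Q \<beta> \<in> xbispans G P X" "xrestr (\<lambda>y. \<not> Q y) \<beta> \<in> xbispans G P X"
        by (rule xrestr_xbispans[OF \<beta>], use Q in blast)+
      have Qb: "Q b" unfolding Q_def by (rule gorb_self[OF XD(6) b])
      have "transitive_lo G (xrestr Q \<beta>)"
        unfolding transitive_lo_def
        by (rule bexI[of _ b]) (use b Qb in \<open>simp_all add: Q_def subset_iff\<close>)
      moreover have st': "stab_le G (Suc n) (xrestr Q \<beta>)" "stab_le G (Suc n) (xrestr (\<lambda>y. \<not> Q y) \<beta>)"
        using st by (simp_all add: stab_le_def)
      ultimately have A1: "ev P X (xrestr Q \<beta>) x \<in> A"
        by (intro realize_A[where Q = True, OF trans 1(1)]) simp_all
      have "lo (xrestr (\<lambda>y. \<not> Q y) \<beta>) \<subset> lo \<beta>" using b Qb by auto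
      then have "card (lo (xrestr (\<lambda>y. \<not> Q y) \<beta>)) < card (lo \<beta>)" by (rule psubset_card_mono[OF XD(4)])
      then have A2: "ev P X (xrestr (\<lambda>y. \<not> Q y) \<beta>) x \<in> A"
        by (intro realize_A[where Q = False, OF less.hyps 1(2) st'(2)]) (simp_all add: \<beta>_def)
      have "ev P X \<beta> x = ev P X (xrestr Q \<beta>) x \<oplus>\<^bsub>L X\<^esub> ev P X (xrestr (\<lambda>y. \<not> Q y) \<beta>) x"
        by (rule ev_split[OF \<beta> x Q])
      then show ?thesis using A_closed(6)[OF A1 A2] by (simp add: \<beta>_def)
    qed
  qed
qed

text \<open>Stabilizers never exceed the order of G, so \<open>all_A\<close> covers every
  bispan.\<close>

lemma V_A: "u \<in> V X \<Longrightarrow> u \<in> A"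
proof (erule V_E)
  fix S assume S: "S \<in> bispans G P X" and u: "u = ev P X (of_bispan S) x"
  have "stab_le G (card (carrier G)) (of_bispan S)"
    using fin by (auto simp: stab_le_def intro!: card_mono)
  then show "u \<in> A" using all_A[OF S] u by simp
qed

lemma D_A: "u \<in> D X \<Longrightarrow> u \<in> A"
  using A_cancel V_A D_in by (metis D_E carrier_L)

lemma finitely_generated:
  assumes "fobj F X = D X"
  shows "finitely_generated_ring (level_ring G F X)"
  unfolding finitely_generated_ring_def
proof (intro exI conjI)
  show "generate_ring (L X) gens = carrier (L X)"
    using D_A A_closed(1) assms by (auto simp: A_def[symmetric])
qed (use finite_gens gens_carrier in auto)

end

section \<open>The G-sets of cosets\<close>

lemma (in group) lcosets_subset:
  assumes "subgroup H G" "K \<in> lcosets H"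
  shows "K \<subseteq> carrier G"
proof -
  obtain a where "a \<in> carrier G" "K = a <# H" using assms(2) by (auto simp: LCOSETS_def)
  then show ?thesis using l_coset_subset_G[OF subgroup.subset[OF assms(1)]] by simp
qed

lemma (in group) finite_gset_coset_gset:
  assumes fin: "finite (carrier G)" and H: "subgroup H G"
  shows "finite_gset G (coset_gset G H)"
  unfolding finite_gset_iff
proof (intro conjI)
  have sub: "H \<subseteq> carrier G" by (rule subgroup.subset[OF H])
  have K: "K \<subseteq> carrier G" if "K \<in> lcosets H" for K using that lcosets_subset[OF H] by blast
  then have "lcosets H \<subseteq> Pow (carrier G)" by blast
  then have "finite (lcosets H)" by (rule finite_subset) (use fin in simp)
  then show "finite (points (coset_gset G H))" by (simp add: coset_gset_def)
  have cl: "g <# K \<in> lcosets H" if g: "g \<in> carrier G" and KH: "K \<in> lcosets H" for g K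
  proof -
    obtain a where a: "a \<in> carrier G" "K = a <# H" using KH by (auto simp: LCOSETS_def)
    then have "g <# K = (g \<otimes> a) <# H" using lcos_m_assoc[OF sub g a(1)] by simp
    then show ?thesis using a g by (auto simp: LCOSETS_def)
  qed
  show "gact G (points (coset_gset G H)) (act (coset_gset G H))"
  proof (rule gactI)
    fix p assume "p \<in> points (coset_gset G H)"
    then have p: "fst p \<in> lcosets H" "snd p = 0" by (auto simp: coset_gset_def)
    show "act (coset_gset G H) \<one> p = p"
      using p lcos_mult_one[OF K[OF p(1)]] by (simp add: coset_gset_def mem_Times_iff prod_eq_iff)
    show "act (coset_gset G H) g p \<in> points (coset_gset G H)" if "g \<in> carrier G" for g
      using p cl[OF that] by (simp add: coset_gset_def mem_Times_iff)
    show "act (coset_gset G H) (g \<otimes> h) p = act (coset_gset G H) g (act (coset_gset G H) h p)"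
      if "g \<in> carrier G" "h \<in> carrier G" for g h
      using p cl[OF that(2) p(1)] lcos_m_assoc[OF K[OF p(1)] that] by (simp add: coset_gset_def mem_Times_iff)
  qed
qed (simp add: coset_gset_def)

lemma (in group) singleton_coset_gset: "is_singleton (points (coset_gset G (carrier G)))"
proof -
  have "a <# carrier G = carrier G" if a: "a \<in> carrier G" for a
  proof
    show "carrier G \<subseteq> a <# carrier G"
    proof
      fix y assume y: "y \<in> carrier G"
      then have "y = a \<otimes> (inv a \<otimes> y)" using a m_assoc[of a "inv a" y] by simp
      then show "y \<in> a <# carrier G" using a y unfolding l_coset_def by blast
    qed
  qed (use a in \<open>auto simp: l_coset_def\<close>)
  then have "lcosets (carrier G) = {carrier G}" using one_closed by (auto simp: LCOSETS_def)
  then have "points (coset_gset G (carrier G)) = {(carrier G, 0)}" by (simp add: coset_gset_def)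
  then show ?thesis by (simp add: is_singleton_def)
qed

theorem theorem4:
  fixes G :: "('g, 'm) monoid_scheme"
    and A :: "('g, 'a) pg_functor"
    and H :: "'g set"
  assumes "group G"
    and "finite (carrier G)"
    and "free_tambara_functor G A"
    and "subgroup H G"
  shows "finitely_generated_ring (level_ring G A (coset_gset G H))"
proof -
  interpret group G by (rule assms(1))
  let ?P = "coset_gset G (carrier G)" and ?X = "coset_gset G H"
  have P: "finite_gset G ?P" by (rule finite_gset_coset_gset[OF assms(2) subgroup_self])
  have X: "finite_gset G ?X" by (rule finite_gset_coset_gset[OF assms(2,4)])
  obtain x where x: "x \<in> fobj A ?P"
    and D: "\<And>X. finite_gset G X \<Longrightarrow> fobj A X = tambara_elt.D G A ?P x X"
    using free_tambara_generated[OF assms(1,3) P] by metis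
  interpret generated_level G A ?P x ?X
    by unfold_locales
      (use assms(2,3) P x X singleton_coset_gset in \<open>simp_all add: free_tambara_functor_def\<close>)
  show ?thesis by (rule finitely_generated[OF D[OF X]])
qed

end
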